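(* Let $1<p\le +\infty$. For $f\in C(K)$ the following are equivalent: (1) $f\in W^{1,p}(K)$; (2) $f\in\mathcal F_p$; (3) there exists a (unique) $\partial f\in L^p(\mathcal S,\nu)$ such that for every $n\ge 0$ and all adjacent vertices $u,v\in V_n$ with $u\le v$, \[ f(v)-f(u)=\int_{\mathbf e(u,v)}\partial f\,d\nu . \] Moreover, on $W^{1,p}(K)$ one has \[ \|f\|_{W^{1,p}(K)}\simeq\|\partial f\|_{L^p(\mathcal S,\nu)}=\|f\|_{\mathcal F_p}, \] where $\simeq$ means that each side is bounded by a positive constant, independent of $f$, times the other.
   Context: Vicsek set. In $\mathbb R^2$ let $q_1=(-\sqrt2/2,\sqrt2/2)$, $q_2=(\sqrt2/2,\sqrt2/2)$, $q_3=(\sqrt2/2,-\sqrt2/2)$, $q_4=(-\sqrt2/2,-\sqrt2/2)$, $q_5=(0,0)$ and $\psi_i(z)=\frac13(z-q_i)+q_i$, $1\le i\le5$. $K$ is the unique non-empty compact set with $K=\bigcup_{i=1}^5\psi_i(K)$. Cable systems. $V_0=\{q_1,\dots,q_5\}$, $\bar V_0$ is the union of the four segments (edges) $[q_5,q_i]$, $1\le i\le4$; $V_{n+1}=\bigcup_i\psi_i(V_n)$, $\bar V_{n+1}=\bigcup_i\psi_i(\bar V_n)$. The edges of $\bar V_n$ are the images of the edges of $\bar V_0$ under the maps $\psi_{i_1}\circ\cdots\circ\psi_{i_n}$; they have length $3^{-n}$, and $\bar V_n$ is a tree with vertex set $V_n$. Vertices $u,v\in V_n$ are adjacent, $u\sim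 v$, if they are joined by an edge of $\bar V_n$, denoted $\mathbf e(u,v)$. The skeleton is $\mathcal S=\bigcup_n\bar V_n$, which is dense in $K$. Distance and measures. $d$ is the geodesic distance: for $x,y\in\bar V_n$, $d(x,y)$ is the length of the path in $\bar V_n$ from $x$ to $y$, and $d$ is extended by continuity to $K\times K$. For adjacent $u,v$ one writes $u\le v$ if $d(q_5,u)<d(q_5,v)$. $B(x,r)=\{y\in K: d(x,y)\le r\}$. $\mu$ is the Borel probability measure on $K$ with $\mu(\psi_{i_1}\circ\cdots\circ\psi_{i_n}(K))=5^{-n}$, and $d_h=\log5/\log3$. $\nu$ is the ($\sigma$-finite) Lebesgue (length) measure on $\mathcal S$: $\nu(\mathbf e)=3^{-n}$ for every edge $\mathbf e$ of $\bar V_n$, $n\ge0$. Sobolev spaces. For $1<p<\infty$ put $\alpha_p=1-\frac1p+\frac{d_h}p$ and \[\|f\|_{W^{1,p}(K)}=\limsup_{r\to0^+}\frac1{r^{\alpha_p}}\Big(\int_K\int_{B(x,r)}\frac{|f(y)-f(x)|^p}{\mu(B(x,r))}d\mu(y)d\mu(x)\Big)^{1/p};\] $W^{1,p}(K)$ is the set of $f\in L^p(K,\mu)$ for which this is finite. $W^{1,\infty}(K)$ is the set of Lipschitz functions on $(K,d)$ with $\|f\|_{W^{1,\infty}(K)}=\sup_{x\ne y}|f(x)-f(y)|/d(x,y)$. Discrete energies. For $f\in C(K)$, $m\ge0$: $\mathcal E_p^m(f)=\frac12 3^{(p-1)m}\sum_{x,y\in V_m,\,x\sim y}|f(x)-f(y)|^p$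 for $1\le p<\infty$ (sum over ordered pairs), and $\mathcal E_\infty^m(f)=3^m\max_{x,y\in V_m,\,x\sim y}|f(x)-f(y)|$. $\mathcal F_p=\{f\in C(K):\sup_m\mathcal E_p^m(f)<\infty\}$, with seminorm $\|f\|_{\mathcal F_p}=\sup_m\mathcal E_p^m(f)^{1/p}$ if $p<\infty$ and $\|f\|_{\mathcal F_\infty}=\sup_m\mathcal E_\infty^m(f)$. *)

theory Defs
  imports "HOL-Analysis.Analysis" "HOL-Probability.Essential_Supremum"
begin

section \<open>The Vicsek set and its cable systems\<close>

text \<open>The plane is \<open>real \<times> real\<close>, whose library norm is the Euclidean one.  Only the indices
  \<open>1, \<dots>, 5\<close> are ever used.\<close>

definition vicsek_q :: "nat \<Rightarrow> real \<times> real" where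
  "vicsek_q i =
     (if i = 1 then (- sqrt 2 / 2, sqrt 2 / 2)
      else if i = 2 then (sqrt 2 / 2, sqrt 2 / 2)
      else if i = 3 then (sqrt 2 / 2, - sqrt 2 / 2)
      else if i = 4 then (- sqrt 2 / 2, - sqrt 2 / 2)
      else (0, 0))"

definition vicsek_psi :: "nat \<Rightarrow> real \<times> real \<Rightarrow> real \<times> real" where
  "vicsek_psi i z = (1 / 3) *\<^sub>R (z - vicsek_q i) + vicsek_q i"

definition vicsek_words :: "nat \<Rightarrow> nat list set" where
  "vicsek_words n = {w. length w = n \<and> set w \<subseteq> {1..5}}"

definition vicsek_psi_word :: "nat list \<Rightarrow> real \<times> real \<Rightarrow> real \<times> real" where
  "vicsek_psi_word w = foldr (\<lambda>i g. vicsek_psi i \<circ> g) w id"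

definition vicsek_set :: "(real \<times> real) set" where
  "vicsek_set = (THE K. K \<noteq> {} \<and> compact K \<and> K = (\<Union>i\<in>{1..5}. vicsek_psi i ` K))"

primrec vicsek_vertices :: "nat \<Rightarrow> (real \<times> real) set" where
  "vicsek_vertices 0 = vicsek_q ` {1..5}"
| "vicsek_vertices (Suc n) = (\<Union>i\<in>{1..5}. vicsek_psi i ` vicsek_vertices n)"

primrec vicsek_cable :: "nat \<Rightarrow> (real \<times> real) set" where
  "vicsek_cable 0 = (\<Union>i\<in>{1..4}. closed_segment (vicsek_q 5) (vicsek_q i))"
| "vicsek_cable (Suc n) = (\<Union>i\<in>{1..5}. vicsek_psi i ` vicsek_cable n)"

definition vicsek_edges :: "nat \<Rightarrow> (real \<times> real) set set" where
  "vicsek_edges n = {vicsek_psi_word w ` closed_segment (vicsek_q 5) (vicsek_q i) | w i.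
     w \<in> vicsek_words n \<and> i \<in> {1..4}}"

text \<open>If \<open>u\<close> and \<open>v\<close> are adjacent, the edge joining them is \<open>closed_segment u v\<close>.\<close>

definition vicsek_adj :: "nat \<Rightarrow> real \<times> real \<Rightarrow> real \<times> real \<Rightarrow> bool" where
  "vicsek_adj n u v \<longleftrightarrow>
     u \<in> vicsek_vertices n \<and> v \<in> vicsek_vertices n \<and> closed_segment u v \<in> vicsek_edges n"

definition vicsek_skeleton :: "(real \<times> real) set" where
  "vicsek_skeleton = (\<Union>n. vicsek_cable n)"


section \<open>Geodesic distance\<close>

text \<open>Length of a curve parametrised by the unit interval: supremum of the lengths of inscribed
  polygons.\<close>

definition curve_length :: "(real \<Rightarrow> 'a::metric_space) \<Rightarrow> ennreal" where
  "curve_length g = (SUP ts\<in>{ts. sorted ts \<and> set ts \<subseteq> {0..1}}.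
     \<Sum>k<length ts - 1. ennreal (dist (g (ts ! k)) (g (ts ! Suc k))))"

text \<open>On the skeleton: each cable system is a tree, so two distinct points are joined by an arc
  that is unique up to reparametrisation; it does not depend on the level either, because the
  cable systems increase.  An \<^const>\<open>arc\<close> has distinct endpoints, whence the case distinction.\<close>

definition vicsek_cable_dist :: "real \<times> real \<Rightarrow> real \<times> real \<Rightarrow> real" where
  "vicsek_cable_dist x y =
     (if x = y then 0
      else enn2real (THE L. \<exists>n g. arc g \<and> path_image g \<subseteq> vicsek_cable n \<and>
        pathstart g = x \<and> pathfinish g = y \<and> L = curve_length g))"

text \<open>Extension by continuity to the closure of the skeleton, the Vicsek set.\<close>

definition vicsek_dist :: "real \<times> real \<Rightarrow> real \<times> real \<Rightarrow> real" where
  "vicsek_dist x y =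
     (if x \<in> vicsek_skeleton \<and> y \<in> vicsek_skeleton then vicsek_cable_dist x y
      else Lim (at (x, y) within vicsek_skeleton \<times> vicsek_skeleton)
             (\<lambda>(a, b). vicsek_cable_dist a b))"

definition vicsek_ball :: "real \<times> real \<Rightarrow> real \<Rightarrow> (real \<times> real) set" where
  "vicsek_ball x r = {y \<in> vicsek_set. vicsek_dist x y \<le> r}"

text \<open>The orientation \<open>u \<le> v\<close> of adjacent vertices.\<close>

definition vicsek_below :: "real \<times> real \<Rightarrow> real \<times> real \<Rightarrow> bool" where
  "vicsek_below u v \<longleftrightarrow> vicsek_dist (vicsek_q 5) u < vicsek_dist (vicsek_q 5) v"


section \<open>Measures\<close>

definition vicsek_mu :: "(real \<times> real) measure" where
  "vicsek_mu = (THE M. space M = vicsek_set \<and> sets M = sets (restrict_space borel vicsek_set) \<and>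
     emeasure M vicsek_set = 1 \<and>
     (\<forall>n. \<forall>w\<in>vicsek_words n. emeasure M (vicsek_psi_word w ` vicsek_set) = ennreal ((1 / 5) ^ n)))"

definition vicsek_nu :: "(real \<times> real) measure" where
  "vicsek_nu = (THE M. space M = vicsek_skeleton \<and>
     sets M = sets (restrict_space borel vicsek_skeleton) \<and> sigma_finite_measure M \<and>
     (\<forall>n. \<forall>e\<in>vicsek_edges n. emeasure M e = ennreal ((1 / 3) ^ n)))"


section \<open>Lebesgue and Sobolev spaces\<close>

text \<open>Exponents range over \<open>ereal\<close>.  All (semi)norms are \<open>ennreal\<close>-valued, so that they are
  meaningful whether or not they are finite.\<close>

text \<open>Powers of extended nonnegative reals, for positive exponents.\<close>

definition ennreal_powr :: "ennreal \<Rightarrow> real \<Rightarrow> ennreal" where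
  "ennreal_powr x a = (if x = \<infinity> then \<infinity> else ennreal (enn2real x powr a))"

definition Lp_norm :: "ereal \<Rightarrow> 'a measure \<Rightarrow> ('a \<Rightarrow> real) \<Rightarrow> ennreal" where
  "Lp_norm p M g =
     (if p = \<infinity> then esssup M (\<lambda>x. ennreal \<bar>g x\<bar>)
      else ennreal_powr (\<integral>\<^sup>+x. ennreal (\<bar>g x\<bar> powr real_of_ereal p) \<partial>M) (1 / real_of_ereal p))"

definition Lp_space :: "ereal \<Rightarrow> 'a measure \<Rightarrow> ('a \<Rightarrow> real) set" where
  "Lp_space p M = {g \<in> borel_measurable M. Lp_norm p M g < \<infinity>}"

definition vicsek_dh :: real where
  "vicsek_dh = ln 5 / ln 3"

definition vicsek_alpha :: "real \<Rightarrow> real" where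
  "vicsek_alpha p = 1 - 1 / p + vicsek_dh / p"

definition korevaar_schoen :: "real \<Rightarrow> (real \<times> real \<Rightarrow> real) \<Rightarrow> real \<Rightarrow> ennreal" where
  "korevaar_schoen p f r =
     ennreal (1 / r powr vicsek_alpha p) *
     ennreal_powr
       (\<integral>\<^sup>+x. (\<integral>\<^sup>+y\<in>vicsek_ball x r.
          ennreal (\<bar>f y - f x\<bar> powr p) / emeasure vicsek_mu (vicsek_ball x r)
          \<partial>vicsek_mu) \<partial>vicsek_mu)
       (1 / p)"

definition W_norm :: "ereal \<Rightarrow> (real \<times> real \<Rightarrow> real) \<Rightarrow> ennreal" where
  "W_norm p f =
     (if p = \<infinity>
      then SUP (x, y)\<in>{(x, y) \<in> vicsek_set \<times> vicsek_set. x \<noteq> y}.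
             ennreal (\<bar>f x - f y\<bar> / vicsek_dist x y)
      else Limsup (at_right 0) (korevaar_schoen (real_of_ereal p) f))"

definition W_space :: "ereal \<Rightarrow> (real \<times> real \<Rightarrow> real) set" where
  "W_space p =
     (if p = \<infinity>
      then {f. \<exists>L. \<forall>x\<in>vicsek_set. \<forall>y\<in>vicsek_set. \<bar>f x - f y\<bar> \<le> L * vicsek_dist x y}
      else {f \<in> Lp_space p vicsek_mu. W_norm p f < \<infinity>})"


section \<open>Discrete energies\<close>

definition vicsek_energy :: "ereal \<Rightarrow> nat \<Rightarrow> (real \<times> real \<Rightarrow> real) \<Rightarrow> real" where
  "vicsek_energy p m f =
     (if p = \<infinity>
      then 3 ^ m * Max {\<bar>f x - f y\<bar> | x y. vicsek_adj m x y}
      else 1 / 2 * 3 powr ((real_of_ereal p - 1) * real m) *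
             (\<Sum>(x, y)\<in>{(x, y). vicsek_adj m x y}. \<bar>f x - f y\<bar> powr real_of_ereal p))"

definition F_space :: "ereal \<Rightarrow> (real \<times> real \<Rightarrow> real) set" where
  "F_space p = {f. continuous_on vicsek_set f \<and> bdd_above (range (\<lambda>m. vicsek_energy p m f))}"

definition F_norm :: "ereal \<Rightarrow> (real \<times> real \<Rightarrow> real) \<Rightarrow> ennreal" where
  "F_norm p f =
     (if p = \<infinity> then SUP m. ennreal (vicsek_energy p m f)
      else SUP m. ennreal (vicsek_energy p m f powr (1 / real_of_ereal p)))"


section \<open>Weak gradients\<close>

definition is_gradient :: "ereal \<Rightarrow> (real \<times> real \<Rightarrow> real) \<Rightarrow> (real \<times> real \<Rightarrow> real) \<Rightarrow> bool" where
  "is_gradient p f g \<longleftrightarrow>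
     g \<in> Lp_space p vicsek_nu \<and>
     (\<forall>n u v. vicsek_adj n u v \<and> vicsek_below u v \<longrightarrow>
        f v - f u = (LINT x:closed_segment u v|vicsek_nu. g x))"

end

theory Submission
  imports Defs "HOL-Probability.Infinite_Product_Measure"
begin

text \<open>Cells of level \<open>n\<close> sit at points of a rescaled integer lattice, so two points at distance less
  than \<open>sqrt 2 / 3 ^ n\<close> lie in cells that share a corner; this makes the geodesic distance
  comparable to the Euclidean one and localises Korevaar--Schoen integrals. Discrete energies
  increase with the level and split over cells, so a chaining argument bounds the oscillation on a
  cell by its energy, which controls the Korevaar--Schoen norm. Conversely, the increment along an
  edge telescopes through cell averages, whose differences are bounded by Korevaar--Schoen
  integrals. The slopes of \<open>f\<close> along the edges of level \<open>n\<close> form a martingale with respect to the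
  length measure whose \<open>L\<^sup>p\<close> norms are the discrete energies: its limit is the gradient, Fatou's
  lemma and Jensen's inequality identify the norms, and a function with vanishing integral over all
  edges vanishes almost everywhere.\<close>

text \<open>\<open>vicsek_set\<close>, \<open>vicsek_mu\<close>, \<open>vicsek_nu\<close> and the
  distance on the skeleton are definite descriptions, and the distance on the rest of K is a
  \<open>Lim\<close>: none of them can be used before existence and uniqueness are proved. One fact
  serves all of these: two different cells of one level meet in at most one point. It makes the
  cable systems trees, and it makes cells (or edges) together with finite sets stable under
  intersection, so that measures without atoms are determined by their values there. The skeleton
  has infinite length, as the cable of level n has length 4 (5/3)^n, so convergence of slopes is
  proved edge by edge. On an edge of level n the slopes are a martingale only from level n on: at
  earlier levels the edge may lie outside the cable, where the slope is 0. The condition p > 1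
  enters three times as a ratio below 1 or a decaying factor: 3^(-(p-1)/p) in the chaining bound,
  (2/3)^(p-1) in the telescoping of averages, and R^(1-q) in the uniform integrability of
  slopes.\<close>

definition dirx :: "nat \<Rightarrow> int" where
  "dirx i = (if i = 1 \<or> i = 4 then - 1 else if i = 2 \<or> i = 3 then 1 else 0)"

definition diry :: "nat \<Rightarrow> int" where
  "diry i = (if i = 1 \<or> i = 2 then 1 else if i = 3 \<or> i = 4 then - 1 else 0)"

text \<open>The arm cell \<open>i\<close> touches the central cell at its own corner
  \<open>opp i\<close>; the half of the arm's diagonal that points back to the centre carries this
  index.\<close>

definition opp :: "nat \<Rightarrow> nat" where
  "opp i = (if i = 1 then 3 else if i = 2 then 4 else if i = 3 then 1 else if i = 4 then 2 else 5)"

text \<open>The cell of a word \<open>w\<close> of length \<open>n\<close> is the image of \<open>K\<close> under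
  \<open>z \<mapsto> (sqrt 2 * P + z) / 3 ^ n\<close>, where \<open>P\<close> is the following integer point, written in
  balanced ternary.\<close>

primrec latx :: "nat list \<Rightarrow> int" where
  "latx [] = 0"
| "latx (i # w) = latx w + 3 ^ length w * dirx i"

primrec laty :: "nat list \<Rightarrow> int" where
  "laty [] = 0"
| "laty (i # w) = laty w + 3 ^ length w * diry i"

section \<open>Affine form of the cell maps, and words\<close>

lemma index5_cases: "i \<in> {1..5::nat} \<longleftrightarrow> i = 1 \<or> i = 2 \<or> i = 3 \<or> i = 4 \<or> i = 5" and
  index4_cases: "i \<in> {1..4::nat} \<longleftrightarrow> i = 1 \<or> i = 2 \<or> i = 3 \<or> i = 4"
  by auto

lemma vicsek_q_eq: "vicsek_q i = (sqrt 2 / 2 * of_int (dirx i), sqrt 2 / 2 * of_int (diry i))"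
  by (auto simp: vicsek_q_def dirx_def diry_def)

lemma vicsek_q_5 [simp]: "vicsek_q 5 = 0"
  by (simp add: vicsek_q_def zero_prod_def)

lemma vicsek_q_opp: "vicsek_q (opp i) = - vicsek_q i"
  by (auto simp: vicsek_q_def opp_def)

lemma dir_opp: "dirx (opp i) = - dirx i" "diry (opp i) = - diry i"
  by (auto simp: dirx_def diry_def opp_def)

lemma opp_in: "i \<in> {1..4} \<Longrightarrow> opp i \<in> {1..4}"
  by (auto simp: opp_def)

lemma norm_vicsek_q: "i \<in> {1..4} \<Longrightarrow> norm (vicsek_q i) = 1"
  by (auto simp: vicsek_q_def norm_Pair power_divide)

lemma vicsek_psi_eq: "vicsek_psi i z = (1 / 3) *\<^sub>R z + (2 / 3) *\<^sub>R vicsek_q i"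
  by (simp add: vicsek_psi_def algebra_simps prod_eq_iff)

lemma vicsek_psi_q [simp]: "vicsek_psi i (vicsek_q i) = vicsek_q i"
  by (simp add: vicsek_psi_def)

lemma psi_word_Nil [simp]: "vicsek_psi_word [] = id"
  and psi_word_Cons: "vicsek_psi_word (i # w) = vicsek_psi i \<circ> vicsek_psi_word w"
  by (simp_all add: vicsek_psi_word_def)

lemma psi_word_append: "vicsek_psi_word (u @ w) = vicsek_psi_word u \<circ> vicsek_psi_word w"
  by (induction u) (auto simp: psi_word_Cons)

lemma psi_word_diff:
  "vicsek_psi_word w x - vicsek_psi_word w y = (1 / 3 ^ length w) *\<^sub>R (x - y)"
proof (induction w)
  case (Cons i w)
  have "vicsek_psi_word (i # w) x - vicsek_psi_word (i # w) y
      = (1 / 3) *\<^sub>R (vicsek_psi_word w x - vicsek_psi_word w y)"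
    by (simp add: psi_word_Cons vicsek_psi_eq scaleR_diff_right)
  then show ?case by (simp add: Cons)
qed simp

lemma psi_word_eq: "vicsek_psi_word w x = vicsek_psi_word w 0 + (1 / 3 ^ length w) *\<^sub>R x"
  using psi_word_diff[of w x 0] by (simp add: algebra_simps)

lemma dist_psi_word: "dist (vicsek_psi_word w x) (vicsek_psi_word w y) = dist x y / 3 ^ length w"
  by (simp add: dist_norm psi_word_diff)

lemma inj_psi_word: "inj (vicsek_psi_word w)"
  by (rule injI) (metis dist_eq_0_iff dist_psi_word divide_eq_0_iff power_eq_0_iff zero_neq_numeral)

lemma continuous_on_psi_word: "continuous_on A (vicsek_psi_word w)"
  by (subst psi_word_eq[abs_def]) (intro continuous_intros)

lemma fst_psi_word: "fst (vicsek_psi_word w z) = (sqrt 2 * of_int (latx w) + fst z) / 3 ^ length w"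
  by (induction w) (auto simp: psi_word_Cons vicsek_psi_eq vicsek_q_eq field_simps)

lemma snd_psi_word: "snd (vicsek_psi_word w z) = (sqrt 2 * of_int (laty w) + snd z) / 3 ^ length w"
  by (induction w) (auto simp: psi_word_Cons vicsek_psi_eq vicsek_q_eq field_simps)

lemma psi_word_segment:
  "vicsek_psi_word w ` closed_segment a b = closed_segment (vicsek_psi_word w a) (vicsek_psi_word w b)"
proof -
  have "linear (\<lambda>x::real \<times> real. (1 / 3 ^ length w) *\<^sub>R x)"
    by (rule linear_scaleR)
  then have "closed_segment ((1 / 3 ^ length w) *\<^sub>R a) ((1 / 3 ^ length w) *\<^sub>R b) =
      (\<lambda>x. (1 / 3 ^ length w) *\<^sub>R x) ` closed_segment a b"
    using closed_segment_linear_image by blast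
  moreover have "vicsek_psi_word w ` closed_segment a b =
     (\<lambda>x. vicsek_psi_word w 0 + x) ` (\<lambda>x. (1 / 3 ^ length w) *\<^sub>R x) ` closed_segment a b"
    unfolding image_image by (rule image_cong[OF refl psi_word_eq])
  ultimately show ?thesis
    by (simp add: closed_segment_translation psi_word_eq[of w a] psi_word_eq[of w b])
qed

lemma words_0 [simp]: "vicsek_words 0 = {[]}"
  by (auto simp: vicsek_words_def)

lemma words_Suc: "vicsek_words (Suc n) = (\<Union>i\<in>{1..5}. (#) i ` vicsek_words n)"
proof (intro equalityI subsetI)
  fix w assume "w \<in> vicsek_words (Suc n)"
  then show "w \<in> (\<Union>i\<in>{1..5}. (#) i ` vicsek_words n)"
    by (cases w) (auto simp: vicsek_words_def)
qed (auto simp: vicsek_words_def)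

lemma words_append: "u \<in> vicsek_words n \<Longrightarrow> w \<in> vicsek_words m \<Longrightarrow> u @ w \<in> vicsek_words (n + m)"
  by (auto simp: vicsek_words_def)

lemma words_snoc: "u \<in> vicsek_words n \<Longrightarrow> i \<in> {1..5} \<Longrightarrow> u @ [i] \<in> vicsek_words (Suc n)"
  by (auto simp: vicsek_words_def)

lemma words_take: "w \<in> vicsek_words (n + m) \<Longrightarrow> take n w \<in> vicsek_words n"
  and words_drop: "w \<in> vicsek_words (n + m) \<Longrightarrow> drop n w \<in> vicsek_words m"
  by (auto simp: vicsek_words_def dest: in_set_takeD in_set_dropD)

lemma length_words: "w \<in> vicsek_words n \<Longrightarrow> length w = n"
  by (simp add: vicsek_words_def)

lemma finite_words [simp]: "finite (vicsek_words n)"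
  using finite_lists_length_eq[of "{1..5::nat}" n] by (simp add: vicsek_words_def conj_commute)

lemma sum_words_add:
  "sum h (vicsek_words (n + m)) = (\<Sum>u\<in>vicsek_words n. \<Sum>w\<in>vicsek_words m. h (u @ w))"
proof -
  have "bij_betw (\<lambda>p. fst p @ snd p) (vicsek_words n \<times> vicsek_words m) (vicsek_words (n + m))"
  proof (rule bij_betwI[where g = "\<lambda>w. (take n w, drop n w)"])
    show "(\<lambda>p. fst p @ snd p) \<in> vicsek_words n \<times> vicsek_words m \<rightarrow> vicsek_words (n + m)"
      by (auto intro: words_append)
    show "(\<lambda>w. (take n w, drop n w)) \<in> vicsek_words (n + m) \<rightarrow> vicsek_words n \<times> vicsek_words m"
      by (auto intro: words_take words_drop)
  qed (auto simp: vicsek_words_def)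
  from sum.reindex_bij_betw[OF this, of h] show ?thesis
    by (simp add: sum.cartesian_product case_prod_beta')
qed

lemma words_1: "vicsek_words (Suc 0) = (\<lambda>i. [i]) ` {1..5}"
  by (auto simp: words_Suc)

lemma sum_words_Suc:
  "sum h (vicsek_words (Suc n)) = (\<Sum>u\<in>vicsek_words n. \<Sum>i\<in>{1..5}. h (u @ [i]))"
  using sum_words_add[of h n "Suc 0"] by (simp add: words_1 sum.reindex inj_on_def)

section \<open>Lattice points of cells\<close>

lemma dir_inj: "i \<in> {1..5} \<Longrightarrow> j \<in> {1..5} \<Longrightarrow> dirx i = dirx j \<Longrightarrow> diry i = diry j \<Longrightarrow> i = j"
  unfolding index5_cases by (elim disjE) (simp_all add: dirx_def diry_def)

lemma latx_bound: "2 * \<bar>latx w\<bar> < 3 ^ length w"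
proof (induction w)
  case (Cons i w)
  have "\<bar>3 ^ length w * dirx i\<bar> \<le> 3 ^ length w"
    by (auto simp: dirx_def abs_mult)
  then have "\<bar>latx (i # w)\<bar> \<le> \<bar>latx w\<bar> + 3 ^ length w"
    unfolding latx.simps using abs_triangle_ineq[of "latx w" "3 ^ length w * dirx i"] by linarith
  then show ?case
    using Cons by auto
qed simp

lemma laty_bound: "2 * \<bar>laty w\<bar> < 3 ^ length w"
proof (induction w)
  case (Cons i w)
  have "\<bar>3 ^ length w * diry i\<bar> \<le> 3 ^ length w"
    by (auto simp: diry_def abs_mult)
  then have "\<bar>laty (i # w)\<bar> \<le> \<bar>laty w\<bar> + 3 ^ length w"
    unfolding laty.simps using abs_triangle_ineq[of "laty w" "3 ^ length w * diry i"] by linarith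
  then show ?case
    using Cons by auto
qed simp

text \<open>Two remainders below N/2 in modulus differ by less than N, so the multiples of N must
  agree. Applied to the leading balanced ternary digit, this gives injectivity of addresses in
  \<open>lat_inj\<close>.\<close>

lemma ternary_digit_unique:
  fixes a b e f N :: int
  assumes "2 * \<bar>a\<bar> < N" "2 * \<bar>b\<bar> < N" "a + N * e = b + N * f"
  shows "e = f"
proof (rule ccontr)
  assume "e \<noteq> f"
  then have "1 \<le> \<bar>e - f\<bar>" by simp
  have "0 < N" using assms by linarith
  then have "N \<le> N * \<bar>e - f\<bar>" using \<open>1 \<le> \<bar>e - f\<bar>\<close> by simp
  also have "\<dots> = \<bar>N * (e - f)\<bar>" using \<open>0 < N\<close> by (simp add: abs_mult)
  also have "\<dots> = \<bar>b - a\<bar>" using assms(3) by (simp add: right_diff_distrib)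
  also have "\<dots> < N" using assms by linarith
  finally show False by simp
qed

lemma lat_inj:
  "w \<in> vicsek_words n \<Longrightarrow> w' \<in> vicsek_words n \<Longrightarrow> latx w = latx w' \<Longrightarrow> laty w = laty w' \<Longrightarrow> w = w'"
proof (induction n arbitrary: w w')
  case (Suc n)
  obtain i v where w: "w = i # v" "i \<in> {1..5}" "v \<in> vicsek_words n"
    using Suc.prems(1) by (auto simp: words_Suc)
  obtain j v' where w': "w' = j # v'" "j \<in> {1..5}" "v' \<in> vicsek_words n"
    using Suc.prems(2) by (auto simp: words_Suc)
  have l: "length v = n" "length v' = n" using w w' by (auto dest: length_words)
  have x: "dirx i = dirx j"
    using ternary_digit_unique[of "latx v" "3 ^ n" "latx v'" "dirx i" "dirx j"]
      latx_bound[of v] latx_bound[of v'] Suc.prems l w w' by simp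
  have y: "diry i = diry j"
    using ternary_digit_unique[of "laty v" "3 ^ n" "laty v'" "diry i" "diry j"]
      laty_bound[of v] laty_bound[of v'] Suc.prems l w w' by simp
  show ?case
    using Suc.IH[of v v'] Suc.prems dir_inj[OF _ _ x y] l w w' x y by simp
qed simp

text \<open>Every digit is (0, 0) or has two odd coordinates, hence an even coordinate sum. This
  excludes cells that share a side.\<close>

lemma lat_parity: "even (latx w + laty w)"
proof (induction w)
  case (Cons i w)
  have "even (dirx i + diry i)" by (auto simp: dirx_def diry_def)
  then have "even ((latx w + laty w) + 3 ^ length w * (dirx i + diry i))"
    using Cons by auto
  then show ?case by (simp add: algebra_simps)
qed simp

text \<open>Meant for words of equal length: lattice points at sup-distance at most 1 belong to
  enclosing squares that touch.\<close>

definition near :: "nat list \<Rightarrow> nat list \<Rightarrow> bool" where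
  "near w w' \<longleftrightarrow> \<bar>latx w - latx w'\<bar> \<le> 1 \<and> \<bar>laty w - laty w'\<bar> \<le> 1"

lemma near_sym: "near w w' \<longleftrightarrow> near w' w"
  by (auto simp: near_def)

lemma near_refl [simp]: "near w w"
  by (simp add: near_def)

text \<open>A 3 by 3 block of lattice points. Parity would leave only five of them; the crude count
  is the source of the 9 and 18 in later constants.\<close>

lemma card_near_le:
  assumes "w \<in> vicsek_words n"
  shows "card {w' \<in> vicsek_words n. near w w'} \<le> 9"
proof -
  have "card {w' \<in> vicsek_words n. near w w'} \<le> card ({latx w - 1..latx w + 1} \<times> {laty w - 1..laty w + 1})"
    by (rule card_inj_on_le[where f = "\<lambda>w. (latx w, laty w)"])
       (auto simp: near_def inj_on_def dest: lat_inj)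
  then show ?thesis by simp
qed

text \<open>By parity, two near cells of the same level lie diagonally to each other.\<close>

lemma near_imp_common_corner:
  assumes w: "w \<in> vicsek_words n" and w': "w' \<in> vicsek_words n" and "near w w'" "w \<noteq> w'"
  obtains i where "i \<in> {1..4}" "latx w' = latx w + dirx i" "laty w' = laty w + diry i"
    "vicsek_psi_word w (vicsek_q i) = vicsek_psi_word w' (vicsek_q (opp i))"
proof -
  have ne: "latx w \<noteq> latx w' \<or> laty w \<noteq> laty w'"
    using lat_inj[OF w w'] \<open>w \<noteq> w'\<close> by auto
  define a where "a = latx w' - latx w"
  define b where "b = laty w' - laty w"
  have "even (a + b)"
    using lat_parity[of w] lat_parity[of w'] unfolding a_def b_def by presburger
  moreover have "a \<in> {-1, 0, 1}" "b \<in> {-1, 0, 1}"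
    using \<open>near w w'\<close> by (auto simp: near_def a_def b_def)
  moreover have "a \<noteq> 0 \<or> b \<noteq> 0" using ne by (auto simp: a_def b_def)
  ultimately have "(a, b) \<in> {(-1, 1), (1, 1), (1, -1), (-1, -1)}" by auto
  then have "dirx 1 = a \<and> diry 1 = b \<or> dirx 2 = a \<and> diry 2 = b \<or> dirx 3 = a \<and> diry 3 = b \<or>
      dirx 4 = a \<and> diry 4 = b"
    by (auto simp: dirx_def diry_def)
  then have "\<exists>i\<in>{1..4}. dirx i = a \<and> diry i = b"
    by (elim disjE) (auto intro: bexI[of _ 1] bexI[of _ 2] bexI[of _ 3] bexI[of _ 4])
  then obtain i where i: "i \<in> {1..4}" "dirx i = a" "diry i = b" by blast
  have "length w = length w'" using w w' by (simp add: length_words)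
  then have "vicsek_psi_word w (vicsek_q i) = vicsek_psi_word w' (vicsek_q (opp i))"
    using i(2,3)[unfolded a_def b_def, THEN arg_cong[where f = real_of_int]]
    by (simp add: prod_eq_iff fst_psi_word snd_psi_word vicsek_q_eq dir_opp) (simp add: field_simps)
  with i show ?thesis by (intro that[of i]) (auto simp: a_def b_def)
qed

section \<open>Incidence of cells, read off from the grid of enclosing squares\<close>

definition square :: "(real \<times> real) set" where
  "square = {z. \<bar>fst z\<bar> \<le> sqrt 2 / 2 \<and> \<bar>snd z\<bar> \<le> sqrt 2 / 2}"

lemma norm_square: "z \<in> square \<Longrightarrow> norm z \<le> 1"
proof -
  assume z: "z \<in> square"
  have "(fst z)\<^sup>2 \<le> (sqrt 2 / 2)\<^sup>2" "(snd z)\<^sup>2 \<le> (sqrt 2 / 2)\<^sup>2"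
    using z by (auto simp: square_def intro!: abs_le_square_iff[THEN iffD1])
  then have "(fst z)\<^sup>2 + (snd z)\<^sup>2 \<le> 1" by (simp add: power_divide)
  then show ?thesis by (simp add: norm_prod_def)
qed

lemma convex_square: "convex square"
proof -
  have "square = {- sqrt 2 / 2..sqrt 2 / 2} \<times> {- sqrt 2 / 2..sqrt 2 / 2}"
    by (auto simp: square_def)
  then show ?thesis by (metis convex_Times convex_real_interval(5))
qed

lemma closed_square: "closed square"
proof -
  have "square = {- sqrt 2 / 2..sqrt 2 / 2} \<times> {- sqrt 2 / 2..sqrt 2 / 2}"
    by (auto simp: square_def)
  then show ?thesis by (metis closed_Times closed_real_atLeastAtMost)
qed

lemma vicsek_q_square: "vicsek_q i \<in> square"
  by (auto simp: square_def vicsek_q_eq dirx_def diry_def)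

text \<open>The triangle inequality gives sqrt 2 * |a - b| < 2 * sqrt 2, and |a - b| is an
  integer.\<close>

lemma lat_coord_near:
  fixes a b :: int and s t :: real
  assumes "\<bar>(sqrt 2 * of_int a + s) - (sqrt 2 * of_int b + t)\<bar> < sqrt 2" "\<bar>s\<bar> \<le> sqrt 2 / 2" "\<bar>t\<bar> \<le> sqrt 2 / 2"
  shows "\<bar>a - b\<bar> \<le> 1"
proof -
  have "sqrt 2 * \<bar>of_int a - of_int b\<bar> = \<bar>sqrt 2 * of_int a - sqrt 2 * of_int b\<bar>"
    by (simp add: abs_mult flip: right_diff_distrib)
  also have "\<dots> < sqrt 2 + sqrt 2 / 2 + sqrt 2 / 2" using assms by linarith
  finally have "sqrt 2 * \<bar>of_int a - of_int b\<bar> < sqrt 2 * 2" by simp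
  then have "\<bar>real_of_int a - of_int b\<bar> < 2" by simp
  then show ?thesis by linarith
qed

text \<open>The threshold \<open>sqrt 2 / 3 ^ n\<close> is the side of the enclosing squares of
  level n.\<close>

lemma dist_imp_near:
  assumes w: "w \<in> vicsek_words n" and w': "w' \<in> vicsek_words n" and xy: "x \<in> square" "y \<in> square"
    and d: "dist (vicsek_psi_word w x) (vicsek_psi_word w' y) < sqrt 2 / 3 ^ n"
  shows "near w w'"
proof -
  have l: "length w = n" "length w' = n" using w w' by (auto dest: length_words)
  let ?a = "vicsek_psi_word w x" and ?b = "vicsek_psi_word w' y"
  have scale: "\<bar>s - t\<bar> < sqrt 2" if "dist (s / 3 ^ n) (t / 3 ^ n) < sqrt 2 / 3 ^ n" for s t :: real
  proof -
    have "dist (s / 3 ^ n) (t / 3 ^ n) = \<bar>s - t\<bar> / 3 ^ n"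
      by (simp add: dist_real_def abs_divide flip: diff_divide_distrib)
    with that show ?thesis by (simp add: divide_less_cancel)
  qed
  have "dist (fst ?a) (fst ?b) < sqrt 2 / 3 ^ n" "dist (snd ?a) (snd ?b) < sqrt 2 / 3 ^ n"
    using dist_fst_le[of ?a ?b] dist_snd_le[of ?a ?b] d by linarith+
  then have "\<bar>(sqrt 2 * of_int (latx w) + fst x) - (sqrt 2 * of_int (latx w') + fst y)\<bar> < sqrt 2"
    "\<bar>(sqrt 2 * of_int (laty w) + snd x) - (sqrt 2 * of_int (laty w') + snd y)\<bar> < sqrt 2"
    unfolding fst_psi_word snd_psi_word l by (blast intro: scale)+
  with xy show ?thesis
    unfolding near_def square_def by (auto intro: lat_coord_near)
qed

text \<open>Two intervals of length c whose centres are c apart share only an endpoint.\<close>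

lemma corner_coord:
  fixes e :: int and s t c :: real
  assumes "e \<in> {-1, 1}" "s = c * of_int e + t" "\<bar>s\<bar> \<le> c / 2" "\<bar>t\<bar> \<le> c / 2"
  shows "s = c / 2 * of_int e"
proof (cases "e = 1")
  case True
  then have "s = c + t" using assms(2) by simp
  moreover have "s \<le> c / 2" "- t \<le> c / 2" using assms(3,4) by linarith+
  ultimately have "s = c / 2" by linarith
  then show ?thesis using True by simp
next
  case False
  then have "e = -1" "s = - c + t" using assms(1,2) by auto
  moreover have "- s \<le> c / 2" "t \<le> c / 2" using assms(3,4) by linarith+
  ultimately have "s = - (c / 2)" by linarith
  then show ?thesis using \<open>e = -1\<close> by simp
qed

text \<open>Cells that are not near have disjoint squares. Near ones are diagonal neighbours by
  parity, and such squares share exactly a corner. Tree structure and null overlaps of cells all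
  rest on this.\<close>

lemma cell_Int_subset:
  assumes w: "w \<in> vicsek_words n" and w': "w' \<in> vicsek_words n" and "w \<noteq> w'"
  shows "\<exists>i\<in>{1..4}. vicsek_psi_word w ` square \<inter> vicsek_psi_word w' ` square \<subseteq> {vicsek_psi_word w (vicsek_q i)}"
proof (cases "near w w'")
  case False
  then have "vicsek_psi_word w ` square \<inter> vicsek_psi_word w' ` square = {}"
    using dist_imp_near[OF w w'] by fastforce
  then show ?thesis by (intro bexI[of _ 1]) auto
next
  case True
  obtain i where i: "i \<in> {1..4}" "latx w' = latx w + dirx i" "laty w' = laty w + diry i"
    using near_imp_common_corner[OF w w' True \<open>w \<noteq> w'\<close>] by metis
  have l: "length w = n" "length w' = n" using w w' by (auto dest: length_words)
  have "vicsek_psi_word w x = vicsek_psi_word w (vicsek_q i)"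
    if "x \<in> square" "y \<in> square" "vicsek_psi_word w x = vicsek_psi_word w' y" for x y
  proof -
    have "fst (vicsek_psi_word w x) = fst (vicsek_psi_word w' y)"
      "snd (vicsek_psi_word w x) = snd (vicsek_psi_word w' y)" using that by simp_all
    then have "fst x = sqrt 2 * dirx i + fst y" "snd x = sqrt 2 * diry i + snd y"
      by (simp_all add: fst_psi_word snd_psi_word l i algebra_simps)
    moreover have "dirx i \<in> {-1, 1}" "diry i \<in> {-1, 1}"
      using i(1) unfolding index4_cases by (auto simp: dirx_def diry_def)
    moreover have "\<bar>fst x\<bar> \<le> sqrt 2 / 2" "\<bar>snd x\<bar> \<le> sqrt 2 / 2" "\<bar>fst y\<bar> \<le> sqrt 2 / 2" "\<bar>snd y\<bar> \<le> sqrt 2 / 2"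
      using that by (auto simp: square_def)
    ultimately have "fst x = sqrt 2 / 2 * dirx i" "snd x = sqrt 2 / 2 * diry i"
      by - (rule corner_coord; assumption)+
    then have "x = vicsek_q i"
      by (simp only: vicsek_q_eq prod_eq_iff fst_conv snd_conv)
    then show ?thesis by simp
  qed
  then have "vicsek_psi_word w ` square \<inter> vicsek_psi_word w' ` square \<subseteq> {vicsek_psi_word w (vicsek_q i)}"
    by blast
  then show ?thesis using i by blast
qed

section \<open>Lengths of arcs and tree-like sets\<close>

fun poly_len :: "'a::metric_space list \<Rightarrow> real" where
  "poly_len (x # y # xs) = dist x y + poly_len (y # xs)"
| "poly_len xs = 0"

lemma poly_len_nonneg: "0 \<le> poly_len xs"
  by (induction xs rule: poly_len.induct) auto

lemma sum_dist_eq_poly_len: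
  "(\<Sum>k<length xs - 1. ennreal (dist (xs ! k) (xs ! Suc k))) = ennreal (poly_len xs)"
proof (induction xs rule: poly_len.induct)
  case (1 x y xs)
  have "(\<Sum>k<length (x # y # xs) - 1. ennreal (dist ((x # y # xs) ! k) ((x # y # xs) ! Suc k)))
     = ennreal (dist x y) + (\<Sum>k<length (y # xs) - 1. ennreal (dist ((y # xs) ! k) ((y # xs) ! Suc k)))"
    by (simp add: sum.lessThan_Suc_shift del: sum.lessThan_Suc)
  then show ?case by (simp only: 1) (simp add: poly_len_nonneg)
qed auto

lemma poly_len_append_split: "poly_len (xs @ y # ys) = poly_len (xs @ [y]) + poly_len (y # ys)"
proof (induction xs rule: poly_len.induct)
  case ("2_2" v) then show ?case by (cases ys) auto
qed auto

lemma poly_len_Cons_ge: "poly_len ys \<le> poly_len (y # ys)"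
  by (cases ys) auto

lemma poly_len_append_ge: "poly_len xs + poly_len ys \<le> poly_len (xs @ ys)"
proof (induction xs rule: poly_len.induct)
  case ("2_2" v) then show ?case using poly_len_Cons_ge by auto
qed auto

lemma poly_len_insert_le: "poly_len (xs @ ys) \<le> poly_len (xs @ y # ys)"
proof (induction xs rule: poly_len.induct)
  case "2_1" then show ?case using poly_len_Cons_ge by auto
next
  case ("2_2" v)
  then show ?case
  proof (cases ys)
    case (Cons z zs)
    then show ?thesis using dist_triangle[of v z y] by auto
  qed auto
qed auto

lemma poly_len_rev: "poly_len (rev xs) = poly_len xs"
proof (induction xs rule: poly_len.induct)
  case (1 x y xs)
  have "poly_len (rev (x # y # xs)) = poly_len (rev xs @ [y]) + poly_len [y, x]"
    using poly_len_append_split[of "rev xs" y "[x]"] by simp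
  with 1 show ?case by (simp add: dist_commute)
qed auto

text \<open>Variation over a subinterval without reparametrisation; additivity is proved here and
  transported to \<open>subpath\<close> afterwards.\<close>

definition length_between :: "(real \<Rightarrow> 'a::metric_space) \<Rightarrow> real \<Rightarrow> real \<Rightarrow> ennreal" where
  "length_between g a b = (SUP ts\<in>{ts. sorted ts \<and> set ts \<subseteq> {a..b}}. ennreal (poly_len (map g ts)))"

lemma curve_length_eq: "curve_length g = length_between g 0 1"
proof -
  have "(\<Sum>k<length ts - 1. ennreal (dist (g (ts ! k)) (g (ts ! Suc k)))) = ennreal (poly_len (map g ts))"
    for ts :: "real list"
    by (subst sum_dist_eq_poly_len[symmetric]) (auto intro!: sum.cong)
  then show ?thesis by (simp add: curve_length_def length_between_def)
qed

lemma poly_len_le_length_between: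
  "sorted ts \<Longrightarrow> set ts \<subseteq> {a..b} \<Longrightarrow> ennreal (poly_len (map g ts)) \<le> length_between g a b"
  unfolding length_between_def by (rule SUP_upper) auto

lemma sorted_split_at:
  fixes ts :: "real list"
  shows "sorted ts \<Longrightarrow> \<exists>xs ys. ts = xs @ ys \<and> (\<forall>x\<in>set xs. x \<le> c) \<and> (\<forall>y\<in>set ys. c < y)"
proof (induction ts)
  case (Cons t ts)
  show ?case
  proof (cases "t \<le> c")
    case True
    obtain xs ys where "ts = xs @ ys" "\<forall>x\<in>set xs. x \<le> c" "\<forall>y\<in>set ys. c < y"
      using Cons by auto
    then show ?thesis using True by (intro exI[of _ "t # xs"] exI[of _ ys]) auto
  next
    case False
    then show ?thesis using Cons.prems by (intro exI[of _ "[]"] exI[of _ "t # ts"]) auto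
  qed
qed auto

lemma ennreal_SUP_add_SUP_le:
  fixes f g :: "_ \<Rightarrow> ennreal"
  assumes "I \<noteq> {}" "J \<noteq> {}" "\<And>i j. i \<in> I \<Longrightarrow> j \<in> J \<Longrightarrow> f i + g j \<le> c"
  shows "(SUP i\<in>I. f i) + (SUP j\<in>J. g j) \<le> c"
proof -
  have "f i + (SUP j\<in>J. g j) \<le> c" if "i \<in> I" for i
  proof -
    have "f i + (SUP j\<in>J. g j) = (SUP j\<in>J. f i + g j)"
      using assms(2) by (simp add: ennreal_SUP_add_right)
    also have "\<dots> \<le> c" using assms that by (auto intro: SUP_least)
    finally show ?thesis .
  qed
  moreover have "(SUP i\<in>I. f i) + (SUP j\<in>J. g j) = (SUP i\<in>I. f i + (SUP j\<in>J. g j))"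
    using assms(1) by (simp add: ennreal_SUP_add_left)
  ultimately show ?thesis by (auto intro: SUP_least)
qed

text \<open>Inserting c into a partition can only lengthen the inscribed polygon, and partitions of
  the two halves concatenate.\<close>

lemma length_between_add:
  assumes "a \<le> c" "c \<le> b"
  shows "length_between g a b = length_between g a c + length_between g c b"
proof (rule antisym)
  show "length_between g a b \<le> length_between g a c + length_between g c b"
    unfolding length_between_def[of g a b]
  proof (rule SUP_least, safe)
    fix ts :: "real list" assume ts: "sorted ts" "set ts \<subseteq> {a..b}"
    obtain xs ys where xy: "ts = xs @ ys" "\<forall>x\<in>set xs. x \<le> c" "\<forall>y\<in>set ys. c < y"
      using sorted_split_at[OF ts(1)] by blast
    have "sorted xs" "sorted ys" using ts(1) xy(1) by (auto simp: sorted_append)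
    then have s: "sorted (xs @ [c])" "sorted (c # ys)" using xy by (auto simp: sorted_append)
    have "poly_len (map g ts) \<le> poly_len (map g (xs @ [c])) + poly_len (map g (c # ys))"
      using poly_len_insert_le[of "map g xs" "map g ys" "g c"]
        poly_len_append_split[of "map g xs" "g c" "map g ys"] xy(1) by simp
    then have "ennreal (poly_len (map g ts)) \<le> ennreal (poly_len (map g (xs @ [c])) + poly_len (map g (c # ys)))"
      by (rule ennreal_leI)
    also have "\<dots> = ennreal (poly_len (map g (xs @ [c]))) + ennreal (poly_len (map g (c # ys)))"
      by (rule ennreal_plus) (rule poly_len_nonneg)+
    also have "\<dots> \<le> length_between g a c + length_between g c b"
      using s xy ts assms by (intro add_mono poly_len_le_length_between) auto
    finally show "ennreal (poly_len (map g ts)) \<le> length_between g a c + length_between g c b" .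
  qed
  show "length_between g a c + length_between g c b \<le> length_between g a b"
    unfolding length_between_def[of g a c] length_between_def[of g c b]
  proof (rule ennreal_SUP_add_SUP_le)
    have "[] \<in> {ts. sorted ts \<and> set ts \<subseteq> {u..v}}" for u v :: real by simp
    then show "{ts. sorted ts \<and> set ts \<subseteq> {a..c}} \<noteq> {}" "{ts. sorted ts \<and> set ts \<subseteq> {c..b}} \<noteq> {}"
      by blast+
  next
    fix xs ys :: "real list"
    assume "xs \<in> {ts. sorted ts \<and> set ts \<subseteq> {a..c}}" "ys \<in> {ts. sorted ts \<and> set ts \<subseteq> {c..b}}"
    then have *: "sorted xs" "set xs \<subseteq> {a..c}" "sorted ys" "set ys \<subseteq> {c..b}" by auto
    then have s: "sorted (xs @ ys)" "set (xs @ ys) \<subseteq> {a..b}"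
      using assms by (force simp: sorted_append)+
    have "ennreal (poly_len (map g xs)) + ennreal (poly_len (map g ys)) = ennreal (poly_len (map g xs) + poly_len (map g ys))"
      by (rule ennreal_plus[symmetric]) (rule poly_len_nonneg)+
    also have "\<dots> \<le> ennreal (poly_len (map g (xs @ ys)))"
      unfolding map_append by (intro ennreal_leI poly_len_append_ge)
    also have "\<dots> \<le> length_between g a b" using s by (rule poly_len_le_length_between)
    finally show "ennreal (poly_len (map g xs)) + ennreal (poly_len (map g ys)) \<le> length_between g a b" .
  qed
qed

lemma curve_length_subpath:
  assumes "u < v"
  shows "curve_length (subpath u v g) = length_between g u v"
proof (rule antisym)
  define \<phi> where "\<phi> t = (v - u) * t + u" for t
  define \<psi> where "\<psi> t = (t - u) / (v - u)" for t
  have inv: "\<phi> (\<psi> t) = t" for t using assms by (simp add: \<phi>_def \<psi>_def)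
  have sub: "map (subpath u v g) ts = map g (map \<phi> ts)" for ts
    by (simp add: subpath_def \<phi>_def)
  have m: "mono \<phi>" "mono \<psi>"
    using assms by (auto simp: \<phi>_def \<psi>_def mono_def intro!: mult_left_mono divide_right_mono)
  have r1: "\<phi> t \<in> {u..v}" if "t \<in> {0..1}" for t
    using mult_left_le[of t "v - u"] mult_nonneg_nonneg[of "v - u" t] that assms unfolding \<phi>_def atLeastAtMost_iff by linarith
  have r2: "\<psi> t \<in> {0..1}" if "t \<in> {u..v}" for t
    using that assms by (simp add: \<psi>_def)
  show "curve_length (subpath u v g) \<le> length_between g u v"
    unfolding curve_length_eq length_between_def[of _ 0 1]
  proof (rule SUP_least, safe)
    fix ts :: "real list" assume "sorted ts" "set ts \<subseteq> {0..1}"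
    then have "sorted (map \<phi> ts)" "set (map \<phi> ts) \<subseteq> {u..v}"
      using m r1 by (auto simp: sorted_map_mono mono_on_def mono_def simp del: atLeastAtMost_iff)
    then show "ennreal (poly_len (map (subpath u v g) ts)) \<le> length_between g u v"
      unfolding sub by (rule poly_len_le_length_between)
  qed
  show "length_between g u v \<le> curve_length (subpath u v g)"
    unfolding length_between_def
  proof (rule SUP_least, safe)
    fix ts :: "real list" assume "sorted ts" "set ts \<subseteq> {u..v}"
    then have "sorted (map \<psi> ts)" "set (map \<psi> ts) \<subseteq> {0..1}"
      using m r2 by (auto simp: sorted_map_mono mono_on_def mono_def simp del: atLeastAtMost_iff)
    then have "ennreal (poly_len (map (subpath u v g) (map \<psi> ts))) \<le> curve_length (subpath u v g)"
      unfolding curve_length_eq by (rule poly_len_le_length_between)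
    also have "map (subpath u v g) (map \<psi> ts) = map g ts"
      unfolding sub by (simp add: inv)
    finally show "ennreal (poly_len (map g ts)) \<le> curve_length (subpath u v g)" .
  qed
qed

lemma curve_length_split:
  assumes "0 < t" "t < 1"
  shows "curve_length g = curve_length (subpath 0 t g) + curve_length (subpath t 1 g)"
  using assms length_between_add[of 0 t 1 g] by (simp add: curve_length_eq[of g] curve_length_subpath)

lemma curve_length_reversepath_le: "curve_length (reversepath g) \<le> curve_length g"
  unfolding curve_length_eq length_between_def[of _ 0 1]
proof (rule SUP_mono)
  fix ts assume "ts \<in> {ts. sorted ts \<and> set ts \<subseteq> {0..1::real}}"
  then have "rev (map ((-) 1) ts) \<in> {ts. sorted ts \<and> set ts \<subseteq> {0..1}}"
    by (auto simp: sorted_wrt_rev sorted_wrt_map elim: sorted_wrt_mono_rel[rotated])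
  moreover have "map g (rev (map ((-) 1) ts)) = rev (map (reversepath g) ts)"
    by (simp add: reversepath_def rev_map)
  ultimately show "\<exists>m\<in>{ts. sorted ts \<and> set ts \<subseteq> {0..1}}.
      ennreal (poly_len (map (reversepath g) ts)) \<le> ennreal (poly_len (map g m))"
    by (metis order_refl poly_len_rev)
qed

lemma curve_length_reversepath: "curve_length (reversepath g) = curve_length g"
  using curve_length_reversepath_le[of g] curve_length_reversepath_le[of "reversepath g"] by simp

lemma dist_le_curve_length: "ennreal (dist (pathstart g) (pathfinish g)) \<le> curve_length g"
  using poly_len_le_length_between[of "[0, 1]" 0 1 g] by (simp add: curve_length_eq pathstart_def pathfinish_def)

lemma curve_length_similarity:
  assumes "\<And>x y. dist (\<phi> x) (\<phi> y) = c * dist x y" "0 \<le> c"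
  shows "curve_length (\<phi> \<circ> g) = ennreal c * curve_length g"
proof -
  have "poly_len (map \<phi> xs) = c * poly_len xs" for xs
    by (induction xs rule: poly_len.induct) (auto simp: assms algebra_simps)
  from this[of "map g ts" for ts] show ?thesis
    using assms(2) by (simp add: curve_length_eq length_between_def SUP_mult_left_ennreal ennreal_mult'' poly_len_nonneg ennreal_mult)
qed

section \<open>Arcs, and sets in which the length of arcs depends only on the endpoints\<close>

definition arc_in :: "'a::real_normed_vector set \<Rightarrow> 'a \<Rightarrow> 'a \<Rightarrow> (real \<Rightarrow> 'a) \<Rightarrow> bool" where
  "arc_in T x y g \<longleftrightarrow> arc g \<and> path_image g \<subseteq> T \<and> pathstart g = x \<and> pathfinish g = y"

lemma arc_inD:
  assumes "arc_in T x y g"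
  shows "arc g" "\<And>t. 0 \<le> t \<Longrightarrow> t \<le> 1 \<Longrightarrow> g t \<in> T" "g 0 = x" "g 1 = y" "inj_on g {0..1}"
    "continuous_on {0..1} g" "x \<noteq> y"
proof -
  show *: "arc g" "\<And>t. 0 \<le> t \<Longrightarrow> t \<le> 1 \<Longrightarrow> g t \<in> T" "g 0 = x" "g 1 = y" using assms
    by (auto simp: arc_in_def path_image_def pathstart_def pathfinish_def)
  then show inj: "inj_on g {0..1}" and "continuous_on {0..1} g" by (auto simp: arc_def path_def)
  show "x \<noteq> y" using inj_onD[OF inj, of 0 1] * by auto
qed

lemma arc_in_eqD: "arc_in T x y g \<Longrightarrow> g s = g t \<Longrightarrow> 0 \<le> s \<Longrightarrow> s \<le> 1 \<Longrightarrow> 0 \<le> t \<Longrightarrow> t \<le> 1 \<Longrightarrow> s = t"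
  using arc_inD(5) by (force dest: inj_onD)

lemma arc_in_mono: "arc_in T x y g \<Longrightarrow> T \<subseteq> T' \<Longrightarrow> arc_in T' x y g"
  by (auto simp: arc_in_def)

lemma arc_in_subpath:
  assumes "arc_in T x y g" "0 \<le> u" "u < v" "v \<le> 1" "\<And>t. u \<le> t \<Longrightarrow> t \<le> v \<Longrightarrow> g t \<in> T'"
  shows "arc_in T' (g u) (g v) (subpath u v g)"
  using assms by (auto simp: arc_in_def path_image_subpath intro: arc_subpath_arc)

lemma arc_in_reverse: "arc_in T x y g \<Longrightarrow> arc_in T y x (reversepath g)"
  by (auto simp: arc_in_def arc_reversepath)

text \<open>The image of an interval is connected, so two closed sets that cover it and both meet it
  must meet on it.\<close>

lemma curve_crosses:
  assumes "continuous_on {u..v} g" "\<And>t. u \<le> t \<Longrightarrow> t \<le> v \<Longrightarrow> g t \<in> A \<union> B" "closed A" "closed B"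
    "g u \<in> A" "g v \<in> B" "u \<le> (v::real)"
  obtains t where "u \<le> t" "t \<le> v" "g t \<in> A" "g t \<in> B"
proof -
  have "connected (g ` {u..v})" using assms(1) by (intro connected_continuous_image) auto
  moreover have "A \<inter> g ` {u..v} \<noteq> {}" "B \<inter> g ` {u..v} \<noteq> {}" using assms by auto
  moreover have "g ` {u..v} \<subseteq> A \<union> B" by (intro image_subsetI assms(2)) auto
  ultimately have "A \<inter> B \<inter> g ` {u..v} \<noteq> {}" using assms(3,4) unfolding connected_closed by blast
  then show ?thesis using that by auto
qed

text \<open>An arc that left A would pass through p once on the way out and once on the way back,
  against injectivity.\<close>

lemma arc_in_stays:
  assumes g: "arc_in (A \<union> B) x y g" and AB: "closed A" "closed B" "A \<inter> B \<subseteq> {p}" and xy: "x \<in> A" "y \<in> A"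
  shows "arc_in A x y g"
proof -
  note gD = arc_inD[OF g]
  have ba: "g s \<in> B \<union> A" if "0 \<le> s" "s \<le> 1" for s using gD(2)[OF that] by blast
  have "g t \<in> A" if t: "0 \<le> t" "t \<le> 1" for t
  proof (rule ccontr)
    assume "g t \<notin> A"
    then have "g t \<in> B" using gD(2)[OF t] by auto
    have c: "continuous_on {0..t} g" "continuous_on {t..1} g"
      by (rule continuous_on_subset[OF gD(6)], use t in auto)+
    obtain r where r: "0 \<le> r" "r \<le> t" "g r \<in> A" "g r \<in> B"
      by (rule curve_crosses[OF c(1) _ AB(1,2)]) (use gD t xy \<open>g t \<in> B\<close> in auto)
    obtain s where s: "t \<le> s" "s \<le> 1" "g s \<in> B" "g s \<in> A"
      by (rule curve_crosses[OF c(2) _ AB(2,1)]) (use ba gD t xy \<open>g t \<in> B\<close> in \<open>auto simp del: Un_iff\<close>)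
    have "g r = g s" using r s AB(3) by auto
    then have "r = s" using arc_in_eqD[OF g] r s t by auto
    then have "g t \<in> A" using r s by auto
    then show False using \<open>g t \<notin> A\<close> by simp
  qed
  then show ?thesis using g by (auto simp: arc_in_def path_image_def)
qed

text \<open>The crossing point of A and B can only be p, and by \<open>arc_in_stays\<close> each
  half remains on its own side.\<close>

lemma arc_in_crosses:
  assumes g: "arc_in (A \<union> B) x y g" and AB: "closed A" "closed B" "A \<inter> B = {p}"
    and xy: "x \<in> A" "y \<in> B" "x \<noteq> p" "y \<noteq> p"
  obtains t where "0 < t" "t < 1" "g t = p" "arc_in A x p (subpath 0 t g)" "arc_in B p y (subpath t 1 g)"
proof -
  note gD = arc_inD[OF g]
  obtain t where t: "0 \<le> t" "t \<le> 1" "g t \<in> A" "g t \<in> B"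
    by (rule curve_crosses[OF gD(6) _ AB(1,2)]) (use gD xy in auto)
  have gt: "g t = p" using t AB by auto
  have t01: "0 < t" "t < 1" using t gD(3,4) xy gt by (auto simp: less_le)
  have ba: "g s \<in> B \<union> A" if "0 \<le> s" "s \<le> 1" for s using gD(2)[OF that] by blast
  have "arc_in (A \<union> B) (g 0) (g t) (subpath 0 t g)" "arc_in (B \<union> A) (g t) (g 1) (subpath t 1 g)"
    by (rule arc_in_subpath[OF g]; use t01 gD ba in \<open>auto simp del: Un_iff\<close>)+
  then have "arc_in (A \<union> B) x p (subpath 0 t g)" "arc_in (B \<union> A) p y (subpath t 1 g)"
    using gD gt by auto
  moreover have "p \<in> A" "p \<in> B" "B \<inter> A = {p}" using AB by auto
  ultimately have "arc_in A x p (subpath 0 t g)" "arc_in B p y (subpath t 1 g)"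
    using arc_in_stays[of A B x p _ p] arc_in_stays[of B A p y _ p] AB xy by auto
  then show ?thesis using gt t01 by (intro that)
qed

text \<open>Uniqueness is required of the length of an arc, not of the arc: this is what the
  description in \<open>vicsek_cable_dist\<close> asks for, and it passes through gluing and
  similarities. Writing the length as \<open>ennreal L\<close> includes rectifiability.\<close>

definition treelike :: "'a::real_normed_vector set \<Rightarrow> bool" where
  "treelike T \<longleftrightarrow> closed T \<and> (\<forall>x\<in>T. \<forall>y\<in>T. x \<noteq> y \<longrightarrow> (\<exists>g. arc_in T x y g)) \<and>
     (\<forall>x y. \<exists>L. \<forall>g. arc_in T x y g \<longrightarrow> curve_length g = ennreal L)"

lemma arc_in_join:
  assumes "arc_in A x p g" "arc_in B p y h" "path_image g \<inter> path_image h \<subseteq> {p}"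
  shows "arc_in (A \<union> B) x y (g +++ h)"
  using assms by (auto simp: arc_in_def path_image_join intro!: arc_join)

text \<open>Arcs between points of one side stay there, and arcs from one side to the other split at
  p into two arcs whose lengths are known.\<close>

lemma treelike_glue:
  assumes A: "treelike A" and B: "treelike B" and p: "A \<inter> B = {p}"
  shows "treelike (A \<union> B)"
proof -
  have cl: "closed A" "closed B" using A B by (auto simp: treelike_def)
  have pp: "p \<in> A" "p \<in> B" "B \<inter> A = {p}" using p by auto
  have exA: "\<exists>g. arc_in A x y g" if "x \<in> A" "y \<in> A" "x \<noteq> y" for x y
    using A that by (auto simp: treelike_def)
  have exB: "\<exists>g. arc_in B x y g" if "x \<in> B" "y \<in> B" "x \<noteq> y" for x y
    using B that by (auto simp: treelike_def)
  have ex2: "\<exists>g. arc_in (A \<union> B) x y g" if xy: "x \<in> A" "y \<in> B" "x \<noteq> y" for x y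
  proof (cases "x = p \<or> y = p")
    case True
    then have "x \<in> B \<and> y \<in> B \<or> x \<in> A \<and> y \<in> A" using xy pp by auto
    then show ?thesis using exA exB xy arc_in_mono by blast
  next
    case False
    obtain g h where gh: "arc_in A x p g" "arc_in B p y h"
      using exA[of x p] exB[of p y] xy False pp by metis
    then have "path_image g \<inter> path_image h \<subseteq> {p}" using p by (auto simp: arc_in_def)
    from arc_in_join[OF gh this] show ?thesis by blast
  qed
  have ex: "\<exists>g. arc_in (A \<union> B) x y g" if xy: "x \<in> A \<union> B" "y \<in> A \<union> B" "x \<noteq> y" for x y
    using xy exA[of x y] exB[of x y] ex2[of x y] ex2[of y x]
    by (metis Un_iff arc_in_mono arc_in_reverse sup_ge1 sup_ge2)
  have uA: "\<exists>L. \<forall>g. arc_in A x y g \<longrightarrow> curve_length g = ennreal L" for x y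
    using A by (auto simp: treelike_def)
  have uB: "\<exists>L. \<forall>g. arc_in B x y g \<longrightarrow> curve_length g = ennreal L" for x y
    using B by (auto simp: treelike_def)
  have u2: "\<exists>L. \<forall>g. arc_in (A \<union> B) x y g \<longrightarrow> curve_length g = ennreal L" if xy: "x \<in> A" "y \<in> B" for x y
  proof (cases "x = p \<or> y = p")
    case True
    then have "x \<in> A \<and> y \<in> A \<or> x \<in> B \<and> y \<in> B" using xy pp by auto
    then show ?thesis
    proof
      assume "x \<in> A \<and> y \<in> A"
      then have "arc_in A x y g" if "arc_in (A \<union> B) x y g" for g
        using arc_in_stays[OF that cl] p by auto
      then show ?thesis using uA[of x y] by blast
    next
      assume "x \<in> B \<and> y \<in> B"
      then have "arc_in B x y g" if "arc_in (A \<union> B) x y g" for g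
        using arc_in_stays[of B A x y g p] that cl pp by (auto simp: Un_commute)
      then show ?thesis using uB[of x y] by blast
    qed
  next
    case False
    obtain L1 where L1: "\<And>g. arc_in A x p g \<Longrightarrow> curve_length g = ennreal L1" using uA[of x p] by blast
    obtain L2 where L2: "\<And>g. arc_in B p y g \<Longrightarrow> curve_length g = ennreal L2" using uB[of p y] by blast
    \<comment> \<open>\<open>L1\<close> and \<open>L2\<close> are only known through
      \<open>ennreal\<close>, which truncates at 0; they may be negative reals, hence the
      maxima.\<close>
    have "curve_length g = ennreal (max 0 L1 + max 0 L2)" if g: "arc_in (A \<union> B) x y g" for g
    proof -
      obtain t where t: "0 < t" "t < 1" "arc_in A x p (subpath 0 t g)" "arc_in B p y (subpath t 1 g)"
        using arc_in_crosses[OF g cl p] xy False by metis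
      have "curve_length g = ennreal L1 + ennreal L2"
        using curve_length_split[of t g] t L1 L2 by simp
      also have "\<dots> = ennreal (max 0 L1 + max 0 L2)"
        by (subst ennreal_plus) (auto simp: max_def ennreal_neg)
      finally show ?thesis .
    qed
    then show ?thesis by blast
  qed
  have u: "\<exists>L. \<forall>g. arc_in (A \<union> B) x y g \<longrightarrow> curve_length g = ennreal L" for x y
  proof (cases "x \<in> A \<union> B \<and> y \<in> A \<union> B")
    case False
    then have "\<not> arc_in (A \<union> B) x y g" for g
      using arc_inD(2)[of "A \<union> B" x y g 0] arc_inD(2)[of "A \<union> B" x y g 1] arc_inD(3,4)[of "A \<union> B" x y g] by auto
    then show ?thesis by blast
  next
    case True
    have inA: "arc_in A x y g" if "x \<in> A" "y \<in> A" "arc_in (A \<union> B) x y g" for g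
      using arc_in_stays[OF that(3) cl _ that(1,2)] p by auto
    have inB: "arc_in B x y g" if "x \<in> B" "y \<in> B" "arc_in (A \<union> B) x y g" for g
      using arc_in_stays[of B A x y g p] that cl pp by (auto simp: Un_commute)
    consider "x \<in> A" "y \<in> A" | "x \<in> B" "y \<in> B" | "x \<in> A" "y \<in> B" | "y \<in> A" "x \<in> B" using True by blast
    then show ?thesis
    proof cases
      case 1 then show ?thesis using uA[of x y] inA by blast
    next
      case 2 then show ?thesis using uB[of x y] inB by blast
    next
      case 3 then show ?thesis by (rule u2)
    next
      case 4
      from u2[OF this] show ?thesis using arc_in_reverse curve_length_reversepath by metis
    qed
  qed
  show ?thesis unfolding treelike_def using ex u closed_Un[OF cl] by blast
qed

lemma poly_len_monotone_le:
  assumes add: "\<And>s t u. a \<le> s \<Longrightarrow> s \<le> t \<Longrightarrow> t \<le> u \<Longrightarrow> u \<le> b \<Longrightarrow> dist (g s) (g u) = dist (g s) (g t) + dist (g t) (g u)"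
  shows "sorted (t # ts) \<Longrightarrow> set (t # ts) \<subseteq> {a..b::real} \<Longrightarrow> poly_len (map g (t # ts)) \<le> dist (g t) (g b)"
proof (induction ts arbitrary: t)
  case (Cons t' ts)
  have "poly_len (map g (t' # ts)) \<le> dist (g t') (g b)" using Cons by auto
  moreover have "dist (g t) (g b) = dist (g t) (g t') + dist (g t') (g b)"
    using Cons.prems by (intro add) auto
  ultimately show ?case by simp
qed simp

text \<open>The coordinate \<open>h\<close> along the segment is continuous and injective on the
  arc, hence monotone. Distances therefore add up along the arc, and no inscribed polygon is longer
  than the distance of the endpoints.\<close>

lemma curve_length_in_segment:
  fixes a b :: "'a::real_inner"
  assumes g: "arc_in (closed_segment a b) x y g"
  shows "curve_length g = ennreal (dist x y)"
proof (rule antisym)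
  note gD = arc_inD[OF g]
  have "a \<noteq> b"
  proof
    assume "a = b"
    then have "g 0 \<in> {a}" "g 1 \<in> {a}" using gD(2)[of 0] gD(2)[of 1] by auto
    then show False using gD by auto
  qed
  define h where "h t = ((g t - a) \<bullet> (b - a)) / ((b - a) \<bullet> (b - a))" for t
  have gh: "g t = a + h t *\<^sub>R (b - a)" if "t \<in> {0..1}" for t
  proof -
    have "g t \<in> closed_segment a b" using gD(2)[of t] that by auto
    then obtain u where "g t = (1 - u) *\<^sub>R a + u *\<^sub>R b"
      unfolding closed_segment_def by blast
    then have u: "g t - a = u *\<^sub>R (b - a)" by (simp add: scaleR_diff_left scaleR_diff_right)
    then have "h t = u" using \<open>a \<noteq> b\<close> by (simp add: h_def)
    then show ?thesis using u by (simp add: diff_eq_eq add.commute)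
  qed
  have dh: "dist (g s) (g t) = \<bar>h s - h t\<bar> * norm (b - a)" if "s \<in> {0..1}" "t \<in> {0..1}" for s t
  proof -
    have "g s - g t = (h s - h t) *\<^sub>R (b - a)"
      by (subst gh[OF that(1)], subst gh[OF that(2)]) (simp add: scaleR_diff_left)
    then show ?thesis by (simp add: dist_norm)
  qed
  have contr: "continuous_on {0..1} h"
    unfolding h_def using gD(6) by (intro continuous_intros) (use \<open>a \<noteq> b\<close> in auto)
  have injr: "inj_on h {0..1}"
    using gD(5) gh unfolding inj_on_def by metis
  have add: "dist (g s) (g u) = dist (g s) (g t) + dist (g t) (g u)"
    if "0 \<le> s" "s \<le> t" "t \<le> u" "u \<le> 1" for s t u
  proof (cases "s < t \<and> t < u")
    case True
    then have "(h s < h t \<and> h t < h u) \<or> (h u < h t \<and> h t < h s)"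
      using continuous_inj_imp_mono[of s t u h] that
      by (meson atLeastatMost_subset_iff continuous_on_subset contr inj_on_subset injr)
    then have "\<bar>h s - h u\<bar> = \<bar>h s - h t\<bar> + \<bar>h t - h u\<bar>" by auto
    then show ?thesis using that by (simp add: dh distrib_right)
  next
    case False
    then have "s = t \<or> t = u" using that by auto
    then show ?thesis by auto
  qed
  show "curve_length g \<le> ennreal (dist x y)"
    unfolding curve_length_eq length_between_def
  proof (rule SUP_least, safe)
    fix ts :: "real list" assume ts: "sorted ts" "set ts \<subseteq> {0..1}"
    show "ennreal (poly_len (map g ts)) \<le> ennreal (dist x y)"
    proof (cases ts)
      case (Cons t ts')
      have "poly_len (map g ts) \<le> dist (g t) (g 1)"
        unfolding Cons using ts Cons by (intro poly_len_monotone_le[of 0 1]) (auto intro: add)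
      also have "\<dots> \<le> dist (g 0) (g 1)"
        using add[of 0 t 1] ts Cons by auto
      finally show ?thesis using gD by (auto intro: ennreal_leI)
    qed auto
  qed
  show "ennreal (dist x y) \<le> curve_length g"
    using dist_le_curve_length[of g] g by (simp add: arc_in_def)
qed

lemma treelike_segment:
  fixes a b :: "'a::real_inner"
  shows "treelike (closed_segment a b)"
proof -
  have "arc_in (closed_segment a b) x y (linepath x y)"
    if "x \<in> closed_segment a b" "y \<in> closed_segment a b" "x \<noteq> y" for x y
    using that by (auto simp: arc_in_def subset_closed_segment dest: subsetD[OF closed_segment_subset])
  then show ?thesis
    unfolding treelike_def using curve_length_in_segment[of a b] by auto
qed

lemma arc_in_similarity:
  assumes d: "\<And>x y. dist (\<phi> x) (\<phi> y) = c * dist x y" "0 < c" and g: "arc_in T x y g"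
  shows "arc_in (\<phi> ` T) (\<phi> x) (\<phi> y) (\<phi> \<circ> g)"
proof -
  have "inj \<phi>"
  proof (rule injI)
    fix x y assume "\<phi> x = \<phi> y"
    then have "c * dist x y = 0" using d(1)[of x y] by simp
    then show "x = y" using d(2) by simp
  qed
  moreover have "continuous_on UNIV \<phi>"
    using d by (intro lipschitz_on_continuous_on[of c] lipschitz_onI) auto
  ultimately have "arc (\<phi> \<circ> g)"
    using arc_inD(5,6)[OF g] unfolding arc_def path_def
    by (auto intro!: comp_inj_on intro: inj_on_subset continuous_on_compose2[of UNIV \<phi>])
  then show ?thesis using g by (auto simp: arc_in_def path_image_compose pathstart_compose pathfinish_compose)
qed

lemma treelike_similarity:
  fixes \<phi> :: "'a::euclidean_space \<Rightarrow> 'a"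
  assumes T: "treelike T" and d: "\<And>x y. dist (\<phi> x) (\<phi> y) = c * dist x y" "0 < c"
    and inv: "\<And>x. \<psi> (\<phi> x) = x" "\<And>x. \<phi> (\<psi> x) = x"
  shows "treelike (\<phi> ` T)"
proof -
  have d': "dist (\<psi> x) (\<psi> y) = (1 / c) * dist x y" for x y
    using d(1)[of "\<psi> x" "\<psi> y"] d(2) inv by simp
  have im: "\<psi> ` \<phi> ` T = T" unfolding image_image inv by simp
  have arcs: "arc_in T (\<psi> x) (\<psi> y) (\<psi> \<circ> g) \<and> curve_length g = ennreal c * curve_length (\<psi> \<circ> g)"
    if "arc_in (\<phi> ` T) x y g" for x y g
  proof
    show "arc_in T (\<psi> x) (\<psi> y) (\<psi> \<circ> g)"
      using arc_in_similarity[OF d' _ that] d(2) unfolding im by simp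
    have "\<phi> \<circ> (\<psi> \<circ> g) = g" by (auto simp: inv)
    then show "curve_length g = ennreal c * curve_length (\<psi> \<circ> g)"
      using curve_length_similarity[of \<phi> c "\<psi> \<circ> g"] d by simp
  qed
  have "\<exists>L. \<forall>g. arc_in (\<phi> ` T) x y g \<longrightarrow> curve_length g = ennreal L" for x y
  proof -
    obtain L where L: "\<And>g. arc_in T (\<psi> x) (\<psi> y) g \<Longrightarrow> curve_length g = ennreal L"
      using T unfolding treelike_def by meson
    have "\<forall>g. arc_in (\<phi> ` T) x y g \<longrightarrow> curve_length g = ennreal (c * L)"
      using arcs L d(2) by (auto simp: ennreal_mult')
    then show ?thesis by blast
  qed
  moreover have "\<exists>g. arc_in (\<phi> ` T) x y g" if "x \<in> \<phi> ` T" "y \<in> \<phi> ` T" "x \<noteq> y" for x y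
  proof -
    obtain x' where x: "x = \<phi> x'" "x' \<in> T" using \<open>x \<in> \<phi> ` T\<close> by (rule imageE)
    obtain y' where y: "y = \<phi> y'" "y' \<in> T" using \<open>y \<in> \<phi> ` T\<close> by (rule imageE)
    note xy = x y
    then have "x' \<noteq> y'" using that by auto
    then obtain g where "arc_in T x' y' g"
      using T xy unfolding treelike_def by blast
    then have "arc_in T (\<psi> x) (\<psi> y) g" unfolding xy inv .
    then show ?thesis using arc_in_similarity[OF d] inv by metis
  qed
  moreover have "closed (\<phi> ` T)"
  proof -
    have "\<phi> ` T = \<psi> -` T" using inv by (auto simp: image_iff) metis
    moreover have "continuous_on UNIV \<psi>"
      using d' d(2) by (intro lipschitz_on_continuous_on[of "1/c"] lipschitz_onI) auto
    ultimately show ?thesis using T by (auto simp: treelike_def intro: closed_vimage)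
  qed
  ultimately show ?thesis unfolding treelike_def by blast
qed

section \<open>The geodesic distance on the skeleton\<close>

text \<open>Labelled by a cell and one of its corners, and drawn from the cell centre outwards. By
  \<open>edge_inj\<close> the label is determined by the edge among labels of one level, so sums
  over edges become sums over labels.\<close>

definition edge :: "nat list \<Rightarrow> nat \<Rightarrow> (real \<times> real) set" where
  "edge w i = closed_segment (vicsek_psi_word w 0) (vicsek_psi_word w (vicsek_q i))"

lemma psi_word_single [simp]: "vicsek_psi_word [i] = vicsek_psi i"
  by (simp add: psi_word_Cons fun_eq_iff)

lemma edge_image: "edge w i = vicsek_psi_word w ` closed_segment 0 (vicsek_q i)"
  by (simp add: edge_def psi_word_segment)

lemma psi_edge: "vicsek_psi j ` edge w i = edge (j # w) i"
  by (simp add: edge_image psi_word_Cons image_comp)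

lemma cable_eq: "vicsek_cable n = (\<Union>w\<in>vicsek_words n. \<Union>i\<in>{1..4}. edge w i)"
proof (induction n)
  case 0
  show ?case by (simp add: edge_image)
next
  case (Suc n)
  have "vicsek_cable (Suc n) = (\<Union>j\<in>{1..5}. \<Union>w\<in>vicsek_words n. \<Union>i\<in>{1..4}. vicsek_psi j ` edge w i)"
    by (simp only: vicsek_cable.simps Suc image_UN)
  then show ?case by (simp add: psi_edge words_Suc)
qed

lemma vertices_eq: "vicsek_vertices n = (\<Union>w\<in>vicsek_words n. vicsek_psi_word w ` vicsek_q ` {1..5})"
proof (induction n)
  case (Suc n)
  have "vicsek_vertices (Suc n) = (\<Union>j\<in>{1..5}. \<Union>w\<in>vicsek_words n. vicsek_psi j ` vicsek_psi_word w ` vicsek_q ` {1..5})"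
    by (simp only: vicsek_vertices.simps Suc image_UN)
  then show ?case by (simp add: psi_word_Cons words_Suc image_comp)
qed simp

lemma edges_eq: "vicsek_edges n = {edge w i | w i. w \<in> vicsek_words n \<and> i \<in> {1..4}}"
  by (simp add: vicsek_edges_def edge_image)

lemma psi_square: "z \<in> square \<Longrightarrow> vicsek_psi i z \<in> square"
proof -
  assume z: "z \<in> square"
  have "\<bar>real_of_int (dirx i)\<bar> \<le> 1" "\<bar>real_of_int (diry i)\<bar> \<le> 1" by (auto simp: dirx_def diry_def)
  then have "\<bar>sqrt 2 * real_of_int (dirx i)\<bar> \<le> sqrt 2" "\<bar>sqrt 2 * real_of_int (diry i)\<bar> \<le> sqrt 2"
    by (simp_all add: abs_mult)
  moreover have "fst (vicsek_psi i z) = (sqrt 2 * dirx i + fst z) / 3" "snd (vicsek_psi i z) = (sqrt 2 * diry i + snd z) / 3"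
    using fst_psi_word[of "[i]" z] snd_psi_word[of "[i]" z] by simp_all
  moreover have "\<bar>fst z\<bar> \<le> sqrt 2 / 2" "\<bar>snd z\<bar> \<le> sqrt 2 / 2" using z by (auto simp: square_def)
  moreover have "\<bar>(a + b) / 3\<bar> \<le> c / 2" if "\<bar>a\<bar> \<le> c" "\<bar>b\<bar> \<le> c / 2" for a b c :: real
    using abs_triangle_ineq[of a b] that by simp
  ultimately have "\<bar>fst (vicsek_psi i z)\<bar> \<le> sqrt 2 / 2" "\<bar>snd (vicsek_psi i z)\<bar> \<le> sqrt 2 / 2" by metis+
  then show ?thesis by (simp add: square_def)
qed

lemma psi_word_square: "z \<in> square \<Longrightarrow> vicsek_psi_word w z \<in> square"
  by (induction w) (auto simp: psi_word_Cons psi_square)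

lemma segment_q_square: "closed_segment 0 (vicsek_q i) \<subseteq> square"
  using vicsek_q_square[of 5] vicsek_q_square[of i] convex_square by (simp add: closed_segment_subset)

lemma edge_subset_square: "edge w i \<subseteq> square"
  unfolding edge_image using segment_q_square psi_word_square by blast

lemma cable_subset_square: "vicsek_cable n \<subseteq> square"
  using edge_subset_square by (auto simp: cable_eq)

lemma q_scaleR_segment:
  "0 \<le> s \<Longrightarrow> s \<le> t \<Longrightarrow> s *\<^sub>R q \<in> closed_segment 0 (t *\<^sub>R (q :: real \<times> real))"
  unfolding closed_segment_def
  by (cases "t = 0") (auto intro!: exI[of _ "s / t"] simp: divide_le_eq)

text \<open>The inner third is an edge of the central cell. The outer two thirds form a diagonal of
  the arm cell \<open>i\<close>, whose centre is 2/3 of \<open>vicsek_q i\<close>; the middle third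
  thus carries the index \<open>opp i\<close>.\<close>

lemma edge_split_0:
  assumes "i \<in> {1..4}"
  shows "closed_segment 0 (vicsek_q i) = edge [5] i \<union> edge [i] (opp i) \<union> edge [i] i"
proof -
  let ?q = "vicsek_q i"
  have a: "(1/3) *\<^sub>R ?q \<in> closed_segment 0 ?q" "(2/3) *\<^sub>R ?q \<in> closed_segment ((1/3) *\<^sub>R ?q) ?q"
    using q_scaleR_segment[of "1/3" 1 ?q] unfolding closed_segment_def
    by (auto intro!: exI[of _ "1/2"] simp: scaleR_add_left[symmetric])
  have "edge [5] i = closed_segment 0 ((1/3) *\<^sub>R ?q)" "edge [i] i = closed_segment ((2/3) *\<^sub>R ?q) ?q"
    "edge [i] (opp i) = closed_segment ((2/3) *\<^sub>R ?q) ((1/3) *\<^sub>R ?q)"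
    by (simp_all add: edge_def vicsek_psi_eq vicsek_q_opp scaleR_add_left[symmetric] flip: scaleR_minus_left)
  then show ?thesis
    using Un_closed_segment[OF a(1)] Un_closed_segment[OF a(2)]
    by (simp add: Un_assoc closed_segment_commute[of "(2/3) *\<^sub>R ?q" "(1/3) *\<^sub>R ?q"])
qed

lemma psi_word_edge: "vicsek_psi_word v ` edge w i = edge (v @ w) i"
  by (simp add: edge_image psi_word_append image_comp)

lemma edge_split:
  "i \<in> {1..4} \<Longrightarrow> edge w i = edge (w @ [5]) i \<union> edge (w @ [i]) (opp i) \<union> edge (w @ [i]) i"
  by (subst edge_image, subst edge_split_0) (simp_all add: image_Un psi_word_edge)

lemma cable_mono_Suc: "vicsek_cable n \<subseteq> vicsek_cable (Suc n)"
proof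
  fix x assume "x \<in> vicsek_cable n"
  then obtain w i where w: "w \<in> vicsek_words n" "i \<in> {1..4}" "x \<in> edge w i" by (auto simp: cable_eq)
  then consider "x \<in> edge (w @ [5]) i" | "x \<in> edge (w @ [i]) (opp i)" | "x \<in> edge (w @ [i]) i"
    using edge_split[of i w] by auto
  moreover have "w @ [5] \<in> vicsek_words (Suc n)" "w @ [i] \<in> vicsek_words (Suc n)"
    using w by (auto intro: words_snoc)
  ultimately show "x \<in> vicsek_cable (Suc n)" unfolding cable_eq using opp_in[of i] w by cases blast+
qed

lemma cable_mono: "m \<le> n \<Longrightarrow> vicsek_cable m \<subseteq> vicsek_cable n"
  using cable_mono_Suc by (rule lift_Suc_mono_le)

lemma cable_add: "vicsek_cable (n + m) = (\<Union>w\<in>vicsek_words n. vicsek_psi_word w ` vicsek_cable m)"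
proof (induction n)
  case (Suc n)
  have "vicsek_cable (Suc n + m) = (\<Union>j\<in>{1..5}. vicsek_psi j ` (\<Union>w\<in>vicsek_words n. vicsek_psi_word w ` vicsek_cable m))"
    by (simp only: add_Suc vicsek_cable.simps Suc)
  also have "\<dots> = (\<Union>j\<in>{1..5}. \<Union>w\<in>vicsek_words n. vicsek_psi_word (j # w) ` vicsek_cable m)"
    by (simp only: image_UN psi_word_Cons image_comp)
  finally show ?case by (simp only: words_Suc UN_UN_flatten image_image)
qed simp

lemma skeleton_cell:
  assumes "x \<in> vicsek_skeleton"
  obtains w y where "w \<in> vicsek_words n" "y \<in> vicsek_skeleton" "x = vicsek_psi_word w y"
proof -
  obtain m where "x \<in> vicsek_cable m" using assms by (auto simp: vicsek_skeleton_def)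
  then have "x \<in> vicsek_cable (n + m)" using cable_mono[of m "n + m"] by auto
  then show ?thesis using that by (auto simp: cable_add vicsek_skeleton_def)
qed

lemma psi_word_skeleton: "w \<in> vicsek_words n \<Longrightarrow> y \<in> vicsek_skeleton \<Longrightarrow> vicsek_psi_word w y \<in> vicsek_skeleton"
  using cable_add by (fastforce simp: vicsek_skeleton_def)

lemma skeleton_subset_square: "vicsek_skeleton \<subseteq> square"
  using cable_subset_square by (auto simp: vicsek_skeleton_def)

lemma cable_0_points: "i \<in> {1..5} \<Longrightarrow> 0 \<le> t \<Longrightarrow> t \<le> 1 \<Longrightarrow> t *\<^sub>R vicsek_q i \<in> vicsek_cable 0"
proof (cases "i = 5")
  case True
  have "0 \<in> closed_segment 0 (vicsek_q 1)" by simp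
  then show ?thesis using True by (auto intro!: bexI[of _ 1])
next
  case False
  assume "i \<in> {1..5}" "0 \<le> t" "t \<le> 1"
  then show ?thesis using False q_scaleR_segment[of t 1 "vicsek_q i"]
    by (auto intro!: bexI[of _ i])
qed

lemma q_in_cable: "i \<in> {1..5} \<Longrightarrow> vicsek_q i \<in> vicsek_cable n"
  using cable_0_points[of i 1] cable_mono[of 0 n] by auto

lemma q_in_skeleton: "i \<in> {1..5} \<Longrightarrow> vicsek_q i \<in> vicsek_skeleton"
  using q_in_cable by (auto simp: vicsek_skeleton_def)

lemma zero_in_skeleton: "0 \<in> vicsek_skeleton"
  using q_in_skeleton[of 5] by simp

lemma vertices_subset_cable: "vicsek_vertices n \<subseteq> vicsek_cable n"
proof -
  have "vicsek_cable n = (\<Union>w\<in>vicsek_words n. vicsek_psi_word w ` vicsek_cable 0)"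
    using cable_add[of n 0] by simp
  moreover have "vicsek_q ` {1..5} \<subseteq> vicsek_cable 0" using q_in_cable by blast
  ultimately show ?thesis unfolding vertices_eq by blast
qed

lemma vertices_subset_skeleton: "vicsek_vertices n \<subseteq> vicsek_skeleton"
  using vertices_subset_cable by (auto simp: vicsek_skeleton_def)

lemma edge_subset_skeleton: "w \<in> vicsek_words n \<Longrightarrow> i \<in> {1..4} \<Longrightarrow> edge w i \<subseteq> vicsek_skeleton"
  unfolding vicsek_skeleton_def cable_eq by blast

lemma level1_disjoint:
  assumes "i \<in> {1..4}" "j \<in> {1..4}" "i \<noteq> j"
  shows "vicsek_psi i ` square \<inter> vicsek_psi j ` square = {}"
proof -
  have "\<not> near [i] [j]"
    using assms unfolding index4_cases by (elim disjE) (simp_all add: near_def dirx_def diry_def)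
  moreover have "[i] \<in> vicsek_words (Suc 0)" "[j] \<in> vicsek_words (Suc 0)" using assms by (auto simp: words_1)
  ultimately show ?thesis
    using dist_imp_near[of "[i]" "Suc 0" "[j]"] by fastforce
qed

lemma level1_meet:
  assumes "i \<in> {1..4}"
  shows "vicsek_psi i ` square \<inter> vicsek_psi 5 ` square = {(1/3) *\<^sub>R vicsek_q i}"
proof -
  have w: "[i] \<in> vicsek_words (Suc 0)" "[5] \<in> vicsek_words (Suc 0)" "[i] \<noteq> [5]" using assms by (auto simp: words_1)
  have "(1/3) *\<^sub>R vicsek_q i = vicsek_psi i (vicsek_q (opp i))" "(1/3) *\<^sub>R vicsek_q i = vicsek_psi 5 (vicsek_q i)"
    by (simp_all add: vicsek_psi_eq vicsek_q_opp flip: scaleR_minus_left scaleR_add_left)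
  then have "(1/3) *\<^sub>R vicsek_q i \<in> vicsek_psi i ` square \<inter> vicsek_psi 5 ` square"
    using vicsek_q_square by blast
  moreover obtain k where "vicsek_psi i ` square \<inter> vicsek_psi 5 ` square \<subseteq> {vicsek_psi i (vicsek_q k)}"
    using cell_Int_subset[OF w] unfolding psi_word_single by blast
  moreover have "A = {p}" if "p \<in> A" "A \<subseteq> {z}" for A :: "(real \<times> real) set" and p z using that by blast
  ultimately show ?thesis by metis
qed

text \<open>Arms are pairwise disjoint and each touches the central piece in one point. The index
  set J is arbitrary because the arms are glued on one at a time.\<close>

lemma cable_arm:
  assumes "i \<in> {1..4}" "J \<subseteq> {1..5} - {i}" "5 \<in> J"
  shows "vicsek_psi i ` vicsek_cable n \<inter> (\<Union>j\<in>J. vicsek_psi j ` vicsek_cable n) = {(1/3) *\<^sub>R vicsek_q i}"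
proof -
  have "vicsek_psi i ` vicsek_cable n \<inter> vicsek_psi j ` vicsek_cable n \<subseteq> {(1/3) *\<^sub>R vicsek_q i}" if "j \<in> J" for j
  proof (cases "j = 5")
    case True
    then show ?thesis using level1_meet[OF assms(1)] cable_subset_square by blast
  next
    case False
    then have "j \<in> {1..4}" "i \<noteq> j" using assms that by force+
    then show ?thesis using level1_disjoint[OF assms(1), of j] cable_subset_square[of n] by blast
  qed
  moreover have p: "(1/3) *\<^sub>R vicsek_q i = vicsek_psi i (vicsek_q (opp i))" "(1/3) *\<^sub>R vicsek_q i = vicsek_psi 5 (vicsek_q i)"
    by (simp_all add: vicsek_psi_eq vicsek_q_opp flip: scaleR_minus_left scaleR_add_left)
  have "(1/3) *\<^sub>R vicsek_q i \<in> vicsek_psi i ` vicsek_cable n"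
    by (subst p(1), intro imageI q_in_cable) (use opp_in[OF assms(1)] in auto)
  moreover have "(1/3) *\<^sub>R vicsek_q i \<in> vicsek_psi 5 ` vicsek_cable n"
    by (subst p(2), intro imageI q_in_cable) (use assms in auto)
  ultimately show ?thesis using assms(3) by blast
qed

lemma dist_psi: "dist (vicsek_psi i x) (vicsek_psi i y) = (1/3) * dist x y"
  using dist_psi_word[of "[i]" x y] by simp

lemma treelike_psi: "treelike T \<Longrightarrow> treelike (vicsek_psi i ` T)"
  by (rule treelike_similarity[OF _ dist_psi, where \<psi> = "\<lambda>z. 3 *\<^sub>R z - 2 *\<^sub>R vicsek_q i"])
     (auto simp: vicsek_psi_eq scaleR_add_right scaleR_diff_right)

lemma segment_q_Int:
  assumes "i \<in> {1..4}" "j \<in> {1..4}" "i \<noteq> j"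
  shows "closed_segment 0 (vicsek_q i) \<inter> closed_segment 0 (vicsek_q j) = {0}"
proof -
  have "u *\<^sub>R vicsek_q i = 0" if "0 \<le> u" "0 \<le> v" "u *\<^sub>R vicsek_q i = v *\<^sub>R vicsek_q j" for u v :: real
  proof (rule ccontr)
    assume nz: "u *\<^sub>R vicsek_q i \<noteq> 0"
    have "norm (u *\<^sub>R vicsek_q i) = u" "norm (v *\<^sub>R vicsek_q j) = v"
      using that(1,2) assms by (simp_all add: norm_vicsek_q)
    then have "u = v" using that(3) by metis
    then have "vicsek_q i = vicsek_q j" using that nz by auto
    then have "dirx i = dirx j" "diry i = diry j" by (simp_all add: vicsek_q_eq)
    then show False using dir_inj[of i j] assms by auto
  qed
  then have "x = 0" if "x \<in> closed_segment 0 (vicsek_q i)" "x \<in> closed_segment 0 (vicsek_q j)" for x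
    using that unfolding closed_segment_def mem_Collect_eq scaleR_zero_right add_0 by metis
  then show ?thesis by auto
qed

text \<open>Level 0 is a star of four segments; each later level is a star of five similar copies,
  glued arm by arm to the central one.\<close>

lemma treelike_cable: "treelike (vicsek_cable n)"
proof (induction n)
  case 0
  let ?S = "\<lambda>i. closed_segment 0 (vicsek_q i)"
  have 1: "treelike (?S 1 \<union> ?S 2)"
    using segment_q_Int[of 1 2] by (intro treelike_glue treelike_segment) auto
  have 2: "treelike (?S 1 \<union> ?S 2 \<union> ?S 3)"
    using segment_q_Int[of 1 3] segment_q_Int[of 2 3] by (intro treelike_glue[OF 1 treelike_segment, of 0]) auto
  have 3: "treelike (?S 1 \<union> ?S 2 \<union> ?S 3 \<union> ?S 4)"
    using segment_q_Int[of 1 4] segment_q_Int[of 2 4] segment_q_Int[of 3 4]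
    by (intro treelike_glue[OF 2 treelike_segment, of 0]) auto
  have "{1..4::nat} = {1, 2, 3, 4}" by auto
  then have "vicsek_cable 0 = ?S 1 \<union> ?S 2 \<union> ?S 3 \<union> ?S 4" by (simp add: Un_assoc)
  with 3 show ?case by simp
next
  case (Suc n)
  let ?T = "\<lambda>i. vicsek_psi i ` vicsek_cable n"
  have T: "treelike (?T i)" for i using Suc by (rule treelike_psi)
  have 1: "treelike (?T 5 \<union> ?T 1)"
    using cable_arm[of 1 "{5}" n] by (intro treelike_glue[OF T T]) (auto simp: Int_commute)
  have 2: "treelike (?T 5 \<union> ?T 1 \<union> ?T 2)"
    using cable_arm[of 2 "{5, 1}" n] by (intro treelike_glue[OF 1 T]) (auto simp: Int_commute)
  have 3: "treelike (?T 5 \<union> ?T 1 \<union> ?T 2 \<union> ?T 3)"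
    using cable_arm[of 3 "{5, 1, 2}" n] by (intro treelike_glue[OF 2 T]) (auto simp: Int_commute Un_assoc)
  have 4: "treelike (?T 5 \<union> ?T 1 \<union> ?T 2 \<union> ?T 3 \<union> ?T 4)"
    using cable_arm[of 4 "{5, 1, 2, 3}" n] by (intro treelike_glue[OF 3 T]) (auto simp: Int_commute Un_assoc)
  have "{1..5::nat} = {5, 1, 2, 3, 4}" by auto
  then have "vicsek_cable (Suc n) = ?T 5 \<union> ?T 1 \<union> ?T 2 \<union> ?T 3 \<union> ?T 4" by (simp add: Un_assoc)
  with 4 show ?case by simp
qed

lemma closed_cable: "closed (vicsek_cable n)"
  using treelike_cable by (auto simp: treelike_def)

section \<open>Metric properties of the arc length distance\<close>

abbreviation cd :: "real \<times> real \<Rightarrow> real \<times> real \<Rightarrow> real" where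
  "cd \<equiv> vicsek_cable_dist"

lemma cd_same [simp]: "cd x x = 0"
  by (simp add: vicsek_cable_dist_def)

lemma cd_nonneg: "0 \<le> cd x y"
  by (simp add: vicsek_cable_dist_def)

text \<open>Arcs found at two levels both lie in the larger of the two cables, which is tree-like;
  so the length is independent of the level and the description in \<open>vicsek_cable_dist\<close>
  is well defined.\<close>

lemma cable_arc_length:
  assumes g: "arc_in (vicsek_cable n) x y g"
  shows "curve_length g = ennreal (cd x y)"
proof -
  have uniq: "curve_length h = curve_length g" if "arc_in (vicsek_cable m) x y h" for m h
  proof -
    have "arc_in (vicsek_cable (max m n)) x y h" "arc_in (vicsek_cable (max m n)) x y g"
      using that g cable_mono arc_in_mono by (meson max.cobounded1 max.cobounded2)+
    then show ?thesis using treelike_cable[of "max m n"] unfolding treelike_def by metis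
  qed
  have "(THE L. \<exists>n g. arc g \<and> path_image g \<subseteq> vicsek_cable n \<and> pathstart g = x \<and> pathfinish g = y \<and> L = curve_length g)
      = curve_length g"
    by (rule the_equality) (use g uniq in \<open>auto simp: arc_in_def\<close>)
  then have "cd x y = enn2real (curve_length g)"
    using arc_inD(7)[OF g] by (simp add: vicsek_cable_dist_def)
  moreover obtain L where "curve_length g = ennreal L"
    using treelike_cable[of n] g unfolding treelike_def by metis
  ultimately show ?thesis by simp
qed

lemma ex_cable_arc: "x \<in> vicsek_cable n \<Longrightarrow> y \<in> vicsek_cable n \<Longrightarrow> x \<noteq> y \<Longrightarrow> \<exists>g. arc_in (vicsek_cable n) x y g"
  using treelike_cable by (auto simp: treelike_def)

lemma skeleton_common_cable:
  assumes "x \<in> vicsek_skeleton" "y \<in> vicsek_skeleton"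
  obtains n where "x \<in> vicsek_cable n" "y \<in> vicsek_cable n"
proof -
  obtain m k where "x \<in> vicsek_cable m" "y \<in> vicsek_cable k" using assms by (auto simp: vicsek_skeleton_def)
  then show ?thesis using that[of "max m k"] cable_mono[of m "max m k"] cable_mono[of k "max m k"] by auto
qed

lemma ex_skeleton_arc:
  assumes "x \<in> vicsek_skeleton" "y \<in> vicsek_skeleton" "x \<noteq> y"
  obtains n g where "arc_in (vicsek_cable n) x y g"
  using skeleton_common_cable[OF assms(1,2)] ex_cable_arc assms(3) by metis

lemma cd_sym:
  assumes "x \<in> vicsek_skeleton" "y \<in> vicsek_skeleton"
  shows "cd x y = cd y x"
proof (cases "x = y")
  case False
  obtain n g where g: "arc_in (vicsek_cable n) x y g" using ex_skeleton_arc[OF assms False] .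
  have "ennreal (cd x y) = ennreal (cd y x)"
    using cable_arc_length[OF g] cable_arc_length[OF arc_in_reverse[OF g]] by (simp add: curve_length_reversepath)
  then show ?thesis using cd_nonneg by simp
qed simp

lemma cd_arc_split:
  assumes g: "arc_in (vicsek_cable n) x y g" and t: "0 \<le> t" "t \<le> 1"
  shows "cd x y = cd x (g t) + cd (g t) y"
proof (cases "t = 0 \<or> t = 1")
  case True
  then show ?thesis using arc_inD(3,4)[OF g] by auto
next
  case False
  then have t: "0 < t" "t < 1" using t by auto
  have "arc_in (vicsek_cable n) (g 0) (g t) (subpath 0 t g)" "arc_in (vicsek_cable n) (g t) (g 1) (subpath t 1 g)"
    by (rule arc_in_subpath[OF g]; use t arc_inD(2)[OF g] in auto)+
  from this[THEN cable_arc_length] have "ennreal (cd x y) = ennreal (cd x (g t)) + ennreal (cd (g t) y)"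
    using cable_arc_length[OF g] curve_length_split[OF t, of g] arc_inD(3,4)[OF g] by simp
  then have "ennreal (cd x y) = ennreal (cd x (g t) + cd (g t) y)" by (simp add: cd_nonneg)
  then show ?thesis by (subst (asm) ennreal_inj) (auto simp: cd_nonneg)
qed

lemma dist_le_cd:
  assumes "x \<in> vicsek_skeleton" "y \<in> vicsek_skeleton"
  shows "dist x y \<le> cd x y"
proof (cases "x = y")
  case False
  obtain n g where g: "arc_in (vicsek_cable n) x y g" using ex_skeleton_arc[OF assms False] .
  have "ennreal (dist x y) \<le> ennreal (cd x y)"
    using dist_le_curve_length[of g] g cable_arc_length[OF g] by (simp add: arc_in_def)
  then show ?thesis using cd_nonneg by simp
qed simp

lemma cd_segment:
  assumes "closed_segment x y \<subseteq> vicsek_cable n"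
  shows "cd x y = dist x y"
proof (cases "x = y")
  case False
  have l: "arc_in (closed_segment x y) x y (linepath x y)" using False by (auto simp: arc_in_def)
  have "ennreal (cd x y) = ennreal (dist x y)"
    using cable_arc_length[OF arc_in_mono[OF l assms]] curve_length_in_segment[OF l] by simp
  then show ?thesis using cd_nonneg by simp
qed simp

lemma cd_edge:
  assumes "w \<in> vicsek_words n" "i \<in> {1..4}" "x \<in> edge w i" "y \<in> edge w i"
  shows "cd x y = dist x y"
proof (rule cd_segment)
  have "closed_segment x y \<subseteq> edge w i" using assms unfolding edge_def by (simp add: closed_segment_subset)
  then show "closed_segment x y \<subseteq> vicsek_cable n" using assms unfolding cable_eq by blast
qed

lemma cd_via:
  assumes AB: "vicsek_cable n = A \<union> B" "closed A" "closed B" "A \<inter> B = {p}" and xy: "x \<in> A" "y \<in> B"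
  shows "cd x y = cd x p + cd p y"
proof (cases "x = p \<or> y = p")
  case False
  then have ne: "x \<noteq> p" "y \<noteq> p" by auto
  then have "x \<noteq> y" using AB xy by auto
  then obtain g where g: "arc_in (vicsek_cable n) x y g" using ex_cable_arc[of x n y] AB xy by auto
  obtain t where "0 < t" "t < 1" "g t = p"
    using arc_in_crosses[OF g[unfolded AB(1)] AB(2-4) xy ne] by metis
  then show ?thesis using cd_arc_split[OF g, of t] by simp
qed auto

text \<open>Once the three distances are split at the centre of the tripod, the two sides differ by
  twice the length of the leg to y. The two legs joined towards y meet only in the centre, because
  it is the first contact.\<close>

lemma cd_triangle:
  assumes xyz: "x \<in> vicsek_skeleton" "y \<in> vicsek_skeleton" "z \<in> vicsek_skeleton"
  shows "cd x z \<le> cd x y + cd y z"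
proof -
  consider "x = z" | "y = z" | "x \<noteq> z" "y \<noteq> z" by blast
  then show ?thesis
  proof cases
    case 3
    obtain m where m: "x \<in> vicsek_cable m" "y \<in> vicsek_cable m" using skeleton_common_cable xyz by metis
    obtain k where k: "z \<in> vicsek_cable k" "y \<in> vicsek_cable k" using skeleton_common_cable xyz by metis
    define n where "n = max m k"
    have n: "x \<in> vicsek_cable n" "y \<in> vicsek_cable n" "z \<in> vicsek_cable n"
      using m k cable_mono[of m n] cable_mono[of k n] by (auto simp: n_def)
    obtain g where g: "arc_in (vicsek_cable n) x z g" using ex_cable_arc n 3 by metis
    obtain h where h: "arc_in (vicsek_cable n) y z h" using ex_cable_arc n 3 by metis
    note gD = arc_inD[OF g] and hD = arc_inD[OF h]
    text \<open>The first point of the arc from \<open>y\<close> on the arc from \<open>x\<close> is the centre of the tripod.\<close>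
    define P where "P = path_image g"
    have "closed P" using gD(1) by (simp add: P_def closed_arc_image)
    define C where "C = {t \<in> {0..1}. h t \<in> P}"
    have "closed C" unfolding C_def
      using continuous_closed_preimage[OF hD(6) _ \<open>closed P\<close>] by (simp add: vimage_def Int_def)
    moreover have "1 \<in> C" using hD(4) gD(4) by (auto simp: C_def P_def path_image_def intro: image_eqI[of _ _ 1])
    moreover have "bdd_below C" by (auto simp: C_def intro: bdd_belowI[of _ 0])
    ultimately have "Inf C \<in> C" by (intro closed_contains_Inf) auto
    define t where "t = Inf C"
    have t: "0 \<le> t" "t \<le> 1" "h t \<in> P" using \<open>Inf C \<in> C\<close> by (auto simp: t_def C_def)
    have first: "h r \<notin> P" if "0 \<le> r" "r < t" for r
      using cInf_lower[OF _ \<open>bdd_below C\<close>, of r] that t unfolding t_def C_def by auto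
    obtain s where s: "0 \<le> s" "s \<le> 1" "g s = h t" using t by (auto simp: P_def path_image_def)
    have xz: "cd x z = cd x (g s) + cd (g s) z" using cd_arc_split[OF g s(1,2)] .
    have yz: "cd y z = cd y (g s) + cd (g s) z" using cd_arc_split[OF h t(1,2)] s by simp
    have xy: "cd x y = cd x (g s) + cd (g s) y"
    proof (cases "s = 0 \<or> t = 0")
      case True
      then show ?thesis using gD(3) hD(3) s by auto
    next
      case False
      then have st: "0 < s" "0 < t" using s t by auto
      have a: "arc_in (vicsek_cable n) (g 0) (g s) (subpath 0 s g)" "arc_in (vicsek_cable n) (h 0) (h t) (subpath 0 t h)"
        by (rule arc_in_subpath[OF g] arc_in_subpath[OF h]; use st s t gD hD in auto)+
      then have a: "arc_in (vicsek_cable n) x (g s) (subpath 0 s g)"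
        "arc_in (vicsek_cable n) (g s) y (reversepath (subpath 0 t h))"
        using gD(3) hD(3) s(3) by (auto dest: arc_in_reverse)
      have "path_image (subpath 0 s g) \<inter> path_image (reversepath (subpath 0 t h)) \<subseteq> {g s}"
      proof
        fix z assume "z \<in> path_image (subpath 0 s g) \<inter> path_image (reversepath (subpath 0 t h))"
        then have "z \<in> g ` {0..s}" "z \<in> h ` {0..t}" using st by (auto simp: path_image_subpath)
        then obtain r r' where "z = g r" "r \<in> {0..s}" "z = h r'" "r' \<in> {0..t}" by blast
        then have r: "z = g r" "0 \<le> r" "r \<le> s" "z = h r'" "0 \<le> r'" "r' \<le> t" by auto
        then have "h r' \<in> P" using s by (auto simp: P_def path_image_def intro!: image_eqI[of _ _ r])
        then have "r' = t" using first[of r'] r by force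
        then show "z \<in> {g s}" using r s by simp
      qed
      from arc_in_join[OF a this] have j: "arc_in (vicsek_cable n) x y (subpath 0 s g +++ reversepath (subpath 0 t h))" by simp
      have "(subpath 0 s g +++ reversepath (subpath 0 t h)) (1/2) = g s"
        by (simp add: joinpaths_def subpath_def)
      then show ?thesis using cd_arc_split[OF j, of "1/2"] by simp
    qed
    have "g s \<in> vicsek_skeleton" using gD(2)[OF s(1,2)] by (auto simp: vicsek_skeleton_def)
    then have "cd y (g s) = cd (g s) y" using cd_sym xyz by blast
    then show ?thesis using xz yz xy cd_nonneg[of "g s" y] by linarith
  qed (auto simp: cd_nonneg)
qed

lemma cd_psi:
  assumes "x \<in> vicsek_skeleton" "y \<in> vicsek_skeleton" "i \<in> {1..5}"
  shows "cd (vicsek_psi i x) (vicsek_psi i y) = cd x y / 3"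
proof (cases "x = y")
  case False
  obtain n g where g: "arc_in (vicsek_cable n) x y g" using ex_skeleton_arc[OF assms(1,2) False] .
  have "arc_in (vicsek_psi i ` vicsek_cable n) (vicsek_psi i x) (vicsek_psi i y) (vicsek_psi i \<circ> g)"
    by (rule arc_in_similarity[OF dist_psi _ g]) simp
  then have "arc_in (vicsek_cable (Suc n)) (vicsek_psi i x) (vicsek_psi i y) (vicsek_psi i \<circ> g)"
    by (rule arc_in_mono) (use assms in auto)
  from cable_arc_length[OF this]
  have "ennreal (cd (vicsek_psi i x) (vicsek_psi i y)) = ennreal (1/3) * ennreal (cd x y)"
    using curve_length_similarity[OF dist_psi, of i g] cable_arc_length[OF g] by simp
  also have "\<dots> = ennreal (cd x y / 3)" by (subst ennreal_mult[symmetric]) (auto simp: cd_nonneg)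
  finally show ?thesis using cd_nonneg by simp
qed simp

lemma cd_psi_word:
  "w \<in> vicsek_words n \<Longrightarrow> x \<in> vicsek_skeleton \<Longrightarrow> y \<in> vicsek_skeleton \<Longrightarrow>
    cd (vicsek_psi_word w x) (vicsek_psi_word w y) = cd x y / 3 ^ n"
proof (induction n arbitrary: w)
  case (Suc n)
  then obtain i v where w: "w = i # v" "i \<in> {1..5}" "v \<in> vicsek_words n" by (auto simp: words_Suc)
  show ?case
    using Suc w cd_psi[of "vicsek_psi_word v x" "vicsek_psi_word v y" i] psi_word_skeleton[OF w(3)]
    by (simp add: psi_word_Cons)
qed simp

text \<open>The bound solves r = 2/3 + r/3: the centre of an arm is at distance 2/3 from 0 and the
  arm is a copy of ratio 1/3.\<close>

lemma cd_center_le_1: "x \<in> vicsek_cable n \<Longrightarrow> cd x 0 \<le> 1"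
proof (induction n arbitrary: x)
  case 0
  then obtain i where i: "i \<in> {1..4}" "x \<in> closed_segment 0 (vicsek_q i)" by auto
  then have "cd x 0 = dist x 0"
    by (intro cd_segment[of _ _ 0]) (auto simp: closed_segment_subset intro!: bexI[of _ i] dest: subsetD[OF closed_segment_subset, rotated -1])
  moreover have "x \<in> square" using i segment_q_square by auto
  ultimately show ?case using norm_square by simp
next
  case (Suc n)
  then obtain i y where y: "x = vicsek_psi i y" "i \<in> {1..5}" "y \<in> vicsek_cable n" by auto
  have S: "y \<in> vicsek_skeleton" using y by (auto simp: vicsek_skeleton_def)
  have i0: "vicsek_psi i 0 \<in> vicsek_skeleton"
    using psi_word_skeleton[of "[i]" "Suc 0" 0] y zero_in_skeleton by (auto simp: words_1)
  have "cd (vicsek_psi i 0) 0 \<le> 2/3"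
  proof (cases "i = 5")
    case True
    then show ?thesis by (simp add: vicsek_psi_eq)
  next
    case False
    then have i: "i \<in> {1..4}" using y by auto
    have "(2/3) *\<^sub>R vicsek_q i \<in> edge [] i"
      using q_scaleR_segment[of "2/3" 1 "vicsek_q i"] by (simp add: edge_def)
    then have "cd (vicsek_psi i 0) 0 = dist (vicsek_psi i 0) 0"
      using cd_edge[of "[]" 0 i] i by (simp add: vicsek_psi_eq edge_def)
    then show ?thesis using norm_vicsek_q[OF i] by (simp add: vicsek_psi_eq)
  qed
  moreover have "cd x (vicsek_psi i 0) \<le> 1/3"
    using cd_psi[OF S zero_in_skeleton y(2)] Suc.IH[OF y(3)] y by simp
  moreover have "cd x 0 \<le> cd x (vicsek_psi i 0) + cd (vicsek_psi i 0) 0"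
    using Suc.prems i0 zero_in_skeleton unfolding vicsek_skeleton_def by (intro cd_triangle[unfolded vicsek_skeleton_def]) blast+
  ultimately show ?case by linarith
qed

lemma cd_le_2:
  assumes "x \<in> vicsek_skeleton" "y \<in> vicsek_skeleton"
  shows "cd x y \<le> 2"
proof -
  have "cd x 0 \<le> 1" "cd y 0 \<le> 1" using assms cd_center_le_1 unfolding vicsek_skeleton_def by blast+
  then show ?thesis
    using cd_triangle[OF assms(1) zero_in_skeleton assms(2)] cd_sym[OF zero_in_skeleton assms(2)] by linarith
qed

section \<open>Comparison with the Euclidean distance\<close>

lemma scale_exists:
  assumes "0 < r" "r < 1"
  obtains n where "1 / 3 ^ Suc n \<le> r" "r < 1 / (3::real) ^ n"
proof -
  obtain m where "(1/3::real) ^ m < r" using real_arch_pow_inv[of r "1/3"] assms by auto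
  moreover have "(1/3::real) ^ Suc m \<le> (1/3) ^ m" by (rule power_decreasing) auto
  ultimately have ex: "\<exists>n. 1 / 3 ^ Suc n \<le> r" by (intro exI[of _ m]) (auto simp: power_one_over)
  define n where "n = (LEAST n. 1 / 3 ^ Suc n \<le> r)"
  have 1: "1 / 3 ^ Suc n \<le> r" unfolding n_def using ex by (rule LeastI_ex)
  have 2: "r < 1 / 3 ^ n"
  proof (cases n)
    case (Suc k)
    then have "\<not> 1 / 3 ^ Suc k \<le> r" unfolding n_def by (metis lessI not_less_Least)
    then show ?thesis using Suc by simp
  qed (use assms in auto)
  show ?thesis using that 1 2 .
qed

lemma one_less_sqrt2: "1 < sqrt 2"
  by simp

text \<open>Distinct near cells share a corner, and each has geodesic diameter at most 2 /
  3^n.\<close>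

lemma cd_near:
  assumes w: "w \<in> vicsek_words n" and w': "w' \<in> vicsek_words n" and "near w w'"
    and xy: "x \<in> vicsek_skeleton" "y \<in> vicsek_skeleton"
  shows "cd (vicsek_psi_word w x) (vicsek_psi_word w' y) \<le> 4 / 3 ^ n"
proof (cases "w = w'")
  case True
  then have "cd (vicsek_psi_word w x) (vicsek_psi_word w' y) \<le> 2 / 3 ^ n"
    using cd_psi_word[OF w xy] cd_le_2[OF xy] by (simp add: divide_right_mono)
  also have "\<dots> \<le> 4 / 3 ^ n" by (simp add: divide_right_mono)
  finally show ?thesis .
next
  case False
  obtain i where i: "i \<in> {1..4}" "vicsek_psi_word w (vicsek_q i) = vicsek_psi_word w' (vicsek_q (opp i))"
    using near_imp_common_corner[OF w w' \<open>near w w'\<close> False] by metis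
  have q: "vicsek_q i \<in> vicsek_skeleton" "vicsek_q (opp i) \<in> vicsek_skeleton"
    using i opp_in[of i] q_in_skeleton by auto
  have "cd (vicsek_psi_word w x) (vicsek_psi_word w' y) \<le>
      cd (vicsek_psi_word w x) (vicsek_psi_word w (vicsek_q i)) + cd (vicsek_psi_word w' (vicsek_q (opp i))) (vicsek_psi_word w' y)"
    using cd_triangle[of "vicsek_psi_word w x" "vicsek_psi_word w (vicsek_q i)" "vicsek_psi_word w' y"] i
      psi_word_skeleton[OF w] psi_word_skeleton[OF w'] xy q by simp
  also have "\<dots> \<le> 2 / 3 ^ n + 2 / 3 ^ n"
    using cd_psi_word[OF w xy(1) q(1)] cd_psi_word[OF w' q(2) xy(2)] cd_le_2[OF xy(1) q(1)] cd_le_2[OF q(2) xy(2)]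
    by (intro add_mono) (simp_all add: divide_right_mono)
  finally show ?thesis by (simp flip: add_divide_distrib)
qed

text \<open>At the level n with 3^-(n+1) \<le> dist < 3^-n the two points lie in near cells, so
  their geodesic distance is at most 4 / 3^n = 12 / 3^(n+1).\<close>

lemma cd_le_dist:
  assumes "x \<in> vicsek_skeleton" "y \<in> vicsek_skeleton"
  shows "cd x y \<le> 12 * dist x y"
proof (cases "x = y \<or> 1 \<le> dist x y")
  case True
  then show ?thesis using cd_le_2[OF assms] by auto
next
  case False
  then have "0 < dist x y" "dist x y < 1" by auto
  then obtain n where n: "1 / 3 ^ Suc n \<le> dist x y" "dist x y < 1 / 3 ^ n" by (rule scale_exists)
  obtain w x' where x: "w \<in> vicsek_words n" "x' \<in> vicsek_skeleton" "x = vicsek_psi_word w x'"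
    using skeleton_cell[OF assms(1)] .
  obtain w' y' where y: "w' \<in> vicsek_words n" "y' \<in> vicsek_skeleton" "y = vicsek_psi_word w' y'"
    using skeleton_cell[OF assms(2)] .
  have "1 / 3 ^ n < sqrt 2 / 3 ^ n" using one_less_sqrt2 by (rule divide_strict_right_mono) simp
  then have "near w w'"
    using dist_imp_near[of w n w' x' y'] x y n skeleton_subset_square by auto
  then have "cd x y \<le> 4 / 3 ^ n" using cd_near x y by metis
  moreover have "4 / 3 ^ n = 12 * (1 / (3::real) ^ Suc n)" by simp
  ultimately show ?thesis using n(1) by linarith
qed

lemma cd_lipschitz:
  assumes "x \<in> vicsek_skeleton" "y \<in> vicsek_skeleton" "x' \<in> vicsek_skeleton" "y' \<in> vicsek_skeleton"
  shows "\<bar>cd x y - cd x' y'\<bar> \<le> 12 * dist x x' + 12 * dist y y'"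
  using cd_triangle[of x x' y] cd_triangle[of x' y' y] cd_triangle[of x' x y'] cd_triangle[of x y y']
    cd_le_dist[of x x'] cd_le_dist[of x' x] cd_le_dist[of y y'] cd_le_dist[of y' y] assms
  by (simp add: dist_commute)

section \<open>Distance from a vertex along an edge\<close>

lemma q_in_vertices: "i \<in> {1..5} \<Longrightarrow> vicsek_q i \<in> vicsek_vertices n"
proof (induction n)
  case (Suc n)
  then show ?case using vicsek_psi_q[of i] by (auto intro!: bexI[of _ i] image_eqI[of _ _ "vicsek_q i"])
qed auto

text \<open>A vertex is never interior to an edge of its own level, so geodesics from c enter the
  edge through one of its ends. With c = 0 this orients the edges. The statement is for all vertices
  c because the induction replaces c by the corner through which a subcell is entered.\<close>

lemma cd_edge_affine:
  "c \<in> vicsek_vertices n \<Longrightarrow> w \<in> vicsek_words n \<Longrightarrow> i \<in> {1..4} \<Longrightarrow>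
    (\<exists>a\<in>{vicsek_psi_word w 0, vicsek_psi_word w (vicsek_q i)}. \<forall>x\<in>edge w i. cd c x = cd c a + dist a x)"
proof (induction n arbitrary: c w)
  case 0
  then obtain j where j: "j \<in> {1..5}" "c = vicsek_q j" and w: "w = []" by auto
  have e: "edge w i = closed_segment 0 (vicsek_q i)" by (simp add: w edge_def)
  consider "j = 5" | "j = i" | "j \<in> {1..4}" "j \<noteq> i" using j by force
  then show ?case
  proof cases
    case 1
    then have "cd c x = cd c 0 + dist 0 x" if "x \<in> edge w i" for x
      using cd_edge[of w 0 i 0 x] that 0 w j e by simp
    then show ?thesis using w by auto
  next
    case 2
    then have "cd c x = cd c (vicsek_q i) + dist (vicsek_q i) x" if "x \<in> edge w i" for x
      using cd_edge[of w 0 i c x] that 0 w j e by simp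
    then show ?thesis using w by auto
  next
    case 3
    let ?B = "\<Union>k\<in>{1..4} - {j}. closed_segment 0 (vicsek_q k)"
    have "vicsek_cable 0 = closed_segment 0 (vicsek_q j) \<union> ?B" using 3 by auto
    moreover have "closed ?B" by (intro closed_UN) auto
    moreover have "closed_segment 0 (vicsek_q j) \<inter> ?B = {0}"
    proof -
      have "0 \<in> ?B" using 3 \<open>i \<in> {1..4}\<close> by (intro UN_I[of i]) auto
      moreover have "closed_segment 0 (vicsek_q j) \<inter> closed_segment 0 (vicsek_q k) = {0}" if "k \<in> {1..4} - {j}" for k
        using segment_q_Int[of j k] 3 that by auto
      ultimately show ?thesis by blast
    qed
    moreover have "x \<in> ?B" if "x \<in> edge w i" for x
      using that 3 \<open>i \<in> {1..4}\<close> unfolding e by (intro UN_I[of i]) auto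
    ultimately have v: "cd c x = cd c 0 + cd 0 x" if "x \<in> edge w i" for x
      using cd_via[of 0 "closed_segment 0 (vicsek_q j)" ?B 0 c x] that j closed_segment by auto
    have "cd 0 x = dist 0 x" if "x \<in> edge w i" for x
      using cd_edge[of w 0 i 0 x] that 0 w e by simp
    with v show ?thesis using w by auto
  qed
next
  case (Suc n)
  obtain k c' where c: "c = vicsek_psi k c'" "k \<in> {1..5}" "c' \<in> vicsek_vertices n" using Suc.prems by auto
  obtain j v where w: "w = j # v" "j \<in> {1..5}" "v \<in> vicsek_words n" using Suc.prems by (auto simp: words_Suc)
  have S: "x \<in> vicsek_skeleton" if "x \<in> vicsek_cable n" for x using that by (auto simp: vicsek_skeleton_def)
  have eC: "edge v i \<subseteq> vicsek_cable n" using w Suc.prems unfolding cable_eq by blast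
  have cC: "c' \<in> vicsek_cable n" using c vertices_subset_cable by auto
  have cl: "closed (vicsek_psi l ` vicsek_cable n)" for l
    using treelike_psi[OF treelike_cable] by (auto simp: treelike_def)
  have arm: "vicsek_cable (Suc n) = vicsek_psi l ` vicsek_cable n \<union> (\<Union>m\<in>{1..5} - {l}. vicsek_psi m ` vicsek_cable n)"
    "closed (\<Union>m\<in>{1..5} - {l}. vicsek_psi m ` vicsek_cable n)"
    "vicsek_psi l ` vicsek_cable n \<inter> (\<Union>m\<in>{1..5} - {l}. vicsek_psi m ` vicsek_cable n) = {(1/3) *\<^sub>R vicsek_q l}"
    if "l \<in> {1..4}" for l
  proof -
    show "vicsek_cable (Suc n) = vicsek_psi l ` vicsek_cable n \<union> (\<Union>m\<in>{1..5} - {l}. vicsek_psi m ` vicsek_cable n)"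
    proof -
      have "{1..5} = insert l ({1..5} - {l})" using that by auto
      then show ?thesis unfolding vicsek_cable.simps by (metis UN_insert)
    qed
    show "closed (\<Union>m\<in>{1..5} - {l}. vicsek_psi m ` vicsek_cable n)" using cl by (intro closed_UN) auto
    show "vicsek_psi l ` vicsek_cable n \<inter> (\<Union>m\<in>{1..5} - {l}. vicsek_psi m ` vicsek_cable n) = {(1/3) *\<^sub>R vicsek_q l}"
      by (rule cable_arm) (use that in auto)
  qed
  \<comment> \<open>Either c lies in the subcell \<open>j\<close>, or every geodesic from c enters
    it through one fixed corner. The pull-back \<open>c''\<close> of c or of that corner is a vertex
    of level n, to which the induction hypothesis applies.\<close>
  have "\<exists>c''\<in>vicsek_vertices n. \<forall>x\<in>edge v i. cd c (vicsek_psi j x) = cd c (vicsek_psi j c'') + cd c'' x / 3"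
  proof (cases "j = k")
    case True
    then show ?thesis using c cC cd_psi[of c' _ k] S eC by (intro bexI[of _ c']) auto
  next
    case False
    have "\<exists>p\<in>{1..4}. \<forall>x\<in>vicsek_cable n. cd c (vicsek_psi j x) = cd c (vicsek_psi j (vicsek_q p)) + cd (vicsek_psi j (vicsek_q p)) (vicsek_psi j x)"
    proof (cases "j = 5")
      case True
      then have k: "k \<in> {1..4}" using c False by auto
      have "(1/3) *\<^sub>R vicsek_q k = vicsek_psi j (vicsek_q k)" using True by (simp add: vicsek_psi_eq)
      moreover have "cd c (vicsek_psi j x) = cd c ((1/3) *\<^sub>R vicsek_q k) + cd ((1/3) *\<^sub>R vicsek_q k) (vicsek_psi j x)"
        if "x \<in> vicsek_cable n" for x
      proof (rule cd_via[OF arm(1)[OF k] cl arm(2,3)[OF k]])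
        show "c \<in> vicsek_psi k ` vicsek_cable n" using c cC by blast
        show "vicsek_psi j x \<in> (\<Union>m\<in>{1..5} - {k}. vicsek_psi m ` vicsek_cable n)" using that w False by blast
      qed
      ultimately show ?thesis using k by metis
    next
      case j5: False
      then have j: "j \<in> {1..4}" using w by auto
      have p: "(1/3) *\<^sub>R vicsek_q j = vicsek_psi j (vicsek_q (opp j))"
        by (simp add: vicsek_psi_eq vicsek_q_opp flip: scaleR_minus_left scaleR_add_left)
      have "cd c (vicsek_psi j x) = cd c ((1/3) *\<^sub>R vicsek_q j) + cd ((1/3) *\<^sub>R vicsek_q j) (vicsek_psi j x)"
        if "x \<in> vicsek_cable n" for x
      proof (rule cd_via[of "Suc n" "\<Union>m\<in>{1..5} - {j}. vicsek_psi m ` vicsek_cable n" "vicsek_psi j ` vicsek_cable n"])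
        show "vicsek_cable (Suc n) = (\<Union>m\<in>{1..5} - {j}. vicsek_psi m ` vicsek_cable n) \<union> vicsek_psi j ` vicsek_cable n"
          using arm(1)[OF j] by blast
        show "(\<Union>m\<in>{1..5} - {j}. vicsek_psi m ` vicsek_cable n) \<inter> vicsek_psi j ` vicsek_cable n = {(1/3) *\<^sub>R vicsek_q j}"
          using arm(3)[OF j] by blast
        show "c \<in> (\<Union>m\<in>{1..5} - {j}. vicsek_psi m ` vicsek_cable n)" using c cC False by blast
      qed (use arm(2)[OF j] cl that in auto)
      then show ?thesis unfolding p using opp_in[OF j] by blast
    qed
    then obtain p where p: "p \<in> {1..4}" "\<And>x. x \<in> vicsek_cable n \<Longrightarrow>
       cd c (vicsek_psi j x) = cd c (vicsek_psi j (vicsek_q p)) + cd (vicsek_psi j (vicsek_q p)) (vicsek_psi j x)" by blast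
    then show ?thesis
      using cd_psi[of "vicsek_q p" _ j] q_in_skeleton[of p] S eC w q_in_vertices[of p n]
      by (intro bexI[of _ "vicsek_q p"] ballI) auto
  qed
  then obtain c'' where c'': "c'' \<in> vicsek_vertices n"
    "\<And>x. x \<in> edge v i \<Longrightarrow> cd c (vicsek_psi j x) = cd c (vicsek_psi j c'') + cd c'' x / 3" by blast
  obtain a where a: "a \<in> {vicsek_psi_word v 0, vicsek_psi_word v (vicsek_q i)}" "\<And>x. x \<in> edge v i \<Longrightarrow> cd c'' x = cd c'' a + dist a x"
    using Suc.IH[OF c''(1) w(3) Suc.prems(3)] by blast
  have "a \<in> edge v i" using a(1) by (auto simp: edge_def)
  have "cd c (vicsek_psi j x) = cd c (vicsek_psi j a) + dist (vicsek_psi j a) (vicsek_psi j x)" if "x \<in> edge v i" for x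
    using c''(2)[OF that] c''(2)[OF \<open>a \<in> edge v i\<close>] a(2)[OF that] by (simp add: dist_psi)
  then have "\<forall>x\<in>edge w i. cd c x = cd c (vicsek_psi j a) + dist (vicsek_psi j a) x"
    unfolding w psi_edge[symmetric] by blast
  then show ?case using a(1) unfolding w psi_word_Cons by auto
qed

section \<open>The Vicsek set and its geodesic distance\<close>

lemma continuous_on_psi: "continuous_on A (vicsek_psi i)"
  using continuous_on_psi_word[of A "[i]"] by simp

lemma skeleton_fixed: "vicsek_skeleton = (\<Union>i\<in>{1..5}. vicsek_psi i ` vicsek_skeleton)"
proof (intro equalityI subsetI)
  fix x assume "x \<in> vicsek_skeleton"
  then obtain w y where "w \<in> vicsek_words (Suc 0)" "y \<in> vicsek_skeleton" "x = vicsek_psi_word w y"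
    by (rule skeleton_cell)
  then show "x \<in> (\<Union>i\<in>{1..5}. vicsek_psi i ` vicsek_skeleton)" unfolding words_1 by force
next
  fix x assume "x \<in> (\<Union>i\<in>{1..5}. vicsek_psi i ` vicsek_skeleton)"
  then obtain i y where "i \<in> {1..5}" "y \<in> vicsek_skeleton" "x = vicsek_psi i y" by blast
  then show "x \<in> vicsek_skeleton" using psi_word_skeleton[of "[i]" "Suc 0" y] by (auto simp: words_1)
qed

lemma compact_closure_skeleton: "compact (closure vicsek_skeleton)"
proof -
  have "bounded vicsek_skeleton"
    using skeleton_subset_square norm_square by (intro boundedI[of _ 1]) blast
  then show ?thesis by simp
qed

lemma closure_skeleton_fixed:
  "closure vicsek_skeleton = (\<Union>i\<in>{1..5}. vicsek_psi i ` closure vicsek_skeleton)"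
proof
  have "closed (\<Union>i\<in>{1..5}. vicsek_psi i ` closure vicsek_skeleton)"
    using compact_closure_skeleton
    by (intro closed_UN) (auto intro!: compact_imp_closed compact_continuous_image continuous_on_psi)
  moreover have "vicsek_skeleton \<subseteq> (\<Union>i\<in>{1..5}. vicsek_psi i ` closure vicsek_skeleton)"
    using skeleton_fixed closure_subset[of vicsek_skeleton] by blast
  ultimately show "closure vicsek_skeleton \<subseteq> (\<Union>i\<in>{1..5}. vicsek_psi i ` closure vicsek_skeleton)"
    by (intro closure_minimal)
  show "(\<Union>i\<in>{1..5}. vicsek_psi i ` closure vicsek_skeleton) \<subseteq> closure vicsek_skeleton"
  proof (rule UN_least)
    fix i assume i: "i \<in> {1..5::nat}"
    have "vicsek_psi i ` vicsek_skeleton \<subseteq> vicsek_skeleton" using skeleton_fixed i by blast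
    then show "vicsek_psi i ` closure vicsek_skeleton \<subseteq> closure vicsek_skeleton"
      using closure_subset[of vicsek_skeleton] by (intro image_closure_subset continuous_on_psi) auto
  qed
qed

lemma fixed_cells:
  assumes "A = (\<Union>i\<in>{1..5}. vicsek_psi i ` A)"
  shows "A = (\<Union>w\<in>vicsek_words n. vicsek_psi_word w ` A)"
proof (induction n)
  case (Suc n)
  have "A = (\<Union>i\<in>{1..5}. vicsek_psi i ` (\<Union>w\<in>vicsek_words n. vicsek_psi_word w ` A))"
    using assms Suc by metis
  also have "\<dots> = (\<Union>i\<in>{1..5}. \<Union>w\<in>vicsek_words n. vicsek_psi_word (i # w) ` A)"
    by (simp only: image_UN psi_word_Cons image_comp)
  finally show ?case by (simp only: words_Suc UN_UN_flatten image_image)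
qed simp

lemma power3_eventually_small: "0 < e \<Longrightarrow> \<exists>n. c / 3 ^ n < (e::real)"
proof -
  assume e: "0 < e"
  obtain n where "(1/3::real) ^ n < e / (\<bar>c\<bar> + 1)" using real_arch_pow_inv[of "e / (\<bar>c\<bar> + 1)" "1/3"] e by auto
  then have "\<bar>c\<bar> + 1 < e * 3 ^ n" by (simp add: power_one_over field_simps)
  then have "c < e * 3 ^ n" by linarith
  then show ?thesis by (intro exI[of _ n]) (simp add: field_simps)
qed

text \<open>A point of A in the cell of a word is approximated by the image of one fixed b in B
  under the same word, since the maps contract by 3^-n. The two inclusions give uniqueness of K
  without the Hausdorff metric.\<close>

lemma fixed_compact_subset:
  assumes A: "compact A" "A = (\<Union>i\<in>{1..5}. vicsek_psi i ` A)"
    and B: "B \<noteq> {}" "compact B" "B = (\<Union>i\<in>{1..5}. vicsek_psi i ` B)"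
  shows "A \<subseteq> B"
proof
  fix x assume x: "x \<in> A"
  obtain b where b: "b \<in> B" using B by blast
  obtain M where M: "\<And>a. a \<in> A \<Longrightarrow> dist b a \<le> M"
    using compact_imp_bounded[OF A(1)] unfolding bounded_any_center[of A b] by blast
  have "\<exists>y\<in>B. dist y x < e" if "0 < e" for e
  proof -
    obtain n where n: "M / 3 ^ n < e" using power3_eventually_small[OF \<open>0 < e\<close>] by blast
    have "x \<in> (\<Union>w\<in>vicsek_words n. vicsek_psi_word w ` A)" using fixed_cells[OF A(2), of n] x by metis
    then obtain w a where w: "w \<in> vicsek_words n" "a \<in> A" "x = vicsek_psi_word w a" by blast
    have "vicsek_psi_word w b \<in> (\<Union>w\<in>vicsek_words n. vicsek_psi_word w ` B)" using w b by blast
    then have "vicsek_psi_word w b \<in> B" using fixed_cells[OF B(3), of n] by metis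
    moreover have "dist (vicsek_psi_word w b) x \<le> M / 3 ^ n"
      using w M[OF w(2)] by (simp add: dist_psi_word length_words divide_right_mono)
    ultimately show ?thesis using n by (intro bexI[of _ "vicsek_psi_word w b"]) auto
  qed
  then show "x \<in> B" using closed_approachable[OF compact_imp_closed[OF B(2)], of x] by blast
qed

text \<open>The closure of the skeleton is the invariant compact set, which makes density of the
  skeleton part of the description of K.\<close>

lemma vicsek_set_eq: "vicsek_set = closure vicsek_skeleton"
  unfolding vicsek_set_def
proof (rule the_equality)
  show *: "closure vicsek_skeleton \<noteq> {} \<and> compact (closure vicsek_skeleton) \<and>
      closure vicsek_skeleton = (\<Union>i\<in>{1..5}. vicsek_psi i ` closure vicsek_skeleton)"
    using zero_in_skeleton closure_subset[of vicsek_skeleton] compact_closure_skeleton closure_skeleton_fixed by blast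
  show "K = closure vicsek_skeleton" if "K \<noteq> {} \<and> compact K \<and> K = (\<Union>i\<in>{1..5}. vicsek_psi i ` K)" for K
    using that * fixed_compact_subset by (intro equalityI) metis+
qed

lemma compact_K: "compact vicsek_set"
  unfolding vicsek_set_eq by (rule compact_closure_skeleton)

lemma closed_K: "closed vicsek_set"
  by (simp add: vicsek_set_eq)

lemma K_cells: "vicsek_set = (\<Union>w\<in>vicsek_words n. vicsek_psi_word w ` vicsek_set)"
  unfolding vicsek_set_eq by (rule fixed_cells[OF closure_skeleton_fixed])

lemma K_cellE:
  assumes "x \<in> vicsek_set"
  obtains w y where "w \<in> vicsek_words n" "y \<in> vicsek_set" "x = vicsek_psi_word w y"
proof -
  have "x \<in> (\<Union>w\<in>vicsek_words n. vicsek_psi_word w ` vicsek_set)" using assms K_cells by metis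
  then show ?thesis using that by blast
qed

lemma psi_word_K: "w \<in> vicsek_words n \<Longrightarrow> x \<in> vicsek_set \<Longrightarrow> vicsek_psi_word w x \<in> vicsek_set"
  using K_cells[of n] by blast

lemma skeleton_subset_K: "vicsek_skeleton \<subseteq> vicsek_set"
  by (simp add: vicsek_set_eq closure_subset)

lemma K_subset_square: "vicsek_set \<subseteq> square"
  unfolding vicsek_set_eq using skeleton_subset_square closed_square by (rule closure_minimal)

lemma q_in_K: "i \<in> {1..5} \<Longrightarrow> vicsek_q i \<in> vicsek_set"
  using q_in_skeleton skeleton_subset_K by blast

lemma zero_in_K: "0 \<in> vicsek_set"
  using zero_in_skeleton skeleton_subset_K by blast

section \<open>Cells of K\<close>

definition cell :: "nat list \<Rightarrow> (real \<times> real) set" where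
  "cell w = vicsek_psi_word w ` vicsek_set"

lemma cell_Nil [simp]: "cell [] = vicsek_set"
  by (simp add: cell_def)

lemma cell_subset_K: "w \<in> vicsek_words n \<Longrightarrow> cell w \<subseteq> vicsek_set"
  using psi_word_K by (auto simp: cell_def)

lemma compact_cell: "compact (cell w)"
  unfolding cell_def by (intro compact_continuous_image continuous_on_psi_word compact_K)

lemma cell_append_subset: "v \<in> vicsek_words m \<Longrightarrow> cell (w @ v) \<subseteq> cell w"
  using psi_word_K by (auto simp: cell_def psi_word_append)

lemma cell_Int_finite: "w \<in> vicsek_words n \<Longrightarrow> w' \<in> vicsek_words n \<Longrightarrow> w \<noteq> w' \<Longrightarrow> finite (cell w \<inter> cell w')"
proof -
  assume "w \<in> vicsek_words n" "w' \<in> vicsek_words n" "w \<noteq> w'"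
  then obtain z where "vicsek_psi_word w ` square \<inter> vicsek_psi_word w' ` square \<subseteq> {z}"
    using cell_Int_subset[of w n w'] by blast
  then have "cell w \<inter> cell w' \<subseteq> {z}" using K_subset_square unfolding cell_def by blast
  then show ?thesis by (rule finite_subset) simp
qed

lemma dist_cell: "x \<in> cell w \<Longrightarrow> y \<in> cell w \<Longrightarrow> dist x y \<le> 2 / 3 ^ length w"
proof -
  assume "x \<in> cell w" "y \<in> cell w"
  then obtain x' y' where xy: "x = vicsek_psi_word w x'" "y = vicsek_psi_word w y'" "x' \<in> vicsek_set" "y' \<in> vicsek_set"
    unfolding cell_def by blast
  then have "norm x' \<le> 1" "norm y' \<le> 1" using K_subset_square norm_square by blast+
  then have "dist x' y' \<le> 2" using norm_triangle_ineq4[of x' y'] by (simp add: dist_norm)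
  then show ?thesis using xy by (simp add: dist_psi_word divide_right_mono)
qed

lemma vertices_dense: "vicsek_set \<subseteq> closure (\<Union>n. vicsek_vertices n)"
proof
  fix x assume x: "x \<in> vicsek_set"
  have "\<exists>y\<in>(\<Union>n. vicsek_vertices n). dist y x < e" if "0 < e" for e
  proof -
    obtain n where n: "2 / 3 ^ n < e" using power3_eventually_small[OF \<open>0 < e\<close>] by blast
    obtain w z where w: "w \<in> vicsek_words n" "z \<in> vicsek_set" "x = vicsek_psi_word w z"
      using x by (rule K_cellE)
    have "vicsek_psi_word w 0 \<in> vicsek_vertices n"
      unfolding vertices_eq using w by (intro UN_I[of w] imageI) (auto intro!: image_eqI[of _ _ 5])
    moreover have "dist (vicsek_psi_word w 0) x < e"
      using dist_cell[of "vicsek_psi_word w 0" w x] w n zero_in_K by (auto simp: cell_def length_words)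
    ultimately show ?thesis by blast
  qed
  then show "x \<in> closure (\<Union>n. vicsek_vertices n)" unfolding closure_approachable by blast
qed

abbreviation "gd \<equiv> vicsek_dist"

lemma gd_skeleton: "x \<in> vicsek_skeleton \<Longrightarrow> y \<in> vicsek_skeleton \<Longrightarrow> gd x y = cd x y"
  by (simp add: vicsek_dist_def)

text \<open>By \<open>cd_lipschitz\<close> the distance is Lipschitz on pairs of skeleton points, so
  it has a continuous extension to the closure. A pair outside the product of skeletons is a limit
  point of it, and there the \<open>Lim\<close> in \<open>vicsek_dist\<close> returns that
  extension.\<close>

lemma gd_continuous: "continuous_on (vicsek_set \<times> vicsek_set) (\<lambda>(x, y). gd x y)"
proof -
  let ?S = "vicsek_skeleton \<times> vicsek_skeleton"
  let ?f = "\<lambda>(x, y). cd x y"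
  have cl: "closure ?S = vicsek_set \<times> vicsek_set" by (simp add: closure_Times vicsek_set_eq)
  have "uniformly_continuous_on ?S ?f"
  proof (rule lipschitz_on_uniformly_continuous[of 24])
    show "24-lipschitz_on ?S ?f"
    proof (rule lipschitz_onI)
      fix p q assume "p \<in> ?S" "q \<in> ?S"
      moreover obtain x y x' y' where p: "p = (x, y)" "q = (x', y')" by (metis surj_pair)
      ultimately have "\<bar>cd x y - cd x' y'\<bar> \<le> 12 * dist x x' + 12 * dist y y'"
        by (intro cd_lipschitz) auto
      also have "\<dots> \<le> 24 * dist p q"
        using dist_fst_le[of p q] dist_snd_le[of p q] p by simp
      finally show "dist (?f p) (?f q) \<le> 24 * dist p q" by (simp add: p dist_real_def)
    qed simp
  qed
  then obtain g where g: "uniformly_continuous_on (closure ?S) g" "\<And>p. p \<in> ?S \<Longrightarrow> ?f p = g p"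
    by (rule uniformly_continuous_on_extension_on_closure) blast
  have cont: "continuous_on (closure ?S) g" using g(1) by (rule uniformly_continuous_imp_continuous)
  have "gd x y = g (x, y)" if xy: "(x, y) \<in> closure ?S" for x y
  proof (cases "(x, y) \<in> ?S")
    case True
    then show ?thesis using g(2)[of "(x, y)"] by (auto simp: gd_skeleton)
  next
    case False
    then have "(x, y) islimpt ?S" using xy unfolding closure_def by blast
    then have nt: "\<not> trivial_limit (at (x, y) within ?S)" by (simp add: trivial_limit_within)
    have "(g \<longlongrightarrow> g (x, y)) (at (x, y) within closure ?S)"
      using cont xy by (simp add: continuous_on_def)
    then have "(g \<longlongrightarrow> g (x, y)) (at (x, y) within ?S)"
      by (rule tendsto_within_subset) (rule closure_subset)
    then have "(?f \<longlongrightarrow> g (x, y)) (at (x, y) within ?S)"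
      by (rule Lim_transform_eventually) (use g(2) in \<open>auto simp: eventually_at_filter\<close>)
    then have "Lim (at (x, y) within ?S) ?f = g (x, y)" by (rule tendsto_Lim[OF nt])
    then show ?thesis using False by (auto simp: vicsek_dist_def)
  qed
  then have "continuous_on (closure ?S) (\<lambda>(x, y). gd x y)"
    using cont by (subst continuous_on_cong[OF refl, of _ _ g]) auto
  then show ?thesis by (simp add: cl)
qed

text \<open>Carries closed inequalities over from the skeleton to K by density.\<close>

lemma K_closed_condition:
  assumes "continuous_on (vicsek_set \<times> vicsek_set) h" "\<And>x y. x \<in> vicsek_skeleton \<Longrightarrow> y \<in> vicsek_skeleton \<Longrightarrow> h (x, y) \<le> a"
    "x \<in> vicsek_set" "y \<in> vicsek_set"
  shows "h (x, y) \<le> (a::real)"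
proof -
  have cl: "closure (vicsek_skeleton \<times> vicsek_skeleton) = vicsek_set \<times> vicsek_set"
    by (simp add: closure_Times vicsek_set_eq)
  show ?thesis
    by (rule continuous_le_on_closure[of "vicsek_skeleton \<times> vicsek_skeleton" h]) (use assms cl in auto)
qed

lemma dist_le_gd:
  assumes "x \<in> vicsek_set" "y \<in> vicsek_set"
  shows "dist x y \<le> gd x y"
proof -
  have "(\<lambda>(x, y). dist x y - gd x y) (x, y) \<le> 0"
  proof (rule K_closed_condition[OF _ _ assms])
    have "continuous_on (vicsek_set \<times> vicsek_set) (\<lambda>p. dist (fst p) (snd p) - (\<lambda>(x, y). gd x y) p)"
      by (intro continuous_intros gd_continuous)
    then show "continuous_on (vicsek_set \<times> vicsek_set) (\<lambda>(x, y). dist x y - gd x y)"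
      by (simp add: case_prod_beta')
  qed (use dist_le_cd gd_skeleton in auto)
  then show ?thesis by simp
qed

lemma gd_cell:
  assumes w: "w \<in> vicsek_words n" and xy: "x \<in> cell w" "y \<in> cell w"
  shows "gd x y \<le> 2 / 3 ^ n"
proof -
  obtain x' y' where x': "x = vicsek_psi_word w x'" "y = vicsek_psi_word w y'" "x' \<in> vicsek_set" "y' \<in> vicsek_set"
    using xy unfolding cell_def by blast
  have "(\<lambda>p. gd (vicsek_psi_word w (fst p)) (vicsek_psi_word w (snd p))) (x', y') \<le> 2 / 3 ^ n"
  proof (rule K_closed_condition[OF _ _ x'(3,4)])
    have "continuous_on (vicsek_set \<times> vicsek_set) (\<lambda>p. (\<lambda>(x, y). gd x y) (vicsek_psi_word w (fst p), vicsek_psi_word w (snd p)))"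
      by (rule continuous_on_compose2[OF gd_continuous])
        (auto intro!: continuous_intros continuous_on_compose2[OF continuous_on_psi_word[of UNIV]] psi_word_K[OF w])
    then show "continuous_on (vicsek_set \<times> vicsek_set) (\<lambda>p. gd (vicsek_psi_word w (fst p)) (vicsek_psi_word w (snd p)))"
      by simp
  next
    fix x y assume xy: "x \<in> vicsek_skeleton" "y \<in> vicsek_skeleton"
    then have "cd (vicsek_psi_word w x) (vicsek_psi_word w y) \<le> 2 / 3 ^ n"
      using cd_psi_word[OF w xy] cd_le_2[OF xy] by (simp add: divide_right_mono)
    then show "gd (vicsek_psi_word w (fst (x, y))) (vicsek_psi_word w (snd (x, y))) \<le> 2 / 3 ^ n"
      using xy psi_word_skeleton[OF w] by (simp add: gd_skeleton)
  qed
  then show ?thesis using x' by simp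
qed

lemma gd_pos: "x \<in> vicsek_set \<Longrightarrow> y \<in> vicsek_set \<Longrightarrow> x \<noteq> y \<Longrightarrow> 0 < gd x y"
  using dist_le_gd[of x y] by (metis dist_pos_lt less_le_trans)

lemma gd_nonneg: "x \<in> vicsek_set \<Longrightarrow> y \<in> vicsek_set \<Longrightarrow> 0 \<le> gd x y"
  using dist_le_gd[of x y] by (meson dual_order.trans zero_le_dist)

lemma gd_small_imp_near:
  assumes w: "w \<in> vicsek_words n" "w' \<in> vicsek_words n" and xy: "x \<in> cell w" "y \<in> cell w'" and d: "gd x y < sqrt 2 / 3 ^ n"
  shows "near w w'"
proof -
  obtain x' y' where x': "x = vicsek_psi_word w x'" "y = vicsek_psi_word w' y'" "x' \<in> vicsek_set" "y' \<in> vicsek_set"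
    using xy unfolding cell_def by blast
  have "x \<in> vicsek_set" "y \<in> vicsek_set" using xy cell_subset_K w by blast+
  then have "dist x y < sqrt 2 / 3 ^ n"
    using d dist_le_gd[of x y] by simp
  moreover have "x' \<in> square" "y' \<in> square" using x' K_subset_square by blast+
  ultimately show ?thesis using dist_imp_near[OF w, of x' y'] x' by simp
qed

lemma closed_ball: "x \<in> vicsek_set \<Longrightarrow> closed (vicsek_ball x r)"
proof -
  assume x: "x \<in> vicsek_set"
  have "continuous_on vicsek_set (\<lambda>y. (\<lambda>(x, y). gd x y) (x, y))"
    by (rule continuous_on_compose2[OF gd_continuous]) (intro continuous_intros, use x in blast)
  then have "continuous_on vicsek_set (\<lambda>y. gd x y)" by simp
  then have "closed (vicsek_set \<inter> (\<lambda>y. gd x y) -` {..r})"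
    by (intro continuous_closed_preimage closed_K) auto
  then show ?thesis by (simp add: vicsek_ball_def vimage_def Int_def)
qed

section \<open>Discrete energies\<close>

text \<open>Tangent line of the convex power function, obtained from Young's inequality with the
  conjugate exponent. Summed or integrated with a the mean, it yields \<open>sum_powr_le\<close> and
  \<open>jensen_powr\<close>.\<close>

lemma powr_tangent:
  fixes a y p :: real
  assumes "0 \<le> a" "0 \<le> y" "1 \<le> p"
  shows "a powr p + p * a powr (p - 1) * (y - a) \<le> y powr p"
proof (cases "p = 1 \<or> a = 0")
  case True
  then show ?thesis using assms by (cases "a = 0") auto
next
  case False
  then have p: "1 < p" "0 < a" using assms by auto
  define q where "q = p / (p - 1)"
  have q: "1 < q" "1 / p + 1 / q = 1" "(p - 1) * q = p" "p / q = p - 1"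
    using p by (auto simp: q_def field_simps)
  have "y * a powr (p - 1) \<le> y powr p / p + (a powr (p - 1)) powr q / q"
    using Youngs_inequality[of p q y "a powr (p - 1)"] p q assms by auto
  then have "p * (y * a powr (p - 1)) \<le> p * (y powr p / p + a powr p / q)"
    using p by (intro mult_left_mono) (auto simp: powr_powr q(3))
  also have "\<dots> = y powr p + (p / q) * a powr p" using p by (simp add: distrib_left)
  finally have "p * (y * a powr (p - 1)) \<le> y powr p + (p - 1) * a powr p" unfolding q(4) .
  moreover have "a powr (p - 1) * a = a powr p" using p by (simp add: powr_mult_base mult.commute)
  then have "p * a powr (p - 1) * (y - a) = p * (y * a powr (p - 1)) - p * a powr p"
    by (simp add: right_diff_distrib mult.assoc)
  ultimately show ?thesis by (simp add: left_diff_distrib)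
qed

text \<open>Summing the tangent inequality at the mean cancels the linear terms.\<close>

lemma sum_powr_le:
  fixes y :: "'a \<Rightarrow> real"
  assumes "finite I" "I \<noteq> {}" "\<And>i. i \<in> I \<Longrightarrow> 0 \<le> y i" "1 \<le> p"
  shows "(\<Sum>i\<in>I. y i) powr p \<le> card I powr (p - 1) * (\<Sum>i\<in>I. y i powr p)"
proof -
  define N where "N = real (card I)"
  have N: "0 < N" using assms by (simp add: N_def card_gt_0_iff)
  define a where "a = (\<Sum>i\<in>I. y i) / N"
  have a: "0 \<le> a" using N assms by (simp add: a_def sum_nonneg)
  have "N * a powr p = (\<Sum>i\<in>I. a powr p + p * a powr (p - 1) * (y i - a))"
    using N by (simp add: sum.distrib sum_subtractf a_def N_def flip: sum_distrib_left)
  also have "\<dots> \<le> (\<Sum>i\<in>I. y i powr p)"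
    using assms a by (intro sum_mono powr_tangent) auto
  finally have *: "N * a powr p \<le> (\<Sum>i\<in>I. y i powr p)" .
  have Np: "N powr p = N * N powr (p - 1)" using N by (simp add: powr_mult_base)
  have "(\<Sum>i\<in>I. y i) powr p = (N * a) powr p" using N by (simp add: a_def)
  also have "\<dots> = N powr (p - 1) * (N * a powr p)"
    using N a by (simp add: powr_mult Np)
  also have "\<dots> \<le> N powr (p - 1) * (\<Sum>i\<in>I. y i powr p)" using * by (intro mult_left_mono) auto
  finally show ?thesis by (simp add: N_def)
qed

lemma abs_add2_powr_le:
  fixes a b p :: real
  assumes "1 \<le> p"
  shows "\<bar>a + b\<bar> powr p \<le> 2 powr (p - 1) * (\<bar>a\<bar> powr p + \<bar>b\<bar> powr p)"
proof -
  have "\<bar>a + b\<bar> powr p \<le> (\<Sum>i\<in>{0,1::nat}. if i = 0 then \<bar>a\<bar> else \<bar>b\<bar>) powr p"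
    using assms by (intro powr_mono2) auto
  also have "\<dots> \<le> card {0,1::nat} powr (p - 1) * (\<Sum>i\<in>{0,1::nat}. (if i = 0 then \<bar>a\<bar> else \<bar>b\<bar>) powr p)"
    by (rule sum_powr_le) (use assms in auto)
  finally show ?thesis by simp
qed

lemma abs_add3_powr_le:
  fixes a b c p :: real
  assumes "1 \<le> p"
  shows "\<bar>a + b + c\<bar> powr p \<le> 3 powr (p - 1) * (\<bar>a\<bar> powr p + \<bar>b\<bar> powr p + \<bar>c\<bar> powr p)"
proof -
  let ?y = "\<lambda>i::nat. if i = 0 then \<bar>a\<bar> else if i = 1 then \<bar>b\<bar> else \<bar>c\<bar>"
  have "\<bar>a + b + c\<bar> powr p \<le> (\<Sum>i\<in>{0,1,2}. ?y i) powr p"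
    using assms by (intro powr_mono2) auto
  also have "\<dots> \<le> card {0,1,2::nat} powr (p - 1) * (\<Sum>i\<in>{0,1,2}. ?y i powr p)"
    by (rule sum_powr_le) (use assms in auto)
  finally show ?thesis by (simp add: add.assoc)
qed

text \<open>Signed from the cell centre outwards. The orientation by \<open>vicsek_below\<close>
  enters only with \<open>oincr\<close>.\<close>

definition incr :: "(real \<times> real \<Rightarrow> real) \<Rightarrow> nat list \<Rightarrow> nat \<Rightarrow> real" where
  "incr f w i = f (vicsek_psi_word w (vicsek_q i)) - f (vicsek_psi_word w 0)"

text \<open>\<open>vicsek_energy\<close> for real p without the factor 1/2, since each edge is
  counted once here.\<close>

definition energy :: "real \<Rightarrow> nat \<Rightarrow> (real \<times> real \<Rightarrow> real) \<Rightarrow> real" where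
  "energy p m f = 3 powr ((p - 1) * m) * (\<Sum>w\<in>vicsek_words m. \<Sum>i\<in>{1..4}. \<bar>incr f w i\<bar> powr p)"

lemma edge_endpoints_ne:
  assumes "i \<in> {1..4}"
  shows "vicsek_psi_word w 0 \<noteq> vicsek_psi_word w (vicsek_q i)"
proof
  assume "vicsek_psi_word w 0 = vicsek_psi_word w (vicsek_q i)"
  then have "0 = vicsek_q i" by (rule injD[OF inj_psi_word])
  then show False using norm_vicsek_q[OF assms] by simp
qed

lemma edge_Int_finite:
  assumes "w \<in> vicsek_words n" "w' \<in> vicsek_words n" "i \<in> {1..4}" "j \<in> {1..4}" "(w, i) \<noteq> (w', j)"
  shows "\<exists>z. edge w i \<inter> edge w' j \<subseteq> {z}"
proof (cases "w = w'")
  case False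
  then obtain z where "vicsek_psi_word w ` square \<inter> vicsek_psi_word w' ` square \<subseteq> {z}"
    using cell_Int_subset[OF assms(1,2)] by blast
  moreover have "edge w i \<inter> edge w' j \<subseteq> vicsek_psi_word w ` square \<inter> vicsek_psi_word w' ` square"
    unfolding edge_image by (intro Int_mono image_mono segment_q_square)
  ultimately have "edge w i \<inter> edge w' j \<subseteq> {z}" by (rule subset_trans[rotated])
  then show ?thesis by (rule exI)
next
  case True
  then have "edge w i \<inter> edge w' j = vicsek_psi_word w ` (closed_segment 0 (vicsek_q i) \<inter> closed_segment 0 (vicsek_q j))"
    by (simp add: edge_image image_Int[OF inj_psi_word])
  then show ?thesis using segment_q_Int[of i j] assms True by auto
qed

lemma edge_inj:
  assumes "w \<in> vicsek_words n" "w' \<in> vicsek_words n" "i \<in> {1..4}" "j \<in> {1..4}" "edge w i = edge w' j"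
  shows "w = w' \<and> i = j"
proof (rule ccontr)
  assume "\<not> (w = w' \<and> i = j)"
  then obtain z where "edge w i \<inter> edge w' j \<subseteq> {z}" using edge_Int_finite[OF assms(1-4)] by auto
  then have "edge w i \<subseteq> {z}" using assms(5) by simp
  then show False using edge_endpoints_ne[OF assms(3), of w] by (auto simp: edge_def)
qed

lemma adj_iff:
  "vicsek_adj m u v \<longleftrightarrow> (\<exists>w\<in>vicsek_words m. \<exists>i\<in>{1..4}.
     u = vicsek_psi_word w 0 \<and> v = vicsek_psi_word w (vicsek_q i) \<or>
     v = vicsek_psi_word w 0 \<and> u = vicsek_psi_word w (vicsek_q i))"
proof -
  have V: "vicsek_psi_word w (vicsek_q i) \<in> vicsek_vertices m" if "w \<in> vicsek_words m" "i \<in> {1..5}" for w i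
    unfolding vertices_eq using that by blast
  have V0: "vicsek_psi_word w 0 \<in> vicsek_vertices m" if "w \<in> vicsek_words m" for w
    using V[OF that, of 5] by simp
  have "closed_segment u v = edge w i \<longleftrightarrow>
     u = vicsek_psi_word w 0 \<and> v = vicsek_psi_word w (vicsek_q i) \<or>
     v = vicsek_psi_word w 0 \<and> u = vicsek_psi_word w (vicsek_q i)" for w i
    by (auto simp: edge_def doubleton_eq_iff)
  moreover have "vicsek_psi_word w (vicsek_q i) \<in> vicsek_vertices m" if "w \<in> vicsek_words m" "i \<in> {1..4}" for w i
    using V that by auto
  ultimately show ?thesis unfolding vicsek_adj_def edges_eq using V0 by blast
qed

text \<open>Each edge contributes its two ordered pairs of endpoints; \<open>edge_inj\<close>
  prevents any pair from arising twice.\<close>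

lemma sum_adj:
  assumes "\<And>x y. h x y = h y x"
  shows "(\<Sum>(x, y)\<in>{(x, y). vicsek_adj m x y}. h x y) =
    2 * (\<Sum>w\<in>vicsek_words m. \<Sum>i\<in>{1..4}. h (vicsek_psi_word w 0) (vicsek_psi_word w (vicsek_q i)) :: real)"
proof -
  let ?J = "vicsek_words m \<times> {1..4::nat}"
  define e where "e = (\<lambda>(w, i). (vicsek_psi_word w 0, vicsek_psi_word w (vicsek_q i)))"
  have seg: "edge w i = edge w' j" if "e (w, i) = e (w', j) \<or> e (w, i) = prod.swap (e (w', j))" for w i w' j
    using that by (auto simp: e_def edge_def closed_segment_commute)
  have set_eq: "{(x, y). vicsek_adj m x y} = e ` ?J \<union> (prod.swap \<circ> e) ` ?J"
  proof (intro equalityI subsetI)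
    fix z assume "z \<in> {(x, y). vicsek_adj m x y}"
    then obtain u v where z: "z = (u, v)" "vicsek_adj m u v" by blast
    then obtain w i where "w \<in> vicsek_words m" "i \<in> {1..4}"
       "u = vicsek_psi_word w 0 \<and> v = vicsek_psi_word w (vicsek_q i) \<or> v = vicsek_psi_word w 0 \<and> u = vicsek_psi_word w (vicsek_q i)"
      unfolding adj_iff by blast
    with z(1) obtain w i where "w \<in> vicsek_words m" "i \<in> {1..4}" "z = e (w, i) \<or> z = prod.swap (e (w, i))"
      unfolding e_def by auto
    then show "z \<in> e ` ?J \<union> (prod.swap \<circ> e) ` ?J" by force
  next
    fix z assume "z \<in> e ` ?J \<union> (prod.swap \<circ> e) ` ?J"
    then obtain w i where "w \<in> vicsek_words m" "i \<in> {1..4}" "z = e (w, i) \<or> z = prod.swap (e (w, i))"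
      by force
    then show "z \<in> {(x, y). vicsek_adj m x y}"
      unfolding adj_iff e_def by force
  qed
  have inj: "inj_on e ?J"
  proof (rule inj_onI)
    fix a b assume "a \<in> ?J" "b \<in> ?J" "e a = e b"
    then show "a = b" using seg[of "fst a" "snd a" "fst b" "snd b"] edge_inj[of "fst a" m "fst b" "snd a" "snd b"]
      by (auto simp: prod_eq_iff)
  qed
  have inj': "inj_on (prod.swap \<circ> e) ?J"
    using inj by (intro comp_inj_on) auto
  have disj: "e ` ?J \<inter> (prod.swap \<circ> e) ` ?J = {}"
  proof (rule ccontr)
    assume "e ` ?J \<inter> (prod.swap \<circ> e) ` ?J \<noteq> {}"
    then obtain z where "z \<in> e ` ?J" "z \<in> (prod.swap \<circ> e) ` ?J" by blast
    then obtain a b where ab: "a \<in> ?J" "b \<in> ?J" "e a = prod.swap (e b)" by (elim imageE) simp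
    obtain w i w' j where "a = (w, i)" "b = (w', j)" by (metis surj_pair)
    with ab have *: "w \<in> vicsek_words m" "i \<in> {1..4}" "w' \<in> vicsek_words m" "j \<in> {1..4}" "e (w, i) = prod.swap (e (w', j))"
      by auto
    then have "edge w i = edge w' j" by (intro seg disjI2)
    then have "w = w' \<and> i = j" by (rule edge_inj[OF *(1,3,2,4)])
    then have "fst (e (w, i)) = fst (prod.swap (e (w, i)))" using *(5) by simp
    then have "vicsek_psi_word w 0 = vicsek_psi_word w (vicsek_q i)" unfolding e_def by simp
    then show False using edge_endpoints_ne[OF *(2), of w] by blast
  qed
  have "(\<Sum>(x, y)\<in>{(x, y). vicsek_adj m x y}. h x y) =
      sum (\<lambda>(x, y). h x y) (e ` ?J) + sum (\<lambda>(x, y). h x y) ((prod.swap \<circ> e) ` ?J)"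
    unfolding set_eq by (rule sum.union_disjoint[OF _ _ disj]) auto
  also have "\<dots> = (\<Sum>p\<in>?J. (\<lambda>(x, y). h x y) (e p)) + (\<Sum>p\<in>?J. (\<lambda>(x, y). h x y) (prod.swap (e p)))"
    unfolding sum.reindex[OF inj] sum.reindex[OF inj'] by simp
  also have "\<dots> = 2 * (\<Sum>p\<in>?J. (\<lambda>(x, y). h x y) (e p))"
    using assms by (simp add: case_prod_beta' prod.swap_def)
  also have "(\<Sum>p\<in>?J. (\<lambda>(x, y). h x y) (e p)) =
     (\<Sum>w\<in>vicsek_words m. \<Sum>i\<in>{1..4}. h (vicsek_psi_word w 0) (vicsek_psi_word w (vicsek_q i)))"
    by (simp add: sum.cartesian_product e_def case_prod_beta')
  finally show ?thesis .
qed

lemma vicsek_energy_eq: "vicsek_energy (ereal p) m f = energy p m f"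
proof -
  have "(\<Sum>(x, y)\<in>{(x, y). vicsek_adj m x y}. \<bar>f x - f y\<bar> powr p) =
    2 * (\<Sum>w\<in>vicsek_words m. \<Sum>i\<in>{1..4}. \<bar>incr f w i\<bar> powr p)"
    by (subst sum_adj) (auto simp: abs_minus_commute incr_def)
  then show ?thesis by (simp add: vicsek_energy_def energy_def)
qed

text \<open>Upper bounds are the only information about the maximum that is used for the infinite
  exponent, so everything there is phrased with increments at most L / 3^m.\<close>

lemma vicsek_energy_infinity_le_iff:
  "vicsek_energy \<infinity> m f \<le> L \<longleftrightarrow> (\<forall>w\<in>vicsek_words m. \<forall>i\<in>{1..4}. \<bar>incr f w i\<bar> \<le> L / 3 ^ m)"
proof -
  let ?J = "vicsek_words m \<times> {1..4::nat}"
  have A: "{\<bar>f x - f y\<bar> | x y. vicsek_adj m x y} = (\<lambda>(w, i). \<bar>incr f w i\<bar>) ` ?J"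
  proof (intro equalityI subsetI)
    fix z assume "z \<in> {\<bar>f x - f y\<bar> | x y. vicsek_adj m x y}"
    then obtain x y where "z = \<bar>f x - f y\<bar>" "vicsek_adj m x y" by blast
    then obtain w i where "w \<in> vicsek_words m" "i \<in> {1..4}" "z = \<bar>incr f w i\<bar>"
      unfolding adj_iff incr_def by (metis abs_minus_commute)
    then show "z \<in> (\<lambda>(w, i). \<bar>incr f w i\<bar>) ` ?J" by auto
  next
    fix z assume "z \<in> (\<lambda>(w, i). \<bar>incr f w i\<bar>) ` ?J"
    then obtain w i where "w \<in> vicsek_words m" "i \<in> {1..4}" "z = \<bar>incr f w i\<bar>" by auto
    then show "z \<in> {\<bar>f x - f y\<bar> | x y. vicsek_adj m x y}"
      unfolding adj_iff incr_def by blast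
  qed
  have ne: "?J \<noteq> {}"
  proof -
    have "(replicate m 1, 1) \<in> ?J" by (auto simp: vicsek_words_def)
    then show ?thesis by blast
  qed
  have "vicsek_energy \<infinity> m f \<le> L \<longleftrightarrow> Max ((\<lambda>(w, i). \<bar>incr f w i\<bar>) ` ?J) \<le> L / 3 ^ m"
    unfolding vicsek_energy_def A by (simp add: le_divide_eq mult.commute)
  also have "\<dots> \<longleftrightarrow> (\<forall>z\<in>(\<lambda>(w, i). \<bar>incr f w i\<bar>) ` ?J. z \<le> L / 3 ^ m)"
    by (rule Max_le_iff) (use ne in auto)
  finally show ?thesis by auto
qed

lemma le_mult_ge_1: "1 \<le> a \<Longrightarrow> 0 \<le> x \<Longrightarrow> x \<le> a * (x::real)"
  using mult_right_mono[of 1 a x] by simp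

section \<open>Self-similarity and monotonicity of the energies\<close>

lemma energy_nonneg: "0 \<le> energy p m f"
  by (auto simp: energy_def intro!: mult_nonneg_nonneg sum_nonneg)

lemma incr_append: "incr f (u @ w) i = incr (f \<circ> vicsek_psi_word u) w i"
  by (simp add: incr_def psi_word_append)

lemma energy_add:
  "energy p (n + m) f = 3 powr ((p - 1) * n) * (\<Sum>u\<in>vicsek_words n. energy p m (f \<circ> vicsek_psi_word u))"
proof -
  have "energy p (n + m) f = 3 powr ((p - 1) * n) * (3 powr ((p - 1) * m) *
     (\<Sum>u\<in>vicsek_words n. \<Sum>w\<in>vicsek_words m. \<Sum>i\<in>{1..4}. \<bar>incr (f \<circ> vicsek_psi_word u) w i\<bar> powr p))"
    by (simp add: energy_def sum_words_add incr_append powr_add[symmetric] ring_distribs flip: mult.assoc)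
  then show ?thesis by (simp add: energy_def sum_distrib_left)
qed

text \<open>Telescoping over the three thirds of an edge. The middle one is run towards the centre
  of the arm cell, against the outward direction of \<open>incr\<close>, hence the minus
  sign.\<close>

lemma incr_split:
  assumes "i \<in> {1..4}"
  shows "incr f w i = incr f (w @ [5]) i - incr f (w @ [i]) (opp i) + incr f (w @ [i]) i"
proof -
  have "vicsek_psi 5 (vicsek_q i) = vicsek_psi i (vicsek_q (opp i))" "vicsek_psi 5 0 = 0"
    by (simp_all add: vicsek_psi_eq vicsek_q_opp flip: scaleR_minus_left scaleR_add_left)
  then show ?thesis by (simp add: incr_def psi_word_append)
qed

lemma incr_0_powr_le:
  assumes "1 \<le> p" "i \<in> {1..4}"
  shows "\<bar>incr f [] i\<bar> powr p \<le> 3 powr (p - 1) * (\<bar>incr f [5] i\<bar> powr p + \<bar>incr f [i] (opp i)\<bar> powr p + \<bar>incr f [i] i\<bar> powr p)"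
  using incr_split[OF assms(2), of f "[]"] abs_add3_powr_le[OF assms(1), of "incr f [5] i" "- incr f [i] (opp i)" "incr f [i] i"]
  by simp

lemma opp_ne: "i \<in> {1..4} \<Longrightarrow> opp i \<noteq> i"
  by (auto simp: opp_def)

text \<open>Splitting an increment into three costs the factor 3^(p-1), which is exactly the weight
  gained by the next level. Distinct edges use distinct thirds.\<close>

lemma energy_0_le_1:
  assumes "1 \<le> p"
  shows "energy p 0 f \<le> energy p (Suc 0) f"
proof -
  have "energy p 0 f \<le> 3 powr (p - 1) * (\<Sum>i\<in>{1..4}. \<bar>incr f [5] i\<bar> powr p + (\<bar>incr f [i] (opp i)\<bar> powr p + \<bar>incr f [i] i\<bar> powr p))"
    using incr_0_powr_le[OF assms] by (auto simp: energy_def sum_distrib_left add.assoc intro!: sum_mono)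
  also have "\<dots> \<le> 3 powr (p - 1) * (\<Sum>j\<in>{1..5}. \<Sum>i\<in>{1..4}. \<bar>incr f [j] i\<bar> powr p)"
  proof (intro mult_left_mono)
    have "(\<Sum>i\<in>{1..4}. \<bar>incr f [i] (opp i)\<bar> powr p + \<bar>incr f [i] i\<bar> powr p) \<le> (\<Sum>j\<in>{1..4}. \<Sum>i\<in>{1..4}. \<bar>incr f [j] i\<bar> powr p)"
    proof (rule sum_mono)
      fix j assume j: "j \<in> {1..4::nat}"
      have "(\<Sum>i\<in>{opp j, j}. \<bar>incr f [j] i\<bar> powr p) \<le> (\<Sum>i\<in>{1..4}. \<bar>incr f [j] i\<bar> powr p)"
        by (rule sum_mono2) (use j opp_in[OF j] in auto)
      then show "\<bar>incr f [j] (opp j)\<bar> powr p + \<bar>incr f [j] j\<bar> powr p \<le> (\<Sum>i\<in>{1..4}. \<bar>incr f [j] i\<bar> powr p)"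
        using opp_ne[OF j] by simp
    qed
    moreover have "{1..5::nat} = insert 5 {1..4}" by auto
    ultimately show "(\<Sum>i\<in>{1..4}. \<bar>incr f [5] i\<bar> powr p + (\<bar>incr f [i] (opp i)\<bar> powr p + \<bar>incr f [i] i\<bar> powr p)) \<le> (\<Sum>j\<in>{1..5}. \<Sum>i\<in>{1..4}. \<bar>incr f [j] i\<bar> powr p)"
      by (simp add: sum.distrib)
  qed simp
  also have "\<dots> = energy p (Suc 0) f"
    by (simp add: energy_def words_1 sum.reindex inj_on_def)
  finally show ?thesis .
qed

lemma energy_mono_Suc:
  assumes "1 \<le> p"
  shows "energy p m f \<le> energy p (Suc m) f"
proof -
  have "energy p (m + 0) f \<le> energy p (m + Suc 0) f"
    unfolding energy_add using energy_0_le_1[OF assms] by (intro mult_left_mono sum_mono) auto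
  then show ?thesis by simp
qed

lemma energy_mono: "1 \<le> p \<Longrightarrow> m \<le> n \<Longrightarrow> energy p m f \<le> energy p n f"
  using energy_mono_Suc by (rule lift_Suc_mono_le)

lemma incr_powr_le_energy:
  assumes "1 \<le> p" "w \<in> vicsek_words m" "i \<in> {1..4}"
  shows "\<bar>incr f w i\<bar> powr p \<le> energy p m f"
proof -
  have "\<bar>incr f w i\<bar> powr p \<le> (\<Sum>i\<in>{1..4}. \<bar>incr f w i\<bar> powr p)"
    using assms(3) by (intro member_le_sum) auto
  also have "\<dots> \<le> (\<Sum>w\<in>vicsek_words m. \<Sum>i\<in>{1..4}. \<bar>incr f w i\<bar> powr p)"
    using assms(2) by (intro member_le_sum[where f = "\<lambda>w. \<Sum>i\<in>{1..4}. \<bar>incr f w i\<bar> powr p"]) (auto intro: sum_nonneg)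
  also have "\<dots> \<le> energy p m f"
    unfolding energy_def using assms(1)
    by - (rule le_mult_ge_1, auto intro!: sum_nonneg ge_one_powr_ge_zero)
  finally show ?thesis .
qed

section \<open>Oscillation bounds of Morrey type\<close>

lemma powr_le_imp_le_root:
  fixes a b p :: real
  assumes "0 \<le> a" "0 < p" "a powr p \<le> b"
  shows "a \<le> b powr (1 / p)"
proof -
  have "a = (a powr p) powr (1 / p)" using assms by (simp add: powr_powr)
  also have "\<dots> \<le> b powr (1 / p)" using assms by (intro powr_mono2) auto
  finally show ?thesis .
qed

text \<open>Sum of the geometric series of the chaining argument, that is, the solution C of C = C t
  + 2 with t = 3^(-(p-1)/p).\<close>

definition morrey :: "real \<Rightarrow> real" where
  "morrey p = 2 / (1 - 3 powr (- (p - 1) / p))"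

lemma morrey_ratio_less_1: "1 < p \<Longrightarrow> 3 powr (- (p - 1) / p) < (1::real)"
  using powr_less_mono[of "- (p - 1) / p" 0 3] divide_neg_pos[of "- (p - 1)" p] by simp

lemma morrey_ge_2: "1 < p \<Longrightarrow> 2 \<le> morrey p"
  using morrey_ratio_less_1[of p] unfolding morrey_def by (subst le_divide_eq) auto

lemma morrey_fixed: "1 < p \<Longrightarrow> morrey p * 3 powr (- (p - 1) / p) + 2 = morrey p"
proof -
  have "2 / (1 - t) * t + 2 = 2 / (1 - t)" if "t < 1" for t :: real
    using that by (simp add: divide_simps)
  then show "1 < p \<Longrightarrow> ?thesis" using morrey_ratio_less_1 unfolding morrey_def by blast
qed

lemma energy_single_cell:
  assumes "i \<in> {1..5}"
  shows "energy p m (f \<circ> vicsek_psi i) \<le> 3 powr (- (p - 1)) * energy p (Suc m) f"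
proof -
  have "energy p m (f \<circ> vicsek_psi_word [i]) \<le> (\<Sum>u\<in>vicsek_words (Suc 0). energy p m (f \<circ> vicsek_psi_word u))"
    by (rule member_le_sum) (use assms energy_nonneg in \<open>auto simp: words_1\<close>)
  also have "\<dots> = 3 powr (- (p - 1)) * energy p (Suc 0 + m) f"
    unfolding energy_add by (simp flip: mult.assoc powr_add)
  finally show ?thesis by simp
qed

text \<open>From x go to the centre of its cell of level 1, by induction on the rescaled function,
  and from there to 0 along two edges of level 1. Rescaling multiplies the energy by at most
  3^-(p-1), so the induction reproduces the constant by \<open>morrey_fixed\<close>.\<close>

lemma morrey_vertices:
  assumes "1 < p"
  shows "x \<in> vicsek_vertices m \<Longrightarrow> \<bar>f x - f 0\<bar> \<le> morrey p * energy p m f powr (1 / p)"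
proof (induction m arbitrary: x f)
  case 0
  then obtain i where i: "i \<in> {1..5}" "x = vicsek_q i" by auto
  show ?case
  proof (cases "i = 5")
    case True
    then show ?thesis using i morrey_ge_2[OF assms] by simp
  next
    case False
    then have "\<bar>incr f [] i\<bar> powr p \<le> energy p 0 f" using i assms by (intro incr_powr_le_energy) auto
    then have "\<bar>incr f [] i\<bar> \<le> energy p 0 f powr (1 / p)" using assms by (intro powr_le_imp_le_root) auto
    also have "\<dots> \<le> morrey p * energy p 0 f powr (1 / p)"
      using morrey_ge_2[OF assms] by - (rule le_mult_ge_1, auto)
    finally show ?thesis by (simp add: i incr_def)
  qed
next
  case (Suc m)
  then obtain i y where i: "i \<in> {1..5}" "x = vicsek_psi i y" "y \<in> vicsek_vertices m" by auto
  let ?E = "energy p (Suc m) f powr (1 / p)"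
  let ?t = "3 powr (- (p - 1) / p)"
  have "\<bar>f x - f (vicsek_psi i 0)\<bar> \<le> morrey p * energy p m (f \<circ> vicsek_psi i) powr (1 / p)"
    using Suc.IH[OF i(3), of "f \<circ> vicsek_psi i"] i by (simp add: comp_def)
  also have "\<dots> \<le> morrey p * (3 powr (- (p - 1)) * energy p (Suc m) f) powr (1 / p)"
    using energy_single_cell[OF i(1)] morrey_ge_2[OF assms] assms energy_nonneg
    by (intro mult_left_mono powr_mono2) auto
  also have "\<dots> = morrey p * ?t * ?E"
    using energy_nonneg by (simp add: powr_mult powr_powr)
  finally have 1: "\<bar>f x - f (vicsek_psi i 0)\<bar> \<le> morrey p * ?t * ?E" .
  have 2: "\<bar>f (vicsek_psi i 0) - f 0\<bar> \<le> 2 * ?E"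
  proof (cases "i = 5")
    case True
    then show ?thesis by (simp add: vicsek_psi_eq)
  next
    case False
    then have i4: "i \<in> {1..4}" using i by auto
    have b: "\<bar>incr f [j] k\<bar> \<le> ?E" if "j \<in> {1..5}" "k \<in> {1..4}" for j k
    proof -
      have "\<bar>incr f [j] k\<bar> powr p \<le> energy p (Suc 0) f" using that assms by (intro incr_powr_le_energy) (auto simp: words_1)
      also have "\<dots> \<le> energy p (Suc m) f" using assms by (intro energy_mono) auto
      finally show ?thesis using assms by (intro powr_le_imp_le_root) auto
    qed
    have "f (vicsek_psi i 0) - f 0 = incr f [5] i - incr f [i] (opp i)"
      using incr_split[OF i4, of f "[]"] by (simp add: incr_def)
    then show ?thesis using b[of 5 i] b[of i "opp i"] i4 opp_in[OF i4] by force
  qed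
  have "morrey p * ?t + 2 = morrey p" using morrey_fixed[OF assms] .
  then have "morrey p * ?t * ?E + 2 * ?E = morrey p * ?E" by (simp flip: distrib_right)
  then show ?case using 1 2 by linarith
qed

lemma K_closed_le:
  assumes "continuous_on vicsek_set h" "\<And>m x. x \<in> vicsek_vertices m \<Longrightarrow> h x \<le> (a::real)" "x \<in> vicsek_set"
  shows "h x \<le> a"
proof (rule continuous_le_on_closure[of "\<Union>m. vicsek_vertices m" h])
  have "closure (\<Union>m. vicsek_vertices m) \<subseteq> vicsek_set"
    using vertices_subset_skeleton skeleton_subset_K by (intro closure_minimal closed_K) auto
  then show "continuous_on (closure (\<Union>m. vicsek_vertices m)) h" using assms(1) by (rule continuous_on_subset[rotated])
qed (use assms vertices_dense in auto)

lemma morrey_K: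
  assumes "1 < p" "continuous_on vicsek_set f" "\<And>m. energy p m f \<le> E" "x \<in> vicsek_set"
  shows "\<bar>f x - f 0\<bar> powr p \<le> morrey p powr p * E"
proof -
  have E: "0 \<le> E" using energy_nonneg[of p 0 f] assms(3)[of 0] by linarith
  have "\<bar>f x - f 0\<bar> \<le> morrey p * E powr (1 / p)"
  proof (rule K_closed_le[of "\<lambda>x. \<bar>f x - f 0\<bar>"])
    fix m x assume "x \<in> vicsek_vertices m"
    then have "\<bar>f x - f 0\<bar> \<le> morrey p * energy p m f powr (1 / p)" by (rule morrey_vertices[OF assms(1)])
    also have "\<dots> \<le> morrey p * E powr (1 / p)"
      using assms energy_nonneg morrey_ge_2[OF assms(1)] by (intro mult_left_mono powr_mono2) auto
    finally show "\<bar>f x - f 0\<bar> \<le> morrey p * E powr (1 / p)" .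
  qed (use assms in \<open>auto intro!: continuous_intros\<close>)
  then have "\<bar>f x - f 0\<bar> powr p \<le> (morrey p * E powr (1 / p)) powr p"
    using assms by (intro powr_mono2) auto
  also have "\<dots> = morrey p powr p * E"
    using assms E morrey_ge_2[OF assms(1)] by (simp add: powr_mult powr_powr)
  finally show ?thesis .
qed

text \<open>The same chain, where L/3 inside the cell and 2L/3 along the two edges add up to L; so
  the constant is 1.\<close>

lemma morrey_infinity_vertices:
  assumes "\<And>m w i. w \<in> vicsek_words m \<Longrightarrow> i \<in> {1..4} \<Longrightarrow> \<bar>incr f w i\<bar> \<le> L / 3 ^ m"
  shows "x \<in> vicsek_vertices m \<Longrightarrow> \<bar>f x - f 0\<bar> \<le> L"
  using assms
proof (induction m arbitrary: x f L)
  case 0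
  then obtain i where i: "i \<in> {1..5}" "x = vicsek_q i" by auto
  show ?case
  proof (cases "i = 5")
    case True
    then show ?thesis using i 0(2)[of "[]" 0 1] by (simp add: incr_def)
  next
    case False
    then show ?thesis using 0(2)[of "[]" 0 i] i by (simp add: incr_def)
  qed
next
  case (Suc m)
  then obtain i y where i: "i \<in> {1..5}" "x = vicsek_psi i y" "y \<in> vicsek_vertices m" by auto
  have L: "0 \<le> L" using Suc(3)[of "[]" 0 1] by simp
  have "\<bar>(f \<circ> vicsek_psi i) y - (f \<circ> vicsek_psi i) 0\<bar> \<le> L / 3"
  proof (rule Suc.IH[OF i(3)])
    fix k w j assume "w \<in> vicsek_words k" "j \<in> {1..4::nat}"
    then have "\<bar>incr f ([i] @ w) j\<bar> \<le> L / 3 ^ Suc k"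
      using i by (intro Suc.prems) (auto simp: words_Suc)
    then show "\<bar>incr (f \<circ> vicsek_psi i) w j\<bar> \<le> L / 3 / 3 ^ k" unfolding incr_append by simp
  qed
  then have 1: "\<bar>f x - f (vicsek_psi i 0)\<bar> \<le> L / 3" using i by simp
  have 2: "\<bar>f (vicsek_psi i 0) - f 0\<bar> \<le> 2 * L / 3"
  proof (cases "i = 5")
    case True
    then show ?thesis using L by (simp add: vicsek_psi_eq)
  next
    case False
    then have i4: "i \<in> {1..4}" using i by auto
    have "f (vicsek_psi i 0) - f 0 = incr f [5] i - incr f [i] (opp i)"
      using incr_split[OF i4, of f "[]"] by (simp add: incr_def)
    moreover have "\<bar>incr f [5] i\<bar> \<le> L / 3 ^ Suc 0" "\<bar>incr f [i] (opp i)\<bar> \<le> L / 3 ^ Suc 0"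
      by (rule Suc.prems(2); use i4 i opp_in[OF i4] in \<open>auto simp: words_1\<close>)+
    ultimately show ?thesis using abs_triangle_ineq4[of "incr f [5] i" "incr f [i] (opp i)"] by simp
  qed
  show ?case using 1 2 by linarith
qed

lemma morrey_infinity_K:
  assumes "\<And>m w i. w \<in> vicsek_words m \<Longrightarrow> i \<in> {1..4} \<Longrightarrow> \<bar>incr f w i\<bar> \<le> L / 3 ^ m"
    "continuous_on vicsek_set f" "x \<in> vicsek_set"
  shows "\<bar>f x - f 0\<bar> \<le> L"
  by (rule K_closed_le[of "\<lambda>x. \<bar>f x - f 0\<bar>"])
    (use assms morrey_infinity_vertices[OF assms(1)] in \<open>auto intro!: continuous_intros\<close>)

lemma continuous_on_comp_psi_word:
  "continuous_on vicsek_set f \<Longrightarrow> w \<in> vicsek_words n \<Longrightarrow> continuous_on vicsek_set (f \<circ> vicsek_psi_word w)"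
  unfolding comp_def by (rule continuous_on_compose2[of vicsek_set f]) (auto intro: continuous_on_psi_word psi_word_K)

section \<open>The measures\<close>

text \<open>A relatively open set is the union of the countably many members of C that it contains.
  The finite sets are included to make the generator stable under intersection.\<close>

lemma sets_restrict_generated:
  fixes X :: "'a::metric_space set"
  assumes C: "countable C" "\<And>c. c \<in> C \<Longrightarrow> closed c \<and> c \<subseteq> X"
    and fine: "\<And>x e. x \<in> X \<Longrightarrow> 0 < e \<Longrightarrow> \<exists>c\<in>C. x \<in> c \<and> c \<subseteq> ball x e"
  shows "sets (restrict_space borel X) = sigma_sets X (C \<union> {F. finite F \<and> F \<subseteq> X})"
proof
  let ?E = "C \<union> {F. finite F \<and> F \<subseteq> X}"
  have sp: "space (restrict_space borel X) = X" by (simp add: space_restrict_space)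
  have "?E \<subseteq> sets (restrict_space borel X)"
  proof
    fix c assume c: "c \<in> ?E"
    then have "closed c" "c \<subseteq> X" using C by (auto simp: finite_imp_closed)
    then have "c = X \<inter> c" "c \<in> sets borel" by auto
    then show "c \<in> sets (restrict_space borel X)" unfolding sets_restrict_space by blast
  qed
  then show "sigma_sets X ?E \<subseteq> sets (restrict_space borel X)"
    using sets.sigma_sets_subset[of ?E "restrict_space borel X"] sp by simp
  have "X \<inter> B \<in> sigma_sets X ?E" if "B \<in> sigma_sets UNIV {S. open S}" for B
    using that
  proof induction
    case (Basic U)
    then have U: "open U" by simp
    let ?D = "{c \<in> C. c \<subseteq> U}"
    have "X \<inter> U = \<Union>?D"
    proof (intro equalityI subsetI)
      fix x assume x: "x \<in> X \<inter> U"
      then obtain e where "0 < e" "ball x e \<subseteq> U" using U by (auto simp: open_contains_ball)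
      then show "x \<in> \<Union>?D" using fine[of x e] x by blast
    qed (use C in blast)
    moreover have "\<Union>?D \<in> sigma_sets X ?E"
      by (rule sigma_sets_UNION) (use C in \<open>auto intro: countable_subset[OF _ C(1)]\<close>)
    ultimately show ?case by simp
  next
    case Empty
    then show ?case by (simp add: sigma_sets.Empty)
  next
    case (Compl a)
    have "X \<inter> (UNIV - a) = X - X \<inter> a" by blast
    then show ?case using Compl by (simp add: sigma_sets.Compl)
  next
    case (Union a)
    have eq: "X \<inter> (\<Union>i. a i) = (\<Union>i. X \<inter> a i)" by blast
    show ?case unfolding eq by (rule sigma_sets.Union) (rule Union)
  qed
  then show "sets (restrict_space borel X) \<subseteq> sigma_sets X ?E"
    by (auto simp: sets_restrict_space borel_def sets_measure_of)
qed

text \<open>Intersections of members of C are again in C or finite, and points are null, so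
  agreement on C extends to a generator stable under intersection. Used for the uniqueness of mu, of
  nu and of the gradient.\<close>

lemma measure_eq_on_cells:
  fixes M N :: "'a::metric_space measure"
  assumes sets: "sets M = sets (restrict_space borel X)" "sets N = sets (restrict_space borel X)"
    and C: "countable C" "\<And>c. c \<in> C \<Longrightarrow> closed c \<and> c \<subseteq> X"
    and fine: "\<And>x e. x \<in> X \<Longrightarrow> 0 < e \<Longrightarrow> \<exists>c\<in>C. x \<in> c \<and> c \<subseteq> ball x e"
    and inter: "\<And>c d. c \<in> C \<Longrightarrow> d \<in> C \<Longrightarrow> c \<inter> d \<in> C \<or> finite (c \<inter> d)"
    and eq: "\<And>c. c \<in> C \<Longrightarrow> emeasure M c = emeasure N c" "\<And>c. c \<in> C \<Longrightarrow> emeasure M c \<noteq> \<infinity>"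
    and null: "\<And>x. x \<in> X \<Longrightarrow> emeasure M {x} = 0" "\<And>x. x \<in> X \<Longrightarrow> emeasure N {x} = 0"
  shows "M = N"
proof -
  let ?E = "C \<union> {F. finite F \<and> F \<subseteq> X}"
  let ?A = "from_nat_into (insert {} C)"
  have rng: "range ?A = insert {} C" using C(1) by (intro range_from_nat_into) auto
  have gen: "sets (restrict_space borel X) = sigma_sets X ?E"
    by (rule sets_restrict_generated[OF C fine])
  have sing: "{x} \<in> sets M" "{x} \<in> sets N" if "x \<in> X" for x
    unfolding sets gen using that by (auto intro!: sigma_sets.Basic)
  show ?thesis
  proof (rule measure_eqI_generator_eq[of ?E X M N ?A])
    show "Int_stable ?E"
      unfolding Int_stable_def using inter C(2) by (auto intro: finite_Int)
    show "?E \<subseteq> Pow X" using C(2) by blast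
    show "sets M = sigma_sets X ?E" "sets N = sigma_sets X ?E" using sets gen by simp_all
    show "emeasure M Y = emeasure N Y" if "Y \<in> ?E" for Y
    proof (cases "Y \<in> C")
      case False
      then have "finite Y" "Y \<subseteq> X" using that by auto
      then have "emeasure M Y = 0" "emeasure N Y = 0"
        using sing null by (subst emeasure_eq_sum_singleton; force)+
      then show ?thesis by simp
    qed (rule eq(1))
    show "range ?A \<subseteq> ?E" unfolding rng by auto
    show "(\<Union>i. ?A i) = X"
    proof -
      have "(\<Union>i. ?A i) = \<Union>(insert {} C)" using rng by metis
      also have "\<dots> = X" using C(2) fine[of _ 1] by fastforce
      finally show ?thesis .
    qed
    show "emeasure M (?A i) \<noteq> \<infinity>" for i
    proof -
      have "?A i \<in> insert {} C" using rng by blast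
      then show ?thesis using eq(2) by auto
    qed
  qed
qed

lemma ennreal_le_all_powers_imp_0:
  assumes "\<And>n. n \<ge> m \<Longrightarrow> (x::ennreal) \<le> ennreal (c * r ^ n)" "0 \<le> c" "0 \<le> r" "r < 1"
  shows "x = 0"
proof -
  have "(\<lambda>n. c * r ^ n) \<longlonglongrightarrow> c * 0"
    using assms by (intro tendsto_intros LIMSEQ_realpow_zero) auto
  then have "(\<lambda>n. ennreal (c * r ^ n)) \<longlonglongrightarrow> ennreal (c * 0)"
    by (rule tendsto_ennrealI)
  then have "x \<le> ennreal (c * 0)"
    by (rule LIMSEQ_le_const) (use assms(1) in blast)
  then show ?thesis by simp
qed

subsection \<open>The self-similar measure\<close>

definition cells :: "(real \<times> real) set set" where
  "cells = (\<Union>n. cell ` vicsek_words n)"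

lemma cells_props:
  shows "countable cells" "\<And>c. c \<in> cells \<Longrightarrow> closed c \<and> c \<subseteq> vicsek_set"
    "\<And>x e. x \<in> vicsek_set \<Longrightarrow> 0 < e \<Longrightarrow> \<exists>c\<in>cells. x \<in> c \<and> c \<subseteq> ball x e"
    "\<And>c d. c \<in> cells \<Longrightarrow> d \<in> cells \<Longrightarrow> c \<inter> d \<in> cells \<or> finite (c \<inter> d)"
proof -
  show "countable cells" unfolding cells_def by (intro countable_UN) (auto intro: countable_finite)
  show "closed c \<and> c \<subseteq> vicsek_set" if "c \<in> cells" for c
    using that compact_imp_closed[OF compact_cell] cell_subset_K unfolding cells_def by blast
  show "\<exists>c\<in>cells. x \<in> c \<and> c \<subseteq> ball x e" if x: "x \<in> vicsek_set" and e: "0 < e" for x e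
  proof -
    obtain n where n: "2 / 3 ^ n < e" using power3_eventually_small[OF e] by blast
    obtain w y where w: "w \<in> vicsek_words n" "y \<in> vicsek_set" "x = vicsek_psi_word w y"
      using x by (rule K_cellE)
    then have xw: "x \<in> cell w" by (simp add: cell_def)
    have "y \<in> ball x e" if "y \<in> cell w" for y
      using dist_cell[OF xw that] n w by (simp add: length_words)
    then show ?thesis using xw w unfolding cells_def by blast
  qed
  have *: "cell w \<inter> cell w' \<in> cells \<or> finite (cell w \<inter> cell w')"
    if w: "w \<in> vicsek_words n" "w' \<in> vicsek_words (n + k)" for w w' n k
  proof (cases "take n w' = w")
    case True
    then have "cell w' \<subseteq> cell w"
      using cell_append_subset[OF words_drop[OF w(2)], of w] by (metis append_take_drop_id)
    then have "cell w \<inter> cell w' = cell w'" by blast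
    then show ?thesis using w unfolding cells_def by auto
  next
    case False
    have "cell w' \<subseteq> cell (take n w')"
      using cell_append_subset[OF words_drop[OF w(2)], of "take n w'"] by simp
    then have "cell w \<inter> cell w' \<subseteq> cell w \<inter> cell (take n w')" by blast
    then show ?thesis
      using cell_Int_finite[OF w(1) words_take[OF w(2)]] False finite_subset by metis
  qed
  show "c \<inter> d \<in> cells \<or> finite (c \<inter> d)" if cd: "c \<in> cells" "d \<in> cells" for c d
  proof -
    obtain n w m w' where w: "w \<in> vicsek_words n" "c = cell w" "w' \<in> vicsek_words m" "d = cell w'"
      using cd unfolding cells_def by blast
    show ?thesis
    proof (cases "n \<le> m")
      case True
      then show ?thesis using *[of w n w' "m - n"] w by simp
    next
      case False
      then show ?thesis using *[of w' m w "n - m"] w by (simp add: Int_commute)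
    qed
  qed
qed

definition is_mu :: "(real \<times> real) measure \<Rightarrow> bool" where
  "is_mu M \<longleftrightarrow> space M = vicsek_set \<and> sets M = sets (restrict_space borel vicsek_set) \<and>
     emeasure M vicsek_set = 1 \<and>
     (\<forall>n. \<forall>w\<in>vicsek_words n. emeasure M (vicsek_psi_word w ` vicsek_set) = ennreal ((1 / 5) ^ n))"

lemma is_mu_cell: "is_mu M \<Longrightarrow> w \<in> vicsek_words n \<Longrightarrow> emeasure M (cell w) = ennreal ((1 / 5) ^ n)"
  unfolding is_mu_def cell_def by blast

lemma closed_in_mu:
  assumes "is_mu M" "closed A" "A \<subseteq> vicsek_set"
  shows "A \<in> sets M"
proof -
  have "A = vicsek_set \<inter> A" "A \<in> sets borel" using assms by auto
  then show ?thesis using assms(1) unfolding is_mu_def sets_restrict_space by blast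
qed

lemma is_mu_singleton:
  assumes M: "is_mu M" and x: "x \<in> vicsek_set"
  shows "emeasure M {x} = 0"
proof (rule ennreal_le_all_powers_imp_0[of 0 _ 1 "1/5"])
  fix n
  obtain w y where w: "w \<in> vicsek_words n" "y \<in> vicsek_set" "x = vicsek_psi_word w y"
    using x by (rule K_cellE)
  then have "emeasure M {x} \<le> emeasure M (cell w)"
    using closed_in_mu[OF M compact_imp_closed[OF compact_cell] cell_subset_K[OF w(1)]]
    by (intro emeasure_mono) (auto simp: cell_def)
  then show "emeasure M {x} \<le> ennreal (1 * (1/5) ^ n)" using is_mu_cell[OF M w(1)] by simp
qed auto

lemma is_mu_unique:
  assumes "is_mu M" "is_mu N"
  shows "M = N"
proof (rule measure_eq_on_cells[OF _ _ cells_props(1,2,3,4)])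
  show "sets M = sets (restrict_space borel vicsek_set)" "sets N = sets (restrict_space borel vicsek_set)"
    using assms by (simp_all add: is_mu_def)
  show "emeasure M c = emeasure N c" "emeasure M c \<noteq> \<infinity>" if "c \<in> cells" for c
    using that is_mu_cell assms unfolding cells_def by auto
qed (use is_mu_singleton assms in auto)

lemma finite_cells_near:
  assumes "z \<in> vicsek_set"
  shows "card {v \<in> vicsek_words m. z \<in> cell v} \<le> 9"
proof (cases "{v \<in> vicsek_words m. z \<in> cell v} = {}")
  case True
  then show ?thesis by (simp only: card.empty)
next
  case False
  then obtain v where v: "v \<in> vicsek_words m" "z \<in> cell v" by blast
  have "near v v'" if v': "v' \<in> vicsek_words m" "z \<in> cell v'" for v'
  proof -
    obtain a b where ab: "z = vicsek_psi_word v a" "z = vicsek_psi_word v' b" "a \<in> vicsek_set" "b \<in> vicsek_set"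
      using v(2) v'(2) unfolding cell_def by blast
    then have "a \<in> square" "b \<in> square" using K_subset_square by blast+
    then show ?thesis using dist_imp_near[OF v(1) v'(1), of a b] ab by simp
  qed
  then have "card {v \<in> vicsek_words m. z \<in> cell v} \<le> card {v' \<in> vicsek_words m. near v v'}"
    by (intro card_mono) auto
  then show ?thesis using card_near_le[OF v(1)] by simp
qed

section \<open>The self-similar measure as the law of a uniformly random address\<close>

definition coin :: "nat measure" where
  "coin = uniform_count_measure {1..5}"

text \<open>Centres of the nested cells along an address; by \<open>coding_Suc\<close> they are
  partial sums, so measurability of the limit is visible.\<close>

definition coding :: "(nat \<Rightarrow> nat) \<Rightarrow> nat \<Rightarrow> real \<times> real" where
  "coding \<omega> n = vicsek_psi_word (map \<omega> [0..<n]) 0"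

lemma space_coin: "space coin = {1..5}" and sets_coin: "sets coin = Pow {1..5}"
  by (simp_all add: coin_def space_uniform_count_measure sets_uniform_count_measure)

lemma coding_Suc: "coding \<omega> (Suc n) = coding \<omega> n + (1 / 3 ^ n) *\<^sub>R (2/3) *\<^sub>R vicsek_q (\<omega> n)"
proof -
  have "coding \<omega> (Suc n) = vicsek_psi_word (map \<omega> [0..<n]) (vicsek_psi (\<omega> n) 0)"
    by (simp add: coding_def psi_word_append)
  also have "\<dots> = coding \<omega> n + (1 / 3 ^ n) *\<^sub>R vicsek_psi (\<omega> n) 0"
    by (subst psi_word_eq) (simp add: coding_def)
  finally show ?thesis by (simp add: vicsek_psi_eq)
qed

lemma coding_words: "(\<And>i. \<omega> i \<in> {1..5}) \<Longrightarrow> map \<omega> [0..<n] \<in> vicsek_words n"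
  by (auto simp: vicsek_words_def)

lemma coding_in_cell:
  assumes "\<And>i. \<omega> i \<in> {1..5}"
  shows "coding \<omega> (n + k) \<in> cell (map \<omega> [0..<n])"
proof -
  have "map \<omega> [0..<n + k] = map \<omega> [0..<n] @ map (\<lambda>i. \<omega> (n + i)) [0..<k]"
    by (induction k) auto
  moreover have "map (\<lambda>i. \<omega> (n + i)) [0..<k] \<in> vicsek_words k" using assms by (intro coding_words) auto
  ultimately show ?thesis
    using psi_word_K[OF _ zero_in_K] by (simp add: coding_def cell_def psi_word_append)
qed

lemma coding_convergent:
  assumes "\<And>i. \<omega> i \<in> {1..5}"
  shows "convergent (coding \<omega>)"
proof (rule Cauchy_convergent, rule metric_CauchyI)
  fix e :: real assume "0 < e"
  then obtain n where n: "2 / 3 ^ n < e" using power3_eventually_small by blast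
  have "dist (coding \<omega> i) (coding \<omega> j) < e" if "n \<le> i" "n \<le> j" for i j
    using dist_cell[OF coding_in_cell[of \<omega> n "i - n", OF assms] coding_in_cell[of \<omega> n "j - n", OF assms]] that n by simp
  then show "\<exists>M. \<forall>m\<ge>M. \<forall>n\<ge>M. dist (coding \<omega> m) (coding \<omega> n) < e" by blast
qed

definition address :: "(nat \<Rightarrow> nat) \<Rightarrow> real \<times> real" where
  "address \<omega> = lim (coding \<omega>)"

lemma address_in_cell:
  assumes "\<And>i. \<omega> i \<in> {1..5}"
  shows "address \<omega> \<in> cell (map \<omega> [0..<n])"
proof -
  have "convergent (coding \<omega>)" by (rule coding_convergent) (rule assms)
  then have "coding \<omega> \<longlonglongrightarrow> address \<omega>" by (simp add: convergent_LIMSEQ_iff address_def)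
  then have l: "(\<lambda>k. coding \<omega> (k + n)) \<longlonglongrightarrow> address \<omega>" by (rule LIMSEQ_ignore_initial_segment)
  have c: "coding \<omega> (k + n) \<in> cell (map \<omega> [0..<n])" for k
    using coding_in_cell[of \<omega> n k, OF assms] by (simp only: add.commute)
  show ?thesis
    using closed_sequentially[OF compact_imp_closed[OF compact_cell] _ l] c by blast
qed

lemma address_measurable: "address \<in> borel_measurable (PiM UNIV (\<lambda>_. coin))"
proof -
  have "(\<lambda>\<omega>. coding \<omega> n) \<in> borel_measurable (PiM UNIV (\<lambda>_. coin))" for n
  proof (induction n)
    case (Suc n)
    have "vicsek_q \<in> measurable coin borel" by (rule measurableI) (auto simp: sets_coin space_coin)
    then have "(\<lambda>\<omega>. vicsek_q (\<omega> n)) \<in> borel_measurable (PiM UNIV (\<lambda>_. coin))"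
      using measurable_compose[OF measurable_component_singleton[of n UNIV "\<lambda>_. coin"]] by simp
    then show ?case unfolding coding_Suc using Suc by measurable
  qed (simp add: coding_def)
  then show ?thesis unfolding address_def[abs_def] by (intro borel_measurable_lim_metric)
qed

lemma emeasure_coin: "j \<in> {1..5} \<Longrightarrow> emeasure coin {j} = ennreal (1/5)"
  unfolding coin_def by (subst emeasure_uniform_count_measure) (simp_all del: atLeastAtMost_iff)

lemma prob_space_coin: "prob_space coin"
  unfolding coin_def by (rule prob_space_uniform_count_measure) auto

text \<open>The addresses landing in the cell of w are the cylinder of w, of probability 5^-n, up to
  addresses of the finitely many points shared with other cells of that level, which form a null
  set.\<close>

lemma ex_is_mu: "\<exists>M. is_mu M"
proof -
  interpret product_prob_space "\<lambda>_::nat. coin" UNIV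
    by (rule product_prob_spaceI) (rule prob_space_coin)
  let ?P = "PiM (UNIV::nat set) (\<lambda>_. coin)"
  let ?\<pi> = address
  have val: "\<omega> i \<in> {1..5}" if "\<omega> \<in> space ?P" for \<omega> i
    using that by (auto simp: space_PiM space_coin PiE_def Pi_def simp del: atLeastAtMost_iff)
  note pim = address_measurable
  have piK: "?\<pi> \<omega> \<in> vicsek_set" if "\<omega> \<in> space ?P" for \<omega>
    using address_in_cell[of \<omega> 0] val[OF that] by simp
  have pimK: "?\<pi> \<in> measurable ?P (restrict_space borel vicsek_set)"
    using piK pim by (intro measurable_restrict_space2) auto
  define cyl where "cyl w = {\<omega> \<in> space ?P. \<forall>i\<in>{..<length w}. \<omega> i \<in> {w ! i}}" for w :: "nat list"
  have cyl: "cyl w \<in> sets ?P \<and> emeasure ?P (cyl w) = ennreal ((1/5) ^ n)" if w: "w \<in> vicsek_words n" for w n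
  proof
    have wi: "w ! i \<in> {1..5}" if "i < length w" for i using w that by (force simp: vicsek_words_def)
    have "emeasure ?P (cyl w) = (\<Prod>i\<in>{..<length w}. emeasure coin {w ! i})"
      unfolding cyl_def using wi by (intro emeasure_PiM_Collect) (auto simp: sets_coin)
    also have "\<dots> = (\<Prod>i\<in>{..<length w}. ennreal (1/5))"
      by (intro prod.cong refl emeasure_coin wi) simp
    finally show "emeasure ?P (cyl w) = ennreal ((1/5) ^ n)" using w by (simp add: length_words ennreal_power)
    show "cyl w \<in> sets ?P" unfolding cyl_def
    proof (intro sets.sets_Collect_finite_All)
      show "{x \<in> space ?P. x i \<in> {w ! i}} \<in> sets ?P" if "i \<in> {..<length w}" for i
      proof -
        have "(\<lambda>x. x i) -` {w ! i} \<inter> space ?P \<in> sets ?P"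
          by (rule measurable_sets[of _ _ coin]) (use wi that in \<open>auto simp: sets_coin intro!: measurable_component_singleton\<close>)
        moreover have "{x \<in> space ?P. x i \<in> {w ! i}} = (\<lambda>x. x i) -` {w ! i} \<inter> space ?P" by auto
        ultimately show ?thesis by simp
      qed
    qed simp
  qed
  have cyl_eq: "\<omega> \<in> cyl (map \<omega> [0..<n])" if "\<omega> \<in> space ?P" for \<omega> n
    using that by (simp add: cyl_def)
  have preK: "?\<pi> -` A \<inter> space ?P \<in> sets ?P" if "closed A" for A
    using measurable_sets[OF pim, of A] that by simp
  \<comment> \<open>A point lies in at most nine cells of level m, so its addresses are covered by
    nine cylinders of probability 5^-m, for every m.\<close>
  have point: "emeasure ?P (?\<pi> -` {z} \<inter> space ?P) = 0" if z: "z \<in> vicsek_set" for z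
  proof (rule ennreal_le_all_powers_imp_0[of 0 _ 9 "1/5"])
    fix m
    let ?W = "{v \<in> vicsek_words m. z \<in> cell v}"
    have "?\<pi> -` {z} \<inter> space ?P \<subseteq> (\<Union>v\<in>?W. cyl v)"
    proof
      fix \<omega> assume "\<omega> \<in> ?\<pi> -` {z} \<inter> space ?P"
      then have "\<omega> \<in> space ?P" "?\<pi> \<omega> = z" by auto
      then show "\<omega> \<in> (\<Union>v\<in>?W. cyl v)"
        using address_in_cell[of \<omega> m] val coding_words[of \<omega> m] cyl_eq[of \<omega> m] by blast
    qed
    then have "emeasure ?P (?\<pi> -` {z} \<inter> space ?P) \<le> emeasure ?P (\<Union>v\<in>?W. cyl v)"
      using cyl by (intro emeasure_mono) (auto intro!: sets.finite_UN)
    also have "\<dots> \<le> (\<Sum>v\<in>?W. emeasure ?P (cyl v))"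
      using cyl by (intro emeasure_subadditive_finite) auto
    also have "\<dots> = (\<Sum>v\<in>?W. ennreal ((1/5) ^ m))" using cyl by (intro sum.cong) auto
    also have "\<dots> = ennreal (card ?W * (1/5) ^ m)"
      by (simp add: ennreal_mult ennreal_of_nat_eq_real_of_nat)
    also have "\<dots> \<le> ennreal (9 * (1/5) ^ m)"
      using finite_cells_near[OF z, of m] by (intro ennreal_leI mult_right_mono) auto
    finally show "emeasure ?P (?\<pi> -` {z} \<inter> space ?P) \<le> ennreal (9 * (1/5) ^ m)" .
  qed auto
  define M where "M = distr ?P (restrict_space borel vicsek_set) ?\<pi>"
  have clM: "A \<in> sets (restrict_space borel vicsek_set)" if "closed A" "A \<subseteq> vicsek_set" for A
  proof -
    have "A = vicsek_set \<inter> A" "A \<in> sets borel" using that by auto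
    then show ?thesis unfolding sets_restrict_space by blast
  qed
  have Mcell: "emeasure M (cell w) = ennreal ((1/5) ^ n)" if w: "w \<in> vicsek_words n" for w n
  proof -
    let ?A = "?\<pi> -` cell w \<inter> space ?P"
    have eq: "emeasure M (cell w) = emeasure ?P ?A"
      unfolding M_def using pimK clM[OF compact_imp_closed[OF compact_cell] cell_subset_K[OF w]]
      by (rule emeasure_distr)
    define F where "F = (\<Union>w'\<in>vicsek_words n - {w}. cell w \<inter> cell w')"
    have F: "finite F" "F \<subseteq> vicsek_set"
    proof -
      show "finite F" unfolding F_def using cell_Int_finite[OF w]
        by (intro finite_UN_I finite_Diff finite_words) (metis DiffE insertCI)
      show "F \<subseteq> vicsek_set" unfolding F_def using cell_subset_K[OF w] by blast
    qed
    \<comment> \<open>\<open>Z\<close> collects the addresses of the overlap points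
      \<open>F\<close>; an address that leads into the cell without starting with w must belong to
      it.\<close>
    define Z where "Z = (\<Union>z\<in>F. ?\<pi> -` {z} \<inter> space ?P)"
    have A1: "cyl w \<subseteq> ?A"
    proof
      fix \<omega> assume a: "\<omega> \<in> cyl w"
      then have "\<omega> \<in> space ?P" by (simp add: cyl_def)
      moreover have "map \<omega> [0..<n] = w"
        using a w by (auto simp: cyl_def length_words intro!: nth_equalityI)
      ultimately show "\<omega> \<in> ?A" using address_in_cell[of \<omega> n] val by auto
    qed
    have A2: "?A \<subseteq> cyl w \<union> Z"
    proof
      fix \<omega> assume a: "\<omega> \<in> ?A"
      show "\<omega> \<in> cyl w \<union> Z"
      proof (cases "map \<omega> [0..<n] = w")
        case True
        then show ?thesis using cyl_eq[of \<omega> n] a by auto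
      next
        case False
        then have "?\<pi> \<omega> \<in> F"
          using address_in_cell[of \<omega> n] val[of \<omega>] coding_words[of \<omega> n] a unfolding F_def by blast
        then show ?thesis using a unfolding Z_def by blast
      qed
    qed
    have sF: "?\<pi> -` {z} \<inter> space ?P \<in> sets ?P" for z by (rule preK) simp
    have "emeasure ?P Z \<le> (\<Sum>z\<in>F. emeasure ?P (?\<pi> -` {z} \<inter> space ?P))"
      unfolding Z_def using F sF by (intro emeasure_subadditive_finite) auto
    also have "\<dots> = 0" using point F by (intro sum.neutral) blast
    finally have nullF: "emeasure ?P Z = 0" by simp
    have sFU: "Z \<in> sets ?P" unfolding Z_def using F sF by (intro sets.finite_UN) auto
    have "emeasure ?P ?A \<le> emeasure ?P (cyl w \<union> Z)"
      using A2 cyl[OF w] sFU by (intro emeasure_mono) auto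
    also have "\<dots> \<le> emeasure ?P (cyl w) + emeasure ?P Z"
      using cyl[OF w] sFU by (intro emeasure_subadditive) auto
    finally have "emeasure ?P ?A \<le> ennreal ((1/5) ^ n)" using nullF cyl[OF w] by simp
    moreover have "emeasure ?P (cyl w) \<le> emeasure ?P ?A"
      using A1 preK[OF compact_imp_closed[OF compact_cell]] by (intro emeasure_mono)
    ultimately show ?thesis using cyl[OF w] eq by simp
  qed
  have "is_mu M"
    unfolding is_mu_def
  proof (intro conjI allI ballI)
    show "space M = vicsek_set" by (simp add: M_def space_restrict_space)
    show "sets M = sets (restrict_space borel vicsek_set)" by (simp add: M_def)
    show "emeasure M vicsek_set = 1" using Mcell[of "[]" 0] by simp
    show "emeasure M (vicsek_psi_word w ` vicsek_set) = ennreal ((1 / 5) ^ n)" if "w \<in> vicsek_words n" for n w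
      using Mcell[OF that] by (simp add: cell_def)
  qed
  then show ?thesis by blast
qed

lemma is_mu_vicsek_mu: "is_mu vicsek_mu"
proof -
  obtain M where M: "is_mu M" using ex_is_mu by blast
  have "vicsek_mu = (THE M. is_mu M)" by (simp add: vicsek_mu_def is_mu_def)
  also have "\<dots> = M" using M is_mu_unique by blast
  finally show ?thesis using M by simp
qed

lemma space_mu: "space vicsek_mu = vicsek_set"
  and sets_mu: "sets vicsek_mu = sets (restrict_space borel vicsek_set)"
  and emeasure_mu_K: "emeasure vicsek_mu vicsek_set = 1"
  using is_mu_vicsek_mu by (auto simp: is_mu_def)

lemmas emeasure_cell = is_mu_cell[OF is_mu_vicsek_mu]
lemmas closed_sets_mu = closed_in_mu[OF is_mu_vicsek_mu]
lemmas emeasure_mu_singleton = is_mu_singleton[OF is_mu_vicsek_mu]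

lemma prob_space_mu: "prob_space vicsek_mu"
  by (rule prob_spaceI) (simp add: space_mu emeasure_mu_K)

lemma cell_sets: "w \<in> vicsek_words n \<Longrightarrow> cell w \<in> sets vicsek_mu"
  using closed_sets_mu compact_imp_closed[OF compact_cell] cell_subset_K by blast

lemma emeasure_mu_finite: "finite F \<Longrightarrow> F \<subseteq> vicsek_set \<Longrightarrow> emeasure vicsek_mu F = 0"
  using emeasure_mu_singleton closed_sets_mu[of "{_}"] by (subst emeasure_eq_sum_singleton) force+

lemma continuous_measurable_mu: "continuous_on vicsek_set f \<Longrightarrow> f \<in> borel_measurable vicsek_mu"
  using borel_measurable_continuous_on_restrict[of vicsek_set f] measurable_cong_sets[OF sets_mu refl] by blast

subsection \<open>The length measure\<close>

definition skeleton_edges :: "(real \<times> real) set set" where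
  "skeleton_edges = {edge w i | n w i. w \<in> vicsek_words n \<and> i \<in> {1..4}}"

text \<open>Lets edges of different levels be compared at a common level.\<close>

lemma edge_refine:
  assumes w: "w \<in> vicsek_words n" and i: "i \<in> {1..4}"
  shows "\<exists>J \<subseteq> vicsek_words (n + k) \<times> {1..4}. edge w i = (\<Union>(v, j)\<in>J. edge v j)"
proof (induction k)
  case 0
  show ?case using w i by (intro exI[of _ "{(w, i)}"]) auto
next
  case (Suc k)
  then obtain J where J: "J \<subseteq> vicsek_words (n + k) \<times> {1..4}" "edge w i = (\<Union>(v, j)\<in>J. edge v j)" by blast
  let ?c = "\<lambda>(v, j). {(v @ [5], j), (v @ [j], opp j), (v @ [j], j)}"
  have "(\<Union>p\<in>J. ?c p) \<subseteq> vicsek_words (n + Suc k) \<times> {1..4}"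
  proof (rule UN_least)
    fix p assume "p \<in> J"
    then obtain v j where p: "p = (v, j)" "v \<in> vicsek_words (n + k)" "j \<in> {1..4}" using J by blast
    then show "?c p \<subseteq> vicsek_words (n + Suc k) \<times> {1..4}"
      using words_snoc[of v "n + k" 5] words_snoc[of v "n + k" j] opp_in[of j] by auto
  qed
  moreover have "edge w i = (\<Union>(v, j)\<in>(\<Union>p\<in>J. ?c p). edge v j)"
  proof -
    have "edge v j = (\<Union>(v, j)\<in>?c (v, j). edge v j)" if "(v, j) \<in> J" for v j
    proof -
      have "j \<in> {1..4}" using that J by blast
      from edge_split[OF this, of v] show ?thesis by (simp add: Un_assoc)
    qed
    then have "(\<Union>(v, j)\<in>J. edge v j) = (\<Union>p\<in>J. \<Union>(v, j)\<in>?c p. edge v j)"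
      by (intro SUP_cong refl) (auto simp del: Un_iff UN_iff)
    then show ?thesis unfolding J(2) UN_UN_flatten .
  qed
  ultimately show ?case by blast
qed

lemma edge_subset_cell: "w \<in> vicsek_words n \<Longrightarrow> i \<in> {1..4} \<Longrightarrow> edge w i \<subseteq> cell w"
proof -
  assume "i \<in> {1..4}"
  then have "closed_segment 0 (vicsek_q i) \<subseteq> vicsek_cable 0" by auto
  then have "closed_segment 0 (vicsek_q i) \<subseteq> vicsek_set"
    using skeleton_subset_K unfolding vicsek_skeleton_def by blast
  then show ?thesis unfolding edge_image cell_def by blast
qed

lemma closed_edge: "closed (edge w i)"
  by (simp add: edge_def)

lemma skeleton_in_edges:
  assumes "x \<in> vicsek_skeleton"
  shows "\<exists>m. \<forall>n\<ge>m. \<exists>w\<in>vicsek_words n. \<exists>i\<in>{1..4}. x \<in> edge w i"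
proof -
  obtain m where m: "x \<in> vicsek_cable m" using assms by (auto simp: vicsek_skeleton_def)
  have "\<exists>w\<in>vicsek_words n. \<exists>i\<in>{1..4}. x \<in> edge w i" if "m \<le> n" for n
    using m cable_mono[OF that] unfolding cable_eq by blast
  then show ?thesis by blast
qed

lemma skeleton_edges_props:
  shows "countable skeleton_edges" "\<And>c. c \<in> skeleton_edges \<Longrightarrow> closed c \<and> c \<subseteq> vicsek_skeleton"
    "\<And>x e. x \<in> vicsek_skeleton \<Longrightarrow> 0 < e \<Longrightarrow> \<exists>c\<in>skeleton_edges. x \<in> c \<and> c \<subseteq> ball x e"
    "\<And>c d. c \<in> skeleton_edges \<Longrightarrow> d \<in> skeleton_edges \<Longrightarrow> c \<inter> d \<in> skeleton_edges \<or> finite (c \<inter> d)"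
proof -
  have "skeleton_edges \<subseteq> (\<Union>n. case_prod edge ` (vicsek_words n \<times> {1..4}))"
    unfolding skeleton_edges_def by fastforce
  moreover have "countable (\<Union>n. case_prod edge ` (vicsek_words n \<times> {1..4}))"
    by (rule countable_UN, simp, rule countable_finite, simp)
  ultimately show "countable skeleton_edges" by (rule countable_subset)
  show "closed c \<and> c \<subseteq> vicsek_skeleton" if "c \<in> skeleton_edges" for c
    using that closed_edge edge_subset_skeleton unfolding skeleton_edges_def by blast
  show "\<exists>c\<in>skeleton_edges. x \<in> c \<and> c \<subseteq> ball x e" if x: "x \<in> vicsek_skeleton" and e: "0 < e" for x e
  proof -
    obtain k where k: "2 / 3 ^ k < e" using power3_eventually_small[OF e] by blast
    obtain m where m: "\<forall>n\<ge>m. \<exists>w\<in>vicsek_words n. \<exists>i\<in>{1..4}. x \<in> edge w i" using skeleton_in_edges[OF x] by blast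
    define n where "n = max m k"
    have "m \<le> n" by (simp add: n_def)
    then obtain w i where w: "w \<in> vicsek_words n" "i \<in> {1..4}" "x \<in> edge w i" using m by blast
    have "(2::real) / 3 ^ n \<le> 2 / 3 ^ k" by (intro divide_left_mono power_increasing) (auto simp: n_def)
    then have n: "2 / 3 ^ n < e" using k by linarith
    have "edge w i \<subseteq> ball x e"
    proof
      fix y assume "y \<in> edge w i"
      then have "dist x y \<le> 2 / 3 ^ length w"
        using edge_subset_cell[OF w(1,2)] w(3) by (intro dist_cell) blast+
      then have "dist x y \<le> 2 / 3 ^ n" using length_words[OF w(1)] by simp
      then show "y \<in> ball x e" using n by simp
    qed
    then show ?thesis using w unfolding skeleton_edges_def by blast
  qed
  \<comment> \<open>The coarser edge is refined to the level of the finer one, which either is one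
    of the pieces or meets each piece in at most one point.\<close>
  have *: "edge w i \<inter> edge v j \<in> skeleton_edges \<or> finite (edge w i \<inter> edge v j)"
    if w: "w \<in> vicsek_words n" "v \<in> vicsek_words (n + k)" "i \<in> {1..4}" "j \<in> {1..4}" for w v n k i j
  proof -
    obtain J where J: "J \<subseteq> vicsek_words (n + k) \<times> {1..4}" "edge w i = (\<Union>(v, j)\<in>J. edge v j)"
      using edge_refine[OF w(1,3)] by blast
    show ?thesis
    proof (cases "(v, j) \<in> J")
      case True
      then have "edge w i \<inter> edge v j = edge v j" using J by blast
      then show ?thesis using w unfolding skeleton_edges_def by auto
    next
      case False
      have "finite J" using J(1) by (rule finite_subset) simp
      moreover have "finite (edge v' j' \<inter> edge v j)" if vj: "(v', j') \<in> J" for v' j'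
      proof -
        have "v' \<in> vicsek_words (n + k)" "j' \<in> {1..4}" "(v', j') \<noteq> (v, j)" using vj J(1) False by blast+
        then obtain z where "edge v' j' \<inter> edge v j \<subseteq> {z}" using edge_Int_finite[OF _ w(2) _ w(4)] by blast
        then show ?thesis by (rule finite_subset) simp
      qed
      ultimately have "finite (\<Union>(v', j')\<in>J. edge v' j' \<inter> edge v j)" by auto
      moreover have "edge w i \<inter> edge v j = (\<Union>(v', j')\<in>J. edge v' j' \<inter> edge v j)" unfolding J(2) by blast
      ultimately show ?thesis by simp
    qed
  qed
  show "c \<inter> d \<in> skeleton_edges \<or> finite (c \<inter> d)" if cd: "c \<in> skeleton_edges" "d \<in> skeleton_edges" for c d
  proof -
    obtain n w i m v j where w: "w \<in> vicsek_words n" "c = edge w i" "i \<in> {1..4}" "v \<in> vicsek_words m" "d = edge v j" "j \<in> {1..4}"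
      using cd unfolding skeleton_edges_def by blast
    show ?thesis
    proof (cases "n \<le> m")
      case True
      then show ?thesis using *[of w n v "m - n" i j] w by simp
    next
      case False
      then show ?thesis using *[of v m w "n - m" j i] w by (simp add: Int_commute)
    qed
  qed
qed

definition is_nu :: "(real \<times> real) measure \<Rightarrow> bool" where
  "is_nu M \<longleftrightarrow> space M = vicsek_skeleton \<and> sets M = sets (restrict_space borel vicsek_skeleton) \<and>
     sigma_finite_measure M \<and> (\<forall>n. \<forall>e\<in>vicsek_edges n. emeasure M e = ennreal ((1 / 3) ^ n))"

lemma is_nu_edge: "is_nu M \<Longrightarrow> w \<in> vicsek_words n \<Longrightarrow> i \<in> {1..4} \<Longrightarrow> emeasure M (edge w i) = ennreal ((1 / 3) ^ n)"
  unfolding is_nu_def edges_eq by blast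

lemma closed_in_nu:
  assumes "is_nu M" "closed A" "A \<subseteq> vicsek_skeleton"
  shows "A \<in> sets M"
proof -
  have "A = vicsek_skeleton \<inter> A" "A \<in> sets borel" using assms by auto
  then show ?thesis using assms(1) unfolding is_nu_def sets_restrict_space by blast
qed

lemma is_nu_singleton:
  assumes M: "is_nu M" and x: "x \<in> vicsek_skeleton"
  shows "emeasure M {x} = 0"
proof -
  obtain m where m: "\<forall>n\<ge>m. \<exists>w\<in>vicsek_words n. \<exists>i\<in>{1..4}. x \<in> edge w i" using skeleton_in_edges[OF x] by blast
  show ?thesis
  proof (rule ennreal_le_all_powers_imp_0[of m _ 1 "1/3"])
    fix n assume "m \<le> n"
    then obtain w i where w: "w \<in> vicsek_words n" "i \<in> {1..4}" "x \<in> edge w i" using m by blast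
    then have "emeasure M {x} \<le> emeasure M (edge w i)"
      using closed_in_nu[OF M closed_edge edge_subset_skeleton[OF w(1,2)]] by (intro emeasure_mono) auto
    then show "emeasure M {x} \<le> ennreal (1 * (1/3) ^ n)" using is_nu_edge[OF M w(1,2)] by simp
  qed auto
qed

lemma is_nu_unique:
  assumes "is_nu M" "is_nu N"
  shows "M = N"
proof (rule measure_eq_on_cells[OF _ _ skeleton_edges_props(1,2,3,4)])
  show "sets M = sets (restrict_space borel vicsek_skeleton)" "sets N = sets (restrict_space borel vicsek_skeleton)"
    using assms by (simp_all add: is_nu_def)
  show "emeasure M c = emeasure N c" "emeasure M c \<noteq> \<infinity>" if "c \<in> skeleton_edges" for c
    using that is_nu_edge assms unfolding skeleton_edges_def by auto
qed (use is_nu_singleton assms in auto)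

text \<open>Every edge is parallel to one of the two diagonals, so the length of a subset of the skeleton
  is the sum of the lengths of its sections by the lines parallel to the diagonals. Edges
  transversal to a line meet it in single points and do not contribute.\<close>

definition line_pt :: "bool \<Rightarrow> real \<Rightarrow> real \<Rightarrow> real \<times> real" where
  "line_pt b s t = (if b then s *\<^sub>R vicsek_q 3 + t *\<^sub>R vicsek_q 2 else t *\<^sub>R vicsek_q 3 + s *\<^sub>R vicsek_q 2)"

definition line_length :: "(real \<times> real) set \<Rightarrow> ennreal" where
  "line_length A = (\<integral>\<^sup>+p. emeasure lborel (line_pt (fst p) (snd p) -` A) \<partial>count_space UNIV)"

lemma q_orthonormal: "vicsek_q 2 \<bullet> vicsek_q 2 = 1" "vicsek_q 3 \<bullet> vicsek_q 3 = 1"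
  "vicsek_q 2 \<bullet> vicsek_q 3 = 0" "vicsek_q 3 \<bullet> vicsek_q 2 = 0"
  by (simp_all add: vicsek_q_def inner_prod_def)

lemma line_pt_inner:
  "line_pt True s t \<bullet> vicsek_q 3 = s" "line_pt True s t \<bullet> vicsek_q 2 = t"
  "line_pt False s t \<bullet> vicsek_q 3 = t" "line_pt False s t \<bullet> vicsek_q 2 = s"
  by (simp_all add: line_pt_def inner_add_left q_orthonormal)

lemma line_pt_inj: "line_pt b s t = line_pt b s' t' \<longleftrightarrow> s = s' \<and> t = t'"
  using line_pt_inner by (cases b) metis+

lemma line_pt_surj: "\<exists>s t. z = line_pt b s t"
proof -
  obtain x y where z: "z = (x, y)" by (metis surj_pair)
  let ?s = "z \<bullet> vicsek_q 3" and ?t = "z \<bullet> vicsek_q 2"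
  have "z = ?s *\<^sub>R vicsek_q 3 + ?t *\<^sub>R vicsek_q 2"
    by (simp add: z vicsek_q_def inner_prod_def prod_eq_iff algebra_simps)
  then show ?thesis unfolding line_pt_def by (cases b) metis+
qed

lemma continuous_line_pt: "continuous_on A (line_pt b s)"
  unfolding line_pt_def by (cases b) (auto intro!: continuous_intros)

lemma line_length_edge:
  assumes w: "w \<in> vicsek_words n" and i: "i \<in> {1..4}"
  shows "line_length (edge w i) = ennreal ((1/3) ^ n)"
proof -
  define b where "b \<longleftrightarrow> i = 2 \<or> i = 4"
  \<comment> \<open>\<open>vicsek_q 4\<close> and \<open>vicsek_q 1\<close> are the negatives of
    \<open>vicsek_q 2\<close> and \<open>vicsek_q 3\<close>: \<open>b\<close> selects the diagonal
    to which the edge is parallel, \<open>\<sigma>\<close> the sign along it.\<close>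
  define \<sigma> :: real where "\<sigma> = (if i = 2 \<or> i = 3 then 1 else -1)"
  define h where "h = \<sigma> / 3 ^ n"
  obtain s0 t0 where z: "vicsek_psi_word w 0 = line_pt b s0 t0" using line_pt_surj by blast
  have lin: "line_pt b s0 t + c *\<^sub>R vicsek_q i = line_pt b s0 (t + \<sigma> * c)" for t c
    using i unfolding index4_cases by (auto simp: line_pt_def b_def \<sigma>_def vicsek_q_def algebra_simps)
  have edge: "edge w i = line_pt b s0 ` closed_segment t0 (t0 + h)"
  proof -
    have "vicsek_psi_word w (vicsek_q i) = line_pt b s0 (t0 + h)"
      using psi_word_eq[of w "vicsek_q i"] lin[of t0 "1 / 3 ^ n"] w by (simp add: z h_def length_words)
    moreover have "line_pt b s0 ` closed_segment x y = closed_segment (line_pt b s0 x) (line_pt b s0 y)" for x y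
    proof -
      have "line_pt b s0 ((1 - u) * x + u * y) = (1 - u) *\<^sub>R line_pt b s0 x + u *\<^sub>R line_pt b s0 y" for u
        by (simp add: line_pt_def prod_eq_iff algebra_simps)
      then show ?thesis unfolding closed_segment_def by (auto simp: image_iff) metis+
    qed
    ultimately show ?thesis by (simp add: edge_def z)
  qed
  have 1: "line_pt b s -` edge w i = (if s = s0 then closed_segment t0 (t0 + h) else {})" for s
    unfolding edge using line_pt_inj[of b] by auto
  have 2: "emeasure lborel (line_pt (\<not> b) s -` edge w i) = 0" for s
  proof -
    have "line_pt (\<not> b) s t = line_pt b t s" for s t by (auto simp: line_pt_def)
    then have "line_pt (\<not> b) s -` edge w i \<subseteq> {s0}" unfolding edge using line_pt_inj[of b] by auto
    then have "finite (line_pt (\<not> b) s -` edge w i)" by (rule finite_subset) simp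
    then show ?thesis by (simp add: emeasure_lborel_countable countable_finite)
  qed
  have len: "emeasure lborel (closed_segment t0 (t0 + h)) = ennreal ((1/3) ^ n)"
  proof -
    have "h = (1/3) ^ n \<or> h = - ((1/3) ^ n)" by (auto simp: h_def \<sigma>_def power_one_over)
    moreover have "0 < (1/3::real) ^ n" by simp
    ultimately show ?thesis by (elim disjE) (simp_all add: closed_segment_eq_real_ivl del: zero_less_power)
  qed
  have "emeasure lborel (line_pt (fst p) (snd p) -` edge w i) = ennreal ((1/3) ^ n) * indicator {(b, s0)} p" for p
  proof (cases "fst p = b")
    case True
    then show ?thesis using 1[of "snd p"] len by (cases p) (auto simp: indicator_def)
  next
    case False
    then have "fst p = (\<not> b)" by auto
    then show ?thesis using 2[of "snd p"] by (cases p) (auto simp: indicator_def)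
  qed
  then have "line_length (edge w i) = (\<integral>\<^sup>+p. ennreal ((1/3) ^ n) * indicator {(b, s0)} p \<partial>count_space UNIV)"
    by (simp add: line_length_def)
  also have "\<dots> = ennreal ((1/3) ^ n)" by (subst nn_integral_cmult_indicator) auto
  finally show ?thesis .
qed

lemma skeleton_borel: "vicsek_skeleton \<in> sets borel"
  unfolding vicsek_skeleton_def using closed_cable by (intro sets.countable_UN) auto

text \<open>Summation over all lines is an integral against a counting measure, so countable
  additivity is interchange of integral and series; the countably many edges of finite length give
  sigma-finiteness.\<close>

lemma ex_is_nu: "\<exists>M. is_nu M"
proof -
  let ?R = "restrict_space borel vicsek_skeleton"
  define M where "M = measure_of vicsek_skeleton (sets ?R) line_length"
  have sp: "space ?R = vicsek_skeleton" by (simp add: space_restrict_space)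
  have sa: "sigma_algebra vicsek_skeleton (sets ?R)" using sets.sigma_algebra_axioms[of ?R] by (simp add: sp)
  have bor: "A \<in> sets borel" if "A \<in> sets ?R" for A
    using that skeleton_borel by (auto simp: sets_restrict_space)
  have meas: "line_pt b s -` A \<in> sets lborel" if "A \<in> sets ?R" for A b s
  proof -
    have "line_pt b s \<in> borel_measurable borel"
      using continuous_line_pt[of UNIV] by (rule borel_measurable_continuous_onI)
    from measurable_sets[OF this bor[OF that]] show ?thesis by simp
  qed
  have "countably_additive (sets ?R) line_length"
  proof (rule countably_additiveI)
    fix A :: "nat \<Rightarrow> (real \<times> real) set" assume A: "range A \<subseteq> sets ?R" "disjoint_family A"
    have "emeasure lborel (line_pt b s -` (\<Union>i. A i)) = (\<Sum>i. emeasure lborel (line_pt b s -` A i))" for b s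
    proof -
      have "disjoint_family (\<lambda>i. line_pt b s -` A i)" using A(2) by (rule disjoint_family_on_vimageI)
      then have "(\<Sum>i. emeasure lborel (line_pt b s -` A i)) = emeasure lborel (\<Union>i. line_pt b s -` A i)"
        using A(1) meas by (intro suminf_emeasure) auto
      then show ?thesis by (simp add: vimage_UN)
    qed
    then show "(\<Sum>i. line_length (A i)) = line_length (\<Union>i. A i)"
      unfolding line_length_def by (subst nn_integral_suminf[symmetric]) auto
  qed
  then have em: "emeasure M A = line_length A" if "A \<in> sets ?R" for A
    unfolding M_def by (intro emeasure_measure_of_sigma[OF sa]) (auto simp: positive_def line_length_def that)
  have "sets ?R \<subseteq> Pow vicsek_skeleton" using sets.space_closed[of ?R] by (simp add: sp)
  then have sM: "sets M = sets ?R" "space M = vicsek_skeleton"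
    using sigma_algebra.sigma_sets_eq[OF sa] by (simp_all add: M_def)
  have edge_em: "edge w i \<in> sets M \<and> emeasure M (edge w i) = ennreal ((1/3) ^ n)" if w: "w \<in> vicsek_words n" "i \<in> {1..4}" for w n i
  proof -
    have "edge w i = vicsek_skeleton \<inter> edge w i" using edge_subset_skeleton[OF w] by blast
    then have "edge w i \<in> sets ?R" unfolding sets_restrict_space by (rule image_eqI) (simp add: closed_edge)
    then show ?thesis using em line_length_edge[OF w] sM by simp
  qed
  have "sigma_finite_measure M"
  proof
    have "\<Union>skeleton_edges = vicsek_skeleton"
      unfolding skeleton_edges_def vicsek_skeleton_def cable_eq by blast
    then show "\<exists>A. countable A \<and> A \<subseteq> sets M \<and> \<Union>A = space M \<and> (\<forall>a\<in>A. emeasure M a \<noteq> \<infinity>)"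
      using skeleton_edges_props(1) edge_em sM unfolding skeleton_edges_def
      by (intro exI[of _ skeleton_edges]) (auto simp: skeleton_edges_def)
  qed
  then have "is_nu M"
    unfolding is_nu_def edges_eq using sM edge_em by blast
  then show ?thesis by blast
qed

lemma is_nu_vicsek_nu: "is_nu vicsek_nu"
proof -
  obtain M where M: "is_nu M" using ex_is_nu by blast
  have "vicsek_nu = (THE M. is_nu M)" by (simp add: vicsek_nu_def is_nu_def)
  also have "\<dots> = M" using M is_nu_unique by blast
  finally show ?thesis using M by simp
qed

lemma space_nu: "space vicsek_nu = vicsek_skeleton"
  and sets_nu: "sets vicsek_nu = sets (restrict_space borel vicsek_skeleton)"
  and sigma_finite_nu: "sigma_finite_measure vicsek_nu"
  using is_nu_vicsek_nu by (auto simp: is_nu_def)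

lemmas emeasure_edge = is_nu_edge[OF is_nu_vicsek_nu]
lemmas closed_sets_nu = closed_in_nu[OF is_nu_vicsek_nu]
lemmas emeasure_nu_singleton = is_nu_singleton[OF is_nu_vicsek_nu]

lemma edge_sets: "w \<in> vicsek_words n \<Longrightarrow> i \<in> {1..4} \<Longrightarrow> edge w i \<in> sets vicsek_nu"
  by (rule closed_sets_nu[OF closed_edge edge_subset_skeleton])

section \<open>Korevaar--Schoen norms and discrete energies\<close>

lemma ennreal_powr_le:
  assumes "x \<le> ennreal b" "0 \<le> b" "0 < a"
  shows "ennreal_powr x a \<le> ennreal (b powr a)"
  using assms by (cases x) (auto simp: ennreal_powr_def top_unique intro!: ennreal_leI powr_mono2)

lemma ennreal_le_powr:
  assumes "ennreal_powr x a \<le> ennreal c" "0 \<le> c" "0 < a"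
  shows "x \<le> ennreal (c powr (1 / a))"
proof (cases x)
  case (real r)
  then have "r powr a \<le> c" using assms by (simp add: ennreal_powr_def)
  then have "r \<le> c powr (1 / a)" using real assms by (intro powr_le_imp_le_root) auto
  then show ?thesis using real by (simp add: ennreal_leI)
qed (use assms in \<open>simp add: ennreal_powr_def top_unique\<close>)

lemma near_common_point:
  assumes w: "w \<in> vicsek_words n" "w' \<in> vicsek_words n" "near w w'"
  shows "cell w \<inter> cell w' \<noteq> {}"
proof (cases "w = w'")
  case True
  then show ?thesis using zero_in_K unfolding cell_def by auto
next
  case False
  obtain i where "i \<in> {1..4}" "vicsek_psi_word w (vicsek_q i) = vicsek_psi_word w' (vicsek_q (opp i))"
    using near_imp_common_corner[OF w False] by metis
  then show ?thesis using q_in_K[of i] q_in_K[of "opp i"] opp_in[of i] unfolding cell_def by force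
qed

lemma finite_measure_mu: "finite_measure vicsek_mu"
  using prob_space_mu by (rule prob_space.finite_measure)

lemma emeasure_mu_eq_measure: "emeasure vicsek_mu A = ennreal (measure vicsek_mu A)"
  using finite_measure_mu by (rule finite_measure.emeasure_eq_measure)

lemma ball_sets: "x \<in> vicsek_set \<Longrightarrow> vicsek_ball x r \<in> sets vicsek_mu"
  using closed_ball by (intro closed_sets_mu) (auto simp: vicsek_ball_def)

lemma measure_cell: "w \<in> vicsek_words n \<Longrightarrow> measure vicsek_mu (cell w) = (1/5) ^ n"
  using emeasure_cell[of w n] by (simp add: measure_def)

text \<open>With \<open>ball_measure_upper\<close> this is Ahlfors regularity of dimension
  \<open>vicsek_dh\<close>, in discrete form: balls of radius about 3^-n have mass about
  5^-n.\<close>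

lemma ball_measure_lower:
  assumes "x \<in> vicsek_set" "2 / 3 ^ k \<le> r"
  shows "(1/5) ^ k \<le> measure vicsek_mu (vicsek_ball x r)"
proof -
  obtain w y where w: "w \<in> vicsek_words k" "y \<in> vicsek_set" "x = vicsek_psi_word w y"
    using assms(1) by (rule K_cellE)
  then have x: "x \<in> cell w" by (simp add: cell_def)
  have "cell w \<subseteq> vicsek_ball x r"
    using gd_cell[OF w(1) x] cell_subset_K[OF w(1)] assms(2) by (force simp: vicsek_ball_def)
  then have "measure vicsek_mu (cell w) \<le> measure vicsek_mu (vicsek_ball x r)"
    using ball_sets[OF assms(1)] finite_measure_mu by (intro finite_measure.finite_measure_mono)
  then show ?thesis using measure_cell[OF w(1)] by simp
qed

lemma ball_subset_near:
  assumes w: "w \<in> vicsek_words n" "x \<in> cell w" and r: "r < sqrt 2 / 3 ^ n"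
  shows "vicsek_ball x r \<subseteq> (\<Union>w'\<in>{w' \<in> vicsek_words n. near w w'}. cell w')"
proof
  fix y assume y: "y \<in> vicsek_ball x r"
  then have "y \<in> vicsek_set" by (simp add: vicsek_ball_def)
  then obtain w' y' where w': "w' \<in> vicsek_words n" "y' \<in> vicsek_set" "y = vicsek_psi_word w' y'" by (rule K_cellE)
  then have "y \<in> cell w'" by (simp add: cell_def)
  moreover have "near w w'"
    using gd_small_imp_near[OF w(1) w'(1) w(2) \<open>y \<in> cell w'\<close>] y r by (simp add: vicsek_ball_def)
  ultimately show "y \<in> (\<Union>w'\<in>{w' \<in> vicsek_words n. near w w'}. cell w')" using w'(1) by blast
qed

lemma ball_measure_upper:
  assumes x: "x \<in> vicsek_set" and r: "r < sqrt 2 / 3 ^ n"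
  shows "measure vicsek_mu (vicsek_ball x r) \<le> 9 * (1/5) ^ n"
proof -
  obtain w y where w: "w \<in> vicsek_words n" "y \<in> vicsek_set" "x = vicsek_psi_word w y"
    using x by (rule K_cellE)
  then have xw: "x \<in> cell w" by (simp add: cell_def)
  let ?N = "{w' \<in> vicsek_words n. near w w'}"
  have "measure vicsek_mu (vicsek_ball x r) \<le> measure vicsek_mu (\<Union>w'\<in>?N. cell w')"
    using ball_subset_near[OF w(1) xw r] finite_measure_mu cell_sets
    by (intro finite_measure.finite_measure_mono sets.finite_UN) auto
  also have "\<dots> \<le> (\<Sum>w'\<in>?N. measure vicsek_mu (cell w'))"
    using finite_measure_mu cell_sets by (intro finite_measure.finite_measure_subadditive_finite) auto
  also have "\<dots> = (\<Sum>w'\<in>?N. (1/5) ^ n)" by (intro sum.cong) (auto simp: measure_cell)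
  also have "\<dots> = card ?N * (1/5) ^ n" by simp
  also have "\<dots> \<le> 9 * (1/5) ^ n" using card_near_le[OF w(1)] by (intro mult_right_mono) auto
  finally show ?thesis .
qed

subsection \<open>From discrete energies to Korevaar--Schoen norms\<close>

text \<open>For p at least 1 the energies increase, so this is also their limit. It is a supremum of
  reals and carries meaning only for bounded energies.\<close>

definition esup :: "real \<Rightarrow> (real \<times> real \<Rightarrow> real) \<Rightarrow> real" where
  "esup p f = (SUP m. energy p m f)"

lemma sum_energy_cells:
  "(\<Sum>w\<in>vicsek_words n. energy p m (f \<circ> vicsek_psi_word w)) = 3 powr (- (p - 1) * n) * energy p (n + m) f"
proof -
  have "3 powr (- (p - 1) * n) * 3 powr ((p - 1) * n) = (1::real)"
    unfolding mult_minus_left powr_minus by simp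
  then show ?thesis unfolding energy_add by (simp flip: mult.assoc)
qed

lemma energy_cell_le:
  assumes "w \<in> vicsek_words n" "\<And>m. energy p m f \<le> E"
  shows "energy p m (f \<circ> vicsek_psi_word w) \<le> 3 powr (- (p - 1) * n) * E"
proof -
  have "energy p m (f \<circ> vicsek_psi_word w) \<le> (\<Sum>w\<in>vicsek_words n. energy p m (f \<circ> vicsek_psi_word w))"
    by (rule member_le_sum[where f = "\<lambda>w. energy p m (f \<circ> vicsek_psi_word w)"]) (use assms energy_nonneg in auto)
  also have "\<dots> \<le> 3 powr (- (p - 1) * n) * E"
    unfolding sum_energy_cells using assms by (intro mult_left_mono) auto
  finally show ?thesis .
qed

lemma energy_le_esup: "(\<And>m. energy p m f \<le> E) \<Longrightarrow> energy p m f \<le> esup p f"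
  unfolding esup_def by (intro cSUP_upper bdd_aboveI2) auto

lemma esup_nonneg: "(\<And>m. energy p m f \<le> E) \<Longrightarrow> 0 \<le> esup p f"
  by (meson energy_le_esup energy_nonneg order_trans)

text \<open>Suprema of increasing sequences are limits, and limits commute with the finite sum over
  cells; at each level the sum is a single energy by \<open>sum_energy_cells\<close>.\<close>

lemma sum_esup_cells_le:
  assumes "1 < p" "\<And>m. energy p m f \<le> E"
  shows "(\<Sum>w\<in>vicsek_words n. esup p (f \<circ> vicsek_psi_word w)) \<le> 3 powr (- (p - 1) * n) * E"
proof (rule LIMSEQ_le_const2)
  show "(\<lambda>m. \<Sum>w\<in>vicsek_words n. energy p m (f \<circ> vicsek_psi_word w)) \<longlonglongrightarrow> (\<Sum>w\<in>vicsek_words n. esup p (f \<circ> vicsek_psi_word w))"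
  proof (rule tendsto_sum)
    fix w assume w: "w \<in> vicsek_words n"
    show "(\<lambda>m. energy p m (f \<circ> vicsek_psi_word w)) \<longlonglongrightarrow> esup p (f \<circ> vicsek_psi_word w)"
      unfolding esup_def
    proof (rule LIMSEQ_incseq_SUP)
      show "bdd_above (range (\<lambda>m. energy p m (f \<circ> vicsek_psi_word w)))"
        by (rule bdd_aboveI2) (rule energy_cell_le[OF w assms(2)])
      show "incseq (\<lambda>m. energy p m (f \<circ> vicsek_psi_word w))"
        using energy_mono[of p] assms(1) by (auto simp: incseq_def)
    qed
  qed
  show "\<exists>N. \<forall>m\<ge>N. (\<Sum>w\<in>vicsek_words n. energy p m (f \<circ> vicsek_psi_word w)) \<le> 3 powr (- (p - 1) * n) * E"
    unfolding sum_energy_cells using assms by (auto intro!: mult_left_mono)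
qed

definition osc_const :: "real \<Rightarrow> real" where
  "osc_const p = 4 powr p * morrey p powr p"

lemma osc_const_nonneg: "0 \<le> osc_const p"
  by (simp add: osc_const_def)

text \<open>From x through the centre of w to a common point z, and on through the centre of w' to
  y. Pairing these four steps twice costs 2^p and 2^(p-1), which \<open>osc_const\<close> rounds up
  to 4^p.\<close>

lemma near_difference_le:
  assumes p: "1 < p" and f: "continuous_on vicsek_set f" and E: "\<And>m. energy p m f \<le> E"
    and w: "w \<in> vicsek_words n" "w' \<in> vicsek_words n" "near w w'" and xy: "x \<in> cell w" "y \<in> cell w'"
  shows "\<bar>f y - f x\<bar> powr p \<le> osc_const p * (esup p (f \<circ> vicsek_psi_word w) + esup p (f \<circ> vicsek_psi_word w'))"
proof -
  let ?e = "\<lambda>w. esup p (f \<circ> vicsek_psi_word w)"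
  have osc: "\<bar>f x - f (vicsek_psi_word w 0)\<bar> powr p \<le> morrey p powr p * ?e w"
    if w: "w \<in> vicsek_words n" and x: "x \<in> cell w" for x w
  proof -
    obtain x' where x': "x' \<in> vicsek_set" "x = vicsek_psi_word w x'" using x unfolding cell_def by blast
    have "\<bar>(f \<circ> vicsek_psi_word w) x' - (f \<circ> vicsek_psi_word w) 0\<bar> powr p \<le> morrey p powr p * ?e w"
      by (rule morrey_K[OF p continuous_on_comp_psi_word[OF f w] energy_le_esup[OF energy_cell_le[OF w E]] x'(1)])
    then show ?thesis using x' by simp
  qed
  have osc2: "\<bar>f x - f z\<bar> powr p \<le> 2 powr p * (morrey p powr p * ?e w)"
    if w: "w \<in> vicsek_words n" and x: "x \<in> cell w" "z \<in> cell w" for x z w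
  proof -
    have "\<bar>f x - f z\<bar> powr p \<le> 2 powr (p - 1) * (\<bar>f x - f (vicsek_psi_word w 0)\<bar> powr p + \<bar>f (vicsek_psi_word w 0) - f z\<bar> powr p)"
      using abs_add2_powr_le[of p "f x - f (vicsek_psi_word w 0)" "f (vicsek_psi_word w 0) - f z"] p by simp
    also have "\<dots> \<le> 2 powr (p - 1) * (morrey p powr p * ?e w + morrey p powr p * ?e w)"
      using osc[OF w x(1)] osc[OF w x(2)] by (intro mult_left_mono add_mono) (auto simp: abs_minus_commute)
    also have "\<dots> = (2 * 2 powr (p - 1)) * (morrey p powr p * ?e w)" by (simp add: algebra_simps)
    also have "2 * 2 powr (p - 1) = 2 powr p" by (simp add: powr_mult_base)
    finally show ?thesis .
  qed
  obtain z where z: "z \<in> cell w" "z \<in> cell w'" using near_common_point[OF w] by blast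
  have "\<bar>f y - f x\<bar> powr p \<le> 2 powr (p - 1) * (\<bar>f y - f z\<bar> powr p + \<bar>f z - f x\<bar> powr p)"
    using abs_add2_powr_le[of p "f y - f z" "f z - f x"] p by simp
  also have "\<dots> \<le> 2 powr (p - 1) * (2 powr p * (morrey p powr p * ?e w') + 2 powr p * (morrey p powr p * ?e w))"
    using osc2[OF w(2) xy(2) z(2)] osc2[OF w(1) z(1) xy(1)] by (intro mult_left_mono add_mono) auto
  also have "\<dots> = (2 powr (p - 1) * 2 powr p) * morrey p powr p * (?e w + ?e w')" by (simp add: algebra_simps)
  also have "\<dots> \<le> osc_const p * (?e w + ?e w')"
    unfolding osc_const_def
  proof (intro mult_right_mono)
    have "(4::real) powr p = 2 powr p * 2 powr p" by (simp flip: powr_mult)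
    then show "2 powr (p - 1) * 2 powr p \<le> (4::real) powr p" by (simp add: powr_mono)
    show "0 \<le> ?e w + ?e w'" using esup_nonneg[OF energy_cell_le[OF w(1) E]] esup_nonneg[OF energy_cell_le[OF w(2) E]] by simp
  qed auto
  finally show ?thesis .
qed

lemma three_powr_dh: "3 powr vicsek_dh = 5"
  by (simp add: vicsek_dh_def powr_def)

lemma alpha_times: "1 < p \<Longrightarrow> vicsek_alpha p * p = p - 1 + vicsek_dh"
  by (simp add: vicsek_alpha_def field_simps)

lemma alpha_pos: "1 < p \<Longrightarrow> 0 < vicsek_alpha p"
proof -
  assume p: "1 < p"
  have "0 < vicsek_dh" by (simp add: vicsek_dh_def)
  then have "0 < vicsek_alpha p * p" using p by (simp add: alpha_times)
  then show ?thesis using p by (simp add: zero_less_mult_iff)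
qed

text \<open>Where the exponent \<open>vicsek_alpha\<close> comes from: alpha p = (p - 1) + d_h, and
  at scale 3^-n the first part matches the decay of cell energies, the second the mass 5^-n of a
  cell.\<close>

lemma scale_powr_alpha:
  assumes "1 < p"
  shows "(1 / 3 ^ n) powr (vicsek_alpha p * p) = 3 powr (- (p - 1) * n) * (1/5) ^ n"
proof -
  have "1 / 3 ^ n = 3 powr (- real n)" by (simp add: powr_minus powr_realpow divide_inverse)
  then have "(1 / 3 ^ n) powr (vicsek_alpha p * p) = 3 powr (- (p - 1) * n + vicsek_dh * - real n)"
    unfolding alpha_times[OF assms] by (simp add: powr_powr algebra_simps)
  also have "\<dots> = 3 powr (- (p - 1) * n) * (3 powr vicsek_dh) powr (- real n)"
    by (simp add: powr_powr flip: powr_add)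
  also have "(3 powr vicsek_dh) powr (- real n) = (1/5) ^ n"
    unfolding three_powr_dh powr_minus by (simp add: powr_realpow power_one_over inverse_eq_divide)
  finally show ?thesis .
qed

lemma sum_near_le:
  assumes "\<And>w. w \<in> vicsek_words n \<Longrightarrow> 0 \<le> (h w :: real)"
  shows "(\<Sum>w\<in>vicsek_words n. \<Sum>w'\<in>{w' \<in> vicsek_words n. near w w'}. h w + h w') \<le> 18 * (\<Sum>w\<in>vicsek_words n. h w)"
proof -
  let ?W = "vicsek_words n" and ?N = "\<lambda>w. {w' \<in> vicsek_words n. near w w'}"
  have card: "(\<Sum>w\<in>?W. \<Sum>w'\<in>?N w. h w) \<le> 9 * (\<Sum>w\<in>?W. h w)"
    unfolding sum_distrib_left using card_near_le assms by (auto intro!: sum_mono mult_right_mono)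
  have "(\<Sum>w\<in>?W. \<Sum>w'\<in>?N w. h w') = (\<Sum>w\<in>?W. \<Sum>w'\<in>?W. if near w w' then h w' else 0)"
    by (rule sum.cong[OF refl]) (simp only: sum.inter_filter finite_words)
  also have "\<dots> = (\<Sum>w'\<in>?W. \<Sum>w\<in>?W. if near w' w then h w' else 0)"
    by (subst sum.swap) (simp add: near_sym)
  also have "\<dots> = (\<Sum>w\<in>?W. \<Sum>w'\<in>?N w. h w)"
    by (rule sum.cong[OF refl]) (simp only: sum.inter_filter finite_words)
  finally show ?thesis using card by (simp add: sum.distrib)
qed

text \<open>2250 = 25 * 18 * 5: the loss 5^2 in the mass of the ball, the neighbour sums of
  \<open>sum_near_le\<close>, and 5 * 3^(p-1) for rounding the radius to a power of 3.\<close>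

definition ks_const :: "real \<Rightarrow> real" where
  "ks_const p = 2250 * 3 powr (p - 1) * osc_const p"

text \<open>For x in a cell of level n the ball of radius r lies in the near cells, where
  differences are bounded by the energies of two cells. Summing over pairs of near cells gives a
  multiple of 3^-(p-1)n E.\<close>

lemma ks_integral_le:
  assumes p: "1 < p" and f: "continuous_on vicsek_set f" and E: "\<And>m. energy p m f \<le> E" and r: "0 < r" "r < 1"
  shows "(\<integral>\<^sup>+x. (\<integral>\<^sup>+y\<in>vicsek_ball x r. ennreal (\<bar>f y - f x\<bar> powr p) / emeasure vicsek_mu (vicsek_ball x r)
          \<partial>vicsek_mu) \<partial>vicsek_mu) \<le> ennreal (ks_const p * r powr (vicsek_alpha p * p) * E)"
proof -
  obtain n where n: "1 / 3 ^ Suc n \<le> r" "r < 1 / 3 ^ n" using scale_exists[OF r] .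
  have "1 / 3 ^ n < sqrt 2 / 3 ^ n" by (rule divide_strict_right_mono) auto
  then have rn: "r < sqrt 2 / 3 ^ n" using n by linarith
  have "(2::real) / 3 ^ (n + 2) \<le> 1 / 3 ^ Suc n" by (simp add: field_simps)
  \<comment> \<open>Cells of level n + 2 have geodesic diameter at most r, so the ball contains one
    and has mass at least 5^-(n+2).\<close>
  then have rk: "2 / 3 ^ (n + 2) \<le> r" using n by linarith
  let ?W = "vicsek_words n" and ?N = "\<lambda>w. {w' \<in> vicsek_words n. near w w'}"
  define e where "e w = esup p (f \<circ> vicsek_psi_word w)" for w
  have e0: "0 \<le> e w" if "w \<in> ?W" for w unfolding e_def by (rule esup_nonneg[OF energy_cell_le[OF that E]])
  define a where "a w w' = 5 ^ (n + 2) * (osc_const p * (e w + e w'))" for w w'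
  have a0: "0 \<le> a w w'" if "w \<in> ?W" "w' \<in> ?W" for w w'
    unfolding a_def using osc_const_nonneg e0 that by simp
  define H where "H w = (\<Sum>w'\<in>?N w. a w w' * (1/5) ^ n)" for w
  have H0: "0 \<le> H w" if "w \<in> ?W" for w unfolding H_def using a0 that by (auto intro!: sum_nonneg)
  have inner: "(\<integral>\<^sup>+y\<in>vicsek_ball x r. ennreal (\<bar>f y - f x\<bar> powr p) / emeasure vicsek_mu (vicsek_ball x r) \<partial>vicsek_mu)
      \<le> ennreal (H w)" if w: "w \<in> ?W" and x: "x \<in> cell w" for x w
  proof -
    have xK: "x \<in> vicsek_set" using cell_subset_K[OF w] x by blast
    define b where "b = measure vicsek_mu (vicsek_ball x r)"
    have b: "(1/5) ^ (n + 2) \<le> b" unfolding b_def by (rule ball_measure_lower[OF xK rk])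
    then have b0: "0 < b" by (rule less_le_trans[rotated]) simp
    have "ennreal (\<bar>f y - f x\<bar> powr p) / emeasure vicsek_mu (vicsek_ball x r) * indicator (vicsek_ball x r) y
        \<le> (\<Sum>w'\<in>?N w. ennreal (a w w') * indicator (cell w') y)" for y
    proof (cases "y \<in> vicsek_ball x r")
      case True
      then obtain w' where w': "w' \<in> ?N w" "y \<in> cell w'" using ball_subset_near[OF w x rn] by blast
      have "\<bar>f y - f x\<bar> powr p / b \<le> (osc_const p * (e w + e w')) / b"
        using near_difference_le[OF p f E w _ _ x w'(2)] w' b0 unfolding e_def by (intro divide_right_mono) auto
      also have "\<dots> \<le> (osc_const p * (e w + e w')) / (1/5) ^ (n + 2)"
        using b e0[OF w] e0[of w'] w' osc_const_nonneg[of p] by (intro divide_left_mono) (auto intro!: mult_nonneg_nonneg mult_pos_pos b0)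
      also have "\<dots> = a w w'" by (simp add: a_def power_one_over)
      finally have "ennreal (\<bar>f y - f x\<bar> powr p / b) \<le> ennreal (a w w') * indicator (cell w') y"
        using w' by (simp add: ennreal_leI)
      also have "\<dots> \<le> (\<Sum>w'\<in>?N w. ennreal (a w w') * indicator (cell w') y)"
        using w' by (intro member_le_sum) auto
      finally show ?thesis using True b0 by (simp add: emeasure_mu_eq_measure b_def[symmetric] divide_ennreal)
    qed simp
    then have "(\<integral>\<^sup>+y\<in>vicsek_ball x r. ennreal (\<bar>f y - f x\<bar> powr p) / emeasure vicsek_mu (vicsek_ball x r) \<partial>vicsek_mu)
      \<le> (\<integral>\<^sup>+y. (\<Sum>w'\<in>?N w. ennreal (a w w') * indicator (cell w') y) \<partial>vicsek_mu)"
      by (intro nn_integral_mono)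
    also have "\<dots> = (\<Sum>w'\<in>?N w. ennreal (a w w') * emeasure vicsek_mu (cell w'))"
      using cell_sets by (subst nn_integral_sum) (auto intro!: sum.cong nn_integral_cmult_indicator)
    also have "\<dots> = (\<Sum>w'\<in>?N w. ennreal (a w w' * (1/5) ^ n))"
      using emeasure_cell a0[OF w] by (intro sum.cong) (auto simp: ennreal_mult)
    also have "\<dots> = ennreal (H w)"
      unfolding H_def using a0[OF w] by (intro sum_ennreal) auto
    finally show ?thesis .
  qed
  have "(\<integral>\<^sup>+x. (\<integral>\<^sup>+y\<in>vicsek_ball x r. ennreal (\<bar>f y - f x\<bar> powr p) / emeasure vicsek_mu (vicsek_ball x r)
          \<partial>vicsek_mu) \<partial>vicsek_mu) \<le> (\<integral>\<^sup>+x. (\<Sum>w\<in>?W. ennreal (H w) * indicator (cell w) x) \<partial>vicsek_mu)"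
  proof (rule nn_integral_mono)
    fix x assume "x \<in> space vicsek_mu"
    then have "x \<in> vicsek_set" by (simp add: space_mu)
    then obtain w y where w: "w \<in> ?W" "y \<in> vicsek_set" "x = vicsek_psi_word w y" by (rule K_cellE)
    then have x: "x \<in> cell w" by (simp add: cell_def)
    have "ennreal (H w) * indicator (cell w) x \<le> (\<Sum>w\<in>?W. ennreal (H w) * indicator (cell w) x)"
      using w by (intro member_le_sum[where f = "\<lambda>w. ennreal (H w) * indicator (cell w) x"]) auto
    then show "(\<integral>\<^sup>+y\<in>vicsek_ball x r. ennreal (\<bar>f y - f x\<bar> powr p) / emeasure vicsek_mu (vicsek_ball x r) \<partial>vicsek_mu)
       \<le> (\<Sum>w\<in>?W. ennreal (H w) * indicator (cell w) x)"
      using inner[OF w(1) x] x by simp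
  qed
  also have "\<dots> = (\<Sum>w\<in>?W. ennreal (H w) * emeasure vicsek_mu (cell w))"
    using cell_sets by (subst nn_integral_sum) (auto intro!: sum.cong nn_integral_cmult_indicator)
  also have "\<dots> = (\<Sum>w\<in>?W. ennreal (H w * (1/5) ^ n))"
    using emeasure_cell H0 by (intro sum.cong) (auto simp: ennreal_mult)
  also have "\<dots> = ennreal (\<Sum>w\<in>?W. H w * (1/5) ^ n)"
    using H0 by (intro sum_ennreal) auto
  also have "\<dots> \<le> ennreal (ks_const p * r powr (vicsek_alpha p * p) * E)"
  proof (rule ennreal_leI)
    have "a w w' * (1/5) ^ n = 25 * osc_const p * (e w + e w')" for w w'
      by (simp add: a_def power_add power_one_over)
    then have "H w = 25 * osc_const p * (\<Sum>w'\<in>?N w. e w + e w')" for w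
      unfolding H_def by (simp add: sum_distrib_left)
    then have "(\<Sum>w\<in>?W. H w * (1/5) ^ n) = (\<Sum>w\<in>?W. 25 * (1/5) ^ n * osc_const p * (\<Sum>w'\<in>?N w. e w + e w'))"
      by (simp only: mult_ac)
    also have "\<dots> = 25 * (1/5) ^ n * osc_const p * (\<Sum>w\<in>?W. \<Sum>w'\<in>?N w. e w + e w')"
      by (rule sum_distrib_left[symmetric])
    also have "\<dots> \<le> 25 * (1/5) ^ n * osc_const p * (18 * (3 powr (- (p - 1) * n) * E))"
    proof (rule mult_left_mono)
      have "(\<Sum>w\<in>?W. \<Sum>w'\<in>?N w. e w + e w') \<le> 18 * (\<Sum>w\<in>?W. e w)" by (rule sum_near_le) (rule e0)
      also have "\<dots> \<le> 18 * (3 powr (- (p - 1) * n) * E)"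
        using sum_esup_cells_le[OF p E] unfolding e_def by simp
      finally show "(\<Sum>w\<in>?W. \<Sum>w'\<in>?N w. e w + e w') \<le> 18 * (3 powr (- (p - 1) * n) * E)" .
    qed (use osc_const_nonneg in auto)
    also have "\<dots> = 450 * osc_const p * E * (3 powr (- (p - 1) * n) * (1/5) ^ n)" by simp
    \<comment> \<open>The level is raised by one because r is bounded below by 3^-(n+1), not by
      3^-n.\<close>
    also have "3 powr (- (p - 1) * n) * (1/5) ^ n = 5 * 3 powr (p - 1) * (3 powr (- (p - 1) * Suc n) * (1/5) ^ Suc n)"
      by (simp add: distrib_left left_diff_distrib powr_diff powr_add)
    also have "\<dots> = 5 * 3 powr (p - 1) * (1 / 3 ^ Suc n) powr (vicsek_alpha p * p)" unfolding scale_powr_alpha[OF p] ..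
    also have "450 * osc_const p * E * (5 * 3 powr (p - 1) * (1 / 3 ^ Suc n) powr (vicsek_alpha p * p)) \<le>
        450 * osc_const p * E * (5 * 3 powr (p - 1) * r powr (vicsek_alpha p * p))"
    proof (intro mult_left_mono powr_mono2)
      show "0 \<le> 450 * osc_const p * E"
        using osc_const_nonneg[of p] energy_nonneg[of p 0 f] E[of 0] by simp
    qed (use n alpha_pos[OF p] p in auto)
    also have "\<dots> = ks_const p * r powr (vicsek_alpha p * p) * E" by (simp add: ks_const_def)
    finally show "(\<Sum>w\<in>?W. H w * (1/5) ^ n) \<le> ks_const p * r powr (vicsek_alpha p * p) * E" .
  qed
  finally show ?thesis .
qed

lemma ks_const_nonneg: "0 \<le> ks_const p"
  by (simp add: ks_const_def osc_const_nonneg)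

lemma korevaar_schoen_le:
  assumes p: "1 < p" and f: "continuous_on vicsek_set f" and E: "\<And>m. energy p m f \<le> E" and r: "0 < r" "r < 1"
  shows "korevaar_schoen p f r \<le> ennreal (ks_const p powr (1/p) * E powr (1/p))"
proof -
  have E0: "0 \<le> E" using energy_nonneg[of p 0 f] E[of 0] by linarith
  have "korevaar_schoen p f r \<le> ennreal (1 / r powr vicsek_alpha p) * ennreal ((ks_const p * r powr (vicsek_alpha p * p) * E) powr (1/p))"
    unfolding korevaar_schoen_def
    using ks_integral_le[OF assms] E0 ks_const_nonneg[of p] p by (intro mult_left_mono ennreal_powr_le) auto
  also have "(ks_const p * r powr (vicsek_alpha p * p) * E) powr (1/p) = ks_const p powr (1/p) * r powr vicsek_alpha p * E powr (1/p)"
    using p E0 ks_const_nonneg[of p] r by (simp add: powr_mult powr_powr)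
  also have "ennreal (1 / r powr vicsek_alpha p) * ennreal (ks_const p powr (1/p) * r powr vicsek_alpha p * E powr (1/p)) =
     ennreal (ks_const p powr (1/p) * E powr (1/p))"
    using r by (subst ennreal_mult[symmetric]) auto
  finally show ?thesis .
qed

lemma W_norm_le:
  assumes p: "1 < p" and f: "continuous_on vicsek_set f" and E: "\<And>m. energy p m f \<le> E"
  shows "W_norm (ereal p) f \<le> ennreal (ks_const p powr (1/p) * E powr (1/p))"
proof -
  have "eventually (\<lambda>r. korevaar_schoen p f r \<le> ennreal (ks_const p powr (1/p) * E powr (1/p))) (at_right 0)"
    using korevaar_schoen_le[OF assms] by (intro eventually_at_rightI[of 0 1]) auto
  then show ?thesis unfolding W_norm_def by (auto intro: Limsup_bounded)
qed

subsection \<open>From Korevaar--Schoen norms to discrete energies\<close>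

text \<open>Integrating the tangent inequality of |h| at its mean a = I / c over X leaves c * a^p on
  the left; c > 0 settles the case of an infinite right-hand side.\<close>

lemma jensen_powr:
  fixes h :: "'a \<Rightarrow> real"
  assumes X: "X \<in> sets M" "emeasure M X = ennreal c" "0 < c" and h: "set_integrable M X h" and p: "1 \<le> p"
  shows "ennreal (\<bar>LINT x:X|M. h x\<bar> powr p) \<le> ennreal (c powr (p - 1)) * (\<integral>\<^sup>+x\<in>X. ennreal (\<bar>h x\<bar> powr p) \<partial>M)"
proof (cases "(\<integral>\<^sup>+x\<in>X. ennreal (\<bar>h x\<bar> powr p) \<partial>M) = \<infinity>")
  case True
  then show ?thesis using X(3) by (simp add: ennreal_mult_top)
next
  case False
  have hm: "(\<lambda>x. indicator X x * h x) \<in> borel_measurable M"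
    using h unfolding set_integrable_def by (auto dest: borel_measurable_integrable)
  have eq: "ennreal (\<bar>indicator X x * h x\<bar> powr p) = ennreal (\<bar>h x\<bar> powr p) * indicator X x" for x
    using p by (auto simp: indicator_def)
  have int_p: "integrable M (\<lambda>x. \<bar>indicator X x * h x\<bar> powr p)"
  proof (rule integrableI_nonneg)
    show "(\<lambda>x. \<bar>indicator X x * h x\<bar> powr p) \<in> borel_measurable M" using hm by measurable
    show "(\<integral>\<^sup>+x. ennreal (\<bar>indicator X x * h x\<bar> powr p) \<partial>M) < \<infinity>" using False unfolding eq by (simp add: less_top)
  qed auto
  have int_1: "integrable M (\<lambda>x. \<bar>indicator X x * h x\<bar>)" using h unfolding set_integrable_def by (simp add: integrable_abs)
  have int_X: "integrable M (\<lambda>x. indicator X x :: real)" using X by (simp add: integrable_indicator_iff)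
  have mX: "measure M X = c" using X by (simp add: measure_def)
  define I where "I = (\<integral>x. \<bar>indicator X x * h x\<bar> \<partial>M)"
  define a where "a = I / c"
  have I0: "0 \<le> I" by (simp add: I_def)
  then have a0: "0 \<le> a" using X(3) by (simp add: a_def)
  have "c * a powr p = (\<integral>x. (a powr p - p * a powr (p - 1) * a) * indicator X x + p * a powr (p - 1) * \<bar>indicator X x * h x\<bar> \<partial>M)"
  proof -
    have "(\<integral>x. (a powr p - p * a powr (p - 1) * a) * indicator X x + p * a powr (p - 1) * \<bar>indicator X x * h x\<bar> \<partial>M)
       = (a powr p - p * a powr (p - 1) * a) * c + p * a powr (p - 1) * I"
      using int_X int_1 mX by (simp add: I_def Int_absorb2[OF sets.sets_into_space[OF X(1)]])
    moreover have "I = a * c" using X(3) by (simp add: a_def)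
    ultimately show ?thesis by (simp add: algebra_simps)
  qed
  also have "\<dots> \<le> (\<integral>x. \<bar>indicator X x * h x\<bar> powr p \<partial>M)"
  proof (rule integral_mono)
    show "(a powr p - p * a powr (p - 1) * a) * indicator X x + p * a powr (p - 1) * \<bar>indicator X x * h x\<bar> \<le> \<bar>indicator X x * h x\<bar> powr p" for x
      using powr_tangent[OF a0, of "\<bar>h x\<bar>" p] p by (auto simp: indicator_def algebra_simps)
  qed (use int_X int_1 int_p in auto)
  finally have *: "c * a powr p \<le> (\<integral>x. \<bar>indicator X x * h x\<bar> powr p \<partial>M)" .
  have "\<bar>LINT x:X|M. h x\<bar> \<le> I"
    unfolding set_lebesgue_integral_def I_def by (simp add: integral_abs_bound)
  then have "\<bar>LINT x:X|M. h x\<bar> powr p \<le> I powr p" using p by (intro powr_mono2) auto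
  also have "\<dots> = c powr (p - 1) * (c * a powr p)"
  proof -
    have "I powr p = c powr p * a powr p" using X(3) a0 by (simp add: a_def powr_divide)
    also have "c powr p = c powr (p - 1) * c" using X(3) by (simp add: powr_mult_base mult.commute)
    finally show ?thesis by simp
  qed
  also have "\<dots> \<le> c powr (p - 1) * (\<integral>x. \<bar>indicator X x * h x\<bar> powr p \<partial>M)" using * by (intro mult_left_mono) auto
  finally have "ennreal (\<bar>LINT x:X|M. h x\<bar> powr p) \<le> ennreal (c powr (p - 1)) * ennreal (\<integral>x. \<bar>indicator X x * h x\<bar> powr p \<partial>M)"
    by (subst ennreal_mult[symmetric]) (auto intro: ennreal_leI)
  also have "ennreal (\<integral>x. \<bar>indicator X x * h x\<bar> powr p \<partial>M) = (\<integral>\<^sup>+x\<in>X. ennreal (\<bar>h x\<bar> powr p) \<partial>M)"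
    by (subst nn_integral_eq_integral[symmetric, OF int_p]) (auto simp: eq)
  finally show ?thesis .
qed

section \<open>Cell averages and their limits at vertices\<close>

definition avg :: "(real \<times> real \<Rightarrow> real) \<Rightarrow> nat list \<Rightarrow> real" where
  "avg f w = 5 ^ length w * (LINT x:cell w|vicsek_mu. f x)"

lemma continuous_integrable_mu:
  fixes f :: "real \<times> real \<Rightarrow> real"
  assumes "continuous_on vicsek_set f" "w \<in> vicsek_words n"
  shows "set_integrable vicsek_mu (cell w) f"
proof -
  obtain B where B: "\<And>x. x \<in> vicsek_set \<Longrightarrow> norm (f x) \<le> B"
    using compact_imp_bounded[OF compact_continuous_image[OF assms(1) compact_K]] unfolding bounded_iff by blast
  interpret finite_measure vicsek_mu by (rule finite_measure_mu)
  have int: "integrable vicsek_mu f"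
    using B continuous_measurable_mu[OF assms(1)] by (auto intro!: integrable_const_bound[where B = B] simp: space_mu)
  show ?thesis unfolding set_integrable_def
    by (rule integrable_mult_indicator) (use cell_sets[OF assms(2)] int in auto)
qed

lemma avg_jensen:
  assumes f: "continuous_on vicsek_set f" and w: "w \<in> vicsek_words n" and p: "1 \<le> p"
  shows "ennreal (\<bar>avg f w - c\<bar> powr p) \<le> ennreal (5 ^ n) * (\<integral>\<^sup>+x\<in>cell w. ennreal (\<bar>f x - c\<bar> powr p) \<partial>vicsek_mu)"
proof -
  have cont: "continuous_on vicsek_set (\<lambda>x. f x - c)" using f by (intro continuous_intros)
  note int = continuous_integrable_mu[OF cont w]
  have "(LINT x:cell w|vicsek_mu. f x - c) = (LINT x:cell w|vicsek_mu. f x) - (1/5) ^ n * c"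
    using continuous_integrable_mu[OF f w] continuous_integrable_mu[OF continuous_on_const w, of c] measure_cell[OF w] cell_sets[OF w]
    by (subst set_integral_diff) (auto simp: set_lebesgue_integral_def Int_absorb2 sets.sets_into_space)
  then have av: "avg f w - c = 5 ^ n * (LINT x:cell w|vicsek_mu. f x - c)"
    using w by (simp add: avg_def length_words right_diff_distrib power_one_over)
  have "ennreal (\<bar>avg f w - c\<bar> powr p) = ennreal ((5 ^ n) powr p) * ennreal (\<bar>LINT x:cell w|vicsek_mu. f x - c\<bar> powr p)"
    unfolding av by (simp add: abs_mult powr_mult ennreal_mult)
  also have "\<dots> \<le> ennreal ((5 ^ n) powr p) * (ennreal (((1/5) ^ n) powr (p - 1)) * (\<integral>\<^sup>+x\<in>cell w. ennreal (\<bar>f x - c\<bar> powr p) \<partial>vicsek_mu))"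
    using jensen_powr[OF cell_sets[OF w] emeasure_cell[OF w] _ int p] by (intro mult_left_mono) auto
  also have "\<dots> = ennreal ((5 ^ n) powr p * ((1/5) ^ n) powr (p - 1)) * (\<integral>\<^sup>+x\<in>cell w. ennreal (\<bar>f x - c\<bar> powr p) \<partial>vicsek_mu)"
    by (simp add: ennreal_mult mult.assoc)
  also have "(5 ^ n) powr p * ((1/5) ^ n) powr (p - 1) = (5::real) ^ n"
  proof -
    have "a powr p * inverse a powr (p - 1) = a" if "0 < a" for a :: real
    proof -
      have "inverse a powr (p - 1) = (a powr -1) powr (p - 1)" using that by (simp add: powr_neg_one inverse_eq_divide)
      also have "\<dots> = a powr (1 - p)" by (subst powr_powr) simp
      finally show ?thesis using that by (simp flip: powr_add)
    qed
    from this[of "5 ^ n"] show ?thesis by (simp add: power_one_over inverse_eq_divide)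
  qed
  finally show ?thesis .
qed

text \<open>Not normalised: the factors 25^n in later bounds are the inverse square of the mass of a
  cell of level n.\<close>

definition cell_energy :: "real \<Rightarrow> (real \<times> real \<Rightarrow> real) \<Rightarrow> nat list \<Rightarrow> ennreal" where
  "cell_energy p f w = (\<integral>\<^sup>+x\<in>cell w. (\<integral>\<^sup>+y\<in>cell w. ennreal (\<bar>f y - f x\<bar> powr p) \<partial>vicsek_mu) \<partial>vicsek_mu)"

text \<open>Jensen twice, over the child and over the parent, gives 5^(n+1) * 5^n; the outer
  integral is then enlarged from the child to the parent.\<close>

lemma avg_child_diff:
  assumes f: "continuous_on vicsek_set f" and w: "w \<in> vicsek_words n" and p: "1 \<le> p" and c: "c \<in> {1..5}"
  shows "ennreal (\<bar>avg f (w @ [c]) - avg f w\<bar> powr p) \<le> ennreal (5 * 25 ^ n) * cell_energy p f w"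
proof -
  have wc: "w @ [c] \<in> vicsek_words (Suc n)" using words_snoc[OF w c] .
  have sub: "cell (w @ [c]) \<subseteq> cell w" by (rule cell_append_subset[of _ 1]) (use c in \<open>auto simp: words_1\<close>)
  have "ennreal (\<bar>avg f (w @ [c]) - avg f w\<bar> powr p) \<le>
     ennreal (5 ^ Suc n) * (\<integral>\<^sup>+x\<in>cell (w @ [c]). ennreal (\<bar>f x - avg f w\<bar> powr p) \<partial>vicsek_mu)"
    by (rule avg_jensen[OF f wc p])
  also have "\<dots> \<le> ennreal (5 ^ Suc n) * (\<integral>\<^sup>+x. ennreal (5 ^ n) * ((\<integral>\<^sup>+y\<in>cell w. ennreal (\<bar>f y - f x\<bar> powr p) \<partial>vicsek_mu) * indicator (cell w) x) \<partial>vicsek_mu)"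
  proof (intro mult_left_mono nn_integral_mono)
    fix x
    have "ennreal (\<bar>f x - avg f w\<bar> powr p) \<le> ennreal (5 ^ n) * (\<integral>\<^sup>+y\<in>cell w. ennreal (\<bar>f y - f x\<bar> powr p) \<partial>vicsek_mu)"
      using avg_jensen[OF f w p, of "f x"] by (simp add: abs_minus_commute)
    then show "ennreal (\<bar>f x - avg f w\<bar> powr p) * indicator (cell (w @ [c])) x \<le>
        ennreal (5 ^ n) * ((\<integral>\<^sup>+y\<in>cell w. ennreal (\<bar>f y - f x\<bar> powr p) \<partial>vicsek_mu) * indicator (cell w) x)"
      using sub by (auto simp: indicator_def)
  qed auto
  also have "\<dots> = ennreal (5 ^ Suc n) * (ennreal (5 ^ n) * cell_energy p f w)"
    unfolding cell_energy_def
    using continuous_measurable_mu[OF f] cell_sets[OF w] finite_measure.axioms(1)[OF finite_measure_mu]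
    by (subst nn_integral_cmult) (auto intro!: borel_measurable_times_ennreal sigma_finite_measure.borel_measurable_nn_integral)
  also have "\<dots> = ennreal (5 * 25 ^ n) * cell_energy p f w"
  proof -
    have "(5::real) ^ Suc n * 5 ^ n = 5 * 25 ^ n" by (simp flip: power_mult_distrib)
    moreover have "ennreal (5 ^ Suc n) * (ennreal (5 ^ n) * X) = ennreal (5 ^ Suc n * 5 ^ n) * X" for X
      by (subst ennreal_mult) (auto simp: mult.assoc)
    ultimately show ?thesis by metis
  qed
  finally show ?thesis .
qed

lemma avg_bound:
  assumes f: "continuous_on vicsek_set f" and w: "w \<in> vicsek_words n" and c: "\<And>x. x \<in> cell w \<Longrightarrow> \<bar>f x - c\<bar> \<le> e" "0 \<le> e"
  shows "\<bar>avg f w - c\<bar> \<le> e"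
proof -
  have "ennreal (\<bar>avg f w - c\<bar> powr 1) \<le> ennreal (5 ^ n) * (\<integral>\<^sup>+x\<in>cell w. ennreal (\<bar>f x - c\<bar> powr 1) \<partial>vicsek_mu)"
    by (rule avg_jensen[OF f w]) simp
  also have "\<dots> \<le> ennreal (5 ^ n) * (\<integral>\<^sup>+x. ennreal e * indicator (cell w) x \<partial>vicsek_mu)"
    using c by (intro mult_left_mono nn_integral_mono) (auto simp: indicator_def intro: ennreal_leI)
  also have "\<dots> = ennreal (5 ^ n) * (ennreal e * ennreal ((1/5) ^ n))"
    using cell_sets[OF w] emeasure_cell[OF w] by (simp add: nn_integral_cmult_indicator)
  also have "\<dots> = ennreal e"
    using c(2) by (simp add: ennreal_mult[symmetric] power_one_over)
  finally show ?thesis using c(2) by simp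
qed

lemma replicate_fixed: "vicsek_psi_word (replicate N c) (vicsek_q c) = vicsek_q c"
  by (induction N) (auto simp: psi_word_Cons)

text \<open>\<open>vicsek_psi c\<close> fixes \<open>vicsek_q c\<close>, so repeating c shrinks the
  cells to the vertex, where f is continuous.\<close>

lemma avg_tendsto:
  assumes f: "continuous_on vicsek_set f" and w: "w \<in> vicsek_words n" and c: "c \<in> {1..5}"
  shows "(\<lambda>N. avg f (w @ replicate N c)) \<longlonglongrightarrow> f (vicsek_psi_word w (vicsek_q c))"
proof (rule LIMSEQ_I)
  let ?z = "vicsek_psi_word w (vicsek_q c)"
  fix e :: real assume e: "0 < e"
  have z: "?z \<in> vicsek_set" using psi_word_K[OF w] q_in_K[OF c] by blast
  have rep: "w @ replicate N c \<in> vicsek_words (n + N)" for N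
    using w c by (intro words_append) (auto simp: vicsek_words_def)
  obtain d where d: "0 < d" "\<And>x. x \<in> vicsek_set \<Longrightarrow> dist x ?z < d \<Longrightarrow> dist (f x) (f ?z) < e / 2"
    using f z e unfolding continuous_on_iff by (meson half_gt_zero)
  obtain N0 where N0: "2 / 3 ^ N0 < d" using power3_eventually_small[OF d(1)] by blast
  have "\<bar>avg f (w @ replicate N c) - f ?z\<bar> \<le> e / 2" if N: "N0 \<le> N" for N
  proof (rule avg_bound[OF f rep])
    fix x assume x: "x \<in> cell (w @ replicate N c)"
    have "?z \<in> cell (w @ replicate N c)"
      using q_in_K[OF c] replicate_fixed[of N c] unfolding cell_def psi_word_append
      by (intro image_eqI[of _ _ "vicsek_q c"]) auto
    then have "dist x ?z \<le> 2 / 3 ^ length (w @ replicate N c)" using x by (intro dist_cell)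
    also have "\<dots> \<le> 2 / 3 ^ N0" using N by (intro divide_left_mono power_increasing) auto
    also have "\<dots> < d" by (rule N0)
    finally have "dist x ?z < d" .
    moreover have "x \<in> vicsek_set" using cell_subset_K[OF rep] x by blast
    ultimately show "\<bar>f x - f ?z\<bar> \<le> e / 2"
      using d(2)[of x] by (simp add: dist_real_def)
  qed (use e in auto)
  then show "\<exists>no. \<forall>N\<ge>no. norm (avg f (w @ replicate N c) - f ?z) < e"
    using e by (intro exI[of _ N0]) (fastforce simp: real_norm_def)
qed

text \<open>Solution of the recursion \<open>telescope_fixed\<close>. The 25 is five children times
  the factor 5 of \<open>avg_child_diff\<close>.\<close>

definition telescope_const :: "real \<Rightarrow> real" where
  "telescope_const p = 25 * 2 powr (p - 1) / (1 - 2 powr (p - 1) * 3 powr (- (p - 1)))"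

lemma telescope_ratio: "1 < p \<Longrightarrow> 2 powr (p - 1) * 3 powr (- (p - 1)) < (1::real)"
proof -
  assume p: "1 < p"
  have "2 powr (p - 1) < (3::real) powr (p - 1)" using p by (intro powr_less_mono2) auto
  then show ?thesis unfolding powr_minus by (simp add: field_simps)
qed

lemma telescope_const_nonneg: "1 < p \<Longrightarrow> 0 \<le> telescope_const p"
  using telescope_ratio[of p] unfolding telescope_const_def by (intro divide_nonneg_pos) auto

lemma telescope_fixed:
  "1 < p \<Longrightarrow> 2 powr (p - 1) * (telescope_const p * 3 powr (- (p - 1)) + 25) = telescope_const p"
proof -
  assume p: "1 < p"
  have "a * (25 * a / (1 - a * b) * b + 25) = 25 * a / (1 - a * b)" if "a * b < 1" for a b :: real
    using that by (simp add: field_simps)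
  from this[OF telescope_ratio[OF p]] show ?thesis unfolding telescope_const_def .
qed

text \<open>Telescoping the cell averages along the cells shrinking to a vertex; the geometric factor
  is \<open>(2 / 3) powr (p - 1) < 1\<close>.\<close>

lemma sum_avg_diff_le:
  assumes p: "1 < p" and f: "continuous_on vicsek_set f" and A: "0 \<le> A"
    and cells: "\<And>n. n0 \<le> n \<Longrightarrow> (\<Sum>w\<in>vicsek_words n. ennreal (25 ^ n) * cell_energy p f w) \<le> ennreal (A * 3 powr (- (p - 1) * n))"
  shows "n0 \<le> n \<Longrightarrow> (\<Sum>w\<in>vicsek_words n. \<Sum>c\<in>{1..5}. \<bar>avg f (w @ replicate N c) - avg f w\<bar> powr p)
     \<le> telescope_const p * A * 3 powr (- (p - 1) * n)"
proof (induction N arbitrary: n)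
  case 0
  then show ?case using p A telescope_const_nonneg[OF p] by simp
next
  case (Suc N)
  let ?W = "vicsek_words n" and ?C = "{1..5::nat}"
  let ?r = "\<lambda>N w c. \<bar>avg f (w @ replicate N c) - avg f w\<bar> powr p"
  let ?d = "\<lambda>w c. \<bar>avg f (w @ [c]) - avg f w\<bar> powr p"
  have d: "(\<Sum>w\<in>?W. \<Sum>c\<in>?C. ?d w c) \<le> 25 * (A * 3 powr (- (p - 1) * n))"
  proof -
    have "ennreal (\<Sum>w\<in>?W. \<Sum>c\<in>?C. ?d w c) = (\<Sum>w\<in>?W. \<Sum>c\<in>?C. ennreal (?d w c))"
      by (simp add: sum_ennreal sum_nonneg)
    also have "\<dots> \<le> (\<Sum>w\<in>?W. \<Sum>c\<in>?C. ennreal (5 * 25 ^ n) * cell_energy p f w)"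
      using avg_child_diff[OF f] p by (intro sum_mono) auto
    also have "\<dots> = (\<Sum>w\<in>?W. ennreal 25 * (ennreal (25 ^ n) * cell_energy p f w))"
    proof (rule sum.cong[OF refl])
      fix w
      have "(\<Sum>c\<in>?C. ennreal (5 * 25 ^ n) * cell_energy p f w) = ennreal 5 * (ennreal (5 * 25 ^ n) * cell_energy p f w)" by simp
      also have "\<dots> = ennreal (5 * (5 * 25 ^ n)) * cell_energy p f w"
        by (subst ennreal_mult) (auto simp: mult.assoc)
      also have "\<dots> = ennreal (25 * 25 ^ n) * cell_energy p f w" by simp
      also have "\<dots> = ennreal 25 * (ennreal (25 ^ n) * cell_energy p f w)"
        by (subst ennreal_mult) (auto simp: mult.assoc)
      finally show "(\<Sum>c\<in>?C. ennreal (5 * 25 ^ n) * cell_energy p f w) = ennreal 25 * (ennreal (25 ^ n) * cell_energy p f w)" .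
    qed
    also have "\<dots> = ennreal 25 * (\<Sum>w\<in>?W. ennreal (25 ^ n) * cell_energy p f w)" by (rule sum_distrib_left[symmetric])
    also have "\<dots> \<le> ennreal 25 * ennreal (A * 3 powr (- (p - 1) * n))"
      using cells[OF Suc.prems] by (rule mult_left_mono) simp
    also have "\<dots> = ennreal (25 * (A * 3 powr (- (p - 1) * n)))" using A by (subst ennreal_mult) auto
    finally show ?thesis using A by (subst (asm) ennreal_le_iff) auto
  qed
  \<comment> \<open>Only continuations repeating the letter c occur; allowing all letters after
    \<open>w @ [c]\<close> produces the full sum of level n + 1.\<close>
  have IH: "(\<Sum>w\<in>?W. \<Sum>c\<in>?C. ?r N (w @ [c]) c) \<le> telescope_const p * A * 3 powr (- (p - 1) * Suc n)"
  proof -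
    have "(\<Sum>w\<in>?W. \<Sum>c\<in>?C. ?r N (w @ [c]) c) \<le> (\<Sum>w\<in>?W. \<Sum>c\<in>?C. \<Sum>c'\<in>?C. ?r N (w @ [c]) c')"
      by (intro sum_mono member_le_sum[where f = "\<lambda>c'. ?r N (_ @ [_]) c'"]) auto
    also have "\<dots> = (\<Sum>v\<in>vicsek_words (Suc n). \<Sum>c'\<in>?C. ?r N v c')" by (simp only: sum_words_Suc)
    also have "\<dots> \<le> telescope_const p * A * 3 powr (- (p - 1) * Suc n)" using Suc.IH[of "Suc n"] Suc.prems by simp
    finally show ?thesis .
  qed
  have "(\<Sum>w\<in>?W. \<Sum>c\<in>?C. ?r (Suc N) w c) \<le> (\<Sum>w\<in>?W. \<Sum>c\<in>?C. 2 powr (p - 1) * (?r N (w @ [c]) c + ?d w c))"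
  proof (intro sum_mono)
    fix w c
    have "avg f (w @ replicate (Suc N) c) - avg f w
       = (avg f ((w @ [c]) @ replicate N c) - avg f (w @ [c])) + (avg f (w @ [c]) - avg f w)" by simp
    then show "?r (Suc N) w c \<le> 2 powr (p - 1) * (?r N (w @ [c]) c + ?d w c)"
      using abs_add2_powr_le[of p "avg f ((w @ [c]) @ replicate N c) - avg f (w @ [c])" "avg f (w @ [c]) - avg f w"] p by simp
  qed
  also have "\<dots> = 2 powr (p - 1) * ((\<Sum>w\<in>?W. \<Sum>c\<in>?C. ?r N (w @ [c]) c) + (\<Sum>w\<in>?W. \<Sum>c\<in>?C. ?d w c))"
    by (simp only: sum.distrib sum_distrib_left[symmetric])
  also have "\<dots> \<le> 2 powr (p - 1) * (telescope_const p * A * 3 powr (- (p - 1) * Suc n) + 25 * (A * 3 powr (- (p - 1) * n)))"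
    using d IH by (intro mult_left_mono add_mono) auto
  also have "3 powr (- (p - 1) * Suc n) = 3 powr (- (p - 1)) * 3 powr (- (p - 1) * n)"
    by (simp add: algebra_simps flip: powr_add)
  also have "2 powr (p - 1) * (telescope_const p * A * (3 powr (- (p - 1)) * 3 powr (- (p - 1) * n)) + 25 * (A * 3 powr (- (p - 1) * n)))
     = (2 powr (p - 1) * (telescope_const p * 3 powr (- (p - 1)) + 25)) * (A * 3 powr (- (p - 1) * n))"
    by (simp only: distrib_left distrib_right mult_ac)
  also have "\<dots> = telescope_const p * A * 3 powr (- (p - 1) * n)"
    unfolding telescope_fixed[OF p] by (simp only: mult.assoc)
  finally show ?case .
qed

text \<open>Each increment passes through the average over its cell. The cell bounds hold only from
  level n0 on, and monotonicity of the energy carries the estimate down to any level m.\<close>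

lemma energy_le_of_cell_energy:
  assumes p: "1 < p" and f: "continuous_on vicsek_set f" and A: "0 \<le> A"
    and cells: "\<And>n. n0 \<le> n \<Longrightarrow> (\<Sum>w\<in>vicsek_words n. ennreal (25 ^ n) * cell_energy p f w) \<le> ennreal (A * 3 powr (- (p - 1) * n))"
  shows "energy p m f \<le> 4 * 2 powr (p - 1) * telescope_const p * A"
proof -
  define n where "n = max m n0"
  let ?W = "vicsek_words n" and ?C = "{1..5::nat}"
  let ?g = "\<lambda>w c. \<bar>f (vicsek_psi_word w (vicsek_q c)) - avg f w\<bar> powr p"
  have "(\<Sum>w\<in>?W. \<Sum>c\<in>?C. ?g w c) \<le> telescope_const p * A * 3 powr (- (p - 1) * n)"
  proof (rule LIMSEQ_le_const2)
    show "(\<lambda>N. \<Sum>w\<in>?W. \<Sum>c\<in>?C. \<bar>avg f (w @ replicate N c) - avg f w\<bar> powr p) \<longlonglongrightarrow> (\<Sum>w\<in>?W. \<Sum>c\<in>?C. ?g w c)"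
      using p by (intro tendsto_sum tendsto_powr' tendsto_rabs tendsto_diff tendsto_const avg_tendsto[OF f]) auto
    show "\<exists>M. \<forall>N\<ge>M. (\<Sum>w\<in>?W. \<Sum>c\<in>?C. \<bar>avg f (w @ replicate N c) - avg f w\<bar> powr p) \<le> telescope_const p * A * 3 powr (- (p - 1) * n)"
      using sum_avg_diff_le[OF p f A cells, of n0] by (auto simp: n_def)
  qed
  then have "3 powr ((p - 1) * n) * (\<Sum>w\<in>?W. \<Sum>c\<in>?C. ?g w c) \<le> 3 powr ((p - 1) * n) * (telescope_const p * A * 3 powr (- (p - 1) * n))"
    by (intro mult_left_mono) auto
  also have "3 powr ((p - 1) * n) * (telescope_const p * A * 3 powr (- (p - 1) * n)) = telescope_const p * A * (3 powr ((p - 1) * n) * 3 powr (- (p - 1) * n))"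
    by (simp only: mult_ac)
  also have "3 powr ((p - 1) * n) * 3 powr (- (p - 1) * n) = (1::real)"
    unfolding mult_minus_left powr_minus by simp
  finally have *: "3 powr ((p - 1) * n) * (\<Sum>w\<in>?W. \<Sum>c\<in>?C. ?g w c) \<le> telescope_const p * A" by (simp only: mult_1_right)
  have "energy p n f \<le> 3 powr ((p - 1) * n) * (\<Sum>w\<in>?W. 4 * 2 powr (p - 1) * (\<Sum>c\<in>?C. ?g w c))"
    unfolding energy_def
  proof (intro mult_left_mono sum_mono)
    fix w
    have "(\<Sum>i\<in>{1..4}. \<bar>incr f w i\<bar> powr p) \<le> (\<Sum>i\<in>{1..4::nat}. 2 powr (p - 1) * (\<Sum>c\<in>?C. ?g w c))"
    proof (rule sum_mono)
      fix i assume i: "i \<in> {1..4::nat}"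
      have "\<bar>incr f w i\<bar> powr p \<le> 2 powr (p - 1) * (?g w i + ?g w 5)"
        using abs_add2_powr_le[of p "f (vicsek_psi_word w (vicsek_q i)) - avg f w" "avg f w - f (vicsek_psi_word w 0)"] p
        by (simp add: incr_def abs_minus_commute)
      also have "?g w i + ?g w 5 = (\<Sum>c\<in>{i, 5}. ?g w c)" using i by auto
      also have "\<dots> \<le> (\<Sum>c\<in>?C. ?g w c)" using i by (intro sum_mono2) auto
      finally show "\<bar>incr f w i\<bar> powr p \<le> 2 powr (p - 1) * (\<Sum>c\<in>?C. ?g w c)" by (simp add: mult_left_mono)
    qed
    then show "(\<Sum>i\<in>{1..4}. \<bar>incr f w i\<bar> powr p) \<le> 4 * 2 powr (p - 1) * (\<Sum>c\<in>?C. ?g w c)" by simp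
  qed auto
  also have "\<dots> = 4 * 2 powr (p - 1) * (3 powr ((p - 1) * n) * (\<Sum>w\<in>?W. \<Sum>c\<in>?C. ?g w c))"
    by (simp only: sum_distrib_left[symmetric] mult_ac)
  also have "\<dots> \<le> 4 * 2 powr (p - 1) * (telescope_const p * A)" using * by (intro mult_left_mono) auto
  finally have "energy p n f \<le> 4 * 2 powr (p - 1) * telescope_const p * A" by (simp only: mult.assoc)
  moreover have "energy p m f \<le> energy p n f" using p by (intro energy_mono) (auto simp: n_def)
  ultimately show ?thesis by linarith
qed

section \<open>From integrals over balls to integrals over cells\<close>

lemma AE_unique_cell: "AE x in vicsek_mu. \<forall>w\<in>vicsek_words n. \<forall>w'\<in>vicsek_words n. x \<in> cell w \<longrightarrow> x \<in> cell w' \<longrightarrow> w = w'"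
proof (rule AE_I)
  let ?F = "\<Union>w\<in>vicsek_words n. \<Union>w'\<in>vicsek_words n - {w}. cell w \<inter> cell w'"
  have F: "finite ?F" using cell_Int_finite by (intro finite_UN_I) auto
  have FK: "?F \<subseteq> vicsek_set" using cell_subset_K by blast
  show "{x \<in> space vicsek_mu. \<not> (\<forall>w\<in>vicsek_words n. \<forall>w'\<in>vicsek_words n. x \<in> cell w \<longrightarrow> x \<in> cell w' \<longrightarrow> w = w')} \<subseteq> ?F" by blast
  show "emeasure vicsek_mu ?F = 0" by (rule emeasure_mu_finite[OF F FK])
  show "?F \<in> sets vicsek_mu" by (rule closed_sets_mu[OF finite_imp_closed[OF F] FK])
qed

text \<open>The radius is the diameter bound of cells of level n, so a cell lies in the ball around
  each of its points. Cells overlap in null sets, so the integrals over the cells add up to at most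
  the integral over K.\<close>

lemma cell_energy_le_ks:
  assumes p: "1 < p" and f: "continuous_on vicsek_set f" and n: "1 \<le> n" and \<kappa>: "0 \<le> \<kappa>"
    and ks: "korevaar_schoen p f (2 / 3 ^ n) \<le> ennreal \<kappa>"
  shows "(\<Sum>w\<in>vicsek_words n. ennreal (25 ^ n) * cell_energy p f w) \<le>
    ennreal (45 * 2 powr (vicsek_alpha p * p) * \<kappa> powr p * 3 powr (- (p - 1) * n))"
proof -
  let ?r = "2 / 3 ^ n :: real"
  let ?W = "vicsek_words n"
  let ?j = "\<lambda>w x. \<integral>\<^sup>+y\<in>cell w. ennreal (\<bar>f y - f x\<bar> powr p) \<partial>vicsek_mu"
  let ?g = "\<lambda>x. \<integral>\<^sup>+y\<in>vicsek_ball x ?r. ennreal (\<bar>f y - f x\<bar> powr p) / emeasure vicsek_mu (vicsek_ball x ?r) \<partial>vicsek_mu"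
  define I where "I = (\<integral>\<^sup>+x. ?g x \<partial>vicsek_mu)"
  define R where "R = ?r powr vicsek_alpha p"
  have R: "0 < R" by (simp add: R_def)
  have fm[measurable]: "f \<in> borel_measurable vicsek_mu" by (rule continuous_measurable_mu[OF f])
  have sf: "sigma_finite_measure vicsek_mu" using finite_measure_mu by (rule finite_measure.axioms(1))
  have jm: "?j w \<in> borel_measurable vicsek_mu" if "w \<in> ?W" for w
  proof -
    have [measurable]: "cell w \<in> sets vicsek_mu" by (rule cell_sets[OF that])
    show ?thesis by (intro sigma_finite_measure.borel_measurable_nn_integral[OF sf]) measurable
  qed
  have g: "ennreal (5 ^ n / 45) * ?j w x \<le> ?g x" if w: "w \<in> ?W" and x: "x \<in> cell w" for w x
  proof -
    have xK: "x \<in> vicsek_set" using cell_subset_K[OF w] x by blast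
    define b where "b = measure vicsek_mu (vicsek_ball x ?r)"
    \<comment> \<open>The upper mass bound is used one level up, because 2 / 3^n is below sqrt 2 /
      3^(n-1) but not below sqrt 2 / 3^n; hence 9 / 5^(n-1) = 45 / 5^n.\<close>
    obtain k where k: "n = Suc k" using n by (cases n) auto
    have "?r < sqrt 2 / 3 ^ k"
    proof -
      have "?r = (2/3) / 3 ^ k" by (simp add: k)
      also have "\<dots> < sqrt 2 / 3 ^ k"
      proof (rule divide_strict_right_mono)
        show "2 / 3 < sqrt 2" using one_less_sqrt2 by linarith
      qed simp
      finally show ?thesis .
    qed
    then have "b \<le> 9 * (1/5) ^ k" unfolding b_def by (rule ball_measure_upper[OF xK])
    then have b: "b \<le> 45 / 5 ^ n" by (simp add: k power_one_over)
    have "(1/5) ^ n \<le> b" unfolding b_def by (rule ball_measure_lower[OF xK]) simp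
    then have b0: "0 < b" by (rule less_le_trans[rotated]) simp
    have sub: "cell w \<subseteq> vicsek_ball x ?r"
      using gd_cell[OF w x] cell_subset_K[OF w] by (force simp: vicsek_ball_def)
    have "ennreal (5 ^ n / 45) * ?j w x = (\<integral>\<^sup>+y. ennreal (5 ^ n / 45) * (ennreal (\<bar>f y - f x\<bar> powr p) * indicator (cell w) y) \<partial>vicsek_mu)"
      using cell_sets[OF w] by (intro nn_integral_cmult[symmetric]) (auto intro!: borel_measurable_times_ennreal)
    also have "\<dots> \<le> ?g x"
    proof (rule nn_integral_mono)
      fix y
      have "5 ^ n / 45 * \<bar>f y - f x\<bar> powr p \<le> \<bar>f y - f x\<bar> powr p / b"
      proof -
        have "b * (5 ^ n / 45) \<le> 45 / 5 ^ n * (5 ^ n / 45)" using b by (intro mult_right_mono) auto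
        then have "5 ^ n / 45 \<le> 1 / b" using b0 by (simp add: pos_le_divide_eq mult.commute)
        then have "5 ^ n / 45 * \<bar>f y - f x\<bar> powr p \<le> 1 / b * \<bar>f y - f x\<bar> powr p" by (intro mult_right_mono) auto
        then show ?thesis by simp
      qed
      then have "ennreal (5 ^ n / 45) * ennreal (\<bar>f y - f x\<bar> powr p) \<le> ennreal (\<bar>f y - f x\<bar> powr p) / emeasure vicsek_mu (vicsek_ball x ?r)"
        using b0 by (simp add: emeasure_mu_eq_measure b_def[symmetric] divide_ennreal ennreal_mult[symmetric] ennreal_leI)
      then show "ennreal (5 ^ n / 45) * (ennreal (\<bar>f y - f x\<bar> powr p) * indicator (cell w) y)
         \<le> ennreal (\<bar>f y - f x\<bar> powr p) / emeasure vicsek_mu (vicsek_ball x ?r) * indicator (vicsek_ball x ?r) y"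
        using sub by (auto simp: indicator_def mult.assoc)
    qed
    finally show ?thesis .
  qed
  have "(\<Sum>w\<in>?W. ennreal (5 ^ n / 45) * cell_energy p f w) = (\<integral>\<^sup>+x. (\<Sum>w\<in>?W. ennreal (5 ^ n / 45) * (?j w x * indicator (cell w) x)) \<partial>vicsek_mu)"
    unfolding cell_energy_def using jm cell_sets by (subst nn_integral_sum) (auto intro!: sum.cong nn_integral_cmult[symmetric] borel_measurable_times_ennreal)
  also have "\<dots> \<le> I"
    unfolding I_def
  proof (rule nn_integral_mono_AE, use AE_unique_cell[of n] in eventually_elim)
    case (elim x)
    show ?case
    proof (cases "\<exists>w\<in>?W. x \<in> cell w")
      case True
      then obtain w where w: "w \<in> ?W" "x \<in> cell w" by blast
      have "(\<Sum>v\<in>?W. ennreal (5 ^ n / 45) * (?j v x * indicator (cell v) x)) = (\<Sum>v\<in>{w}. ennreal (5 ^ n / 45) * (?j v x * indicator (cell v) x))"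
        using elim w by (intro sum.mono_neutral_right) (auto simp: indicator_def)
      also have "\<dots> \<le> ?g x" using g[OF w] w by simp
      finally show ?thesis .
    next
      case False
      then have "(\<Sum>v\<in>?W. ennreal (5 ^ n / 45) * (?j v x * indicator (cell v) x)) = 0"
        by (intro sum.neutral) (auto simp: indicator_def)
      from ord_eq_le_trans[OF this zero_le] show ?thesis .
    qed
  qed
  also have "I \<le> ennreal ((\<kappa> * R) powr p)"
  proof -
    have "ennreal (1 / R) * ennreal_powr I (1 / p) \<le> ennreal \<kappa>"
      using ks by (simp add: korevaar_schoen_def I_def R_def)
    then have "ennreal R * (ennreal (1 / R) * ennreal_powr I (1 / p)) \<le> ennreal R * ennreal \<kappa>" by (rule mult_left_mono) simp
    also have "ennreal R * (ennreal (1 / R) * ennreal_powr I (1 / p)) = (ennreal R * ennreal (1 / R)) * ennreal_powr I (1 / p)"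
      by (simp only: mult.assoc)
    also have "ennreal R * ennreal (1 / R) = 1" using R by (subst ennreal_mult[symmetric]) auto
    also have "ennreal R * ennreal \<kappa> = ennreal (\<kappa> * R)" using R \<kappa> by (subst ennreal_mult[symmetric]) (auto simp: mult.commute)
    finally have "ennreal_powr I (1 / p) \<le> ennreal (\<kappa> * R)" by simp
    from ennreal_le_powr[OF this] show ?thesis using R \<kappa> p by simp
  qed
  finally have *: "(\<Sum>w\<in>?W. ennreal (5 ^ n / 45) * cell_energy p f w) \<le> ennreal ((\<kappa> * R) powr p)" .
  have "(\<kappa> * R) powr p = \<kappa> powr p * 2 powr (vicsek_alpha p * p) * (1 / 3 ^ n) powr (vicsek_alpha p * p)"
  proof -
    have "R powr p = (2 * (1 / 3 ^ n)) powr (vicsek_alpha p * p)" by (simp add: R_def powr_powr)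
    also have "\<dots> = 2 powr (vicsek_alpha p * p) * (1 / 3 ^ n) powr (vicsek_alpha p * p)" by (rule powr_mult)
    finally show ?thesis using R \<kappa> by (simp add: powr_mult)
  qed
  also have "\<dots> = \<kappa> powr p * 2 powr (vicsek_alpha p * p) * (3 powr (- (p - 1) * n) * (1/5) ^ n)"
    unfolding scale_powr_alpha[OF p] ..
  finally have eq: "45 * 5 ^ n * (\<kappa> * R) powr p = 45 * 2 powr (vicsek_alpha p * p) * \<kappa> powr p * 3 powr (- (p - 1) * n)"
    by (simp add: power_one_over)
  have "(\<Sum>w\<in>?W. ennreal (25 ^ n) * cell_energy p f w) = ennreal (45 * 5 ^ n) * (\<Sum>w\<in>?W. ennreal (5 ^ n / 45) * cell_energy p f w)"
    unfolding sum_distrib_left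
  proof (rule sum.cong[OF refl])
    fix w
    have "(45 * 5 ^ n) * (5 ^ n / 45) = (25::real) ^ n" by (simp flip: power_mult_distrib)
    then show "ennreal (25 ^ n) * cell_energy p f w = ennreal (45 * 5 ^ n) * (ennreal (5 ^ n / 45) * cell_energy p f w)"
      by (simp add: ennreal_mult[symmetric] flip: mult.assoc)
  qed
  also have "\<dots> \<le> ennreal (45 * 5 ^ n) * ennreal ((\<kappa> * R) powr p)" using * by (rule mult_left_mono) simp
  also have "\<dots> = ennreal (45 * 5 ^ n * (\<kappa> * R) powr p)" by (subst ennreal_mult) auto
  finally show ?thesis unfolding eq .
qed

definition energy_const :: "real \<Rightarrow> real" where
  "energy_const p = 4 * 2 powr (p - 1) * telescope_const p * (45 * 2 powr (vicsek_alpha p * p))"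

lemma energy_const_nonneg: "1 < p \<Longrightarrow> 0 \<le> energy_const p"
  using telescope_const_nonneg[of p] by (simp add: energy_const_def)

text \<open>A limsup strictly below \<kappa> bounds the functional for all small radii, in
  particular for 2 / 3^n with n large. The bound on the energy then holds at every level.\<close>

lemma energy_le_W_norm:
  assumes p: "1 < p" and f: "continuous_on vicsek_set f" and \<kappa>: "0 \<le> \<kappa>" "W_norm (ereal p) f < ennreal \<kappa>"
  shows "energy p m f \<le> energy_const p * \<kappa> powr p"
proof -
  have "eventually (\<lambda>r. korevaar_schoen p f r < ennreal \<kappa>) (at_right 0)"
    using \<kappa>(2) by (intro Limsup_lessD) (simp add: W_norm_def)
  then obtain b where b: "0 < b" "\<And>r. 0 < r \<Longrightarrow> r < b \<Longrightarrow> korevaar_schoen p f r < ennreal \<kappa>"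
    unfolding eventually_at_right_field by auto
  obtain n0 where n0: "2 / 3 ^ n0 < b" using power3_eventually_small[OF b(1)] by blast
  have "energy p m f \<le> 4 * 2 powr (p - 1) * telescope_const p * (45 * 2 powr (vicsek_alpha p * p) * \<kappa> powr p)"
  proof (rule energy_le_of_cell_energy[OF p f])
    fix n assume n: "max 1 n0 \<le> n"
    have "(2::real) / 3 ^ n \<le> 2 / 3 ^ n0" using n by (intro divide_left_mono power_increasing) auto
    then have "korevaar_schoen p f (2 / 3 ^ n) \<le> ennreal \<kappa>" using b(2)[of "2 / 3 ^ n"] n0 by (intro less_imp_le) auto
    then show "(\<Sum>w\<in>vicsek_words n. ennreal (25 ^ n) * cell_energy p f w) \<le> ennreal (45 * 2 powr (vicsek_alpha p * p) * \<kappa> powr p * 3 powr (- (p - 1) * n))"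
      using n \<kappa> by (intro cell_energy_le_ks[OF p f]) auto
  qed simp
  then show ?thesis by (simp add: energy_const_def mult_ac)
qed

subsection \<open>The Lipschitz case\<close>

text \<open>Four steps of size L / 3^n lead between points in near cells, and 4 L / 3^n = 12 L /
  3^(n+1). At distance at least 1 the global oscillation 2 L suffices.\<close>

lemma lipschitz_of_incr:
  assumes f: "continuous_on vicsek_set f" and L: "\<And>m w i. w \<in> vicsek_words m \<Longrightarrow> i \<in> {1..4} \<Longrightarrow> \<bar>incr f w i\<bar> \<le> L / 3 ^ m"
    and xy: "x \<in> vicsek_set" "y \<in> vicsek_set"
  shows "\<bar>f x - f y\<bar> \<le> 12 * L * gd x y"
proof -
  have L0: "0 \<le> L" using L[of "[]" 0 1] by simp
  have osc: "\<bar>f x - f (vicsek_psi_word w 0)\<bar> \<le> L / 3 ^ n" if w: "w \<in> vicsek_words n" and x: "x \<in> cell w" for x w n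
  proof -
    obtain x' where x': "x' \<in> vicsek_set" "x = vicsek_psi_word w x'" using x unfolding cell_def by blast
    have "\<bar>(f \<circ> vicsek_psi_word w) x' - (f \<circ> vicsek_psi_word w) 0\<bar> \<le> L / 3 ^ n"
    proof (rule morrey_infinity_K[OF _ continuous_on_comp_psi_word[OF f w] x'(1)])
      fix m v i assume "v \<in> vicsek_words m" "i \<in> {1..4::nat}"
      then have "\<bar>incr f (w @ v) i\<bar> \<le> L / 3 ^ (n + m)" by (intro L words_append w)
      then show "\<bar>incr (f \<circ> vicsek_psi_word w) v i\<bar> \<le> L / 3 ^ n / 3 ^ m" by (simp add: incr_append power_add)
    qed
    then show ?thesis using x' by simp
  qed
  consider "x = y" | "x \<noteq> y" "1 \<le> gd x y" | "0 < gd x y" "gd x y < 1" using gd_pos[OF xy] by linarith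
  then show ?thesis
  proof cases
    case 1
    then show ?thesis using L0 gd_nonneg[OF xy] by simp
  next
    case 2
    have "\<bar>f x - f y\<bar> \<le> 2 * L" using osc[of "[]" 0 x] osc[of "[]" 0 y] xy by simp
    also have "\<dots> \<le> 12 * L" using L0 by simp
    also have "\<dots> \<le> 12 * L * gd x y" using L0 2 mult_left_mono[of 1 "gd x y" "12 * L"] by simp
    finally show ?thesis .
  next
    case 3
    obtain n where n: "1 / 3 ^ Suc n \<le> gd x y" "gd x y < 1 / 3 ^ n" using scale_exists[OF 3] .
    obtain w x' where w: "w \<in> vicsek_words n" "x' \<in> vicsek_set" "x = vicsek_psi_word w x'" using xy(1) by (rule K_cellE)
    obtain w' y' where w': "w' \<in> vicsek_words n" "y' \<in> vicsek_set" "y = vicsek_psi_word w' y'" using xy(2) by (rule K_cellE)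
    have c: "x \<in> cell w" "y \<in> cell w'" using w w' by (auto simp: cell_def)
    have "1 / 3 ^ n < sqrt 2 / 3 ^ n" by (rule divide_strict_right_mono) auto
    then have "near w w'" using n by (intro gd_small_imp_near[OF w(1) w'(1) c]) linarith
    then obtain z where z: "z \<in> cell w" "z \<in> cell w'" using near_common_point[OF w(1) w'(1)] by blast
    have "\<bar>f x - f y\<bar> \<le> 4 * (L / 3 ^ n)"
      using osc[OF w(1) c(1)] osc[OF w(1) z(1)] osc[OF w'(1) z(2)] osc[OF w'(1) c(2)] by linarith
    also have "\<dots> = 12 * L * (1 / 3 ^ Suc n)" by simp
    also have "\<dots> \<le> 12 * L * gd x y" using n L0 by (intro mult_left_mono) auto
    finally show ?thesis .
  qed
qed

text \<open>The factor 2 comes from bounding the length of the edge by the diameter bound of its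
  cell.\<close>

lemma incr_of_lipschitz:
  assumes L: "\<And>x y. x \<in> vicsek_set \<Longrightarrow> y \<in> vicsek_set \<Longrightarrow> \<bar>f x - f y\<bar> \<le> L * gd x y"
    and w: "w \<in> vicsek_words m" and i: "i \<in> {1..4}"
  shows "\<bar>incr f w i\<bar> \<le> 2 * L / 3 ^ m"
proof -
  let ?u = "vicsek_psi_word w (vicsek_q i)" and ?v = "vicsek_psi_word w 0"
  have c: "?u \<in> cell w" "?v \<in> cell w" using q_in_K[of i] zero_in_K i by (auto simp: cell_def)
  have K: "?u \<in> vicsek_set" "?v \<in> vicsek_set" using c cell_subset_K[OF w] by blast+
  have "0 < gd ?u ?v" using gd_pos[OF K] edge_endpoints_ne[OF i, of w] by metis
  moreover have "0 \<le> L * gd ?u ?v" using L[OF K] by linarith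
  ultimately have "0 \<le> L" by (simp add: zero_le_mult_iff)
  have "\<bar>incr f w i\<bar> \<le> L * gd ?u ?v" using L[OF K] by (simp add: incr_def)
  also have "\<dots> \<le> L * (2 / 3 ^ m)" using gd_cell[OF w c] \<open>0 \<le> L\<close> by (rule mult_left_mono)
  finally show ?thesis by (simp add: mult.commute)
qed

section \<open>Weak gradients\<close>

abbreviation edge_index :: "nat \<Rightarrow> (nat list \<times> nat) set" where
  "edge_index n \<equiv> vicsek_words n \<times> {1..4}"

text \<open>The distance to the centre is affine along an edge, so orientation is inherited by all
  of its subedges.\<close>

lemma gd_on_edge:
  assumes w: "w \<in> vicsek_words n" and i: "i \<in> {1..4}"
  obtains \<sigma> :: real where "\<sigma> = 1 \<or> \<sigma> = -1"
    "\<And>t. 0 \<le> t \<Longrightarrow> t \<le> 1 \<Longrightarrow> gd 0 (vicsek_psi_word w (t *\<^sub>R vicsek_q i)) = gd 0 (vicsek_psi_word w 0) + \<sigma> * t / 3 ^ n"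
proof -
  let ?a = "vicsek_psi_word w 0" and ?b = "vicsek_psi_word w (vicsek_q i)"
  have "0 \<in> vicsek_vertices n" using q_in_vertices[of 5 n] by simp
  then obtain c where c: "c = ?a \<or> c = ?b" "\<And>x. x \<in> edge w i \<Longrightarrow> cd 0 x = cd 0 c + dist c x"
    using cd_edge_affine[OF _ w i, of 0] by blast
  have pt: "vicsek_psi_word w (t *\<^sub>R vicsek_q i) \<in> edge w i" if "0 \<le> t" "t \<le> 1" for t
    unfolding edge_image using q_scaleR_segment[of t 1 "vicsek_q i"] that by simp
  have gd: "gd 0 x = cd 0 x" if "x \<in> edge w i" for x
    using edge_subset_skeleton[OF w i] zero_in_skeleton that by (intro gd_skeleton) blast+
  have d: "dist (vicsek_psi_word w (s *\<^sub>R vicsek_q i)) (vicsek_psi_word w (t *\<^sub>R vicsek_q i)) = \<bar>s - t\<bar> / 3 ^ n" for s t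
    unfolding dist_psi_word length_words[OF w]
    using norm_vicsek_q[OF i] by (simp add: dist_norm flip: scaleR_diff_left)
  show ?thesis
  proof (cases "c = ?a")
    case True
    show ?thesis
    proof (rule that[of 1])
      fix t :: real assume t: "0 \<le> t" "t \<le> 1"
      show "gd 0 (vicsek_psi_word w (t *\<^sub>R vicsek_q i)) = gd 0 (vicsek_psi_word w 0) + 1 * t / 3 ^ n"
        using gd[OF pt[OF t]] gd[OF pt[of 0]] c(2)[OF pt[OF t]] d[of 0 t] t True by simp
    qed simp
  next
    case False
    then have cb: "c = ?b" using c by blast
    show ?thesis
    proof (rule that[of "-1"])
      fix t :: real assume t: "0 \<le> t" "t \<le> 1"
      show "gd 0 (vicsek_psi_word w (t *\<^sub>R vicsek_q i)) = gd 0 (vicsek_psi_word w 0) + (-1) * t / 3 ^ n"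
        using gd[OF pt[OF t]] gd[OF pt[of 0]] c(2)[OF pt[OF t]] c(2)[OF pt[of 0]] d[of 1 t] d[of 1 0] t cb
        by (simp add: diff_divide_distrib)
    qed simp
  qed
qed

definition upward :: "nat list \<Rightarrow> nat \<Rightarrow> bool" where
  "upward w i \<longleftrightarrow> vicsek_below (vicsek_psi_word w 0) (vicsek_psi_word w (vicsek_q i))"

lemma not_upward_iff:
  assumes w: "w \<in> vicsek_words n" and i: "i \<in> {1..4}"
  shows "\<not> upward w i \<longleftrightarrow> vicsek_below (vicsek_psi_word w (vicsek_q i)) (vicsek_psi_word w 0)"
proof -
  obtain \<sigma> :: real where \<sigma>: "\<sigma> = 1 \<or> \<sigma> = -1"
    "\<And>t. 0 \<le> t \<Longrightarrow> t \<le> 1 \<Longrightarrow> gd 0 (vicsek_psi_word w (t *\<^sub>R vicsek_q i)) = gd 0 (vicsek_psi_word w 0) + \<sigma> * t / 3 ^ n"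
    using gd_on_edge[OF w i] by metis
  have "gd 0 (vicsek_psi_word w (vicsek_q i)) \<noteq> gd 0 (vicsek_psi_word w 0)" using \<sigma>(1) \<sigma>(2)[of 1] by auto
  then show ?thesis by (auto simp: upward_def vicsek_below_def)
qed

text \<open>In outward direction, the inner and outer thirds point the same way as the whole edge,
  but the middle third runs from 2/3 back to 1/3.\<close>

lemma upward_children:
  assumes w: "w \<in> vicsek_words n" and i: "i \<in> {1..4}"
  shows "upward (w @ [5]) i \<longleftrightarrow> upward w i" "upward (w @ [i]) (opp i) \<longleftrightarrow> \<not> upward w i" "upward (w @ [i]) i \<longleftrightarrow> upward w i"
proof -
  obtain \<sigma> :: real where \<sigma>: "\<sigma> = 1 \<or> \<sigma> = -1"
    "\<And>t. 0 \<le> t \<Longrightarrow> t \<le> 1 \<Longrightarrow> gd 0 (vicsek_psi_word w (t *\<^sub>R vicsek_q i)) = gd 0 (vicsek_psi_word w 0) + \<sigma> * t / 3 ^ n"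
    using gd_on_edge[OF w i] by metis
  have pts: "vicsek_psi_word (w @ [5]) 0 = vicsek_psi_word w 0"
    "vicsek_psi_word (w @ [5]) (vicsek_q i) = vicsek_psi_word w ((1/3) *\<^sub>R vicsek_q i)"
    "vicsek_psi_word (w @ [i]) (vicsek_q (opp i)) = vicsek_psi_word w ((1/3) *\<^sub>R vicsek_q i)"
    "vicsek_psi_word (w @ [i]) 0 = vicsek_psi_word w ((2/3) *\<^sub>R vicsek_q i)"
    "vicsek_psi_word (w @ [i]) (vicsek_q i) = vicsek_psi_word w (vicsek_q i)"
    by (simp_all add: psi_word_append vicsek_psi_eq vicsek_q_opp flip: scaleR_minus_left scaleR_add_left)
  have v: "gd 0 (vicsek_psi_word w ((1/3) *\<^sub>R vicsek_q i)) = gd 0 (vicsek_psi_word w 0) + \<sigma> * (1/3) / 3 ^ n"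
    "gd 0 (vicsek_psi_word w ((2/3) *\<^sub>R vicsek_q i)) = gd 0 (vicsek_psi_word w 0) + \<sigma> * (2/3) / 3 ^ n"
    "gd 0 (vicsek_psi_word w (vicsek_q i)) = gd 0 (vicsek_psi_word w 0) + \<sigma> * 1 / 3 ^ n"
    using \<sigma>(2)[of "1/3"] \<sigma>(2)[of "2/3"] \<sigma>(2)[of 1] by simp_all
  have up: "upward w i \<longleftrightarrow> \<sigma> = 1"
    using \<sigma>(1) unfolding upward_def vicsek_below_def vicsek_q_5 v by (elim disjE) simp_all
  show "upward (w @ [5]) i \<longleftrightarrow> upward w i" "upward (w @ [i]) (opp i) \<longleftrightarrow> \<not> upward w i" "upward (w @ [i]) i \<longleftrightarrow> upward w i"
    using \<sigma>(1) unfolding up upward_def vicsek_below_def vicsek_q_5 pts v by (elim disjE; simp add: field_simps)+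
qed

text \<open>Increment along the orientation of the edge. It adds over subedges without signs, see
  \<open>oincr_split\<close>, which is the martingale property of the slopes.\<close>

definition oincr :: "(real \<times> real \<Rightarrow> real) \<Rightarrow> nat list \<Rightarrow> nat \<Rightarrow> real" where
  "oincr f w i = (if upward w i then incr f w i else - incr f w i)"

lemma abs_oincr: "\<bar>oincr f w i\<bar> = \<bar>incr f w i\<bar>"
  by (simp add: oincr_def)

lemma oincr_split:
  "w \<in> vicsek_words n \<Longrightarrow> i \<in> {1..4} \<Longrightarrow>
    oincr f w i = oincr f (w @ [5]) i + oincr f (w @ [i]) (opp i) + oincr f (w @ [i]) i"
  using incr_split[of i f w] by (simp add: oincr_def upward_children)

lemma is_gradient_iff:
  "is_gradient p f g \<longleftrightarrow> g \<in> Lp_space p vicsek_nu \<and>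
     (\<forall>n. \<forall>w\<in>vicsek_words n. \<forall>i\<in>{1..4}. oincr f w i = (LINT x:edge w i|vicsek_nu. g x))"
proof -
  have "(\<forall>u v. vicsek_adj n u v \<and> vicsek_below u v \<longrightarrow> f v - f u = (LINT x:closed_segment u v|vicsek_nu. g x)) \<longleftrightarrow>
    (\<forall>w\<in>vicsek_words n. \<forall>i\<in>{1..4}. oincr f w i = (LINT x:edge w i|vicsek_nu. g x))" (is "?L \<longleftrightarrow> ?R") for n
  proof
    assume L: ?L
    show ?R
    proof (intro ballI)
      fix w i assume w: "w \<in> vicsek_words n" and i: "i \<in> {1..4::nat}"
      let ?a = "vicsek_psi_word w 0" and ?b = "vicsek_psi_word w (vicsek_q i)"
      have adj: "vicsek_adj n ?a ?b" "vicsek_adj n ?b ?a" unfolding adj_iff using w i by blast+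
      show "oincr f w i = (LINT x:edge w i|vicsek_nu. g x)"
      proof (cases "upward w i")
        case True
        then have "f ?b - f ?a = (LINT x:closed_segment ?a ?b|vicsek_nu. g x)"
          using L adj(1) unfolding upward_def by blast
        then show ?thesis using True by (simp add: oincr_def incr_def edge_def)
      next
        case False
        then have "vicsek_below ?b ?a" using not_upward_iff[OF w i] by blast
        then have "f ?a - f ?b = (LINT x:closed_segment ?b ?a|vicsek_nu. g x)" using L adj(2) by blast
        then show ?thesis using False by (simp add: oincr_def incr_def edge_def closed_segment_commute[of ?b ?a])
      qed
    qed
  next
    assume R: ?R
    show ?L
    proof (intro allI impI, elim conjE)
      fix u v assume adj: "vicsek_adj n u v" and below: "vicsek_below u v"
      obtain w i where w: "w \<in> vicsek_words n" and i: "i \<in> {1..4}" and uv: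
        "u = vicsek_psi_word w 0 \<and> v = vicsek_psi_word w (vicsek_q i) \<or>
         v = vicsek_psi_word w 0 \<and> u = vicsek_psi_word w (vicsek_q i)"
        using adj unfolding adj_iff by blast
      have r: "oincr f w i = (LINT x:edge w i|vicsek_nu. g x)" using R w i by blast
      from uv show "f v - f u = (LINT x:closed_segment u v|vicsek_nu. g x)"
      proof
        assume *: "u = vicsek_psi_word w 0 \<and> v = vicsek_psi_word w (vicsek_q i)"
        then have "upward w i" using below by (simp add: upward_def)
        then show ?thesis using r * by (simp add: oincr_def incr_def edge_def)
      next
        assume *: "v = vicsek_psi_word w 0 \<and> u = vicsek_psi_word w (vicsek_q i)"
        then have "\<not> upward w i" using below not_upward_iff[OF w i] by simp
        moreover have "closed_segment u v = edge w i"
          using * closed_segment_commute[of "vicsek_psi_word w (vicsek_q i)" "vicsek_psi_word w 0"] by (simp add: edge_def)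
        ultimately show ?thesis using r * by (simp add: oincr_def incr_def)
      qed
    qed
  qed
  then show ?thesis unfolding is_gradient_def by blast
qed

section \<open>Null sets of the length measure and subdivision of edge integrals\<close>

lemma AE_nu_not_in_finite:
  assumes "finite F" "F \<subseteq> vicsek_skeleton"
  shows "AE x in vicsek_nu. x \<notin> F"
proof (rule AE_not_in)
  have s: "{x} \<in> sets vicsek_nu" if "x \<in> F" for x using that assms by (intro closed_sets_nu) auto
  have "emeasure vicsek_nu F = 0"
    using assms s emeasure_nu_singleton by (subst emeasure_eq_sum_singleton) auto
  moreover have "F \<in> sets vicsek_nu" using assms by (intro closed_sets_nu finite_imp_closed)
  ultimately show "F \<in> null_sets vicsek_nu" by (intro null_setsI)
qed

lemma AE_unique_edge:
  "AE x in vicsek_nu. \<forall>e\<in>edge_index n. \<forall>e'\<in>edge_index n. x \<in> case_prod edge e \<longrightarrow> x \<in> case_prod edge e' \<longrightarrow> e = e'"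
proof -
  define F where "F = (\<Union>e\<in>edge_index n. \<Union>e'\<in>edge_index n - {e}. case_prod edge e \<inter> case_prod edge e')"
  have fin: "finite (case_prod edge e \<inter> case_prod edge e')" if ee: "e \<in> edge_index n" "e' \<in> edge_index n - {e}" for e e'
  proof -
    obtain w i w' j where e: "e = (w, i)" "e' = (w', j)" by (metis surj_pair)
    then obtain z where "edge w i \<inter> edge w' j \<subseteq> {z}" using edge_Int_finite[of w n w' i j] ee by blast
    then show ?thesis unfolding e prod.case by (rule finite_subset) simp
  qed
  have "finite F" unfolding F_def using fin by (intro finite_UN_I finite_Diff finite_cartesian_product finite_words) auto
  moreover have "F \<subseteq> vicsek_skeleton"
  proof
    fix x assume "x \<in> F"
    then obtain e where "e \<in> edge_index n" "x \<in> case_prod edge e" unfolding F_def by blast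
    then show "x \<in> vicsek_skeleton" using edge_subset_skeleton[of "fst e" n "snd e"] by (auto simp: case_prod_beta)
  qed
  ultimately have "AE x in vicsek_nu. x \<notin> F" by (rule AE_nu_not_in_finite)
  then show ?thesis by (rule AE_mp) (rule AE_I2, unfold F_def, blast)
qed

lemma children_index:
  assumes w: "w \<in> vicsek_words n" and i: "i \<in> {1..4}"
  shows "(w @ [5], i) \<in> edge_index (Suc n)" "(w @ [i], opp i) \<in> edge_index (Suc n)" "(w @ [i], i) \<in> edge_index (Suc n)"
  using words_snoc[OF w, of 5] words_snoc[OF w, of i] i opp_in[OF i] by auto

lemma AE_indicator_split:
  assumes w: "w \<in> vicsek_words n" and i: "i \<in> {1..4}"
  shows "AE x in vicsek_nu. (indicator (edge w i) x :: 'b::semiring_1) =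
    indicator (edge (w @ [5]) i) x + indicator (edge (w @ [i]) (opp i)) x + indicator (edge (w @ [i]) i) x"
  using AE_unique_edge[of "Suc n"]
proof eventually_elim
  case (elim x)
  note u = elim[rule_format, of "(w @ [5], i)" "(w @ [i], opp i)"] elim[rule_format, of "(w @ [5], i)" "(w @ [i], i)"]
    elim[rule_format, of "(w @ [i], opp i)" "(w @ [i], i)"]
  have "\<not> (x \<in> edge (w @ [5]) i \<and> x \<in> edge (w @ [i]) (opp i))" "\<not> (x \<in> edge (w @ [5]) i \<and> x \<in> edge (w @ [i]) i)"
    "\<not> (x \<in> edge (w @ [i]) (opp i) \<and> x \<in> edge (w @ [i]) i)"
    using u children_index[OF w i] opp_ne[OF i] i by auto
  then show ?case unfolding edge_split[OF i, of w] by (auto simp: indicator_def)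
qed

lemma set_integrable_edge_child:
  assumes w: "w \<in> vicsek_words n" and i: "i \<in> {1..4}" and h: "set_integrable vicsek_nu (edge w i) (h :: _ \<Rightarrow> real)"
  shows "set_integrable vicsek_nu (edge (w @ [5]) i) h" "set_integrable vicsek_nu (edge (w @ [i]) (opp i)) h"
    "set_integrable vicsek_nu (edge (w @ [i]) i) h"
  using children_index[OF w i] edge_split[OF i, of w]
  by (auto intro!: set_integrable_subset[OF h] edge_sets simp del: Un_iff)

lemma set_integral_edge_split:
  assumes w: "w \<in> vicsek_words n" and i: "i \<in> {1..4}" and h: "set_integrable vicsek_nu (edge w i) (h :: _ \<Rightarrow> real)"
  shows "(LINT x:edge w i|vicsek_nu. h x) = (LINT x:edge (w @ [5]) i|vicsek_nu. h x) +
     (LINT x:edge (w @ [i]) (opp i)|vicsek_nu. h x) + (LINT x:edge (w @ [i]) i|vicsek_nu. h x)"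
proof -
  note c = set_integrable_edge_child[OF assms]
  have "(LINT x:edge w i|vicsek_nu. h x) = (\<integral>x. indicator (edge (w @ [5]) i) x *\<^sub>R h x + indicator (edge (w @ [i]) (opp i)) x *\<^sub>R h x
     + indicator (edge (w @ [i]) i) x *\<^sub>R h x \<partial>vicsek_nu)"
    unfolding set_lebesgue_integral_def
  proof (rule integral_cong_AE)
    show "(\<lambda>x. indicat_real (edge w i) x *\<^sub>R h x) \<in> borel_measurable vicsek_nu"
      using h unfolding set_integrable_def by (rule borel_measurable_integrable)
    show "(\<lambda>x. indicat_real (edge (w @ [5]) i) x *\<^sub>R h x + indicat_real (edge (w @ [i]) (opp i)) x *\<^sub>R h x
     + indicat_real (edge (w @ [i]) i) x *\<^sub>R h x) \<in> borel_measurable vicsek_nu"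
      using c unfolding set_integrable_def by (intro borel_measurable_add borel_measurable_integrable)
    show "AE x in vicsek_nu. indicat_real (edge w i) x *\<^sub>R h x = indicat_real (edge (w @ [5]) i) x *\<^sub>R h x +
        indicat_real (edge (w @ [i]) (opp i)) x *\<^sub>R h x + indicat_real (edge (w @ [i]) i) x *\<^sub>R h x"
      using AE_indicator_split[OF w i, where 'b = real] by eventually_elim (simp add: distrib_right)
  qed
  also have "\<dots> = (LINT x:edge (w @ [5]) i|vicsek_nu. h x) +
     (LINT x:edge (w @ [i]) (opp i)|vicsek_nu. h x) + (LINT x:edge (w @ [i]) i|vicsek_nu. h x)"
    using c unfolding set_lebesgue_integral_def set_integrable_def by simp
  finally show ?thesis .
qed

subsection \<open>Slopes at a fixed level form a martingale\<close>

text \<open>At a vertex the contributions of several edges add up, so the value on an edge is the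
  intended one only almost everywhere; off the cable of level m the function is 0.\<close>

definition slope :: "(real \<times> real \<Rightarrow> real) \<Rightarrow> nat \<Rightarrow> real \<times> real \<Rightarrow> real" where
  "slope f m x = (\<Sum>(w, i)\<in>edge_index m. 3 ^ m * oincr f w i * indicator (edge w i) x)"

lemma slope_integrable [measurable]: "integrable vicsek_nu (slope f m)"
proof -
  have "integrable vicsek_nu (\<lambda>x. case e of (w, i) \<Rightarrow> 3 ^ m * oincr f w i * indicator (edge w i) x)" if "e \<in> edge_index m" for e
    using that edge_sets[of "fst e" m "snd e"] emeasure_edge[of "fst e" m "snd e"]
    by (auto simp: case_prod_beta integrable_indicator_iff)
  then show ?thesis unfolding slope_def[abs_def] by (intro Bochner_Integration.integrable_sum) simp
qed

lemma AE_slope: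
  "AE x in vicsek_nu. \<forall>w\<in>vicsek_words m. \<forall>i\<in>{1..4}. x \<in> edge w i \<longrightarrow> slope f m x = 3 ^ m * oincr f w i"
  using AE_unique_edge[of m]
proof eventually_elim
  case (elim x)
  show ?case
  proof (intro ballI impI)
    fix w i assume w: "w \<in> vicsek_words m" "i \<in> {1..4::nat}" "x \<in> edge w i"
    have "slope f m x = (\<Sum>(w, i)\<in>{(w, i)}. 3 ^ m * oincr f w i * indicator (edge w i) x)"
      unfolding slope_def
    proof (rule sum.mono_neutral_right)
      show "\<forall>e\<in>edge_index m - {(w, i)}. (case e of (w, i) \<Rightarrow> 3 ^ m * oincr f w i * indicator (edge w i) x) = 0"
      proof
        fix e assume e: "e \<in> edge_index m - {(w, i)}"
        then have "x \<notin> case_prod edge e" using elim[rule_format, of "(w, i)" e] w by auto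
        then show "(case e of (w, i) \<Rightarrow> 3 ^ m * oincr f w i * indicator (edge w i) x) = 0" by (cases e) simp
      qed
    qed (use w in auto)
    then show "slope f m x = 3 ^ m * oincr f w i" using w by simp
  qed
qed

lemma set_integrable_edge_bound:
  assumes w: "w \<in> vicsek_words n" and i: "i \<in> {1..4}" and h: "h \<in> borel_measurable vicsek_nu"
    and b: "integrable vicsek_nu b" "\<And>x. \<bar>h x\<bar> \<le> c + b x" "0 \<le> c"
  shows "set_integrable vicsek_nu (edge w i) (h :: _ \<Rightarrow> real)"
  unfolding set_integrable_def
proof (rule Bochner_Integration.integrable_bound)
  show "integrable vicsek_nu (\<lambda>x. c * indicator (edge w i) x + \<bar>b x\<bar>)"
    using b(1) edge_sets[OF w i] emeasure_edge[OF w i] by (auto simp: integrable_indicator_iff intro!: integrable_abs)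
  show "(\<lambda>x. indicat_real (edge w i) x *\<^sub>R h x) \<in> borel_measurable vicsek_nu"
    using h edge_sets[OF w i] by (intro borel_measurable_scaleR borel_measurable_indicator)
  have "\<bar>indicat_real (edge w i) x * h x\<bar> \<le> c * indicator (edge w i) x + \<bar>b x\<bar>" for x
    using b(2)[of x] by (cases "x \<in> edge w i") auto
  then show "AE x in vicsek_nu. norm (indicat_real (edge w i) x *\<^sub>R h x) \<le> norm (c * indicator (edge w i) x + \<bar>b x\<bar>)"
    by (intro AE_I2) (simp add: order_trans[OF _ abs_ge_self])
qed

lemma measure_edge: "w \<in> vicsek_words n \<Longrightarrow> i \<in> {1..4} \<Longrightarrow> measure vicsek_nu (edge w i) = (1/3) ^ n"
  using emeasure_edge[of w n i] by (simp add: measure_def)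

lemma set_integral_edge_const:
  fixes h :: "real \<times> real \<Rightarrow> real"
  assumes w: "w \<in> vicsek_words n" and i: "i \<in> {1..4}" and h: "h \<in> borel_measurable vicsek_nu"
    and c: "AE x in vicsek_nu. x \<in> edge w i \<longrightarrow> h x = c"
  shows "(LINT x:edge w i|vicsek_nu. h x) = c * (1/3) ^ n"
proof -
  have "(LINT x:edge w i|vicsek_nu. h x) = (\<integral>x. indicator (edge w i) x * c \<partial>vicsek_nu)"
    unfolding set_lebesgue_integral_def
  proof (rule integral_cong_AE)
    show "AE x in vicsek_nu. indicat_real (edge w i) x *\<^sub>R h x = indicat_real (edge w i) x * c"
      using c by eventually_elim (auto simp: indicator_def)
  qed (use h edge_sets[OF w i] in \<open>auto intro!: borel_measurable_scaleR borel_measurable_indicator borel_measurable_times\<close>)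
  also have "\<dots> = c * (1/3) ^ n"
    using measure_edge[OF w i] by (simp add: Int_absorb2[OF sets.sets_into_space[OF edge_sets[OF w i]]])
  finally show ?thesis .
qed

lemma slope_set_integrable: "w \<in> vicsek_words n \<Longrightarrow> i \<in> {1..4} \<Longrightarrow> set_integrable vicsek_nu (edge w i) (slope f m)"
  by (rule set_integrable_edge_bound[where b = "\<lambda>x. \<bar>slope f m x\<bar>" and c = 0]) (auto simp: slope_integrable)

text \<open>The martingale property, by passing to the three subedges until the level of the slope
  is reached.\<close>

lemma slope_integral:
  "w \<in> vicsek_words n \<Longrightarrow> i \<in> {1..4} \<Longrightarrow> (LINT x:edge w i|vicsek_nu. slope f (n + k) x) = oincr f w i"
proof (induction k arbitrary: n w i)
  case 0
  have "(LINT x:edge w i|vicsek_nu. slope f n x) = (3 ^ n * oincr f w i) * (1/3) ^ n"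
    by (rule set_integral_edge_const[OF 0]) (use AE_slope[of n f] 0 in auto)
  then show ?case by (simp add: power_one_over)
next
  case (Suc k)
  note c = children_index[OF Suc.prems]
  have "(LINT x:edge w' j|vicsek_nu. slope f (n + Suc k) x) = oincr f w' j" if "(w', j) \<in> edge_index (Suc n)" for w' j
    using Suc.IH[of w' "Suc n" j] that by simp
  then show ?case
    unfolding set_integral_edge_split[OF Suc.prems slope_set_integrable[OF Suc.prems]] using c oincr_split[OF Suc.prems, of f] by simp
qed

text \<open>The convex function \<open>sqrt (1 + t\<^sup>2)\<close> has linear growth and its Bregman divergence controls
  squared differences on bounded sets. So a martingale bounded in \<open>L\<^sup>q\<close>, \<open>q > 1\<close>, converges in
  \<open>L\<^sup>1\<close>, without any maximal inequality.\<close>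

definition breg :: "real \<Rightarrow> real \<Rightarrow> real" where
  "breg a b = sqrt (1 + b\<^sup>2) - sqrt (1 + a\<^sup>2) - a / sqrt (1 + a\<^sup>2) * (b - a)"

text \<open>With A, B the two square roots, (A B)^2 - (1 + a b)^2 = (b - a)^2 and A times the
  divergence is A B - (1 + a b). Factoring the difference of squares gives the bound.\<close>

lemma breg_ge: "(b - a)\<^sup>2 \<le> 2 * (1 + a\<^sup>2) * sqrt (1 + b\<^sup>2) * breg a b"
proof -
  define A where "A = sqrt (1 + a\<^sup>2)"
  define B where "B = sqrt (1 + b\<^sup>2)"
  have A: "0 < A" "A * A = 1 + a\<^sup>2" and B: "0 < B" "B * B = 1 + b\<^sup>2"
    by (auto simp: A_def B_def add_pos_nonneg)
  have sq: "(A * B)\<^sup>2 = (1 + a * b)\<^sup>2 + (b - a)\<^sup>2"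
  proof -
    have "(A * B)\<^sup>2 = (A * A) * (B * B)" by (simp add: power2_eq_square mult_ac)
    then show ?thesis unfolding A(2) B(2) by (simp add: power2_eq_square algebra_simps)
  qed
  have "(1 + a * b)\<^sup>2 \<le> (A * B)\<^sup>2" unfolding sq by simp
  then have le: "\<bar>1 + a * b\<bar> \<le> A * B" using A B by (simp add: abs_le_square_iff[symmetric])
  have "(b - a)\<^sup>2 = (A * B - (1 + a * b)) * (A * B + (1 + a * b))"
    using sq by (simp add: power2_eq_square algebra_simps)
  also have "\<dots> \<le> (A * B - (1 + a * b)) * (2 * (A * B))" using le by (intro mult_left_mono) auto
  also have "A * B - (1 + a * b) = A * breg a b"
  proof -
    have "A * breg a b = A * B - A * A - A * (a / A) * (b - a)"
      unfolding breg_def A_def[symmetric] B_def[symmetric] by (simp add: right_diff_distrib)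
    also have "\<dots> = A * B - (1 + a * b)" using A by (simp add: power2_eq_square algebra_simps)
    finally show ?thesis by simp
  qed
  also have "A * breg a b * (2 * (A * B)) = 2 * (A * A) * B * breg a b" by simp
  finally show ?thesis unfolding A(2) unfolding B_def .
qed

lemma breg_nonneg: "0 \<le> breg a b"
proof (rule ccontr)
  assume "\<not> 0 \<le> breg a b"
  then have "2 * (1 + a\<^sup>2) * sqrt (1 + b\<^sup>2) * breg a b < 0"
    by (intro mult_pos_neg mult_pos_pos) (auto simp: add_pos_nonneg)
  then show False using breg_ge[where a = a and b = b] zero_le_power2[of "b - a"] by linarith
qed

text \<open>One term for each regime: differences below e; larger ones between values at most R,
  where the divergence controls the square; and values beyond R, controlled by the moment of order
  q.\<close>

lemma difference_le_breg:
  assumes q: "1 < q" and R: "1 \<le> R" and e: "0 < e"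
  shows "\<bar>b - a\<bar> \<le> e + 2 * (1 + R\<^sup>2)\<^sup>2 / e * breg a b + 2 * R powr (1 - q) * (\<bar>a\<bar> powr q + \<bar>b\<bar> powr q)"
proof (cases "\<bar>a\<bar> \<le> R \<and> \<bar>b\<bar> \<le> R")
  case True
  then have sq: "a\<^sup>2 \<le> R\<^sup>2" "b\<^sup>2 \<le> R\<^sup>2" using R by (auto simp: abs_le_square_iff[symmetric])
  have "sqrt (1 + b\<^sup>2) \<le> sqrt ((1 + R\<^sup>2)\<^sup>2)"
  proof (rule real_sqrt_le_mono)
    have "1 + b\<^sup>2 \<le> 1 + R\<^sup>2" using sq by simp
    also have "\<dots> \<le> (1 + R\<^sup>2)\<^sup>2" by (rule self_le_power) auto
    finally show "1 + b\<^sup>2 \<le> (1 + R\<^sup>2)\<^sup>2" .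
  qed
  then have sB: "sqrt (1 + b\<^sup>2) \<le> 1 + R\<^sup>2" by simp
  have "(b - a)\<^sup>2 \<le> 2 * (1 + a\<^sup>2) * sqrt (1 + b\<^sup>2) * breg a b" by (rule breg_ge)
  also have "\<dots> \<le> 2 * (1 + R\<^sup>2) * (1 + R\<^sup>2) * breg a b"
    using sq sB breg_nonneg by (intro mult_right_mono mult_mono) auto
  also have "2 * (1 + R\<^sup>2) * (1 + R\<^sup>2) = 2 * (1 + R\<^sup>2)\<^sup>2" by (simp only: power2_eq_square[of "1 + R\<^sup>2"] mult.assoc)
  finally have 1: "(b - a)\<^sup>2 \<le> 2 * (1 + R\<^sup>2)\<^sup>2 * breg a b" .
  have "\<bar>b - a\<bar> \<le> e + (b - a)\<^sup>2 / e"
  proof (cases "\<bar>b - a\<bar> \<le> e")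
    case True
    then show ?thesis using e by (simp add: add_increasing2)
  next
    case False
    then have "\<bar>b - a\<bar> * e \<le> \<bar>b - a\<bar> * \<bar>b - a\<bar>" using e by (intro mult_left_mono) auto
    then have "\<bar>b - a\<bar> \<le> (b - a)\<^sup>2 / e" using e by (simp add: pos_le_divide_eq power2_eq_square flip: abs_mult)
    then show ?thesis using e by linarith
  qed
  also have "(b - a)\<^sup>2 / e \<le> 2 * (1 + R\<^sup>2)\<^sup>2 * breg a b / e" using 1 e by (intro divide_right_mono) auto
  finally have "\<bar>b - a\<bar> \<le> e + 2 * (1 + R\<^sup>2)\<^sup>2 / e * breg a b" by simp
  moreover have "0 \<le> 2 * R powr (1 - q) * (\<bar>a\<bar> powr q + \<bar>b\<bar> powr q)" by simp
  ultimately show ?thesis by linarith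
next
  case False
  define m where "m = max \<bar>a\<bar> \<bar>b\<bar>"
  have m: "R \<le> m" "0 < m" using False R by (auto simp: m_def)
  have "m = m powr (1 - q) * m powr q" using m by (simp flip: powr_add)
  also have "\<dots> \<le> R powr (1 - q) * m powr q" using m R q by (intro mult_right_mono powr_mono2') auto
  also have "\<dots> \<le> R powr (1 - q) * (\<bar>a\<bar> powr q + \<bar>b\<bar> powr q)"
    by (intro mult_left_mono) (auto simp: m_def max_def)
  finally have "m \<le> R powr (1 - q) * (\<bar>a\<bar> powr q + \<bar>b\<bar> powr q)" by simp
  moreover have "\<bar>b - a\<bar> \<le> 2 * m" by (auto simp: m_def)
  moreover have "0 \<le> 2 * (1 + R\<^sup>2)\<^sup>2 / e * breg a b" using e breg_nonneg by simp
  ultimately show ?thesis using e by linarith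
qed

text \<open>The first factor is constant on edges of level n + j, and by
  \<open>slope_integral\<close> the increment of the slope integrates to 0 over each of them. It
  removes the linear term of \<open>breg\<close> under the integral.\<close>

lemma slope_orthogonal:
  assumes "w \<in> vicsek_words n" "i \<in> {1..4}" "n + j \<le> k"
  shows "(LINT x:edge w i|vicsek_nu. slope f (n + j) x / sqrt (1 + (slope f (n + j) x)\<^sup>2) * (slope f k x - slope f (n + j) x)) = 0"
  using assms
proof (induction j arbitrary: n w i)
  case 0
  note w = 0(1,2)
  let ?c = "3 ^ n * oincr f w i"
  have "(LINT x:edge w i|vicsek_nu. slope f n x / sqrt (1 + (slope f n x)\<^sup>2) * (slope f k x - slope f n x))
     = (LINT x:edge w i|vicsek_nu. ?c / sqrt (1 + ?c\<^sup>2) * (slope f k x - slope f n x))"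
    unfolding set_lebesgue_integral_def
  proof (rule integral_cong_AE)
    show "AE x in vicsek_nu. indicat_real (edge w i) x *\<^sub>R (slope f n x / sqrt (1 + (slope f n x)\<^sup>2) * (slope f k x - slope f n x)) =
        indicat_real (edge w i) x *\<^sub>R (?c / sqrt (1 + ?c\<^sup>2) * (slope f k x - slope f n x))"
      using AE_slope[of n f] by eventually_elim (use w in \<open>auto simp: indicator_def\<close>)
  qed (use edge_sets[OF w] in \<open>auto intro!: borel_measurable_scaleR borel_measurable_indicator\<close>)
  also have "\<dots> = ?c / sqrt (1 + ?c\<^sup>2) * ((LINT x:edge w i|vicsek_nu. slope f k x) - (LINT x:edge w i|vicsek_nu. slope f n x))"
    using slope_set_integrable[OF w] by (simp add: set_integral_diff)
  also have "\<dots> = 0" using slope_integral[OF w, of f "k - n"] slope_integral[OF w, of f 0] 0(3) by simp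
  finally show ?case by simp
next
  case (Suc j)
  let ?h = "\<lambda>x. slope f (n + Suc j) x / sqrt (1 + (slope f (n + Suc j) x)\<^sup>2) * (slope f k x - slope f (n + Suc j) x)"
  have "set_integrable vicsek_nu (edge w i) ?h"
  proof (rule set_integrable_edge_bound[OF Suc.prems(1,2), where b = "\<lambda>x. \<bar>slope f k x\<bar> + \<bar>slope f (n + Suc j) x\<bar>" and c = 0])
    show "\<bar>?h x\<bar> \<le> 0 + (\<bar>slope f k x\<bar> + \<bar>slope f (n + Suc j) x\<bar>)" for x
    proof -
      have "\<bar>t\<bar> \<le> sqrt (1 + t\<^sup>2)" for t :: real by (metis abs_ge_zero add.commute le_add_same_cancel1 power2_abs real_le_rsqrt zero_le_one)
      then have "\<bar>t / sqrt (1 + t\<^sup>2)\<bar> \<le> 1" for t :: real by (simp add: abs_divide add_pos_nonneg)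
      from this[of "slope f (n + Suc j) x"] have "\<bar>?h x\<bar> \<le> 1 * \<bar>slope f k x - slope f (n + Suc j) x\<bar>"
        unfolding abs_mult by (rule mult_right_mono) simp
      also have "\<dots> \<le> 0 + (\<bar>slope f k x\<bar> + \<bar>slope f (n + Suc j) x\<bar>)"
        using abs_triangle_ineq4[of "slope f k x" "slope f (n + Suc j) x"] by simp
      finally show ?thesis .
    qed
  qed (auto intro!: integrable_abs slope_integrable Bochner_Integration.integrable_add)
  from set_integral_edge_split[OF Suc.prems(1,2) this]
  show ?case using Suc.IH[of _ "Suc n"] children_index[OF Suc.prems(1,2)] Suc.prems(3) by simp
qed

subsection \<open>Convergence of the slopes\<close>

text \<open>The bound depends on m and only serves to make functions of the slopes integrable over
  an edge.\<close>

lemma slope_bounded: "\<exists>c\<ge>0. \<forall>x. \<bar>slope f m x\<bar> \<le> c"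
proof (intro exI conjI allI)
  show "0 \<le> (\<Sum>(w, i)\<in>edge_index m. \<bar>3 ^ m * oincr f w i\<bar>)" by (intro sum_nonneg) auto
  fix x
  have "\<bar>slope f m x\<bar> \<le> (\<Sum>e\<in>edge_index m. \<bar>case e of (w, i) \<Rightarrow> 3 ^ m * oincr f w i * indicator (edge w i) x\<bar>)"
    unfolding slope_def by (rule sum_abs)
  also have "\<dots> \<le> (\<Sum>(w, i)\<in>edge_index m. \<bar>3 ^ m * oincr f w i\<bar>)"
    by (intro sum_mono) (auto simp: indicator_def)
  finally show "\<bar>slope f m x\<bar> \<le> (\<Sum>(w, i)\<in>edge_index m. \<bar>3 ^ m * oincr f w i\<bar>)" .
qed

lemma set_integrable_edge_bounded:
  assumes "w \<in> vicsek_words n" "i \<in> {1..4}" "h \<in> borel_measurable vicsek_nu" "\<And>x. \<bar>h x\<bar> \<le> c"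
  shows "set_integrable vicsek_nu (edge w i) (h :: _ \<Rightarrow> real)"
proof (rule set_integrable_edge_bound[OF assms(1-3), where b = "\<lambda>_. 0"])
  show "\<bar>h x\<bar> \<le> c + 0" for x using assms(4) by simp
  show "0 \<le> c" using assms(4)[of undefined] by linarith
qed simp

lemma sqrt_one_plus_square_le: "sqrt (1 + t\<^sup>2) \<le> 1 + \<bar>t\<bar>"
  by (rule real_le_lsqrt) (auto simp: power2_eq_square algebra_simps)

lemma abs_le_one_plus_powr:
  assumes "1 \<le> q"
  shows "\<bar>t\<bar> \<le> 1 + \<bar>t\<bar> powr (q::real)"
proof (cases "\<bar>t\<bar> \<le> 1")
  case False
  then have "\<bar>t\<bar> powr 1 \<le> \<bar>t\<bar> powr q" using assms by (intro powr_mono) auto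
  then show ?thesis using False by simp
qed (simp add: add_increasing2)

text \<open>\<open>S m\<close>, the integral of sqrt (1 + slope^2), increases from level n on,
  because its increments are integrals of divergences, and it is at most 2 + B. So these divergences
  become small, and \<open>difference_le_breg\<close> turns this into L^1 smallness once R makes the
  tails small uniformly in the level.\<close>

lemma slope_L1_cauchy:
  assumes w: "w \<in> vicsek_words n" and i: "i \<in> {1..4}" and q: "1 < q"
    and B: "\<And>m. (LINT x:edge w i|vicsek_nu. \<bar>slope f m x\<bar> powr q) \<le> B" and \<epsilon>: "0 < \<epsilon>"
  shows "\<forall>\<^sub>F m in sequentially. \<forall>k\<ge>m. (LINT x:edge w i|vicsek_nu. \<bar>slope f k x - slope f m x\<bar>) \<le> \<epsilon>"
proof -
  note bdd = set_integrable_edge_bounded[OF w i]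
  have int_powr: "set_integrable vicsek_nu (edge w i) (\<lambda>x. \<bar>slope f m x\<bar> powr q)" for m
  proof -
    obtain c where "\<And>x. \<bar>slope f m x\<bar> \<le> c" using slope_bounded by blast
    then show ?thesis using q by (intro bdd[where c = "c powr q"]) (auto intro!: powr_mono2)
  qed
  have int_sqrt: "set_integrable vicsek_nu (edge w i) (\<lambda>x. sqrt (1 + (slope f m x)\<^sup>2))" for m
  proof -
    obtain c where c: "\<And>x. \<bar>slope f m x\<bar> \<le> c" using slope_bounded by blast
    show ?thesis
    proof (rule bdd[where c = "1 + c"])
      show "\<bar>sqrt (1 + (slope f m x)\<^sup>2)\<bar> \<le> 1 + c" for x
        using sqrt_one_plus_square_le[of "slope f m x"] c[of x] by simp
    qed measurable
  qed
  have int_orth: "set_integrable vicsek_nu (edge w i)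
      (\<lambda>x. slope f m x / sqrt (1 + (slope f m x)\<^sup>2) * (slope f k x - slope f m x))" for m k
  proof -
    obtain c d where c: "\<And>x. \<bar>slope f m x\<bar> \<le> c" "\<And>x. \<bar>slope f k x\<bar> \<le> d" using slope_bounded by meson
    show ?thesis
    proof (rule bdd[where c = "c * (c + d)"])
      fix x
      have "\<bar>slope f m x / sqrt (1 + (slope f m x)\<^sup>2)\<bar> \<le> \<bar>slope f m x\<bar> / 1"
        unfolding abs_divide by (intro divide_left_mono) (auto simp: add_pos_nonneg)
      then show "\<bar>slope f m x / sqrt (1 + (slope f m x)\<^sup>2) * (slope f k x - slope f m x)\<bar> \<le> c * (c + d)"
        unfolding abs_mult using c[of x] abs_triangle_ineq4[of "slope f k x" "slope f m x"] by (intro mult_mono) auto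
    qed measurable
  qed
  have int_diff: "set_integrable vicsek_nu (edge w i) (\<lambda>x. \<bar>slope f k x - slope f m x\<bar>)" for m k
    using slope_set_integrable[OF w i] by (intro set_integrable_abs set_integral_diff)
  define S where "S m = (LINT x:edge w i|vicsek_nu. sqrt (1 + (slope f m x)\<^sup>2))" for m
  have int_breg: "set_integrable vicsek_nu (edge w i) (\<lambda>x. breg (slope f m x) (slope f k x))" for m k
    unfolding breg_def by (intro set_integral_diff int_sqrt int_orth)
  have breg: "(LINT x:edge w i|vicsek_nu. breg (slope f m x) (slope f k x)) = S k - S m" if "n \<le> m" "m \<le> k" for m k
    using slope_orthogonal[OF w i, of "m - n" k f] that int_sqrt int_orth
    unfolding breg_def S_def by (simp add: set_integral_diff)
  have mono: "S m \<le> S k" if "n \<le> m" "m \<le> k" for m k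
  proof -
    have "0 \<le> (LINT x:edge w i|vicsek_nu. breg (slope f m x) (slope f k x))"
      unfolding set_lebesgue_integral_def by (intro Bochner_Integration.integral_nonneg) (auto simp: breg_nonneg)
    then show ?thesis using breg[OF that] by simp
  qed
  have const: "set_integrable vicsek_nu (edge w i) (\<lambda>x. c :: real)" for c by (intro bdd[where c = "\<bar>c\<bar>"]) auto
  have LINT_const: "(LINT x:edge w i|vicsek_nu. c) = c * (1/3) ^ n" for c :: real
    by (rule set_integral_edge_const[OF w i]) auto
  have third: "(1/3::real) ^ n \<le> 1" by (simp add: power_le_one)
  have upper: "S m \<le> 2 + B" for m
  proof -
    have "S m \<le> (LINT x:edge w i|vicsek_nu. 2 + \<bar>slope f m x\<bar> powr q)"
      unfolding S_def
    proof (rule set_integral_mono[OF int_sqrt])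
      show "set_integrable vicsek_nu (edge w i) (\<lambda>x. 2 + \<bar>slope f m x\<bar> powr q)"
        using const int_powr by (rule set_integral_add)
      show "sqrt (1 + (slope f m x)\<^sup>2) \<le> 2 + \<bar>slope f m x\<bar> powr q" for x
        using sqrt_one_plus_square_le[of "slope f m x"] abs_le_one_plus_powr[of q "slope f m x"] q by simp
    qed
    also have "\<dots> = 2 * (1/3) ^ n + (LINT x:edge w i|vicsek_nu. \<bar>slope f m x\<bar> powr q)"
      using const int_powr LINT_const[of 2] by (simp add: set_integral_add)
    also have "\<dots> \<le> 2 + B" using B[of m] third by linarith
    finally show ?thesis .
  qed
  have "convergent (\<lambda>m. S (n + m))"
  proof (rule Bseq_mono_convergent)
    show "Bseq (\<lambda>m. S (n + m))"
    proof (rule BseqI')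
      show "norm (S (n + m)) \<le> \<bar>S n\<bar> + \<bar>2 + B\<bar>" for m using upper[of "n + m"] mono[of n "n + m"] by simp
    qed
  qed (auto intro: mono)
  then have Cauchy: "Cauchy (\<lambda>m. S (n + m))" by (rule convergent_Cauchy)
  have "((\<lambda>R. R powr (1 - q)) \<longlongrightarrow> 0) at_top" using q filterlim_ident by (intro tendsto_neg_powr) auto
  \<comment> \<open>The tail term below is at most 4 R^(1-q) (|B| + 1), which this choice makes at
    most \<epsilon> / 3.\<close>
  then have "\<forall>\<^sub>F R in at_top. R powr (1 - q) < \<epsilon> / (12 * (\<bar>B\<bar> + 1))"
    using \<epsilon> by (intro order_tendstoD(2)) (auto intro!: divide_pos_pos)
  then have "\<forall>\<^sub>F R in at_top. 1 \<le> R \<and> R powr (1 - q) < \<epsilon> / (12 * (\<bar>B\<bar> + 1))"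
    using eventually_ge_at_top[of 1] by eventually_elim simp
  then obtain R where R: "1 \<le> R" "R powr (1 - q) < \<epsilon> / (12 * (\<bar>B\<bar> + 1))"
    using eventually_happens'[OF trivial_limit_at_top_linorder] by blast
  define K where "K = 2 * (1 + R\<^sup>2)\<^sup>2 / (\<epsilon> / 3)"
  have K: "0 < K" using \<epsilon> by (auto simp: K_def add_pos_nonneg intro!: divide_pos_pos mult_pos_pos zero_less_power)
  obtain M where M: "\<And>m k. M \<le> m \<Longrightarrow> M \<le> k \<Longrightarrow> \<bar>S (n + m) - S (n + k)\<bar> < \<epsilon> / (3 * K)"
    using Cauchy K \<epsilon> unfolding Cauchy_def dist_real_def by (metis divide_pos_pos mult_pos_pos zero_less_numeral)
  have "(LINT x:edge w i|vicsek_nu. \<bar>slope f k x - slope f m x\<bar>) \<le> \<epsilon>" if m: "n + M \<le> m" "m \<le> k" for m k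
  proof -
    have nm: "n \<le> m" using m by simp
    have "(LINT x:edge w i|vicsek_nu. \<bar>slope f k x - slope f m x\<bar>) \<le> (LINT x:edge w i|vicsek_nu.
       \<epsilon> / 3 + K * breg (slope f m x) (slope f k x) + 2 * R powr (1 - q) * (\<bar>slope f m x\<bar> powr q + \<bar>slope f k x\<bar> powr q))"
      unfolding K_def using difference_le_breg[OF q R(1), of "\<epsilon> / 3"] \<epsilon>
      by (intro set_integral_mono int_diff set_integral_add const set_integrable_mult_right int_breg int_powr) auto
    also have "\<dots> = \<epsilon> / 3 * (1/3) ^ n + K * (S k - S m) + 2 * R powr (1 - q) *
       ((LINT x:edge w i|vicsek_nu. \<bar>slope f m x\<bar> powr q) + (LINT x:edge w i|vicsek_nu. \<bar>slope f k x\<bar> powr q))"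
      using breg[OF nm m(2)] LINT_const[of "\<epsilon> / 3"] const[of "\<epsilon> / 3"]
      by (simp add: set_integral_add set_integrable_mult_right int_breg int_powr)
    also have "\<dots> \<le> \<epsilon> / 3 + \<epsilon> / 3 + \<epsilon> / 3"
    proof (intro add_mono)
      show "\<epsilon> / 3 * (1/3) ^ n \<le> \<epsilon> / 3" using third \<epsilon> by simp
      have "\<bar>S k - S m\<bar> < \<epsilon> / (3 * K)" using M[of "k - n" "m - n"] m by simp
      then have "K * (S k - S m) \<le> K * (\<epsilon> / (3 * K))" using K by (intro mult_left_mono) auto
      also have "\<dots> = \<epsilon> / 3" using K by simp
      finally show "K * (S k - S m) \<le> \<epsilon> / 3" .
      have "2 * R powr (1 - q) * ((LINT x:edge w i|vicsek_nu. \<bar>slope f m x\<bar> powr q) + (LINT x:edge w i|vicsek_nu. \<bar>slope f k x\<bar> powr q))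
        \<le> 2 * R powr (1 - q) * (2 * (\<bar>B\<bar> + 1))"
        using B[of m] B[of k] by (intro mult_left_mono) auto
      also have "\<dots> = 4 * (R powr (1 - q) * (\<bar>B\<bar> + 1))" by simp
      also have "R powr (1 - q) * (\<bar>B\<bar> + 1) \<le> \<epsilon> / (12 * (\<bar>B\<bar> + 1)) * (\<bar>B\<bar> + 1)"
        using R by (intro mult_right_mono) auto
      also have "\<epsilon> / (12 * (\<bar>B\<bar> + 1)) * (\<bar>B\<bar> + 1) = \<epsilon> / 12"
        using abs_ge_zero[of B] nonzero_mult_divide_mult_cancel_right[of "\<bar>B\<bar> + 1" \<epsilon> 12] by (simp add: mult.commute)
      finally show "2 * R powr (1 - q) * ((LINT x:edge w i|vicsek_nu. \<bar>slope f m x\<bar> powr q) + (LINT x:edge w i|vicsek_nu. \<bar>slope f k x\<bar> powr q)) \<le> \<epsilon> / 3"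
        by simp
    qed
    finally show ?thesis by simp
  qed
  then show ?thesis unfolding eventually_sequentially by blast
qed

text \<open>One subsequence is chosen that is Cauchy with error 2^-K on the finitely many edges of
  levels up to K. The errors are summable, so it converges almost everywhere on each edge and hence
  on the skeleton, a countable union of edges; Fatou upgrades this to L^1 on edges and preserves the
  integrals.\<close>

lemma slope_limit:
  assumes cauchy: "\<forall>n. \<forall>w\<in>vicsek_words n. \<forall>i\<in>{1..4}. \<forall>\<epsilon>>0. \<forall>\<^sub>F m in sequentially. \<forall>k\<ge>m. (LINT x:edge w i|vicsek_nu. \<bar>slope f k x - slope f m x\<bar>) \<le> \<epsilon>"
  shows "\<exists>G s. G \<in> borel_measurable vicsek_nu \<and> (AE x in vicsek_nu. (\<lambda>k. slope f (s k) x) \<longlonglongrightarrow> G x) \<and>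
    (\<forall>n. \<forall>w\<in>vicsek_words n. \<forall>i\<in>{1..4}. (LINT x:edge w i|vicsek_nu. G x) = oincr f w i)"
proof -
  have "\<forall>K. \<exists>M. \<forall>n\<in>{..K}. \<forall>e\<in>edge_index n. \<forall>m\<ge>M. \<forall>k\<ge>m.
     (LINT x:case_prod edge e|vicsek_nu. \<bar>slope f k x - slope f m x\<bar>) \<le> (1/2) ^ K"
  proof
    fix K
    have "\<forall>\<^sub>F m in sequentially. \<forall>n\<in>{..K}. \<forall>e\<in>edge_index n. \<forall>k\<ge>m.
      (LINT x:case_prod edge e|vicsek_nu. \<bar>slope f k x - slope f m x\<bar>) \<le> (1/2) ^ K"
      using cauchy by (intro eventually_ball_finite ballI) (auto simp: case_prod_beta)
    then show "\<exists>M. \<forall>n\<in>{..K}. \<forall>e\<in>edge_index n. \<forall>m\<ge>M. \<forall>k\<ge>m.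
      (LINT x:case_prod edge e|vicsek_nu. \<bar>slope f k x - slope f m x\<bar>) \<le> (1/2) ^ K"
      unfolding eventually_sequentially by blast
  qed
  then obtain M where M: "\<forall>K. \<forall>n\<in>{..K}. \<forall>e\<in>edge_index n. \<forall>m\<ge>M K. \<forall>k\<ge>m.
     (LINT x:case_prod edge e|vicsek_nu. \<bar>slope f k x - slope f m x\<bar>) \<le> (1/2) ^ K"
    by (rule choice[THEN exE])
  \<comment> \<open>The partial sums make \<open>s\<close> monotone and at least \<open>M\<close>;
    the summand K makes it tend to infinity, so that it eventually exceeds the level of any given
    edge.\<close>
  define s where "s K = (\<Sum>j\<le>K. M j) + K" for K
  have s_M: "M K \<le> s K" for K unfolding s_def by (intro trans_le_add1 member_le_sum) auto
  have s_mono: "s K \<le> s K'" if "K \<le> K'" for K K' unfolding s_def by (rule add_mono[OF sum_mono2 that]) (use that in auto)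
  have s_ge: "K \<le> s K" for K by (simp add: s_def)
  have close: "(LINT x:edge w i|vicsek_nu. \<bar>slope f (s K') x - slope f (s K) x\<bar>) \<le> (1/2) ^ K"
    if "w \<in> vicsek_words n" "i \<in> {1..4}" "n \<le> K" "K \<le> K'" for w n i K K'
    using M[rule_format, of n K "(w, i)" "s K" "s K'"] that s_M s_mono by simp
  have nn_close: "(\<integral>\<^sup>+x\<in>edge w i. ennreal \<bar>slope f (s K') x - slope f (s K) x\<bar> \<partial>vicsek_nu) \<le> ennreal ((1/2) ^ K)"
    if w: "w \<in> vicsek_words n" "i \<in> {1..4}" "n \<le> K" "K \<le> K'" for w n i K K'
  proof -
    have "set_integrable vicsek_nu (edge w i) (\<lambda>x. \<bar>slope f (s K') x - slope f (s K) x\<bar>)"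
      using slope_set_integrable[OF w(1,2)] by (intro set_integrable_abs set_integral_diff)
    then have "(\<integral>\<^sup>+x\<in>edge w i. ennreal \<bar>slope f (s K') x - slope f (s K) x\<bar> \<partial>vicsek_nu) =
        ennreal (LINT x:edge w i|vicsek_nu. \<bar>slope f (s K') x - slope f (s K) x\<bar>)"
      unfolding set_integrable_def set_lebesgue_integral_def nn_integral_set_ennreal
      by (subst nn_integral_eq_integral[symmetric]) (auto simp: mult.commute)
    then show ?thesis using close[OF w] by (simp add: ennreal_leI)
  qed
  have conv: "AE x in vicsek_nu. x \<in> edge w i \<longrightarrow> convergent (\<lambda>k. slope f (s k) x)"
    if w: "w \<in> vicsek_words n" "i \<in> {1..4}" for w n i
  proof -
    let ?d = "\<lambda>k x. ennreal \<bar>slope f (s (Suc (n + k))) x - slope f (s (n + k)) x\<bar> * indicator (edge w i) x"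
    have [measurable]: "edge w i \<in> sets vicsek_nu" by (rule edge_sets[OF w])
    have half: "(\<lambda>k. (1/2) ^ (n + k) :: real) sums ((1/2) ^ n * 2)"
      using sums_mult[OF geometric_sums[of "1/2 :: real"], of "(1/2) ^ n"] by (simp add: power_add)
    have "(\<integral>\<^sup>+x. (\<Sum>k. ?d k x) \<partial>vicsek_nu) = (\<Sum>k. \<integral>\<^sup>+x. ?d k x \<partial>vicsek_nu)"
      by (rule nn_integral_suminf) measurable
    also have "\<dots> \<le> (\<Sum>k. ennreal ((1/2) ^ (n + k)))"
      using nn_close[OF w] by (intro suminf_le) auto
    also have "\<dots> = ennreal ((1/2) ^ n * 2)" using half by (intro suminf_ennreal_eq) auto
    also have "\<dots> < \<infinity>" by simp
    finally have "AE x in vicsek_nu. (\<Sum>k. ?d k x) \<noteq> \<infinity>" by (intro nn_integral_PInf_AE) auto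
    then show ?thesis
    proof eventually_elim
      case (elim x)
      show ?case
      proof
        assume x: "x \<in> edge w i"
        then have "summable (\<lambda>k. \<bar>slope f (s (Suc (n + k))) x - slope f (s (n + k)) x\<bar>)"
          using elim by (intro summable_suminf_not_top) auto
        then have "summable (\<lambda>k. slope f (s (Suc (n + k))) x - slope f (s (n + k)) x)" by (rule summable_rabs_cancel)
        then have "convergent (\<lambda>k. \<Sum>j<k. slope f (s (Suc (n + j))) x - slope f (s (n + j)) x)"
          by (simp add: summable_iff_convergent)
        moreover have "(\<Sum>j<k. slope f (s (Suc (n + j))) x - slope f (s (n + j)) x) = slope f (s (n + k)) x - slope f (s n) x" for k
          using sum_lessThan_telescope[of "\<lambda>j. slope f (s (n + j)) x" k] by simp
        ultimately have "convergent (\<lambda>k. slope f (s (n + k)) x - slope f (s n) x)" by simp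
        then have "convergent (\<lambda>k. slope f (s (n + k)) x)" using convergent_add_const_right_iff[of "\<lambda>k. slope f (s (n + k)) x" "- slope f (s n) x"] by simp
        then show "convergent (\<lambda>k. slope f (s k) x)"
          using convergent_ignore_initial_segment[of "\<lambda>k. slope f (s k) x" n] by (simp add: add.commute)
      qed
    qed
  qed
  have conv_AE: "AE x in vicsek_nu. convergent (\<lambda>k. slope f (s k) x)"
  proof -
    have "AE x in vicsek_nu. \<forall>n. \<forall>e\<in>edge_index n. x \<in> case_prod edge e \<longrightarrow> convergent (\<lambda>k. slope f (s k) x)"
      using conv by (subst AE_all_countable, intro allI AE_finite_allI) (auto simp: case_prod_beta)
    then show ?thesis using AE_space
    proof eventually_elim
      case (elim x)
      then obtain n w i where "w \<in> vicsek_words n" "i \<in> {1..4}" "x \<in> edge w i"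
        unfolding space_nu using skeleton_in_edges[of x] by blast
      then show ?case using elim(1)[rule_format, of "(w, i)" n] by simp
    qed
  qed
  define G where "G x = lim (\<lambda>k. slope f (s k) x)" for x
  have G_meas [measurable]: "G \<in> borel_measurable vicsek_nu" unfolding G_def by measurable
  have lim: "AE x in vicsek_nu. (\<lambda>k. slope f (s k) x) \<longlonglongrightarrow> G x"
    using conv_AE by eventually_elim (simp add: G_def convergent_LIMSEQ_iff)
  have "(LINT x:edge w i|vicsek_nu. G x) = oincr f w i" if w: "w \<in> vicsek_words n" "i \<in> {1..4}" for n w i
  proof -
    have [measurable]: "edge w i \<in> sets vicsek_nu" by (rule edge_sets[OF w])
    \<comment> \<open>The bound \<open>nn_close\<close> with the later index sent to
      infinity.\<close>
    have fatou: "(\<integral>\<^sup>+x. ennreal (norm (indicator (edge w i) x *\<^sub>R slope f (s K) x - indicator (edge w i) x *\<^sub>R G x)) \<partial>vicsek_nu) \<le> ennreal ((1/2) ^ K)"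
      if K: "n \<le> K" for K
    proof -
      have "(\<integral>\<^sup>+x. ennreal (norm (indicator (edge w i) x *\<^sub>R slope f (s K) x - indicator (edge w i) x *\<^sub>R G x)) \<partial>vicsek_nu) =
         (\<integral>\<^sup>+x. liminf (\<lambda>k. ennreal \<bar>slope f (s k) x - slope f (s K) x\<bar> * indicator (edge w i) x) \<partial>vicsek_nu)"
      proof (rule nn_integral_cong_AE)
        show "AE x in vicsek_nu. ennreal (norm (indicator (edge w i) x *\<^sub>R slope f (s K) x - indicator (edge w i) x *\<^sub>R G x)) =
          liminf (\<lambda>k. ennreal \<bar>slope f (s k) x - slope f (s K) x\<bar> * indicator (edge w i) x)"
          using lim
        proof eventually_elim
          case (elim x)
          have "(\<lambda>k. ennreal \<bar>slope f (s k) x - slope f (s K) x\<bar> * indicator (edge w i) x) \<longlonglongrightarrow>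
             ennreal \<bar>G x - slope f (s K) x\<bar> * indicator (edge w i) x"
            using elim by (cases "x \<in> edge w i") (auto intro!: tendsto_intros tendsto_ennrealI)
          then have "liminf (\<lambda>k. ennreal \<bar>slope f (s k) x - slope f (s K) x\<bar> * indicator (edge w i) x) =
             ennreal \<bar>G x - slope f (s K) x\<bar> * indicator (edge w i) x"
            by (intro lim_imp_Liminf) auto
          then show ?case by (cases "x \<in> edge w i") (auto simp: abs_minus_commute)
        qed
      qed
      also have "\<dots> \<le> liminf (\<lambda>k. \<integral>\<^sup>+x\<in>edge w i. ennreal \<bar>slope f (s k) x - slope f (s K) x\<bar> \<partial>vicsek_nu)"
        by (rule nn_integral_liminf) measurable
      also have "\<dots> \<le> ennreal ((1/2) ^ K)"
      proof (rule Liminf_le)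
        show "\<forall>\<^sub>F k in sequentially. (\<integral>\<^sup>+x\<in>edge w i. ennreal \<bar>slope f (s k) x - slope f (s K) x\<bar> \<partial>vicsek_nu) \<le> ennreal ((1/2) ^ K)"
          using nn_close[OF w K] unfolding eventually_sequentially by blast
      qed simp
      finally show ?thesis .
    qed
    have int_s: "integrable vicsek_nu (\<lambda>x. indicator (edge w i) x *\<^sub>R slope f m x)" for m
      using slope_set_integrable[OF w] by (simp add: set_integrable_def)
    have int_G: "integrable vicsek_nu (\<lambda>x. indicator (edge w i) x *\<^sub>R G x)"
    proof -
      have "integrable vicsek_nu (\<lambda>x. indicator (edge w i) x *\<^sub>R slope f (s n) x - indicator (edge w i) x *\<^sub>R G x)"
        using fatou[of n] by (intro integrableI_bounded) (auto simp: order_le_less_trans)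
      from Bochner_Integration.integrable_diff[OF int_s[of "s n"] this] show ?thesis by simp
    qed
    have half: "(\<lambda>K. ennreal ((1/2) ^ K)) \<longlonglongrightarrow> 0"
      using tendsto_ennrealI[OF LIMSEQ_power_zero[of "1/2 :: real"]] by simp
    have "(\<lambda>K. \<integral>\<^sup>+x. ennreal (norm (indicator (edge w i) x *\<^sub>R slope f (s K) x - indicator (edge w i) x *\<^sub>R G x)) \<partial>vicsek_nu) \<longlonglongrightarrow> 0"
    proof (rule tendsto_sandwich[OF _ _ tendsto_const half])
      show "\<forall>\<^sub>F K in sequentially. (\<integral>\<^sup>+x. ennreal (norm (indicator (edge w i) x *\<^sub>R slope f (s K) x - indicator (edge w i) x *\<^sub>R G x)) \<partial>vicsek_nu) \<le> ennreal ((1/2) ^ K)"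
        using fatou unfolding eventually_sequentially by blast
    qed simp
    then have "(\<lambda>K. \<integral>x. indicator (edge w i) x *\<^sub>R slope f (s K) x \<partial>vicsek_nu) \<longlonglongrightarrow> (\<integral>x. indicator (edge w i) x *\<^sub>R G x \<partial>vicsek_nu)"
      using int_s int_G by (intro tendsto_L1_int) auto
    moreover have "\<forall>\<^sub>F K in sequentially. (\<integral>x. indicator (edge w i) x *\<^sub>R slope f (s K) x \<partial>vicsek_nu) = oincr f w i"
      unfolding eventually_sequentially
    proof (intro exI allI impI)
      fix K assume "n \<le> K"
      then have "n \<le> s K" using s_ge[of K] by simp
      then show "(\<integral>x. indicator (edge w i) x *\<^sub>R slope f (s K) x \<partial>vicsek_nu) = oincr f w i"
        using slope_integral[OF w, of f "s K - n"] by (simp add: set_lebesgue_integral_def)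
    qed
    ultimately have "(\<lambda>K. oincr f w i) \<longlonglongrightarrow> (\<integral>x. indicator (edge w i) x *\<^sub>R G x \<partial>vicsek_nu)"
      by (rule Lim_transform_eventually)
    then show ?thesis unfolding set_lebesgue_integral_def by (simp add: LIMSEQ_const_iff)
  qed
  with G_meas lim show ?thesis by blast
qed

subsection \<open>Existence of the gradient\<close>

lemma edge_index_measurable: "e \<in> edge_index n \<Longrightarrow> case_prod edge e \<in> sets vicsek_nu"
  using edge_sets[of "fst e" n "snd e"] by (auto simp: case_prod_beta)

lemma AE_slope_comp:
  fixes \<phi> :: "real \<Rightarrow> ennreal"
  assumes "\<phi> 0 = 0"
  shows "AE x in vicsek_nu. \<phi> (slope f m x) = (\<Sum>(w, i)\<in>edge_index m. \<phi> (3 ^ m * oincr f w i) * indicator (edge w i) x)"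
  using AE_unique_edge[of m] AE_slope[of m f]
proof eventually_elim
  case (elim x)
  show ?case
  proof (cases "\<exists>e\<in>edge_index m. x \<in> case_prod edge e")
    case True
    then obtain w i where w: "(w, i) \<in> edge_index m" "x \<in> edge w i" by auto
    have "(\<Sum>(w, i)\<in>edge_index m. \<phi> (3 ^ m * oincr f w i) * indicator (edge w i) x) =
        (\<Sum>(w, i)\<in>{(w, i)}. \<phi> (3 ^ m * oincr f w i) * indicator (edge w i) x)"
    proof (rule sum.mono_neutral_right)
      show "\<forall>e\<in>edge_index m - {(w, i)}. (case e of (w, i) \<Rightarrow> \<phi> (3 ^ m * oincr f w i) * indicator (edge w i) x) = 0"
      proof
        fix e assume e: "e \<in> edge_index m - {(w, i)}"
        then have "x \<notin> case_prod edge e" using elim(1)[rule_format, of "(w, i)" e] w by auto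
        then show "(case e of (w, i) \<Rightarrow> \<phi> (3 ^ m * oincr f w i) * indicator (edge w i) x) = 0" by (cases e) simp
      qed
    qed (use w in auto)
    then show ?thesis using elim(2)[rule_format, of w i] w by simp
  next
    case False
    then have "slope f m x = 0" unfolding slope_def by (intro sum.neutral) (auto simp: case_prod_beta)
    moreover have "(\<Sum>(w, i)\<in>edge_index m. \<phi> (3 ^ m * oincr f w i) * indicator (edge w i) x) = 0"
      using False by (intro sum.neutral) (auto simp: case_prod_beta)
    ultimately show ?thesis using assms by simp
  qed
qed

lemma energy_eq_sum_oincr:
  "energy p m f = (\<Sum>(w, i)\<in>edge_index m. \<bar>3 ^ m * oincr f w i\<bar> powr p * (1/3) ^ m)"
proof -
  have "\<bar>3 ^ m * oincr f w i\<bar> powr p * (1/3) ^ m = 3 powr ((p - 1) * m) * \<bar>incr f w i\<bar> powr p" for w i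
  proof -
    have "\<bar>3 ^ m * oincr f w i\<bar> powr p * (1/3) ^ m = ((3 powr m) powr p * 3 powr - m) * \<bar>incr f w i\<bar> powr p"
      by (simp add: abs_mult powr_mult abs_oincr powr_realpow powr_minus_divide power_one_over)
    also have "(3 powr m) powr p * 3 powr - m = (3::real) powr ((p - 1) * m)"
      by (simp add: powr_powr algebra_simps flip: powr_add)
    finally show ?thesis .
  qed
  then show ?thesis by (simp add: energy_def sum_distrib_left sum.cartesian_product case_prod_beta)
qed

lemma nn_integral_slope_powr:
  "(\<integral>\<^sup>+x. ennreal (\<bar>slope f m x\<bar> powr p) \<partial>vicsek_nu) = ennreal (energy p m f)"
proof -
  have "(\<integral>\<^sup>+x. ennreal (\<bar>slope f m x\<bar> powr p) \<partial>vicsek_nu) =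
    (\<integral>\<^sup>+x. (\<Sum>(w, i)\<in>edge_index m. ennreal (\<bar>3 ^ m * oincr f w i\<bar> powr p) * indicator (edge w i) x) \<partial>vicsek_nu)"
    by (intro nn_integral_cong_AE AE_slope_comp) simp
  also have "\<dots> = (\<Sum>e\<in>edge_index m. \<integral>\<^sup>+x. (case e of (w, i) \<Rightarrow> ennreal (\<bar>3 ^ m * oincr f w i\<bar> powr p) * indicator (edge w i) x) \<partial>vicsek_nu)"
    by (rule nn_integral_sum) (use edge_index_measurable[of _ m] in \<open>auto simp: case_prod_beta\<close>)
  also have "\<dots> = (\<Sum>(w, i)\<in>edge_index m. ennreal (\<bar>3 ^ m * oincr f w i\<bar> powr p * (1/3) ^ m))"
    by (intro sum.cong refl) (auto simp: nn_integral_cmult_indicator edge_sets emeasure_edge ennreal_mult)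
  also have "\<dots> = ennreal (energy p m f)"
    unfolding energy_eq_sum_oincr case_prod_beta by (rule sum_ennreal) simp
  finally show ?thesis .
qed

lemma slope_set_integral_powr_le:
  assumes w: "w \<in> vicsek_words n" "i \<in> {1..4}"
    and B: "(\<integral>\<^sup>+x\<in>edge w i. ennreal (\<bar>slope f m x\<bar> powr q) \<partial>vicsek_nu) \<le> ennreal B" "0 \<le> B"
  shows "(LINT x:edge w i|vicsek_nu. \<bar>slope f m x\<bar> powr q) \<le> B"
  unfolding set_lebesgue_integral_def
proof (rule integral_real_bounded[OF B(2)])
  have "(\<integral>\<^sup>+x. ennreal (indicat_real (edge w i) x *\<^sub>R \<bar>slope f m x\<bar> powr q) \<partial>vicsek_nu) =
      (\<integral>\<^sup>+x\<in>edge w i. ennreal (\<bar>slope f m x\<bar> powr q) \<partial>vicsek_nu)"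
    by (intro nn_integral_cong) (simp split: split_indicator)
  then show "(\<integral>\<^sup>+x. ennreal (indicat_real (edge w i) x *\<^sub>R \<bar>slope f m x\<bar> powr q) \<partial>vicsek_nu) \<le> ennreal B"
    using B(1) by simp
qed

lemma exists_gradient:
  assumes p: "1 < p" and E: "\<And>m. energy p m f \<le> E"
  shows "\<exists>G. G \<in> borel_measurable vicsek_nu \<and> (\<integral>\<^sup>+x. ennreal (\<bar>G x\<bar> powr p) \<partial>vicsek_nu) \<le> ennreal E \<and>
    (\<forall>n. \<forall>w\<in>vicsek_words n. \<forall>i\<in>{1..4}. (LINT x:edge w i|vicsek_nu. G x) = oincr f w i)"
proof -
  have E0: "0 \<le> E" using E[of 0] energy_nonneg[of p 0 f] by linarith
  have slope_E: "(\<integral>\<^sup>+x. ennreal (\<bar>slope f m x\<bar> powr p) \<partial>vicsek_nu) \<le> ennreal E" for m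
    unfolding nn_integral_slope_powr using E by (intro ennreal_leI)
  have "(LINT x:edge w i|vicsek_nu. \<bar>slope f m x\<bar> powr p) \<le> E" if "w \<in> vicsek_words n" "i \<in> {1..4}" for w n i m
  proof (rule slope_set_integral_powr_le[OF that _ E0])
    show "(\<integral>\<^sup>+x\<in>edge w i. ennreal (\<bar>slope f m x\<bar> powr p) \<partial>vicsek_nu) \<le> ennreal E"
      by (rule order_trans[OF nn_integral_mono slope_E]) (auto simp: indicator_def)
  qed
  then have cauchy: "\<forall>n. \<forall>w\<in>vicsek_words n. \<forall>i\<in>{1..4}. \<forall>\<epsilon>>0. \<forall>\<^sub>F m in sequentially. \<forall>k\<ge>m.
      (LINT x:edge w i|vicsek_nu. \<bar>slope f k x - slope f m x\<bar>) \<le> \<epsilon>"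
    using slope_L1_cauchy[OF _ _ p] by blast
  obtain G s where G [measurable]: "G \<in> borel_measurable vicsek_nu"
    and lim: "AE x in vicsek_nu. (\<lambda>k. slope f (s k) x) \<longlonglongrightarrow> G x"
    and int: "\<forall>n. \<forall>w\<in>vicsek_words n. \<forall>i\<in>{1..4}. (LINT x:edge w i|vicsek_nu. G x) = oincr f w i"
    using slope_limit[OF cauchy] by blast
  have "(\<integral>\<^sup>+x. ennreal (\<bar>G x\<bar> powr p) \<partial>vicsek_nu) = (\<integral>\<^sup>+x. liminf (\<lambda>k. ennreal (\<bar>slope f (s k) x\<bar> powr p)) \<partial>vicsek_nu)"
  proof (rule nn_integral_cong_AE)
    show "AE x in vicsek_nu. ennreal (\<bar>G x\<bar> powr p) = liminf (\<lambda>k. ennreal (\<bar>slope f (s k) x\<bar> powr p))"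
      using lim
    proof eventually_elim
      case (elim x)
      have "(\<lambda>k. ennreal (\<bar>slope f (s k) x\<bar> powr p)) \<longlonglongrightarrow> ennreal (\<bar>G x\<bar> powr p)"
        using p by (intro tendsto_ennrealI tendsto_powr' tendsto_rabs elim tendsto_const) auto
      then show ?case by (intro lim_imp_Liminf[symmetric]) auto
    qed
  qed
  also have "\<dots> \<le> liminf (\<lambda>k. \<integral>\<^sup>+x. ennreal (\<bar>slope f (s k) x\<bar> powr p) \<partial>vicsek_nu)"
    by (rule nn_integral_liminf) measurable
  also have "\<dots> \<le> ennreal E" by (intro Liminf_le always_eventually allI slope_E) auto
  finally show ?thesis using G int by blast
qed

text \<open>Edges have finite length, so slopes bounded by L are bounded in L^2 of each edge and the
  convergence criterion applies with q = 2; the bound L passes to the pointwise limit.\<close>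

lemma exists_gradient_infinity:
  assumes L: "\<And>m w i. w \<in> vicsek_words m \<Longrightarrow> i \<in> {1..4} \<Longrightarrow> \<bar>incr f w i\<bar> \<le> L / 3 ^ m"
  shows "\<exists>G. G \<in> borel_measurable vicsek_nu \<and> (AE x in vicsek_nu. \<bar>G x\<bar> \<le> L) \<and>
    (\<forall>n. \<forall>w\<in>vicsek_words n. \<forall>i\<in>{1..4}. (LINT x:edge w i|vicsek_nu. G x) = oincr f w i)"
proof -
  have L0: "0 \<le> L" using L[of "[]" 0 1] by simp
  have slope_L: "AE x in vicsek_nu. \<forall>m. \<bar>slope f m x\<bar> \<le> L"
  proof (subst AE_all_countable, rule allI)
    fix m
    show "AE x in vicsek_nu. \<bar>slope f m x\<bar> \<le> L"
      using AE_slope[of m f]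
    proof eventually_elim
      case (elim x)
      show ?case
      proof (cases "\<exists>e\<in>edge_index m. x \<in> case_prod edge e")
        case True
        then obtain w i where w: "w \<in> vicsek_words m" "i \<in> {1..4}" "x \<in> edge w i" by auto
        then have "\<bar>slope f m x\<bar> = 3 ^ m * \<bar>incr f w i\<bar>" using elim by (simp add: abs_mult abs_oincr)
        then show ?thesis using L[OF w(1,2)] by (simp add: field_simps)
      next
        case False
        then have "slope f m x = 0" unfolding slope_def by (intro sum.neutral) (auto simp: case_prod_beta)
        then show ?thesis using L0 by simp
      qed
    qed
  qed
  have bound: "(LINT x:edge w i|vicsek_nu. \<bar>slope f m x\<bar> powr 2) \<le> L\<^sup>2" if w: "w \<in> vicsek_words n" "i \<in> {1..4}" for w n i m
  proof (rule slope_set_integral_powr_le[OF w])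
    have "(\<integral>\<^sup>+x\<in>edge w i. ennreal (\<bar>slope f m x\<bar> powr 2) \<partial>vicsek_nu) \<le> (\<integral>\<^sup>+x. ennreal (L\<^sup>2) * indicator (edge w i) x \<partial>vicsek_nu)"
    proof (rule nn_integral_mono_AE)
      show "AE x in vicsek_nu. ennreal (\<bar>slope f m x\<bar> powr 2) * indicator (edge w i) x \<le> ennreal (L\<^sup>2) * indicator (edge w i) x"
        using slope_L
      proof eventually_elim
        case (elim x)
        then have "\<bar>slope f m x\<bar>\<^sup>2 \<le> L\<^sup>2" by (intro power_mono) auto
        then show ?case by (intro mult_right_mono ennreal_leI) auto
      qed
    qed
    also have "\<dots> = ennreal (L\<^sup>2 * (1/3) ^ n)"
      using w by (simp add: nn_integral_cmult_indicator edge_sets emeasure_edge ennreal_mult)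
    also have "\<dots> \<le> ennreal (L\<^sup>2)" by (intro ennreal_leI mult_left_le) (auto simp: power_le_one)
    finally show "(\<integral>\<^sup>+x\<in>edge w i. ennreal (\<bar>slope f m x\<bar> powr 2) \<partial>vicsek_nu) \<le> ennreal (L\<^sup>2)" .
  qed simp
  have cauchy: "\<forall>n. \<forall>w\<in>vicsek_words n. \<forall>i\<in>{1..4}. \<forall>\<epsilon>>0. \<forall>\<^sub>F m in sequentially. \<forall>k\<ge>m.
      (LINT x:edge w i|vicsek_nu. \<bar>slope f k x - slope f m x\<bar>) \<le> \<epsilon>"
  proof (intro allI ballI impI)
    fix n w i and \<epsilon> :: real assume *: "w \<in> vicsek_words n" "i \<in> {1..4::nat}" "0 < \<epsilon>"
    show "\<forall>\<^sub>F m in sequentially. \<forall>k\<ge>m. (LINT x:edge w i|vicsek_nu. \<bar>slope f k x - slope f m x\<bar>) \<le> \<epsilon>"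
      by (rule slope_L1_cauchy[OF *(1,2) _ bound[OF *(1,2)] *(3)]) simp
  qed
  obtain G s where G: "G \<in> borel_measurable vicsek_nu"
    and lim: "AE x in vicsek_nu. (\<lambda>k. slope f (s k) x) \<longlonglongrightarrow> G x"
    and int: "\<forall>n. \<forall>w\<in>vicsek_words n. \<forall>i\<in>{1..4}. (LINT x:edge w i|vicsek_nu. G x) = oincr f w i"
    using slope_limit[OF cauchy] by blast
  have "AE x in vicsek_nu. \<bar>G x\<bar> \<le> L"
    using lim slope_L
  proof eventually_elim
    case (elim x)
    show ?case by (rule LIMSEQ_le_const2[OF tendsto_rabs[OF elim(1)]]) (use elim(2) in auto)
  qed
  then show ?thesis using G int by blast
qed

subsection \<open>Energies are controlled by the gradient\<close>

lemma Lp_norm_real: "Lp_norm (ereal p) M g = ennreal_powr (\<integral>\<^sup>+x. ennreal (\<bar>g x\<bar> powr p) \<partial>M) (1 / p)"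
  by (simp add: Lp_norm_def)

lemma ennreal_powr_less_top_iff: "ennreal_powr x a < top \<longleftrightarrow> x < top"
  by (cases x) (auto simp: ennreal_powr_def)

lemma set_integrable_edge_AE_bound:
  assumes w: "w \<in> vicsek_words n" "i \<in> {1..4}" and g: "g \<in> borel_measurable vicsek_nu"
    and L: "AE x in vicsek_nu. \<bar>g x\<bar> \<le> L"
  shows "set_integrable vicsek_nu (edge w i) (g :: _ \<Rightarrow> real)"
  unfolding set_integrable_def
proof (rule Bochner_Integration.integrable_bound)
  show "integrable vicsek_nu (\<lambda>x. L * indicat_real (edge w i) x)"
    using edge_sets[OF w] emeasure_edge[OF w] by (auto simp: integrable_indicator_iff)
  show "(\<lambda>x. indicat_real (edge w i) x *\<^sub>R g x) \<in> borel_measurable vicsek_nu"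
    using g edge_sets[OF w] by (intro borel_measurable_scaleR borel_measurable_indicator)
  show "AE x in vicsek_nu. norm (indicat_real (edge w i) x *\<^sub>R g x) \<le> norm (L * indicat_real (edge w i) x)"
    using L by eventually_elim (auto simp: indicator_def)
qed

lemma set_integrable_edge_powr:
  assumes w: "w \<in> vicsek_words n" "i \<in> {1..4}" and g: "g \<in> borel_measurable vicsek_nu"
    and p: "1 \<le> p" "(\<integral>\<^sup>+x. ennreal (\<bar>g x\<bar> powr p) \<partial>vicsek_nu) < \<infinity>"
  shows "set_integrable vicsek_nu (edge w i) (g :: _ \<Rightarrow> real)"
proof (rule set_integrable_edge_bound[OF w g, where b = "\<lambda>x. \<bar>g x\<bar> powr p" and c = 1])
  show "integrable vicsek_nu (\<lambda>x. \<bar>g x\<bar> powr p)"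
    using g p(2) by (intro integrableI_bounded) auto
qed (use p abs_le_one_plus_powr in auto)

text \<open>The factor (3^-m)^(p-1) of Jensen on an edge is exactly the normalisation of the energy,
  and edges of one level overlap in a null set, so their integrals add up to at most the
  whole.\<close>

lemma energy_le_gradient:
  assumes p: "1 \<le> p" and g: "g \<in> borel_measurable vicsek_nu"
    and int: "\<And>w i. w \<in> vicsek_words m \<Longrightarrow> i \<in> {1..4} \<Longrightarrow> set_integrable vicsek_nu (edge w i) g"
    and eq: "\<And>w i. w \<in> vicsek_words m \<Longrightarrow> i \<in> {1..4} \<Longrightarrow> (LINT x:edge w i|vicsek_nu. g x) = oincr f w i"
  shows "ennreal (energy p m f) \<le> (\<integral>\<^sup>+x. ennreal (\<bar>g x\<bar> powr p) \<partial>vicsek_nu)"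
proof -
  have edge: "ennreal (\<bar>3 ^ m * oincr f w i\<bar> powr p * (1/3) ^ m) \<le> (\<integral>\<^sup>+x\<in>edge w i. ennreal (\<bar>g x\<bar> powr p) \<partial>vicsek_nu)"
    if w: "w \<in> vicsek_words m" "i \<in> {1..4}" for w i
  proof -
    let ?I = "\<integral>\<^sup>+x\<in>edge w i. ennreal (\<bar>g x\<bar> powr p) \<partial>vicsek_nu"
    have "ennreal (\<bar>oincr f w i\<bar> powr p) \<le> ennreal (((1/3) ^ m) powr (p - 1)) * ?I"
      using jensen_powr[OF edge_sets[OF w] emeasure_edge[OF w] _ int[OF w] p] eq[OF w] by simp
    then have "ennreal ((3 ^ m) powr (p - 1)) * ennreal (\<bar>oincr f w i\<bar> powr p) \<le>
        ennreal ((3 ^ m) powr (p - 1)) * (ennreal (((1/3) ^ m) powr (p - 1)) * ?I)"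
      by (rule mult_left_mono) simp
    also have "\<dots> = ennreal ((3 ^ m) powr (p - 1) * ((1/3) ^ m) powr (p - 1)) * ?I"
      by (simp add: ennreal_mult mult.assoc)
    also have "(3 ^ m) powr (p - 1) * ((1/3) ^ m) powr (p - 1) = (1::real)"
      by (simp add: power_one_over flip: powr_mult)
    finally have "ennreal ((3 ^ m) powr (p - 1) * \<bar>oincr f w i\<bar> powr p) \<le> ?I" by (simp add: ennreal_mult)
    moreover have "\<bar>3 ^ m * oincr f w i\<bar> powr p * (1/3) ^ m = (3 ^ m) powr (p - 1) * \<bar>oincr f w i\<bar> powr p"
      by (simp add: abs_mult powr_mult powr_diff power_one_over)
    ultimately show ?thesis by simp
  qed
  have "ennreal (energy p m f) = (\<Sum>(w, i)\<in>edge_index m. ennreal (\<bar>3 ^ m * oincr f w i\<bar> powr p * (1/3) ^ m))"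
    unfolding energy_eq_sum_oincr case_prod_beta by (rule sum_ennreal[symmetric]) simp
  also have "\<dots> \<le> (\<Sum>e\<in>edge_index m. \<integral>\<^sup>+x\<in>case_prod edge e. ennreal (\<bar>g x\<bar> powr p) \<partial>vicsek_nu)"
    using edge by (intro sum_mono) auto
  also have "\<dots> = (\<integral>\<^sup>+x. (\<Sum>e\<in>edge_index m. ennreal (\<bar>g x\<bar> powr p) * indicator (case_prod edge e) x) \<partial>vicsek_nu)"
    using g edge_index_measurable by (intro nn_integral_sum[symmetric]) auto
  also have "\<dots> \<le> (\<integral>\<^sup>+x. ennreal (\<bar>g x\<bar> powr p) \<partial>vicsek_nu)"
  proof (rule nn_integral_mono_AE)
    show "AE x in vicsek_nu. (\<Sum>e\<in>edge_index m. ennreal (\<bar>g x\<bar> powr p) * indicator (case_prod edge e) x) \<le> ennreal (\<bar>g x\<bar> powr p)"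
      using AE_unique_edge[of m]
    proof eventually_elim
      case (elim x)
      show ?case
      proof (cases "\<exists>e\<in>edge_index m. x \<in> case_prod edge e")
        case True
        then obtain e where e: "e \<in> edge_index m" "x \<in> case_prod edge e" by blast
        have "(\<Sum>e\<in>edge_index m. ennreal (\<bar>g x\<bar> powr p) * indicator (case_prod edge e) x) =
            (\<Sum>e\<in>{e}. ennreal (\<bar>g x\<bar> powr p) * indicator (case_prod edge e) x)"
        proof (rule sum.mono_neutral_right)
          show "\<forall>e'\<in>edge_index m - {e}. ennreal (\<bar>g x\<bar> powr p) * indicator (case_prod edge e') x = 0"
          proof
            fix e' assume "e' \<in> edge_index m - {e}"
            then have "x \<notin> case_prod edge e'" using e elim by blast
            then show "ennreal (\<bar>g x\<bar> powr p) * indicator (case_prod edge e') x = 0" by (simp add: indicator_def)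
          qed
        qed (use e in auto)
        then show ?thesis using e by simp
      next
        case False
        then have "(\<Sum>e\<in>edge_index m. ennreal (\<bar>g x\<bar> powr p) * indicator (case_prod edge e) x) = 0"
        proof (intro sum.neutral ballI)
          fix e assume "e \<in> edge_index m"
          then have "x \<notin> case_prod edge e" using False by blast
          then show "ennreal (\<bar>g x\<bar> powr p) * indicator (case_prod edge e) x = 0" by (simp add: indicator_def)
        qed
        then show ?thesis by (rule ord_eq_le_trans) simp
      qed
    qed
  qed
  finally show ?thesis .
qed

lemma incr_le_gradient:
  assumes w: "w \<in> vicsek_words m" "i \<in> {1..4}" and g: "g \<in> borel_measurable vicsek_nu"
    and L: "AE x in vicsek_nu. \<bar>g x\<bar> \<le> L" and eq: "(LINT x:edge w i|vicsek_nu. g x) = oincr f w i"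
  shows "\<bar>incr f w i\<bar> \<le> L / 3 ^ m"
proof -
  have int: "integrable vicsek_nu (\<lambda>x. indicat_real (edge w i) x *\<^sub>R g x)"
    using set_integrable_edge_AE_bound[OF w g L] by (simp add: set_integrable_def)
  have "\<bar>oincr f w i\<bar> \<le> (\<integral>x. \<bar>indicat_real (edge w i) x *\<^sub>R g x\<bar> \<partial>vicsek_nu)"
    unfolding eq[symmetric] set_lebesgue_integral_def by (rule integral_abs_bound)
  also have "\<dots> \<le> (\<integral>x. L * indicat_real (edge w i) x \<partial>vicsek_nu)"
  proof (rule integral_mono_AE)
    show "integrable vicsek_nu (\<lambda>x. \<bar>indicat_real (edge w i) x *\<^sub>R g x\<bar>)" using int by (rule integrable_abs)
    show "integrable vicsek_nu (\<lambda>x. L * indicat_real (edge w i) x)"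
      using edge_sets[OF w] emeasure_edge[OF w] by (auto simp: integrable_indicator_iff)
    show "AE x in vicsek_nu. \<bar>indicat_real (edge w i) x *\<^sub>R g x\<bar> \<le> L * indicat_real (edge w i) x"
      using L by eventually_elim (auto simp: indicator_def)
  qed
  also have "\<dots> = L * (1/3) ^ m"
    using measure_edge[OF w] sets.sets_into_space[OF edge_sets[OF w]] by (simp add: Int_absorb2)
  finally show ?thesis unfolding abs_oincr power_one_over by simp
qed

subsection \<open>Uniqueness of the gradient\<close>

lemma enn2real_eqD: "enn2real a = enn2real b \<Longrightarrow> a \<noteq> \<infinity> \<Longrightarrow> b \<noteq> \<infinity> \<Longrightarrow> a = b"
  by (cases a; cases b) auto

text \<open>The positive and negative parts of g - h, taken as densities, give every edge the same
  finite mass. By \<open>measure_eq_on_cells\<close> the two measures coincide, so the densities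
  agree almost everywhere, and both parts can only be equal where they vanish.\<close>

lemma gradient_unique:
  fixes g h :: "real \<times> real \<Rightarrow> real"
  assumes g: "g \<in> borel_measurable vicsek_nu" "\<And>n w i. w \<in> vicsek_words n \<Longrightarrow> i \<in> {1..4} \<Longrightarrow> set_integrable vicsek_nu (edge w i) g"
    and h: "h \<in> borel_measurable vicsek_nu" "\<And>n w i. w \<in> vicsek_words n \<Longrightarrow> i \<in> {1..4} \<Longrightarrow> set_integrable vicsek_nu (edge w i) h"
    and eq: "\<And>n w i. w \<in> vicsek_words n \<Longrightarrow> i \<in> {1..4} \<Longrightarrow> (LINT x:edge w i|vicsek_nu. g x) = (LINT x:edge w i|vicsek_nu. h x)"
  shows "AE x in vicsek_nu. g x = h x"
proof -
  note [measurable] = g(1) h(1)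
  define k where "k x = g x - h x" for x
  have [measurable]: "k \<in> borel_measurable vicsek_nu" unfolding k_def by measurable
  \<comment> \<open>\<open>ennreal\<close> truncates at 0, so these densities are the positive and
    the negative part of \<open>k\<close>.\<close>
  let ?M = "density vicsek_nu (\<lambda>x. ennreal (k x))" and ?N = "density vicsek_nu (\<lambda>x. ennreal (- k x))"
  have null: "emeasure (density vicsek_nu u) {x} = 0" if "x \<in> vicsek_skeleton" "u \<in> borel_measurable vicsek_nu" for x u
  proof -
    have x: "{x} \<in> null_sets vicsek_nu"
      using that emeasure_nu_singleton by (intro null_setsI closed_sets_nu) auto
    have "AE y in vicsek_nu. y \<in> {x} \<longrightarrow> u y = 0" using AE_not_in[OF x] by eventually_elim simp
    then have "{x} \<in> null_sets (density vicsek_nu u)" using x that(2) by (simp add: null_sets_density_iff null_setsD2)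
    then show ?thesis by (rule null_setsD1)
  qed
  have edge: "emeasure ?M c = emeasure ?N c \<and> emeasure ?M c \<noteq> \<infinity>" if csk: "c \<in> skeleton_edges" for c
  proof -
    obtain n w i where c: "c = edge w i" and w: "w \<in> vicsek_words n" "i \<in> {1..4}"
      using csk unfolding skeleton_edges_def by blast
    have [measurable]: "edge w i \<in> sets vicsek_nu" by (rule edge_sets[OF w])
    let ?k = "\<lambda>x. indicat_real (edge w i) x *\<^sub>R k x"
    have "set_integrable vicsek_nu (edge w i) k"
      unfolding k_def using g(2)[OF w] h(2)[OF w] by (rule set_integral_diff)
    then have int: "integrable vicsek_nu ?k" by (simp add: set_integrable_def)
    have "(LINT x:edge w i|vicsek_nu. k x) = 0"
      unfolding k_def using g(2)[OF w] h(2)[OF w] eq[OF w] by (simp add: set_integral_diff)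
    then have "enn2real (\<integral>\<^sup>+x. ennreal (?k x) \<partial>vicsek_nu) = enn2real (\<integral>\<^sup>+x. ennreal (- ?k x) \<partial>vicsek_nu)"
      using real_lebesgue_integral_def[OF int] by (simp add: set_lebesgue_integral_def)
    moreover have fin: "(\<integral>\<^sup>+x. ennreal (?k x) \<partial>vicsek_nu) \<noteq> \<infinity>" "(\<integral>\<^sup>+x. ennreal (- ?k x) \<partial>vicsek_nu) \<noteq> \<infinity>"
      using int unfolding real_integrable_def by auto
    ultimately have "(\<integral>\<^sup>+x. ennreal (?k x) \<partial>vicsek_nu) = (\<integral>\<^sup>+x. ennreal (- ?k x) \<partial>vicsek_nu)"
      by (intro enn2real_eqD)
    moreover have "emeasure ?M c = (\<integral>\<^sup>+x. ennreal (?k x) \<partial>vicsek_nu)" "emeasure ?N c = (\<integral>\<^sup>+x. ennreal (- ?k x) \<partial>vicsek_nu)"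
      unfolding c by (subst emeasure_density; auto intro!: nn_integral_cong simp: indicator_def)+
    ultimately show ?thesis using fin by simp
  qed
  have "?M = ?N"
  proof (rule measure_eq_on_cells[OF _ _ skeleton_edges_props(1,2,3,4)])
    show "emeasure ?M c = emeasure ?N c" "emeasure ?M c \<noteq> \<infinity>" if csk: "c \<in> skeleton_edges" for c
      using edge[OF csk] by auto
    show "emeasure ?M {x} = 0" "emeasure ?N {x} = 0" if "x \<in> vicsek_skeleton" for x
      using null[OF that] by auto
  qed (auto simp: sets_nu)
  then have "AE x in vicsek_nu. ennreal (k x) = ennreal (- k x)"
    by (intro sigma_finite_measure.density_unique[OF sigma_finite_nu]) auto
  then show ?thesis
  proof eventually_elim
    case (elim x)
    then have "k x = 0" by (cases "0 \<le> k x") (auto simp: ennreal_neg)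
    then show ?case by (simp add: k_def)
  qed
qed

section \<open>Equivalence of the Sobolev, energy and gradient descriptions\<close>

text \<open>The Bochner integral of a non-integrable function is 0 by convention, so the defining
  identity of a gradient says something only with this. It holds because edges have finite
  length.\<close>

lemma gradient_set_integrable:
  assumes p: "1 < p" and g: "g \<in> Lp_space p vicsek_nu" and w: "w \<in> vicsek_words n" "i \<in> {1..4}"
  shows "set_integrable vicsek_nu (edge w i) g"
proof (cases p)
  case (real r)
  have "set_integrable vicsek_nu (edge w i) g" if "1 \<le> r" "(\<integral>\<^sup>+x. ennreal (\<bar>g x\<bar> powr r) \<partial>vicsek_nu) < \<infinity>"
    using g that by (intro set_integrable_edge_powr[OF w]) (auto simp: Lp_space_def)
  then show ?thesis
    using p g real by (simp add: Lp_space_def Lp_norm_real ennreal_powr_less_top_iff)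
next
  case PInf
  define L where "L = enn2real (esssup vicsek_nu (\<lambda>x. ennreal \<bar>g x\<bar>))"
  have fin: "esssup vicsek_nu (\<lambda>x. ennreal \<bar>g x\<bar>) = ennreal L"
    using g PInf by (simp add: L_def Lp_space_def Lp_norm_def)
  have "AE x in vicsek_nu. \<bar>g x\<bar> \<le> L"
    using esssup_AE[of "\<lambda>x. ennreal \<bar>g x\<bar>" vicsek_nu] unfolding fin by eventually_elim (simp add: L_def)
  then show ?thesis using g by (intro set_integrable_edge_AE_bound[OF w]) (auto simp: Lp_space_def)
qed (use p in auto)

lemma is_gradient_unique:
  assumes p: "1 < p" and g: "is_gradient p f g" and h: "is_gradient p f h"
  shows "AE x in vicsek_nu. g x = h x"
proof (rule gradient_unique)
  show "g \<in> borel_measurable vicsek_nu" "h \<in> borel_measurable vicsek_nu"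
    using g h by (auto simp: is_gradient_def Lp_space_def)
  show "set_integrable vicsek_nu (edge w i) g" "set_integrable vicsek_nu (edge w i) h"
    if "w \<in> vicsek_words n" "i \<in> {1..4}" for n w i
    using gradient_set_integrable[OF p _ that] g h by (auto simp: is_gradient_def)
  show "(LINT x:edge w i|vicsek_nu. g x) = (LINT x:edge w i|vicsek_nu. h x)"
    if w: "w \<in> vicsek_words n" "i \<in> {1..4}" for n w i
    using g h w unfolding is_gradient_iff by metis
qed

lemma F_space_iff: "continuous_on vicsek_set f \<Longrightarrow> f \<in> F_space p \<longleftrightarrow> (\<exists>E. \<forall>m. vicsek_energy p m f \<le> E)"
  by (auto simp: F_space_def bdd_above_def)

subsection \<open>Finite exponents\<close>

text \<open>Supplies the L^p membership in \<open>W_space\<close>: a continuous function on K is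
  bounded and mu is a probability.\<close>

lemma continuous_Lp_mu:
  assumes "1 < p" "continuous_on vicsek_set f"
  shows "f \<in> Lp_space (ereal p) vicsek_mu"
proof -
  obtain c where c: "\<And>x. x \<in> vicsek_set \<Longrightarrow> \<bar>f x\<bar> \<le> c"
    using compact_imp_bounded[OF compact_continuous_image[OF assms(2) compact_K]] unfolding bounded_iff by auto
  have "(\<integral>\<^sup>+x. ennreal (\<bar>f x\<bar> powr p) \<partial>vicsek_mu) \<le> (\<integral>\<^sup>+x. ennreal (c powr p) \<partial>vicsek_mu)"
    using c assms(1) by (intro nn_integral_mono ennreal_leI powr_mono2) (auto simp: space_mu)
  also have "\<dots> = ennreal (c powr p)"
    using prob_space.emeasure_space_1[OF prob_space_mu] by simp
  also have "\<dots> < \<infinity>" by simp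
  finally show ?thesis
    using continuous_measurable_mu[OF assms(2)] by (simp add: Lp_space_def Lp_norm_real ennreal_powr_less_top_iff)
qed

lemma W_space_iff_F_space:
  assumes p: "1 < p" and f: "continuous_on vicsek_set f"
  shows "f \<in> W_space (ereal p) \<longleftrightarrow> f \<in> F_space (ereal p)"
proof -
  have "f \<in> W_space (ereal p) \<longleftrightarrow> W_norm (ereal p) f < \<infinity>"
    using continuous_Lp_mu[OF p f] by (simp add: W_space_def)
  also have "\<dots> \<longleftrightarrow> (\<exists>E. \<forall>m. energy p m f \<le> E)"
  proof
    assume "W_norm (ereal p) f < \<infinity>"
    then obtain \<kappa> where \<kappa>: "W_norm (ereal p) f = ennreal \<kappa>" "0 \<le> \<kappa>" by (cases "W_norm (ereal p) f") auto
    then have "W_norm (ereal p) f < ennreal (\<kappa> + 1)" by (simp add: ennreal_less_iff)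
    then show "\<exists>E. \<forall>m. energy p m f \<le> E" using energy_le_W_norm[OF p f, of "\<kappa> + 1"] \<kappa>(2) by auto
  next
    assume "\<exists>E. \<forall>m. energy p m f \<le> E"
    then obtain E where "\<And>m. energy p m f \<le> E" by blast
    from W_norm_le[OF p f this] show "W_norm (ereal p) f < \<infinity>" by (rule order_le_less_trans) simp
  qed
  finally show ?thesis using f by (simp add: F_space_iff vicsek_energy_eq)
qed

lemma gradient_energy_le:
  assumes p: "1 < p" and g: "is_gradient (ereal p) f g"
  obtains \<iota> where "0 \<le> \<iota>" "(\<integral>\<^sup>+x. ennreal (\<bar>g x\<bar> powr p) \<partial>vicsek_nu) = ennreal \<iota>" "\<And>m. energy p m f \<le> \<iota>"
proof -
  let ?I = "\<integral>\<^sup>+x. ennreal (\<bar>g x\<bar> powr p) \<partial>vicsek_nu"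
  have Lp: "g \<in> Lp_space (ereal p) vicsek_nu" using g by (simp add: is_gradient_def)
  then have "?I < \<infinity>" by (simp add: Lp_space_def Lp_norm_real ennreal_powr_less_top_iff)
  then obtain \<iota> where \<iota>: "0 \<le> \<iota>" "?I = ennreal \<iota>" by (cases ?I) auto
  have "ennreal (energy p m f) \<le> ?I" for m
  proof (rule energy_le_gradient)
    show "g \<in> borel_measurable vicsek_nu" using Lp by (simp add: Lp_space_def)
    show "set_integrable vicsek_nu (edge w i) g" if "w \<in> vicsek_words m" "i \<in> {1..4}" for w i
      using gradient_set_integrable[OF _ Lp that] p by simp
    show "(LINT x:edge w i|vicsek_nu. g x) = oincr f w i" if "w \<in> vicsek_words m" "i \<in> {1..4}" for w i
      using g that unfolding is_gradient_iff by metis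
  qed (use p in simp)
  then have "energy p m f \<le> \<iota>" for m using \<iota> by simp
  then show thesis using \<iota> that by blast
qed

lemma is_gradient_of_energy:
  assumes p: "1 < p" and E: "\<And>m. energy p m f \<le> E"
  obtains G where "is_gradient (ereal p) f G" "(\<integral>\<^sup>+x. ennreal (\<bar>G x\<bar> powr p) \<partial>vicsek_nu) \<le> ennreal E"
proof -
  obtain G where G: "G \<in> borel_measurable vicsek_nu" "(\<integral>\<^sup>+x. ennreal (\<bar>G x\<bar> powr p) \<partial>vicsek_nu) \<le> ennreal E"
    "\<forall>n. \<forall>w\<in>vicsek_words n. \<forall>i\<in>{1..4}. (LINT x:edge w i|vicsek_nu. G x) = oincr f w i"
    using exists_gradient[OF p E] by blast
  have "(\<integral>\<^sup>+x. ennreal (\<bar>G x\<bar> powr p) \<partial>vicsek_nu) < \<infinity>" using G(2) by (rule order_le_less_trans) simp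
  then have "G \<in> Lp_space (ereal p) vicsek_nu" using G(1) by (simp add: Lp_space_def Lp_norm_real ennreal_powr_less_top_iff)
  moreover have "\<forall>n. \<forall>w\<in>vicsek_words n. \<forall>i\<in>{1..4}. oincr f w i = (LINT x:edge w i|vicsek_nu. G x)" using G(3) by metis
  ultimately have "is_gradient (ereal p) f G" unfolding is_gradient_iff by blast
  then show thesis using G(2) that by blast
qed

lemma F_space_iff_gradient:
  assumes p: "1 < p" and f: "continuous_on vicsek_set f"
  shows "f \<in> F_space (ereal p) \<longleftrightarrow> (\<exists>g. is_gradient (ereal p) f g)"
  unfolding F_space_iff[OF f] vicsek_energy_eq
  using is_gradient_of_energy[OF p] gradient_energy_le[OF p] by metis

text \<open>One gradient with norm at most the energy was constructed, any gradient has norm at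
  least the energy, and uniqueness identifies the two.\<close>

lemma Lp_norm_gradient:
  assumes p: "1 < p" and g: "is_gradient (ereal p) f g"
  shows "Lp_norm (ereal p) vicsek_nu g = ennreal (esup p f powr (1/p))"
proof -
  obtain \<iota> where \<iota>: "0 \<le> \<iota>" "(\<integral>\<^sup>+x. ennreal (\<bar>g x\<bar> powr p) \<partial>vicsek_nu) = ennreal \<iota>" "\<And>m. energy p m f \<le> \<iota>"
    using gradient_energy_le[OF p g] by blast
  have "energy p m f \<le> esup p f" for m using \<iota>(3) by (rule energy_le_esup)
  then obtain G where G: "is_gradient (ereal p) f G" "(\<integral>\<^sup>+x. ennreal (\<bar>G x\<bar> powr p) \<partial>vicsek_nu) \<le> ennreal (esup p f)"
    using is_gradient_of_energy[OF p] by blast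
  have "AE x in vicsek_nu. g x = G x" using is_gradient_unique[OF _ g G(1)] p by simp
  then have "(\<integral>\<^sup>+x. ennreal (\<bar>g x\<bar> powr p) \<partial>vicsek_nu) = (\<integral>\<^sup>+x. ennreal (\<bar>G x\<bar> powr p) \<partial>vicsek_nu)"
    by (intro nn_integral_cong_AE) (auto elim: eventually_mono)
  then have "ennreal \<iota> \<le> ennreal (esup p f)" using \<iota>(2) G(2) by simp
  moreover have "0 \<le> esup p f" using \<iota>(3) by (rule esup_nonneg)
  ultimately have "\<iota> \<le> esup p f" by simp
  moreover have "esup p f \<le> \<iota>" unfolding esup_def using \<iota>(3) by (intro cSUP_least) auto
  ultimately have "\<iota> = esup p f" by simp
  then show ?thesis using \<iota> by (simp add: Lp_norm_real ennreal_powr_def)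
qed

lemma F_norm_real:
  assumes p: "1 < p" and E: "\<And>m. energy p m f \<le> E"
  shows "F_norm (ereal p) f = ennreal (esup p f powr (1/p))"
proof -
  have F: "F_norm (ereal p) f = (SUP m. ennreal (energy p m f powr (1/p)))"
    by (simp add: F_norm_def vicsek_energy_eq)
  have "(\<lambda>m. energy p m f) \<longlonglongrightarrow> esup p f"
    unfolding esup_def
  proof (rule LIMSEQ_incseq_SUP)
    show "bdd_above (range (\<lambda>m. energy p m f))" using E by (rule bdd_aboveI2)
    show "incseq (\<lambda>m. energy p m f)" using energy_mono[of p] p by (auto simp: incseq_def)
  qed
  then have "(\<lambda>m. ennreal (energy p m f powr (1/p))) \<longlonglongrightarrow> ennreal (esup p f powr (1/p))"
    using p energy_nonneg by (intro tendsto_ennrealI tendsto_powr' tendsto_const) auto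
  then have "ennreal (esup p f powr (1/p)) \<le> F_norm (ereal p) f"
    unfolding F by (rule LIMSEQ_le_const2) (auto intro!: exI SUP_upper)
  moreover have "F_norm (ereal p) f \<le> ennreal (esup p f powr (1/p))"
    unfolding F using p energy_nonneg energy_le_esup[OF E]
    by (intro SUP_least ennreal_leI powr_mono2) auto
  ultimately show ?thesis by (rule antisym[rotated])
qed

text \<open>By contradiction, since \<open>energy_le_W_norm\<close> asks for a number strictly above
  the norm. With N the root of \<open>esup p f\<close>, the number N / (A + 1) would then satisfy N
  \<le> A N / (A + 1); the summand 1 makes this absurd and keeps the denominator positive.\<close>

lemma W_norm_lower:
  assumes p: "1 < p" and f: "continuous_on vicsek_set f" and W: "W_norm (ereal p) f < \<infinity>"
  shows "ennreal (1 / (energy_const p powr (1/p) + 1)) * ennreal (esup p f powr (1/p)) \<le> W_norm (ereal p) f"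
proof -
  let ?A = "energy_const p powr (1/p)" and ?N = "esup p f powr (1/p)"
  obtain W' where W': "W_norm (ereal p) f = ennreal W'" "0 \<le> W'" using W by (cases "W_norm (ereal p) f") auto
  have "?N / (?A + 1) \<le> W'"
  proof (rule ccontr)
    define \<kappa> where "\<kappa> = ?N / (?A + 1)"
    have A: "0 < ?A + 1" by (simp add: add_nonneg_pos)
    assume "\<not> ?N / (?A + 1) \<le> W'"
    then have \<kappa>: "W' < \<kappa>" by (simp add: \<kappa>_def)
    then have "0 < \<kappa>" "W_norm (ereal p) f < ennreal \<kappa>" using W' by (auto simp: ennreal_less_iff)
    then have E: "energy p m f \<le> energy_const p * \<kappa> powr p" for m
      by (intro energy_le_W_norm[OF p f]) auto
    then have "esup p f \<le> energy_const p * \<kappa> powr p" unfolding esup_def by (intro cSUP_least) auto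
    then have "?N \<le> (energy_const p * \<kappa> powr p) powr (1/p)"
      using esup_nonneg[OF E] p by (intro powr_mono2) auto
    also have "\<dots> = ?A * \<kappa>"
      using \<open>0 < \<kappa>\<close> p energy_const_nonneg[OF p] by (simp add: powr_mult powr_powr)
    finally have "?N \<le> ?A * \<kappa>" .
    moreover have "?N = (?A + 1) * \<kappa>" using A by (simp add: \<kappa>_def)
    ultimately show False using \<open>0 < \<kappa>\<close> by (simp add: distrib_right)
  qed
  then have "ennreal (1 / (?A + 1) * ?N) \<le> ennreal W'" by (intro ennreal_leI) simp
  then show ?thesis unfolding W'(1) by (simp add: ennreal_mult[symmetric])
qed

subsection \<open>The infinite exponent\<close>

lemma incr_le_of_W_infinity:
  assumes "f \<in> W_space \<infinity>" "W_norm \<infinity> f \<le> ennreal L" "0 \<le> L" "w \<in> vicsek_words m" "i \<in> {1..4}"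
  shows "\<bar>incr f w i\<bar> \<le> 2 * L / 3 ^ m"
proof (rule incr_of_lipschitz[OF _ assms(4,5)])
  fix x y assume xy: "x \<in> vicsek_set" "y \<in> vicsek_set"
  show "\<bar>f x - f y\<bar> \<le> L * gd x y"
  proof (cases "x = y")
    case False
    have "ennreal (\<bar>f x - f y\<bar> / gd x y) \<le> W_norm \<infinity> f"
      unfolding W_norm_def using xy False by (auto intro!: SUP_upper2[of "(x, y)"])
    then have "\<bar>f x - f y\<bar> / gd x y \<le> L" using assms(2,3) by (meson ennreal_le_iff order_trans)
    then show ?thesis using gd_pos[OF xy False] by (simp add: pos_divide_le_eq)
  qed (use assms(3) gd_nonneg[OF xy] in simp)
qed

lemma W_norm_infinity_le:
  assumes "0 \<le> L" "\<And>x y. x \<in> vicsek_set \<Longrightarrow> y \<in> vicsek_set \<Longrightarrow> \<bar>f x - f y\<bar> \<le> L * gd x y"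
  shows "W_norm \<infinity> f \<le> ennreal L"
proof -
  have "ennreal (\<bar>f x - f y\<bar> / gd x y) \<le> ennreal L" if "x \<in> vicsek_set" "y \<in> vicsek_set" "x \<noteq> y" for x y
    using assms(2)[OF that(1,2)] gd_pos[OF that] by (intro ennreal_leI) (simp add: pos_divide_le_eq)
  then show ?thesis unfolding W_norm_def by (auto intro!: SUP_least)
qed

lemma F_space_infinity_iff:
  "continuous_on vicsek_set f \<Longrightarrow> f \<in> F_space \<infinity> \<longleftrightarrow>
    (\<exists>L. \<forall>m. \<forall>w\<in>vicsek_words m. \<forall>i\<in>{1..4}. \<bar>incr f w i\<bar> \<le> L / 3 ^ m)"
  by (simp add: F_space_iff vicsek_energy_infinity_le_iff)

lemma W_space_iff_F_space_infinity:
  assumes f: "continuous_on vicsek_set f"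
  shows "f \<in> W_space \<infinity> \<longleftrightarrow> f \<in> F_space \<infinity>"
proof
  assume "f \<in> W_space \<infinity>"
  then obtain L where "\<And>x y. x \<in> vicsek_set \<Longrightarrow> y \<in> vicsek_set \<Longrightarrow> \<bar>f x - f y\<bar> \<le> L * gd x y"
    by (auto simp: W_space_def)
  from incr_of_lipschitz[OF this] show "f \<in> F_space \<infinity>" unfolding F_space_infinity_iff[OF f] by blast
next
  assume "f \<in> F_space \<infinity>"
  then obtain L where "\<And>m w i. w \<in> vicsek_words m \<Longrightarrow> i \<in> {1..4} \<Longrightarrow> \<bar>incr f w i\<bar> \<le> L / 3 ^ m"
    unfolding F_space_infinity_iff[OF f] by blast
  from lipschitz_of_incr[OF f this] show "f \<in> W_space \<infinity>"
    unfolding W_space_def if_P[OF refl] mem_Collect_eq by blast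
qed

lemma gradient_bound_infinity:
  assumes g: "is_gradient \<infinity> f g"
  obtains L where "0 \<le> L" "Lp_norm \<infinity> vicsek_nu g = ennreal L"
    "\<And>m w i. w \<in> vicsek_words m \<Longrightarrow> i \<in> {1..4} \<Longrightarrow> \<bar>incr f w i\<bar> \<le> L / 3 ^ m"
proof -
  have m: "g \<in> borel_measurable vicsek_nu" and "Lp_norm \<infinity> vicsek_nu g < \<infinity>"
    using g by (auto simp: is_gradient_def Lp_space_def)
  then obtain L where L: "0 \<le> L" "Lp_norm \<infinity> vicsek_nu g = ennreal L" by (cases "Lp_norm \<infinity> vicsek_nu g") auto
  then have eq: "esssup vicsek_nu (\<lambda>x. ennreal \<bar>g x\<bar>) = ennreal L" by (simp add: Lp_norm_def)
  have AE: "AE x in vicsek_nu. \<bar>g x\<bar> \<le> L"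
    using esssup_AE[of "\<lambda>x. ennreal \<bar>g x\<bar>" vicsek_nu] unfolding eq by eventually_elim (use L(1) in simp)
  have "\<bar>incr f w i\<bar> \<le> L / 3 ^ m" if w: "w \<in> vicsek_words m" "i \<in> {1..4}" for m w i
    using g w unfolding is_gradient_iff by (intro incr_le_gradient[OF w m AE]) metis
  then show thesis using L that by blast
qed

lemma is_gradient_of_incr:
  assumes "\<And>m w i. w \<in> vicsek_words m \<Longrightarrow> i \<in> {1..4} \<Longrightarrow> \<bar>incr f w i\<bar> \<le> L / 3 ^ m"
  obtains G where "is_gradient \<infinity> f G" "Lp_norm \<infinity> vicsek_nu G \<le> ennreal L"
proof -
  obtain G where G: "G \<in> borel_measurable vicsek_nu" "AE x in vicsek_nu. \<bar>G x\<bar> \<le> L"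
    "\<forall>n. \<forall>w\<in>vicsek_words n. \<forall>i\<in>{1..4}. (LINT x:edge w i|vicsek_nu. G x) = oincr f w i"
    using exists_gradient_infinity[OF assms] by blast
  have le: "Lp_norm \<infinity> vicsek_nu G \<le> ennreal L"
    unfolding Lp_norm_def using G(1,2) by (auto intro!: esssup_I ennreal_leI elim: eventually_mono)
  then have "Lp_norm \<infinity> vicsek_nu G < \<infinity>" by (rule order_le_less_trans) simp
  then have "G \<in> Lp_space \<infinity> vicsek_nu" using G(1) by (simp add: Lp_space_def)
  moreover have "\<forall>n. \<forall>w\<in>vicsek_words n. \<forall>i\<in>{1..4}. oincr f w i = (LINT x:edge w i|vicsek_nu. G x)" using G(3) by metis
  ultimately have "is_gradient \<infinity> f G" unfolding is_gradient_iff by blast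
  then show thesis using le that by blast
qed

lemma F_space_iff_gradient_infinity:
  assumes f: "continuous_on vicsek_set f"
  shows "f \<in> F_space \<infinity> \<longleftrightarrow> (\<exists>g. is_gradient \<infinity> f g)"
proof
  assume "f \<in> F_space \<infinity>"
  then obtain L where "\<And>m w i. w \<in> vicsek_words m \<Longrightarrow> i \<in> {1..4} \<Longrightarrow> \<bar>incr f w i\<bar> \<le> L / 3 ^ m"
    unfolding F_space_infinity_iff[OF f] by blast
  from is_gradient_of_incr[OF this] show "\<exists>g. is_gradient \<infinity> f g" by blast
next
  assume "\<exists>g. is_gradient \<infinity> f g"
  then obtain g where g: "is_gradient \<infinity> f g" by blast
  obtain L where "0 \<le> L" "Lp_norm \<infinity> vicsek_nu g = ennreal L"
    "\<And>m w i. w \<in> vicsek_words m \<Longrightarrow> i \<in> {1..4} \<Longrightarrow> \<bar>incr f w i\<bar> \<le> L / 3 ^ m"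
    using gradient_bound_infinity[OF g] by blast
  then show "f \<in> F_space \<infinity>" unfolding F_space_infinity_iff[OF f] by blast
qed

lemma F_norm_infinity_le_iff:
  assumes "0 \<le> L"
  shows "F_norm \<infinity> f \<le> ennreal L \<longleftrightarrow> (\<forall>m. \<forall>w\<in>vicsek_words m. \<forall>i\<in>{1..4}. \<bar>incr f w i\<bar> \<le> L / 3 ^ m)"
  using assms by (simp add: F_norm_def SUP_le_iff vicsek_energy_infinity_le_iff)

text \<open>As for finite p: the constructed gradient has the optimal bound, and uniqueness
  transfers it to g.\<close>

lemma Lp_norm_gradient_infinity:
  assumes g: "is_gradient \<infinity> f g"
  shows "Lp_norm \<infinity> vicsek_nu g = F_norm \<infinity> f"
proof (rule antisym)
  obtain L where L: "0 \<le> L" "Lp_norm \<infinity> vicsek_nu g = ennreal L"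
    "\<And>m w i. w \<in> vicsek_words m \<Longrightarrow> i \<in> {1..4} \<Longrightarrow> \<bar>incr f w i\<bar> \<le> L / 3 ^ m"
    using gradient_bound_infinity[OF g] by blast
  show F: "F_norm \<infinity> f \<le> Lp_norm \<infinity> vicsek_nu g" unfolding L(2) F_norm_infinity_le_iff[OF L(1)] using L(3) by blast
  then have "F_norm \<infinity> f < \<infinity>" unfolding L(2) by (rule order_le_less_trans) simp
  then obtain F' where F': "0 \<le> F'" "F_norm \<infinity> f = ennreal F'" by (cases "F_norm \<infinity> f") auto
  then have "\<bar>incr f w i\<bar> \<le> F' / 3 ^ m" if "w \<in> vicsek_words m" "i \<in> {1..4}" for m w i
    using F_norm_infinity_le_iff[OF F'(1), of f] that by simp
  then obtain G where G: "is_gradient \<infinity> f G" "Lp_norm \<infinity> vicsek_nu G \<le> ennreal F'"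
    using is_gradient_of_incr by blast
  have "AE x in vicsek_nu. ennreal \<bar>g x\<bar> = ennreal \<bar>G x\<bar>"
    using is_gradient_unique[OF _ g G(1)] by (auto elim: eventually_mono)
  then have "esssup vicsek_nu (\<lambda>x. ennreal \<bar>g x\<bar>) = esssup vicsek_nu (\<lambda>x. ennreal \<bar>G x\<bar>)"
    using g G(1) by (intro esssup_AE_cong) (auto simp: is_gradient_def Lp_space_def)
  then have "Lp_norm \<infinity> vicsek_nu g = Lp_norm \<infinity> vicsek_nu G" by (simp add: Lp_norm_def)
  then show "Lp_norm \<infinity> vicsek_nu g \<le> F_norm \<infinity> f" using G(2) F'(2) by simp
qed

text \<open>The constants are those of \<open>incr_of_lipschitz\<close> and
  \<open>lipschitz_of_incr\<close>.\<close>

lemma W_norm_infinity_bounds: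
  assumes f: "continuous_on vicsek_set f" "f \<in> W_space \<infinity>" and g: "is_gradient \<infinity> f g"
  shows "ennreal (1/2) * Lp_norm \<infinity> vicsek_nu g \<le> W_norm \<infinity> f"
    "W_norm \<infinity> f \<le> ennreal 12 * Lp_norm \<infinity> vicsek_nu g"
proof -
  obtain L where L: "0 \<le> L" "Lp_norm \<infinity> vicsek_nu g = ennreal L"
    "\<And>m w i. w \<in> vicsek_words m \<Longrightarrow> i \<in> {1..4} \<Longrightarrow> \<bar>incr f w i\<bar> \<le> L / 3 ^ m"
    using gradient_bound_infinity[OF g] by blast
  have le: "W_norm \<infinity> f \<le> ennreal (12 * L)"
    using lipschitz_of_incr[OF f(1) L(3)] L(1) by (intro W_norm_infinity_le) auto
  then show "W_norm \<infinity> f \<le> ennreal 12 * Lp_norm \<infinity> vicsek_nu g" using L(1,2) by (simp add: ennreal_mult)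
  have "W_norm \<infinity> f < \<infinity>" using le by (rule order_le_less_trans) simp
  then obtain W' where W': "0 \<le> W'" "W_norm \<infinity> f = ennreal W'" by (cases "W_norm \<infinity> f") auto
  have "F_norm \<infinity> f \<le> ennreal (2 * W')"
    using incr_le_of_W_infinity[OF f(2) _ W'(1)] W' by (subst F_norm_infinity_le_iff) auto
  then have "ennreal L \<le> ennreal (2 * W')" unfolding L(2)[symmetric] Lp_norm_gradient_infinity[OF g] .
  then have "L \<le> 2 * W'" using W'(1) by simp
  then have "ennreal (1/2 * L) \<le> ennreal W'" by (intro ennreal_leI) simp
  then show "ennreal (1/2) * Lp_norm \<infinity> vicsek_nu g \<le> W_norm \<infinity> f"
    unfolding L(2) W'(2) using L(1) by (subst ennreal_mult[symmetric]) auto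
qed

theorem theorem2p9:
  fixes p :: ereal
  assumes "1 < p"
  shows "(\<forall>f. continuous_on vicsek_set f \<longrightarrow>
            (f \<in> W_space p \<longleftrightarrow> f \<in> F_space p) \<and>
            (f \<in> F_space p \<longleftrightarrow> (\<exists>df. is_gradient p f df)) \<and>
            (\<forall>g h. is_gradient p f g \<and> is_gradient p f h \<longrightarrow> (AE x in vicsek_nu. g x = h x)))
       \<and> (\<exists>c C :: real. 0 < c \<and> 0 < C \<and>
            (\<forall>f df. continuous_on vicsek_set f \<and> f \<in> W_space p \<and> is_gradient p f df \<longrightarrow>
               ennreal c * Lp_norm p vicsek_nu df \<le> W_norm p f \<and>
               W_norm p f \<le> ennreal C * Lp_norm p vicsek_nu df \<and>
               Lp_norm p vicsek_nu df = F_norm p f))"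
  (is "(\<forall>f. continuous_on vicsek_set f \<longrightarrow> ?equiv f) \<and> (\<exists>c C. 0 < c \<and> 0 < C \<and> ?norms c C)")
proof -
  have unique: "\<forall>g h. is_gradient p f g \<and> is_gradient p f h \<longrightarrow> (AE x in vicsek_nu. g x = h x)" for f
    using is_gradient_unique[OF assms] by blast
  show ?thesis
  proof (cases p)
    case (real r)
    then have r: "1 < r" using assms by simp
    \<comment> \<open>Adding 1 makes both constants positive whatever the values of
      \<open>energy_const\<close> and \<open>ks_const\<close>.\<close>
    let ?c = "1 / (energy_const r powr (1/r) + 1)" and ?C = "ks_const r powr (1/r) + 1"
    have "?equiv f" if "continuous_on vicsek_set f" for f
      using W_space_iff_F_space[OF r that] F_space_iff_gradient[OF r that] unique unfolding real by blast
    moreover have "0 < ?c" "0 < ?C" by (simp_all add: add_nonneg_pos)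
    moreover have "?norms ?c ?C"
    proof (intro allI impI, elim conjE, intro conjI)
      fix f g assume f: "continuous_on vicsek_set f" and W: "f \<in> W_space p" and g: "is_gradient p f g"
      have g': "is_gradient (ereal r) f g" using g real by simp
      obtain E where E: "\<And>m. energy r m f \<le> E" using gradient_energy_le[OF r g'] by blast
      have Lp: "Lp_norm p vicsek_nu g = ennreal (esup r f powr (1/r))"
        using Lp_norm_gradient[OF r g'] real by simp
      show "Lp_norm p vicsek_nu g = F_norm p f" using F_norm_real[OF r E] Lp real by simp
      show "ennreal ?c * Lp_norm p vicsek_nu g \<le> W_norm p f"
        unfolding Lp unfolding real using W real by (intro W_norm_lower[OF r f]) (simp add: W_space_def)
      have "W_norm p f \<le> ennreal (ks_const r powr (1/r) * esup r f powr (1/r))"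
        unfolding real using W_norm_le[OF r f energy_le_esup[OF E]] .
      also have "\<dots> \<le> ennreal (?C * esup r f powr (1/r))"
        by (intro ennreal_leI mult_right_mono) auto
      also have "\<dots> = ennreal ?C * Lp_norm p vicsek_nu g" unfolding Lp by (simp add: ennreal_mult)
      finally show "W_norm p f \<le> ennreal ?C * Lp_norm p vicsek_nu g" .
    qed
    ultimately show ?thesis by blast
  next
    case PInf
    have "?equiv f" if "continuous_on vicsek_set f" for f
      using W_space_iff_F_space_infinity[OF that] F_space_iff_gradient_infinity[OF that] unique unfolding PInf by blast
    moreover have "?norms (1/2) 12"
      using W_norm_infinity_bounds Lp_norm_gradient_infinity unfolding PInf by blast
    moreover have "0 < (1/2 :: real)" "0 < (12 :: real)" by simp_all
    ultimately show ?thesis by blast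
  qed (use assms in auto)
qed

end
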